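(* Let $a\in S^{-n(1-\rho)}_{\rho,\delta}$ with $0<\rho\le1$ and $0\le\delta<1$, and let $T_a$ be the associated pseudodifferential operator. Then for every $f\in C_0^\infty(\mathbb{R}^n)$ and any $r>1$ (finite), there exists a sparse family $\mathcal{S}$ such that for a.e. $x\in\mathbb{R}^n$, $$|T_af(x)|\lesssim\mathcal{A}_{r,\mathcal{S}}f(x),$$ where the implicit constant does not depend on $f$ or $x$.
   Context: Symbol classes: for $m\in\mathbb{R}$ and $0\le\delta,\rho\le1$, $S^m_{\rho,\delta}$ is the set of all $a\in C^\infty(\mathbb{R}^n\times\mathbb{R}^n)$ such that for all multi-indices $\nu,\sigma\in\mathbb{N}^n$ there is a constant $C_{\nu,\sigma}$ with $|\partial_x^\nu\partial_\xi^\sigma a(x,\xi)|\le C_{\nu,\sigma}(1+|\xi|)^{m-\rho|\sigma|+\delta|\nu|}$ for all $x,\xi$. The pseudodifferential operator is $T_af(x)=\int_{\mathbb{R}^n}e^{ix\cdot\xi}a(x,\xi)\widehat f(\xi)\,d\xi$, with $\widehat f(\xi)=\int f(y)e^{-iy\cdot\xi}\,dy$ (constant factors of $\pi$ are immaterial). $C_0^\infty(\mathbb{R}^n)$ is the space of smooth compactly supported functions. Dyadic cubes are the cubes of the universal shifted dyadic grids, i.e. the cubes $2^k\prod_{i=1}^n[m_i+\frac{v_i}{3},m_i+1+\frac{v_i}{3}]$ with $k\in\mathbb{Z}$, $(m_1,\dots,m_n)\in\mathbb{Z}^n$, $(v_1,\dots,v_n)\in\{0,1,2\}^n$. A collection $\mathcal{S}$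 of dyadic cubes is $\eta$-sparse, $0<\eta<1$, if there are pairwise disjoint sets $E_Q\subset Q$, $Q\in\mathcal{S}$, with $|E_Q|>\eta|Q|$ for all $Q\in\mathcal{S}$; "sparse" means $\eta$-sparse for some $\eta\in(0,1)$ that does not depend on $f$. For $1\le r<\infty$, $\langle f\rangle_{r,Q}=\big(|Q|^{-1}\int_Q|f|^r\,dx\big)^{1/r}$, and the $r$-sparse operator is $\mathcal{A}_{r,\mathcal{S}}f(x)=\sum_{Q\in\mathcal{S}}\langle f\rangle_{r,Q}\chi_Q(x)$. $A\lesssim B$ means $A\le CB$ for a constant $C$, here allowed to depend on $n,\rho,\delta,r$ and the constants $C_{\nu,\sigma}$ of $a$. *)

theory Defs
  imports "HOL-Analysis.Analysis"
begin

section \<open>Partial derivatives and smooth functions\<close>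

definition partial :: "'a \<Rightarrow> ('a::euclidean_space \<Rightarrow> 'b::real_normed_vector) \<Rightarrow> 'a \<Rightarrow> 'b" where
  "partial b f = (\<lambda>x. frechet_derivative f (at x) b)"

primrec Ck :: "nat \<Rightarrow> ('a::euclidean_space \<Rightarrow> 'b::real_normed_vector) \<Rightarrow> bool" where
  "Ck 0 f \<longleftrightarrow> continuous_on UNIV f"
| "Ck (Suc k) f \<longleftrightarrow> f differentiable_on UNIV \<and> (\<forall>b\<in>Basis. Ck k (partial b f))"

definition smooth :: "('a::euclidean_space \<Rightarrow> 'b::real_normed_vector) \<Rightarrow> bool" where
  "smooth f \<longleftrightarrow> (\<forall>k. Ck k f)"

text \<open>\<open>C\<^sub>0\<^sup>\<infinity>\<close>; the compact set below is the support of \<open>f\<close>.\<close>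

definition test_function :: "('a::euclidean_space \<Rightarrow> complex) \<Rightarrow> bool" where
  "test_function f \<longleftrightarrow> smooth f \<and> compact (closure {x. f x \<noteq> 0})"

text \<open>
  A multi-index is a function \<open>\<nu> :: 'n \<Rightarrow> nat\<close> on the finite index type of the coordinates.
  The index type carries no order, so the coordinates are differentiated in the order of an arbitrary
  fixed enumeration; mixed partial derivatives of smooth functions do not depend on it.
\<close>

definition coords :: "'n::finite list" where
  "coords = (SOME is. distinct is \<and> set is = UNIV)"

lemma distinct_coords: "distinct (coords :: 'n::finite list)"
  and set_coords: "set (coords :: 'n::finite list) = UNIV"
proof -
  have "\<exists>is :: 'n list. distinct is \<and> set is = UNIV"
    using finite_distinct_list[of "UNIV :: 'n set"] by auto
  then have "distinct (coords :: 'n list) \<and> set (coords :: 'n list) = UNIV"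
    unfolding coords_def by (rule someI_ex)
  then show "distinct (coords :: 'n list)" "set (coords :: 'n list) = UNIV"
    by auto
qed

text \<open>\<open>multi_partial e \<nu> f\<close> differentiates \<open>\<nu> i\<close> times in the direction \<open>e i\<close>, for every \<open>i\<close>.\<close>

definition multi_partial ::
  "('n::finite \<Rightarrow> 'a) \<Rightarrow> ('n \<Rightarrow> nat) \<Rightarrow> ('a::euclidean_space \<Rightarrow> 'b::real_normed_vector) \<Rightarrow> 'a \<Rightarrow> 'b"
  where "multi_partial e \<nu> f = foldr (\<lambda>i g. (partial (e i) ^^ \<nu> i) g) coords f"

definition multi_order :: "('n::finite \<Rightarrow> nat) \<Rightarrow> nat" where
  "multi_order \<nu> = (\<Sum>i\<in>UNIV. \<nu> i)"


section \<open>Symbols and pseudodifferential operators\<close>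

text \<open>\<open>symbol_partial \<nu> \<sigma> a\<close> is \<open>\<partial>\<^sub>x\<^sup>\<nu> \<partial>\<^sub>\<xi>\<^sup>\<sigma> a\<close>, a function of the pair \<open>(x, \<xi>)\<close>.\<close>

definition symbol_partial ::
  "('n::finite \<Rightarrow> nat) \<Rightarrow> ('n \<Rightarrow> nat) \<Rightarrow> ((real^'n) \<times> (real^'n) \<Rightarrow> complex)
    \<Rightarrow> (real^'n) \<times> (real^'n) \<Rightarrow> complex" where
  "symbol_partial \<nu> \<sigma> a =
     multi_partial (\<lambda>i. (axis i 1, 0)) \<nu> (multi_partial (\<lambda>i. (0, axis i 1)) \<sigma> a)"

definition symbol_estimate ::
  "real \<Rightarrow> real \<Rightarrow> real \<Rightarrow> ('n::finite \<Rightarrow> nat) \<Rightarrow> ('n \<Rightarrow> nat) \<Rightarrow> real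
    \<Rightarrow> ((real^'n) \<times> (real^'n) \<Rightarrow> complex) \<Rightarrow> bool" where
  "symbol_estimate m \<rho> \<delta> \<nu> \<sigma> c a \<longleftrightarrow>
     (\<forall>x \<xi>. norm (symbol_partial \<nu> \<sigma> a (x, \<xi>))
        \<le> c * (1 + norm \<xi>) powr (m - \<rho> * real (multi_order \<sigma>) + \<delta> * real (multi_order \<nu>)))"

definition symbol_class ::
  "real \<Rightarrow> real \<Rightarrow> real \<Rightarrow> ((real^'n::finite) \<times> (real^'n) \<Rightarrow> complex) set" where
  "symbol_class m \<rho> \<delta> = {a. smooth a \<and> (\<forall>\<nu> \<sigma>. \<exists>c. symbol_estimate m \<rho> \<delta> \<nu> \<sigma> c a)}"

definition fourier :: "(real^'n::finite \<Rightarrow> complex) \<Rightarrow> real^'n \<Rightarrow> complex" where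
  "fourier f \<xi> = (LINT y|lborel. f y * cis (- (y \<bullet> \<xi>)))"

definition pseudo_diff ::
  "((real^'n::finite) \<times> (real^'n) \<Rightarrow> complex) \<Rightarrow> (real^'n \<Rightarrow> complex) \<Rightarrow> real^'n \<Rightarrow> complex" where
  "pseudo_diff a f x = (LINT \<xi>|lborel. cis (x \<bullet> \<xi>) * a (x, \<xi>) * fourier f \<xi>)"


section \<open>Sparse families and sparse operators\<close>

definition dyadic_cube :: "int \<Rightarrow> ('n::finite \<Rightarrow> int) \<Rightarrow> ('n \<Rightarrow> nat) \<Rightarrow> (real^'n) set" where
  "dyadic_cube k m v =
     cbox (\<chi> i. 2 powi k * (of_int (m i) + of_nat (v i) / 3))
          (\<chi> i. 2 powi k * (of_int (m i) + 1 + of_nat (v i) / 3))"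

definition dyadic_cubes :: "(real^'n::finite) set set" where
  "dyadic_cubes = {dyadic_cube k m v |k m v. \<forall>i. v i \<in> {0, 1, 2}}"

definition sparse_family :: "real \<Rightarrow> (real^'n::finite) set set \<Rightarrow> bool" where
  "sparse_family \<eta> S \<longleftrightarrow> S \<subseteq> dyadic_cubes \<and>
     (\<exists>E. disjoint_family_on E S \<and>
       (\<forall>Q\<in>S. E Q \<in> sets lebesgue \<and> E Q \<subseteq> Q \<and> measure lebesgue (E Q) > \<eta> * measure lebesgue Q))"

definition cube_average :: "real \<Rightarrow> (real^'n::finite) set \<Rightarrow> (real^'n \<Rightarrow> complex) \<Rightarrow> real" where
  "cube_average r Q f = ((LINT x:Q|lborel. norm (f x) powr r) / measure lborel Q) powr (1 / r)"

text \<open>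
  The sum may be infinite and may diverge, so it is taken in \<open>[0, \<infinity>]\<close>, where every family is summable.
\<close>

definition sparse_operator ::
  "real \<Rightarrow> (real^'n::finite) set set \<Rightarrow> (real^'n \<Rightarrow> complex) \<Rightarrow> real^'n \<Rightarrow> ennreal" where
  "sparse_operator r S f x = (\<Sum>\<^sub>\<infinity>Q\<in>S. ennreal (cube_average r Q f) * indicator Q x)"

end

theory Submission
  imports Defs
begin

text \<open>
  The symbol is cut into dyadic rings in \<open>\<xi>\<close>, and the maximal truncation \<open>M\<close> of the resulting series of
  integral operators dominates \<open>T\<^sub>a f\<close>. If \<open>\<rho> < 1\<close>, the kernel of the \<open>j\<close>-th piece lives at scale
  \<open>2\<^sup>-\<^sup>j\<^sup>\<rho>\<close>; interpolating its size with Plancherel's theorem bounds the piece by a geometrically small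
  multiple of the supremum of the \<open>s\<close>-averages over balls, for any \<open>s \<in> (1, 2]\<close>, and no regularity in \<open>x\<close> is
  used. If \<open>\<rho> = 1\<close>, the pieces are almost orthogonal and form a Calderon-Zygmund kernel, so Cotlar's
  inequality and the Calderon-Zygmund decomposition give the weak type (1,1) of \<open>M\<close>.

  In both cases, off an open set that fills at most half of a given dyadic cube, \<open>M\<close> of \<open>f\<close> restricted to
  the threefold dilate is bounded by one average, and passing to a maximal dyadic subcube of the open set costs
  one more average. Iterating over these stopping cubes gives the sparse family near the support of \<open>f\<close>; far
  away the decay \<open>\<bar>x\<bar>\<^sup>-\<^sup>n\<close> of the kernel is absorbed by a growing sequence of cubes.
\<close>

text \<open>At order \<open>-n(1-\<rho>)\<close> the \<open>j\<close>-th kernel has height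
  \<open>2^(j \<rho> n)\<close> at scale \<open>2^(-j \<rho>)\<close>, so its L^1 norm is bounded
  but does not decay in \<open>j\<close>, and size alone does not sum the pieces. Plancherel bounds
  the square of its L^2 norm by \<open>2^(-j n (1-\<rho>))\<close> times what height and scale give;
  interpolation turns this into a gain of \<open>2^(-j n (1-\<rho>) (1-1/s))\<close> per piece. The
  gain is lost when \<open>\<rho> = 1\<close> or \<open>s = 1\<close>. So for
  \<open>\<rho> < 1\<close> an exponent above 1 is paid, and for \<open>\<rho> = 1\<close>
  cancellation has to help, where \<open>\<delta> < 1\<close> makes an increment in \<open>x\<close>
  of the \<open>j\<close>-th symbol piece smaller by \<open>2^(j(\<delta>-1))\<close> than its scale
  suggests.

  All truncations are kept because a stopping cube is compared with one point outside the
  exceptional set, and the comparison cuts the series at the scale of that cube.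

  The iteration uses half-open cubes of a single grid, which partition space; only at the end is
  each dilate put into a closed cube of a shifted grid. Lebesgue's differentiation theorem is
  replaced by continuity of \<open>f\<close> together with open dilates.\<close>

abbreviation (input) BM :: "('a::topological_space => 'b::topological_space) set" where
  "BM \<equiv> borel_measurable borel"

abbreviation (input) BM2 :: "('a::topological_space \<times> 'b::topological_space => 'c::topological_space) set" where
  "BM2 \<equiv> borel_measurable (borel \<Otimes>\<^sub>M borel)"

abbreviation (input) vol :: "'a::euclidean_space set => ennreal" where "vol \<equiv> emeasure lborel"

abbreviation (input) enorm :: "'a::real_normed_vector => ennreal" where "enorm x \<equiv> ennreal (norm x)"

abbreviation (input) nn_lborel :: "('a::euclidean_space => ennreal) => ennreal" (binder "\<integral>\<^sup>+" 10) where
  "nn_lborel \<equiv> nn_integral lborel"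

section \<open>Averages over balls\<close>

text \<open>The superlevel set of the uncentred Hardy-Littlewood maximal function. As a union of
  balls it is open by construction, and a point outside it controls every ball through that point,
  not only the centred ones.\<close>

definition big_set :: "('a::euclidean_space => ennreal) => real => 'a set" where
 "big_set w l = \<Union>{ball c r | c r. 0 < r \<and>
  ennreal l * vol (ball c r) < (\<integral>\<^sup>+y\<in>ball c r. w y \<partial>lborel)}"

lemma open_big_set: "open (big_set w l)"
 unfolding big_set_def by auto

lemma not_big_set:
 assumes "x \<notin> big_set w l" "x \<in> ball c r"
 shows "(\<integral>\<^sup>+y\<in>ball c r. w y \<partial>lborel) \<le> ennreal l * vol (ball c r)"
proof -
 have "0 < r" using assms(2) by (metis mem_ball order_le_less_trans zero_le_dist)
 then have "ball c r \<subseteq> big_set w l"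
  if "ennreal l * vol (ball c r) < (\<integral>\<^sup>+y\<in>ball c r. w y \<partial>lborel)"
  using that unfolding big_set_def by blast
 then show ?thesis using assms by (meson not_le subsetD)
qed

text \<open>Countable subadditivity for the \<open>A i\<close> meets additivity for the disjoint
  \<open>B i\<close>; both are written as integrals over the counting measure. It serves Vitali
  balls, dilated cubes and generations of stopping cubes alike.\<close>

lemma emeasure_UN_le_disjoint:
 fixes A B :: "'i => 'b set"
 assumes C: "countable C" and A: "\<And>i. i \<in> C ==> A i \<in> sets M" and B: "\<And>i. i \<in> C ==> B i \<in> sets M"
  and disj: "disjoint_family_on B C" and [measurable]: "w \<in> borel_measurable M"
  and le: "\<And>i. i \<in> C ==> emeasure M (A i) \<le> c * (\<integral>\<^sup>+y\<in>B i. w y \<partial>M)"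
 shows "emeasure M (\<Union>i\<in>C. A i) \<le> c * (\<integral>\<^sup>+y\<in>(\<Union>i\<in>C. B i). w y \<partial>M)"
proof -
 have UA[measurable]: "(\<Union>i\<in>C. A i) \<in> sets M" and UB: "(\<Union>i\<in>C. B i) \<in> sets M"
  using C A B by auto
 have "emeasure M (\<Union>i\<in>C. A i) = (\<integral>\<^sup>+x. indicator (\<Union>i\<in>C. A i) x \<partial>M)" by simp
 also have "\<dots> \<le> (\<integral>\<^sup>+x. (\<integral>\<^sup>+i. indicator (A i) x \<partial>count_space C) \<partial>M)"
 proof (intro nn_integral_mono)
  fix x
  show "indicator (\<Union>i\<in>C. A i) x \<le> (\<integral>\<^sup>+i. indicator (A i) x \<partial>count_space C)"
  proof (cases "x \<in> (\<Union>i\<in>C. A i)")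
   case True
   then obtain j where j: "j \<in> C" "x \<in> A j" by auto
   have "(1::ennreal) = (\<integral>\<^sup>+i. indicator {j} i \<partial>count_space C)"
    using j by (simp add: nn_integral_indicator_singleton' one_ennreal_def)
   also have "\<dots> \<le> (\<integral>\<^sup>+i. indicator (A i) x \<partial>count_space C)"
    using j by (intro nn_integral_mono) (auto simp: indicator_def)
   finally show ?thesis using True by simp
  qed auto
 qed
 also have "\<dots> = (\<integral>\<^sup>+i. (\<integral>\<^sup>+x. indicator (A i) x \<partial>M) \<partial>count_space C)"
  using A by (intro nn_integral_count_space_nn_integral C) auto
 also have "\<dots> \<le> (\<integral>\<^sup>+i. c * emeasure (density M w) (B i) \<partial>count_space C)"
  using A B le by (intro nn_integral_mono) (auto simp: emeasure_density)
 also have "\<dots> = c * (\<integral>\<^sup>+i. emeasure (density M w) (B i) \<partial>count_space C)"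
  by (intro nn_integral_cmult) auto
 also have "(\<integral>\<^sup>+i. emeasure (density M w) (B i) \<partial>count_space C) = emeasure (density M w) (\<Union>i\<in>C. B i)"
  using B disj C by (subst emeasure_UN_countable) auto
 also have "\<dots> = (\<integral>\<^sup>+y\<in>(\<Union>i\<in>C. B i). w y \<partial>M)"
  using UB by (simp add: emeasure_density)
 finally show ?thesis .
qed

lemma emeasure_ball_scale:
 fixes x y :: "'a::euclidean_space"
 assumes "0 \<le> c" "0 \<le> r"
 shows "vol (ball y (c * r)) = ennreal (c ^ DIM('a)) * vol (ball x r)"
proof -
 have "unit_ball_vol (real DIM('a)) * (c * r) ^ DIM('a) = c ^ DIM('a) * (unit_ball_vol (real DIM('a)) * r ^ DIM('a))"
  by (simp add: power_mult_distrib)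
 then show ?thesis using assms by (simp add: emeasure_ball flip: ennreal_mult)
qed

text \<open>Vitali's covering lemma: fivefold dilates of disjoint bad balls cover the set, whence
  the constant \<open>5 ^ DIM('a)\<close>.\<close>

lemma emeasure_big_set:
 fixes w :: "'a::euclidean_space => ennreal"
 assumes l: "0 < l" and [measurable]: "w \<in> BM"
 shows "vol (big_set w l) \<le> ennreal (5 ^ DIM('a) / l) * (\<integral>\<^sup>+y. w y)"
proof (cases "(\<integral>\<^sup>+y. w y) = \<infinity>")
 case True
 then show ?thesis using l by (simp add: ennreal_mult_top)
next
 case False
 then obtain I where I: "(\<integral>\<^sup>+y. w y) = ennreal I" "0 \<le> I"
  by (cases "\<integral>\<^sup>+y. w y \<partial>lborel") auto
 define V where "V = unit_ball_vol (real DIM('a))"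
 have V: "0 < V" by (simp add: V_def)
 define K where "K = {(c::'a, r). 0 < r \<and>
  ennreal l * vol (ball c r) < (\<integral>\<^sup>+y\<in>ball c r. w y \<partial>lborel)}"
 \<comment> \<open>Vitali's lemma needs bounded radii. A bad ball satisfies
   \<open>l * V * r ^ DIM('a) < I\<close>, and for \<open>r > 1\<close> the power dominates
   \<open>r\<close> itself, so no root has to be taken.\<close>
 have rb: "0 < snd i \<and> snd i \<le> max 1 (I / (l * V))" if "i \<in> K" for i
 proof -
  obtain c r where i: "i = (c, r)" by (cases i)
  have r: "0 < r" and "ennreal l * vol (ball c r) < (\<integral>\<^sup>+y\<in>ball c r. w y \<partial>lborel)"
   using that by (auto simp: K_def i)
  note this(2)
  also have "(\<integral>\<^sup>+y\<in>ball c r. w y \<partial>lborel) \<le> (\<integral>\<^sup>+y. w y)"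
   by (intro nn_integral_mono) (auto simp: indicator_def)
  finally have "ennreal (l * (V * r ^ DIM('a))) < ennreal I"
   using l r V by (simp add: emeasure_ball I V_def ennreal_mult)
  then have *: "l * V * r ^ DIM('a) < I"
   using l r V by (simp add: ennreal_less_iff mult_ac)
  have "r \<le> max 1 (I / (l * V))"
  proof (cases "r \<le> 1")
   case False
   then have "r \<le> r ^ DIM('a)" using self_le_power[of r "DIM('a)"] by simp
   then have "l * V * r \<le> l * V * r ^ DIM('a)" using l V by simp
   then have "l * V * r \<le> I" using * by linarith
   then have "r \<le> I / (l * V)" using l V by (simp add: field_simps)
   then show ?thesis by simp
  qed simp
  then show ?thesis using r i by simp
 qed
 obtain C where C: "countable C" "C \<subseteq> K"
  "pairwise (\<lambda>i j. disjnt (cball (fst i) (snd i)) (cball (fst j) (snd j))) C"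
  "\<And>i. i \<in> K ==> \<exists>j. j \<in> C \<and>
            \<not> disjnt (cball (fst i) (snd i)) (cball (fst j) (snd j)) \<and>
            cball (fst i) (snd i) \<subseteq> ball (fst j) (5 * snd j)"
  by (rule Vitali_covering_lemma_cballs_balls[of K snd "max 1 (I / (l * V))" fst]) (use rb in blast)+
 have "big_set w l \<subseteq> (\<Union>j\<in>C. ball (fst j) (5 * snd j))"
 proof
  fix x assume "x \<in> big_set w l"
  then obtain c r where "(c, r) \<in> K" "x \<in> ball c r" unfolding big_set_def K_def by auto
  with C(4)[of "(c,r)"] show "x \<in> (\<Union>j\<in>C. ball (fst j) (5 * snd j))" by force
 qed
 then have "vol (big_set w l) \<le> vol (\<Union>j\<in>C. ball (fst j) (5 * snd j))"
  using C(1) by (intro emeasure_mono) auto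
 also have "\<dots> \<le> ennreal (5 ^ DIM('a) / l) * (\<integral>\<^sup>+y\<in>(\<Union>j\<in>C. ball (fst j) (snd j)). w y \<partial>lborel)"
 proof (rule emeasure_UN_le_disjoint)
  show "disjoint_family_on (\<lambda>j. ball (fst j) (snd j)) C"
   using C(3) unfolding disjoint_family_on_def pairwise_def disjnt_def
   by (smt (verit, best) ball_subset_cball disjoint_iff subsetD)
  fix j assume "j \<in> C"
  then obtain c r where j: "j = (c, r)" and r: "0 < r" and
   le: "ennreal l * vol (ball c r) < (\<integral>\<^sup>+y\<in>ball c r. w y \<partial>lborel)"
   using C(2) by (cases j) (auto simp: K_def)
  have "vol (ball c (5 * r)) = ennreal (5 ^ DIM('a) / l) * (ennreal l * vol (ball c r))"
   using l r by (simp add: emeasure_ball_scale[of 5 r c c] flip: ennreal_mult mult.assoc)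
  also have "\<dots> \<le> ennreal (5 ^ DIM('a) / l) * (\<integral>\<^sup>+y\<in>ball c r. w y \<partial>lborel)"
   using le by (intro mult_left_mono) auto
  finally show "vol (ball (fst j) (5 * snd j)) \<le> ennreal (5 ^ DIM('a) / l) * (\<integral>\<^sup>+y\<in>ball (fst j) (snd j). w y \<partial>lborel)"
   by (simp add: j)
 qed (use C in auto)
 also have "\<dots> \<le> ennreal (5 ^ DIM('a) / l) * (\<integral>\<^sup>+y. w y)"
  by (intro mult_left_mono nn_integral_mono) (auto simp: indicator_def)
 finally show ?thesis .
qed

text \<open>Up to a constant, an L^1-normalised profile at scale \<open>1 / R\<close>. The exponent
  \<open>DIM('a) + 1\<close> leaves one power for the summation over dyadic shells.\<close>

definition bump :: "'a::euclidean_space itself => real => 'a => real" where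
 "bump _ R z = R ^ DIM('a) / (1 + R * norm z) ^ (DIM('a) + 1)"

abbreviation bmp :: "real => 'a::euclidean_space => real" where "bmp R z \<equiv> bump TYPE('a) R z"

lemma bmp_nonneg: "0 < R ==> 0 \<le> bmp R z"
 by (simp add: bump_def)

lemma bmp_commute: "bmp R (x - y) = bmp R (y - x)"
 by (simp add: bump_def norm_minus_commute)

lemma bmp_measurable[measurable]: "bump T R \<in> BM"
 unfolding bump_def by measurable

definition bconst :: "'a::euclidean_space itself => real" where
 "bconst _ = unit_ball_vol (real DIM('a)) * 2 ^ (DIM('a) + 1)"

lemma bconst_pos: "0 < bconst TYPE('a::euclidean_space)"
 by (simp add: bconst_def)

text \<open>A decreasing radial profile is a superposition of normalised balls: the shell where
  \<open>1 + R * norm (x - y)\<close> is about \<open>2^i\<close> lies in a ball about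
  \<open>x\<close>, and its weight times the volume of that ball is of order \<open>2^(-i)\<close>.
  Hence only centred averages enter.\<close>

lemma nn_integral_bmp:
 fixes w :: "'a::euclidean_space => ennreal"
 assumes R: "0 < R" and l: "0 \<le> l" and [measurable]: "w \<in> BM"
  and avg: "\<And>t. 0 < t ==> (\<integral>\<^sup>+y\<in>ball x t. w y \<partial>lborel) \<le> ennreal l * vol (ball x t)"
 shows "(\<integral>\<^sup>+y. ennreal (bmp R (x - y)) * w y) \<le> ennreal (bconst TYPE('a) * l)"
proof -
 define n where "n = DIM('a)"
 define V where "V = unit_ball_vol (real n)"
 have V: "0 < V" by (simp add: V_def)
 define t where "t i = 2 ^ (Suc i) / R" for i :: nat
 have t: "0 < t i" for i using R by (simp add: t_def)
 define c where "c i = R ^ n / (2 ^ i) ^ (n + 1)" for i :: nat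
 have c: "0 < c i" for i using R by (simp add: c_def)
 have pw: "ennreal (bmp R (x - y)) * w y \<le> (\<Sum>i. ennreal (c i) * (w y * indicator (ball x (t i)) y))" for y
 proof -
  define s where "s = 1 + R * norm (x - y)"
  have s: "1 \<le> s" using R by (simp add: s_def)
  obtain i where i: "2 ^ i \<le> s" "s < 2 ^ Suc i"
  proof -
   define k where "k = nat \<lfloor>log 2 s\<rfloor>"
   have "0 \<le> log 2 s" using s by simp
   then have k: "real k \<le> log 2 s" "log 2 s < real (Suc k)" unfolding k_def by linarith+
   have "2 powr real k \<le> s" using k(1) s by (simp add: le_log_iff)
   moreover have "s < 2 powr real (Suc k)" using k(2) s by (simp add: log_less_iff del: of_nat_Suc)
   ultimately have "2 ^ k \<le> s" "s < 2 ^ Suc k" by (simp_all only: powr_realpow zero_less_numeral)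
   then show ?thesis using that by blast
  qed
  have "R * norm (x - y) < 2 ^ Suc i" using i s_def by linarith
  then have "norm (x - y) < t i" using R by (simp add: t_def field_simps)
  then have ind: "indicator (ball x (t i)) y = (1::ennreal)" by (auto simp: dist_norm)
  have "bmp R (x - y) \<le> c i" unfolding bump_def c_def n_def[symmetric] s_def[symmetric]
   using R i s by (intro divide_left_mono power_mono mult_pos_pos zero_less_power) auto
  then have "ennreal (bmp R (x - y)) * w y \<le> ennreal (c i) * (w y * indicator (ball x (t i)) y)"
   unfolding ind by (simp add: mult_right_mono ennreal_leI)
  also have "\<dots> \<le> (\<Sum>i. ennreal (c i) * (w y * indicator (ball x (t i)) y))"
   by (rule order_trans[OF _ sum_le_suminf[of _ "{i}"]]) auto
  finally show ?thesis .
 qed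
 have "(\<integral>\<^sup>+y. ennreal (bmp R (x - y)) * w y)
  \<le> (\<integral>\<^sup>+y. (\<Sum>i. ennreal (c i) * (w y * indicator (ball x (t i)) y)))"
  by (intro nn_integral_mono pw)
 also have "\<dots> = (\<Sum>i. ennreal (c i) * (\<integral>\<^sup>+y\<in>ball x (t i). w y \<partial>lborel))"
 proof -
  have [measurable]: "ball x r \<in> sets borel" for r by simp
  show ?thesis by (subst nn_integral_suminf, measurable) (simp add: nn_integral_cmult)
 qed
 also have "\<dots> \<le> (\<Sum>i. ennreal (c i) * (ennreal l * vol (ball x (t i))))"
  by (intro suminf_le mult_left_mono avg t) auto
 also have "\<dots> = (\<Sum>i. ennreal (l * V * 2 ^ n * (1/2) ^ i))"
 proof (intro suminf_cong)
  fix i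
  have "ennreal (c i) * (ennreal l * vol (ball x (t i))) = ennreal (c i * (l * (V * t i ^ n)))"
   using c[of i] t[of i] l V by (simp add: emeasure_ball V_def n_def flip: ennreal_mult)
  also have "c i * (l * (V * t i ^ n)) = l * V * 2 ^ n * (1/2) ^ i"
   using R by (simp add: c_def t_def power_divide power_mult_distrib field_simps)
  finally show "ennreal (c i) * (ennreal l * vol (ball x (t i))) = ennreal (l * V * 2 ^ n * (1/2) ^ i)" .
 qed
 also have "\<dots> = ennreal (\<Sum>i. l * V * 2 ^ n * (1/2) ^ i)"
  using l V by (intro suminf_ennreal2 summable_mult summable_geometric) auto
 also have "(\<Sum>i. l * V * 2 ^ n * (1/2) ^ i) = l * V * 2 ^ n * 2"
  by (subst suminf_mult) (auto simp: suminf_geometric summable_geometric)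
 finally show ?thesis by (simp add: bconst_def V_def n_def mult_ac)
qed

lemma nn_integral_bmp_1:
 fixes x :: "'a::euclidean_space"
 assumes "0 < R"
 shows "(\<integral>\<^sup>+y. ennreal (bmp R (x - y))) \<le> ennreal (bconst TYPE('a))"
  and "(\<integral>\<^sup>+y. ennreal (bmp R (y - x))) \<le> ennreal (bconst TYPE('a))"
 using nn_integral_bmp[of R 1 "\<lambda>_. 1" x] assms by (simp_all add: bmp_commute[of R _ x])

section \<open>Half-open dyadic cubes\<close>

text \<open>A cube is named by its level and its integer corner, not by its point set, so that
  levels, parents and nestedness become arithmetic on keys.\<close>

type_synonym 'n key = "int \<times> ('n => int)"

definition side :: "'n key => real" where "side q = 2 powi fst q"

definition cube :: "('n::finite) key => (real^'n) set" where
 "cube q = {x. \<forall>i. side q * of_int (snd q i) \<le> x$i \<and> x$i < side q * (of_int (snd q i) + 1)}"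

text \<open>The threefold dilate is taken open, so that cutting off a continuous function with it keeps
 the superlevel sets of its modulus open.\<close>

definition dil :: "('n::finite) key => (real^'n) set" where
 "dil q = {x. \<forall>i. side q * (of_int (snd q i) - 1) < x$i \<and> x$i < side q * (of_int (snd q i) + 2)}"

definition key_of :: "int => real^('n::finite) => 'n key" where
 "key_of k x = (k, \<lambda>i. \<lfloor>x$i / 2 powi k\<rfloor>)"

definition parent :: "'n key => 'n key" where
 "parent q = (fst q + 1, \<lambda>i. snd q i div 2)"

lemma side_pos[simp]: "0 < side q" by (simp add: side_def)

lemma side_nonneg[simp]: "0 \<le> side q" by (simp add: less_imp_le)

lemma fst_key_of[simp]: "fst (key_of k x) = k" by (simp add: key_of_def)

lemma fst_parent[simp]: "fst (parent q) = fst q + 1" by (simp add: parent_def)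

lemma side_parent: "side (parent q) = 2 * side q"
 by (simp add: side_def power_int_add)

text \<open>Membership becomes an equation between keys; disjointness on one level and nestedness
  across levels then follow from functional properties of \<open>key_of\<close>.\<close>

lemma mem_cube_iff: "x \<in> cube q \<longleftrightarrow> key_of (fst q) x = q"
proof -
 have "(\<lfloor>x$i / 2 powi fst q\<rfloor> = snd q i) \<longleftrightarrow> (side q * of_int (snd q i) \<le> x$i \<and> x$i < side q * (of_int (snd q i) + 1))" for i
  unfolding floor_eq_iff side_def by (simp add: field_simps)
 then show ?thesis by (cases q) (auto simp: cube_def key_of_def fun_eq_iff)
qed

lemma mem_cube_key_of[simp]: "x \<in> cube (key_of k x)"
 by (simp add: mem_cube_iff)

lemma parent_key_of: "parent (key_of k x) = key_of (k + 1) x"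
proof -
 have "\<lfloor>x$i / 2 powi (k + 1)\<rfloor> = \<lfloor>x$i / 2 powi k\<rfloor> div 2" for i
  using floor_divide_real_eq_div[of 2 "x$i / 2 powi k"] by (simp add: power_int_add)
 then show ?thesis by (simp add: key_of_def parent_def)
qed

lemma cube_subset_parent: "cube q \<subseteq> cube (parent q)"
 by (auto simp: mem_cube_iff) (metis parent_key_of)

lemma key_of_mono:
 assumes "k \<le> k'" "key_of k x = key_of k y"
 shows "key_of k' x = key_of k' y"
 using assms by (induction k' rule: int_ge_induct) (auto simp flip: parent_key_of)

lemma cube_nested:
 assumes "fst q \<le> fst q'" "x \<in> cube q" "x \<in> cube q'"
 shows "cube q \<subseteq> cube q'"
 using assms key_of_mono unfolding mem_cube_iff subset_iff by metis

lemma cube_eqI: "fst q = fst q' ==> x \<in> cube q ==> x \<in> cube q' ==> q = q'"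
 by (metis mem_cube_iff)

lemma cube_nonempty: "cube q \<noteq> {}"
proof -
 have "(\<chi> i. side q * of_int (snd q i)) \<in> cube q" by (simp add: cube_def)
 then show ?thesis by auto
qed

lemma emeasure_box_cart:
 fixes a b :: "real^'n"
 assumes "\<And>i. a$i \<le> b$i"
 shows "vol (box a b) = ennreal (\<Prod>i\<in>UNIV. b$i - a$i)"
  "vol (cbox a b) = ennreal (\<Prod>i\<in>UNIV. b$i - a$i)"
proof -
 have eq: "measure lborel (cbox a b) = (\<Prod>i\<in>UNIV. b$i - a$i)"
  using assms by (subst content_cbox_cart) (auto simp: interval_ne_empty_cart(1))
 show "vol (cbox a b) = ennreal (\<Prod>i\<in>UNIV. b$i - a$i)"
  using eq emeasure_lborel_cbox_finite[of a b] by (simp add: emeasure_eq_ennreal_measure)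
 have "measure lborel (box a b) = measure lborel (cbox a b)"
  by (simp add: measure_lborel_box_eq measure_lborel_cbox_eq)
 then show "vol (box a b) = ennreal (\<Prod>i\<in>UNIV. b$i - a$i)"
  using eq emeasure_lborel_box_finite[of a b] by (simp add: emeasure_eq_ennreal_measure)
qed

lemma dil_eq_box: "dil q = box (\<chi> i. side q * (of_int (snd q i) - 1)) (\<chi> i. side q * (of_int (snd q i) + 2))"
 by (auto simp: dil_def mem_box_cart)

lemma open_dil: "open (dil q)" by (simp add: dil_eq_box open_box)

lemma emeasure_dil: "vol (dil (q :: 'n::finite key)) = ennreal ((3 * side q) ^ CARD('n))"
 unfolding dil_eq_box by (subst emeasure_box_cart) (simp_all add: algebra_simps)

lemma cube_borel[measurable]: "cube q \<in> sets borel"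
proof -
 have "cube q = (\<Inter>i. {x. side q * of_int (snd q i) \<le> x$i} \<inter> {x. x$i < side q * (of_int (snd q i) + 1)})"
  by (auto simp: cube_def)
 moreover have "\<dots> \<in> sets borel"
  by (intro sets.finite_INT sets.Int borel_closed borel_open closed_Collect_le open_Collect_less
    continuous_intros) auto
 ultimately show ?thesis by simp
qed

lemma dil_borel[measurable]: "dil q \<in> sets borel"
 by (simp add: open_dil)

lemma emeasure_cube: "vol (cube (q :: 'n::finite key)) = ennreal (side q ^ CARD('n))"
proof (rule antisym)
 let ?a = "\<chi> i. side q * of_int (snd q i)" and ?b = "\<chi> i. side q * (of_int (snd q i) + 1)"
 have v: "(\<Prod>i\<in>UNIV. ?b$i - ?a$i) = side q ^ CARD('n)" by (simp add: algebra_simps)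
 have "cube q \<subseteq> cbox ?a ?b" "box ?a ?b \<subseteq> cube q"
  by (auto simp: cube_def mem_box_cart less_imp_le)
 then have "vol (cube q) \<le> vol (cbox ?a ?b)"
  "vol (box ?a ?b) \<le> vol (cube q)"
  by (auto intro!: emeasure_mono)
 moreover have "\<And>i. ?a$i \<le> ?b$i" by (simp add: algebra_simps)
 ultimately show "vol (cube q) \<le> ennreal (side q ^ CARD('n))"
  "ennreal (side q ^ CARD('n)) \<le> vol (cube q)"
  using emeasure_box_cart[of ?a ?b] v by auto
qed

lemma norm_le_card:
 fixes x :: "real^'n"
 assumes "\<And>i. \<bar>x$i\<bar> \<le> d"
 shows "norm x \<le> real CARD('n) * d"
proof -
 have "norm x \<le> (\<Sum>i\<in>UNIV. \<bar>x$i\<bar>)" by (rule norm_le_l1_cart)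
 also have "\<dots> \<le> (\<Sum>i\<in>(UNIV::'n set). d)" by (intro sum_mono assms)
 finally show ?thesis by simp
qed

lemma cube_dist:
 fixes q :: "'n::finite key"
 assumes "x \<in> cube q" "y \<in> cube q"
 shows "norm (x - y) \<le> real CARD('n) * side q"
proof (rule norm_le_card)
 fix i
 have "side q * of_int (snd q i) \<le> x$i" "x$i < side q * of_int (snd q i) + side q"
  "side q * of_int (snd q i) \<le> y$i" "y$i < side q * of_int (snd q i) + side q"
  using assms by (simp_all add: cube_def algebra_simps)
 then show "\<bar>(x - y)$i\<bar> \<le> side q" by simp
qed

lemma ball_subset_dil: "x \<in> cube q ==> ball x (side q) \<subseteq> dil q"
proof
 fix y assume x: "x \<in> cube q" and y: "y \<in> ball x (side q)"
 have "side q * (of_int (snd q i) - 1) < y$i \<and> y$i < side q * (of_int (snd q i) + 2)" for i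
 proof -
  have "\<bar>x$i - y$i\<bar> < side q"
   using component_le_norm_cart[of "x - y" i] y by (simp add: dist_norm)
  moreover have "side q * of_int (snd q i) \<le> x$i" "x$i < side q * of_int (snd q i) + side q"
   using x by (simp_all add: cube_def algebra_simps)
  ultimately show ?thesis by (simp add: algebra_simps) linarith
 qed
 then show "y \<in> dil q" by (simp add: dil_def)
qed

lemma cube_subset_dil: "cube q \<subseteq> dil q"
 using ball_subset_dil side_pos by (metis centre_in_ball subsetD subsetI)

lemma dil_mono:
 fixes q q' :: "'n::finite key"
 assumes "fst q \<le> fst q'" "cube q \<subseteq> cube q'"
 shows "dil q \<subseteq> dil q'"
proof -
 obtain d where d: "fst q' = fst q + int d" using assms(1) zle_iff_zadd by auto
 define D where "D = (2::int) ^ d"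
 have D: "side q' = side q * of_int D" by (simp add: side_def d power_int_add D_def)
 have s: "side q \<le> side q'" using assms(1) by (simp add: side_def power_int_increasing)
 have "(\<chi> i. side q * of_int (snd q i)) \<in> cube q"
  by (simp add: cube_def)
 then have "(\<chi> i. side q * of_int (snd q i)) \<in> cube q'"
  using assms(2) by blast
 then have c: "side q' * of_int (snd q' i) \<le> side q * of_int (snd q i)"
  "side q * of_int (snd q i) < side q' * (of_int (snd q' i) + 1)" for i
  by (simp_all add: cube_def)
 \<comment> \<open>Both ends are integer multiples of \<open>side q\<close>, so the strict
   inequality between the left end of the small cube and the right end of the large one improves by
   a whole side.\<close>
 have d: "side q * (of_int (snd q i) + 1) \<le> side q' * (of_int (snd q' i) + 1)" for i
 proof -
  have "side q * of_int (snd q i) < side q * of_int (D * (snd q' i + 1))"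
   using c(2)[of i] by (simp add: D mult.assoc)
  then have "snd q i < D * (snd q' i + 1)" by (simp only: mult_less_cancel_left_pos side_pos of_int_less_iff)
  then have "snd q i + 1 \<le> D * (snd q' i + 1)" by simp
  then have "real_of_int (snd q i + 1) \<le> of_int (D * (snd q' i + 1))" by (simp only: of_int_le_iff)
  then have "side q * real_of_int (snd q i + 1) \<le> side q * of_int (D * (snd q' i + 1))"
   by (intro mult_left_mono) auto
  then show ?thesis by (simp add: D mult.assoc)
 qed
 show ?thesis
 proof
  fix x assume x: "x \<in> dil q"
  have "side q' * (of_int (snd q' i) - 1) < x$i \<and> x$i < side q' * (of_int (snd q' i) + 2)" for i
  proof -
   have "side q * (of_int (snd q i) - 1) < x$i" "x$i < side q * (of_int (snd q i) + 2)"
    using x by (auto simp: dil_def)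
   with c(1)[of i] d[of i] s show ?thesis by (simp add: algebra_simps)
  qed
  then show "x \<in> dil q'" by (simp add: dil_def)
 qed
qed

text \<open>The maximal dyadic cubes inside \<open>Om\<close> below level \<open>k0\<close>:
  containment passes down the grid, so one failing parent excludes all ancestors. The strict level
  bound makes stopping cubes strictly smaller than the cube of level \<open>k0\<close> in which they
  are selected.\<close>

definition sel :: "int => (real^'n::finite) set => 'n key set" where
 "sel k0 Om = {q. fst q < k0 \<and> cube q \<subseteq> Om \<and> \<not> cube (parent q) \<subseteq> Om}"

lemma countable_keys: "countable (K :: ('n::finite) key set)"
 by (rule countable_subset[of _ UNIV]) auto

lemma disjoint_sel: "disjoint_family_on cube (sel k0 Om)"
proof -
 have *: False if q: "q \<in> sel k0 Om" "q' \<in> sel k0 Om" "x \<in> cube q" "x \<in> cube q'" "fst q < fst q'" for q q' x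
 proof -
  have "cube (parent q) \<subseteq> cube q'"
   using q cube_subset_parent[of q] by (intro cube_nested[of _ _ x]) auto
  then show False using q by (auto simp: sel_def)
 qed
 show ?thesis
  unfolding disjoint_family_on_def
 proof (intro ballI impI)
  fix q q' assume q: "q \<in> sel k0 Om" "q' \<in> sel k0 Om" "q \<noteq> q'"
  have False if "x \<in> cube q" "x \<in> cube q'" for x
   using *[of q q' x] *[of q' q x] cube_eqI[of q q' x] that q by linarith
  then show "cube q \<inter> cube q' = {}" by auto
 qed
qed

text \<open>Descend from level \<open>k0\<close>, where containment fails, to levels whose cubes are
  small enough to fit by openness; the first success has a failing parent.\<close>

lemma sel_cover:
 assumes Om: "open Om" and x: "x \<in> Om" "\<not> cube (key_of k0 x) \<subseteq> Om"
 obtains q where "q \<in> sel k0 Om" "x \<in> cube q" "q = key_of (fst q) x"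
proof -
 obtain e where e: "0 < e" "ball x e \<subseteq> Om" using Om x(1) by (meson openE)
 obtain d where "(1/2) ^ d < e / (2 powi k0 * real CARD('a))"
  using e real_arch_pow_inv[of "e / (2 powi k0 * real CARD('a))" "1/2"] by auto
 then have "real CARD('a) * side (key_of (k0 - int d) x) < e"
  by (simp add: side_def power_int_diff field_simps power_one_over)
 moreover have "y \<in> ball x e" if "y \<in> cube (key_of (k0 - int d) x)"
  "real CARD('a) * side (key_of (k0 - int d) x) < e" for y
  using cube_dist[OF mem_cube_key_of that(1)] that(2) by (auto simp: dist_norm)
 ultimately have ex: "cube (key_of (k0 - int d) x) \<subseteq> Om" using e by auto
 define d' where "d' = (LEAST d. cube (key_of (k0 - int d) x) \<subseteq> Om)"
 have d'1: "cube (key_of (k0 - int d') x) \<subseteq> Om"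
  unfolding d'_def by (rule LeastI, rule ex)
 have "d' \<noteq> 0" using d'1 x(2) by auto
 then have d'2: "\<not> cube (key_of (k0 - int (d' - 1)) x) \<subseteq> Om"
  unfolding d'_def using not_less_Least by (metis (no_types, lifting) diff_less neq0_conv zero_less_one)
 show ?thesis
 proof (rule that[of "key_of (k0 - int d') x"])
  have "parent (key_of (k0 - int d') x) = key_of (k0 - int (d' - 1)) x"
   unfolding parent_key_of using \<open>d' \<noteq> 0\<close> by (intro arg_cong2[where f=key_of]) (auto simp: of_nat_diff)
  then show "key_of (k0 - int d') x \<in> sel k0 Om"
   using d'1 d'2 \<open>d' \<noteq> 0\<close> by (auto simp: sel_def)
 qed auto
qed

section \<open>Sums of dyadic kernels: weak type of the maximal truncation\<close>

text \<open>The class has to survive multiplication by indicators of cubes and balls, so continuity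
  is not asked for; boundedness and bounded support make all integrals against bounded kernels
  converge.\<close>

definition adm :: "('a::euclidean_space => complex) => bool" where
 "adm h \<longleftrightarrow> h \<in> BM \<and> (\<exists>M. \<forall>x. norm (h x) \<le> M) \<and> bounded {x. h x \<noteq> 0}"

lemma admD_measurable[measurable_dest]: "adm h ==> h \<in> BM"
 by (simp add: adm_def)

lemma adm_mult_bounded:
 assumes "adm h" "k \<in> BM" "\<And>x. norm (k x) \<le> M"
 shows "adm (\<lambda>x. k x * h x)"
proof -
 obtain M' where M': "\<And>x. norm (h x) \<le> M'" using assms(1) by (auto simp: adm_def)
 have "norm (k x * h x) \<le> M * M'" for x
  unfolding norm_mult using assms(3)[of x] M'[of x] by (intro mult_mono) (auto intro: order_trans[OF norm_ge_zero])
 moreover have "bounded {x. k x * h x \<noteq> 0}"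
  using assms(1) by (auto simp: adm_def intro: bounded_subset)
 moreover have [measurable]: "h \<in> BM" "k \<in> BM"
  using assms by (auto simp: adm_def)
 ultimately show ?thesis unfolding adm_def by (intro conjI exI[of _ "M * M'"] allI) measurable
qed

lemma adm_add: "adm g ==> adm h ==> adm (\<lambda>x. g x + h x)"
proof -
 assume a: "adm g" "adm h"
 obtain M M' where M: "\<And>x. norm (g x) \<le> M" "\<And>x. norm (h x) \<le> M'" using a by (auto simp: adm_def)
 have 1: "norm (g x + h x) \<le> M + M'" for x using M[of x] by (intro norm_triangle_mono)
 have 2: "bounded {x. g x + h x \<noteq> 0}"
 proof (rule bounded_subset)
  show "bounded ({x. g x \<noteq> 0} \<union> {x. h x \<noteq> 0})" using a by (simp add: adm_def)
 qed auto
 have [measurable]: "g \<in> BM" "h \<in> BM" using a by (auto simp: adm_def)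
 show ?thesis unfolding adm_def using 1 2 by (intro conjI exI[of _ "M + M'"] allI) measurable
qed

lemma adm_indicator: "adm h ==> S \<in> sets borel ==> adm (\<lambda>x. indicator S x * h x)"
 by (rule adm_mult_bounded[where M=1]) (auto simp: indicator_def)

lemma adm_integrable:
 assumes "adm h" shows "integrable lborel h"
proof -
 obtain M where M: "\<And>x. norm (h x) \<le> M" using assms by (auto simp: adm_def)
 have b: "bounded {x. h x \<noteq> 0}" and [measurable]: "h \<in> BM" using assms by (auto simp: adm_def)
 have "vol {x. h x \<noteq> 0} < \<infinity>" using b by (intro emeasure_bounded_finite)
 moreover have "{x. h x \<noteq> 0} \<in> sets lborel" by measurable
 ultimately have i: "integrable lborel (\<lambda>x. M * indicator {x. h x \<noteq> 0} x)" by simp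
 show ?thesis
 proof (rule Bochner_Integration.integrable_bound[OF i])
  show "AE x in lborel. norm (h x) \<le> norm (M * indicator {x. h x \<noteq> 0} x)"
   using M by (auto simp: indicator_def intro!: always_eventually intro: order_trans[OF _ abs_ge_self])
 qed simp
qed

lemma integrable_mult_bounded:
 assumes h: "integrable lborel h" and [measurable]: "k \<in> BM" and M: "\<And>x. norm (k x) \<le> M"
 shows "integrable lborel (\<lambda>x. k x * (h x :: complex))"
proof (rule Bochner_Integration.integrable_bound)
 show "integrable lborel (\<lambda>x. M * norm (h x))" using h by simp
 show "(\<lambda>x. k x * h x) \<in> borel_measurable lborel" using h by measurable
 show "AE x in lborel. norm (k x * h x) \<le> norm (M * norm (h x))"
  using M by (auto simp: norm_mult intro!: always_eventually mult_right_mono intro: order_trans[OF _ abs_ge_self] simp: abs_mult)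
qed

lemma norm_LINT_le: "enorm (LINT x|M. f x) \<le> (\<integral>\<^sup>+x. enorm (f x) \<partial>M)"
 for f :: "_ => complex"
 by (cases "integrable M f") (auto intro: integral_norm_bound_ennreal simp: not_integrable_integral_eq)

definition Top :: "(nat => 'a => 'a::euclidean_space => complex) => nat => ('a => complex) => 'a => complex" where
 "Top K J h x = (\<Sum>j<J. LINT y|lborel. K j x y * h y)"

text \<open>The size bound has one power more than \<open>bump\<close>; this makes the fine scales
  summable at a fixed distance. Regularity is asked only for increments below the scale
  \<open>2^(-j)\<close>. The last conjunct is an L^2 bound of the partial sums that is uniform in
  \<open>J\<close>; it is the only place where cancellation between the scales enters.\<close>

definition czker :: "real => (nat => 'a => 'a::euclidean_space => complex) => bool" where
 "czker A K \<longleftrightarrow>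
  (\<forall>j. case_prod (K j) \<in> BM2) \<and>
  (\<forall>j x y. norm (K j x y) \<le> A * (bmp (2^j) (x - y) / (1 + 2^j * norm (x - y)))) \<and>
  (\<forall>j x y y'. 2^j * norm (y - y') \<le> 1 \<longrightarrow>
    norm (K j x y - K j x y') \<le> A * (2^j * norm (y - y')) * bmp (2^j) (x - y)) \<and>
  (\<forall>j x x' y. 2^j * norm (x - x') \<le> 1 \<longrightarrow>
    norm (K j x y - K j x' y) \<le> A * (2^j * norm (x - x')) * bmp (2^j) (x - y)) \<and>
  (\<forall>J h. adm h \<longrightarrow>
    (\<integral>\<^sup>+x. ennreal (norm (Top K J h x) ^ 2)) \<le> ennreal A * (\<integral>\<^sup>+x. ennreal (norm (h x) ^ 2)))"

lemma bmp_compare: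
 fixes u v :: "'a::euclidean_space"
 assumes "0 < R" "0 \<le> c" "1 + R * norm v \<le> c * (1 + R * norm u)"
 shows "bmp R u \<le> c ^ (DIM('a) + 1) * bmp R v"
proof -
 have p: "0 < 1 + R * norm u" "0 < 1 + R * norm v" using assms(1) by (auto intro: add_pos_nonneg)
 have "(1 + R * norm v) ^ (DIM('a) + 1) \<le> (c * (1 + R * norm u)) ^ (DIM('a) + 1)"
  using assms p by (intro power_mono) auto
 then have "(1 + R * norm v) ^ (DIM('a) + 1) \<le> c ^ (DIM('a) + 1) * (1 + R * norm u) ^ (DIM('a) + 1)"
  by (simp only: power_mult_distrib)
 then have "R ^ DIM('a) * (1 + R * norm v) ^ (DIM('a) + 1) \<le> R ^ DIM('a) * (c ^ (DIM('a) + 1) * (1 + R * norm u) ^ (DIM('a) + 1))"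
  using assms(1) by (intro mult_left_mono) auto
 then show ?thesis using p unfolding bump_def
  by (simp add: divide_simps zero_less_power del: power_Suc power_add) (simp add: mult_ac del: power_Suc)
qed

lemma bmp_shift:
 fixes u v :: "'a::euclidean_space"
 assumes "0 < R" "0 \<le> c" "R * norm (u - v) \<le> c"
 shows "bmp R u \<le> (1 + c) ^ (DIM('a) + 1) * bmp R v"
proof (rule bmp_compare)
 have "norm v \<le> norm u + norm (u - v)" by (metis norm_minus_commute norm_triangle_sub)
 then have "R * norm v \<le> R * norm u + R * norm (u - v)" using assms(1) by (simp flip: distrib_left)
 moreover have "0 \<le> R * (c * norm u)" using assms by simp
 ultimately have "1 + R * norm v \<le> 1 + R * norm u + c + R * (c * norm u)" using assms by linarith
 then show "1 + R * norm v \<le> (1 + c) * (1 + R * norm u)" by (simp add: algebra_simps)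
qed (use assms in auto)

definition avgok :: "('a::euclidean_space => complex) => 'a => real => bool" where
 "avgok h x l \<longleftrightarrow> (\<forall>t>0. (\<integral>\<^sup>+y\<in>ball x t. enorm (h y) \<partial>lborel) \<le> ennreal l * vol (ball x t))"

lemma avgok_big_set: "x \<notin> big_set (\<lambda>y. enorm (h y)) l ==> avgok h x l"
 using not_big_set[of x "(\<lambda>y. enorm (h y))" l] by (simp add: avgok_def)

lemma avgok_mono_fun:
 assumes "avgok h x l" "\<And>y. norm (g y) \<le> norm (h y)"
 shows "avgok g x l"
 unfolding avgok_def
proof (intro allI impI)
 fix t :: real assume "0 < t"
 have "(\<integral>\<^sup>+y\<in>ball x t. enorm (g y) \<partial>lborel) \<le> (\<integral>\<^sup>+y\<in>ball x t. enorm (h y) \<partial>lborel)"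
  using assms(2) by (intro nn_integral_mono mult_right_mono ennreal_leI) auto
 also have "\<dots> \<le> ennreal l * vol (ball x t)" using assms(1) \<open>0 < t\<close> by (simp add: avgok_def)
 finally show "(\<integral>\<^sup>+y\<in>ball x t. enorm (g y) \<partial>lborel) \<le> ennreal l * vol (ball x t)" .
qed

text \<open>The pointwise bound \<open>|f| \<le> l/2 + |f|^2/(2 l)\<close> takes the place of the
  Cauchy-Schwarz inequality; \<open>l\<close> stands for the expected size of
  \<open>f\<close>.\<close>

lemma nn_integral_le_of_sq:
 fixes f :: "_ => complex"
 assumes l: "0 < l" and [measurable]: "f \<in> borel_measurable M" "S \<in> sets M"
 shows "(\<integral>\<^sup>+y\<in>S. enorm (f y) \<partial>M)
  \<le> ennreal (l / 2) * emeasure M S + ennreal (1 / (2 * l)) * (\<integral>\<^sup>+y\<in>S. ennreal (norm (f y) ^ 2) \<partial>M)"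
proof -
 have "(\<integral>\<^sup>+y\<in>S. enorm (f y) \<partial>M)
   \<le> (\<integral>\<^sup>+y. ennreal (l/2) * indicator S y + ennreal (1 / (2 * l)) * (ennreal (norm (f y) ^ 2) * indicator S y) \<partial>M)"
 proof (intro nn_integral_mono)
  fix y
  have "0 \<le> (norm (f y) - l)^2" by simp
  then have "norm (f y) \<le> l / 2 + 1 / (2 * l) * norm (f y) ^ 2"
   using l by (simp add: field_simps power2_eq_square)
  then have "enorm (f y) \<le> ennreal (l/2) + ennreal (1 / (2 * l)) * ennreal (norm (f y) ^ 2)"
   using l by (simp add: ennreal_leI flip: ennreal_mult ennreal_plus)
  then show "enorm (f y) * indicator S y \<le> ennreal (l/2) * indicator S y + ennreal (1 / (2 * l)) * (ennreal (norm (f y) ^ 2) * indicator S y)"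
   by (auto simp: indicator_def)
 qed
 also have "\<dots> = ennreal (l / 2) * emeasure M S + ennreal (1 / (2 * l)) * (\<integral>\<^sup>+y\<in>S. ennreal (norm (f y) ^ 2) \<partial>M)"
  by (subst nn_integral_add) (auto simp: nn_integral_cmult)
 finally show ?thesis .
qed

lemma nn_integral_le_of_sq':
 fixes f :: "_ => complex"
 assumes l: "0 < l" "0 \<le> c" and m[measurable]: "f \<in> borel_measurable M" "S \<in> sets M"
  and le: "(\<integral>\<^sup>+y\<in>S. ennreal (norm (f y) ^ 2) \<partial>M) \<le> ennreal (c * l ^ 2) * emeasure M S"
 shows "(\<integral>\<^sup>+y\<in>S. enorm (f y) \<partial>M) \<le> ennreal ((1 + c) * l / 2) * emeasure M S"
proof -
 have "(\<integral>\<^sup>+y\<in>S. enorm (f y) \<partial>M)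
  \<le> ennreal (l / 2) * emeasure M S + ennreal (1 / (2 * l)) * (\<integral>\<^sup>+y\<in>S. ennreal (norm (f y) ^ 2) \<partial>M)"
  by (rule nn_integral_le_of_sq[OF l(1) m])
 also have "\<dots> \<le> ennreal (l / 2) * emeasure M S + ennreal (1 / (2 * l)) * (ennreal (c * l ^ 2) * emeasure M S)"
  by (intro add_left_mono mult_left_mono le) auto
 also have "\<dots> = (ennreal (l/2) + ennreal (1 / (2 * l)) * ennreal (c * l^2)) * emeasure M S"
  by (simp add: distrib_right mult.assoc)
 also have "ennreal (l/2) + ennreal (1 / (2 * l)) * ennreal (c * l^2) = ennreal (l / 2 + 1 / (2 * l) * (c * l^2))"
  using l by (simp flip: ennreal_mult ennreal_plus)
 also have "l / 2 + 1 / (2 * l) * (c * l^2) = (1 + c) * l / 2"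
  using l by (simp add: field_simps power2_eq_square)
 finally show ?thesis .
qed

lemma avgok_sq:
 assumes l: "0 < l" and [measurable]: "g \<in> BM" and x: "x \<notin> big_set (\<lambda>y. ennreal (norm (g y) ^ 2)) (l^2)"
 shows "avgok g x l"
 unfolding avgok_def
proof (intro allI impI)
 fix t :: real assume t: "0 < t"
 have "(\<integral>\<^sup>+y\<in>ball x t. enorm (g y) \<partial>lborel) \<le> ennreal ((1 + 1) * l / 2) * vol (ball x t)"
  using l t not_big_set[OF x, of x t] by (intro nn_integral_le_of_sq') auto
 then show "(\<integral>\<^sup>+y\<in>ball x t. enorm (g y) \<partial>lborel) \<le> ennreal l * vol (ball x t)" by simp
qed

lemma sum_inv_pow2_le: "(\<Sum>j\<in>{p..<J}. c / 2^j) \<le> 2 * c / 2^p" if "0 \<le> (c::real)"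
proof -
 have "(\<Sum>j\<in>{p..<p+m}. c / 2^j) = 2 * c / 2^p - 2 * c / 2^(p+m)" for m
 proof (induction m)
  case (Suc m)
  have "(\<Sum>j\<in>{p..<p+Suc m}. c / 2^j) = 2 * c / 2^p - 2 * c / 2^(p+m) + c / 2^(p+m)"
   using Suc by simp
  also have "2 * c / 2^(p+m) - c / 2^(p+m) = 2 * c / 2^(p+Suc m)" by simp
  then have "2 * c / 2^p - 2 * c / 2^(p+m) + c / 2^(p+m) = 2 * c / 2^p - 2 * c / 2^(p+Suc m)" by linarith
  finally show ?case .
 qed simp
 then have "(\<Sum>j\<in>{p..<p+(J-p)}. c / 2^j) \<le> 2 * c / 2^p" using that by simp
 then show ?thesis by (cases "p \<le> J") (use that in auto)
qed

context
 fixes A :: real and K :: "nat => 'a => 'a::euclidean_space => complex"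
 assumes A: "0 < A" and cz: "czker A K"
begin

lemma K_meas2[measurable]: "case_prod (K j) \<in> BM2"
 using cz by (simp add: czker_def)

lemma K_meas2'[measurable]: "(\<lambda>p. K j (fst p) (snd p)) \<in> BM2"
 using K_meas2[of j] by (simp add: case_prod_beta')

lemma K_meas[measurable]: "K j x \<in> BM" "(\<lambda>x. K j x y) \<in> BM"
proof -
 show "K j x \<in> BM" using K_meas2[of j] by measurable
 show "(\<lambda>x. K j x y) \<in> BM" using K_meas2[of j] by measurable
qed

lemma K_size: "norm (K j x y) \<le> A * (bmp (2^j) (x - y) / (1 + 2^j * norm (x - y)))"
 using cz by (simp add: czker_def)

lemma K_size': "norm (K j x y) \<le> A * bmp (2^j) (x - y)"
proof -
 have "1 \<le> 1 + 2 ^ j * norm (x - y)" by simp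
 then have "bmp (2^j) (x - y) / (1 + 2^j * norm (x - y)) \<le> bmp (2^j) (x - y) / 1"
  by (intro divide_left_mono bmp_nonneg) (auto intro: add_pos_nonneg)
 then have "A * (bmp (2^j) (x - y) / (1 + 2^j * norm (x - y))) \<le> A * bmp (2^j) (x - y)"
  using A by (intro mult_left_mono) auto
 with K_size[of j x y] show ?thesis by linarith
qed

lemma K_bounded: "norm (K j x y) \<le> A * (2^j) ^ DIM('a)"
proof -
 have "1 \<le> (1 + 2 ^ j * norm (x - y)) ^ (DIM('a) + 1)" by (intro one_le_power) simp
 then have "bmp (2^j) (x - y) \<le> (2^j) ^ DIM('a) / 1"
  unfolding bump_def by (intro divide_left_mono) (auto intro!: add_pos_nonneg zero_less_power)
 then have "A * bmp (2^j) (x - y) \<le> A * (2^j) ^ DIM('a)" using A by (intro mult_left_mono) auto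
 with K_size'[of j x y] show ?thesis by linarith
qed

lemma K_integrable: "adm h ==> integrable lborel (\<lambda>y. K j x y * h y)"
 by (rule integrable_mult_bounded[OF adm_integrable _ K_bounded]) measurable

lemma Top_meas:
 assumes [measurable]: "h \<in> BM" shows "Top K J h \<in> BM"
 unfolding Top_def by (intro borel_measurable_sum lborel.borel_measurable_lebesgue_integral) measurable

lemma Top_add: "adm g ==> adm h ==> Top K J (\<lambda>y. g y + h y) x = Top K J g x + Top K J h x"
 unfolding Top_def by (simp add: distrib_left K_integrable sum.distrib)

text \<open>Beyond the scale \<open>2^(-j)\<close> the factor \<open>2^j * norm (x - x')\<close>
  exceeds 1, so the size bound at both points suffices; \<open>c\<close> is the price of moving the
  profile from \<open>x'\<close> to \<open>x\<close>.\<close>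

lemma K_diff_x:
 assumes c: "1 \<le> c" "2^j * norm (x - x') \<le> c"
 shows "norm (K j x y - K j x' y) \<le> A * (1 + (1 + c) ^ (DIM('a) + 1)) * (2^j * norm (x - x')) * bmp (2^j) (x - y)"
proof (cases "2^j * norm (x - x') \<le> 1")
 case True
 then have "norm (K j x y - K j x' y) \<le> A * 1 * (2^j * norm (x - x')) * bmp (2^j) (x - y)"
  using cz by (simp add: czker_def)
 also have "\<dots> \<le> A * (1 + (1 + c) ^ (DIM('a) + 1)) * (2^j * norm (x - x')) * bmp (2^j) (x - y)"
  using A c by (intro mult_right_mono mult_left_mono bmp_nonneg) auto
 finally show ?thesis .
next
 case False
 have "norm (K j x y - K j x' y) \<le> A * bmp (2^j) (x - y) + A * bmp (2^j) (x' - y)"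
  using K_size'[of j x y] K_size'[of j x' y] norm_triangle_ineq4[of "K j x y" "K j x' y"] by linarith
 also have "bmp (2^j) (x' - y) \<le> (1 + c) ^ (DIM('a) + 1) * bmp (2^j) (x - y)"
  using c by (intro bmp_shift) (auto simp: norm_minus_commute)
 finally have "norm (K j x y - K j x' y) \<le> A * (1 + (1 + c) ^ (DIM('a) + 1)) * 1 * bmp (2^j) (x - y)"
  using A by (simp add: algebra_simps)
 also have "\<dots> \<le> A * (1 + (1 + c) ^ (DIM('a) + 1)) * (2^j * norm (x - x')) * bmp (2^j) (x - y)"
  using A c False by (intro mult_right_mono mult_left_mono bmp_nonneg) auto
 finally show ?thesis .
qed

lemma nn_integral_bmp_avgok:
 fixes h :: "'a => complex"
 assumes "avgok h x l" "0 \<le> l" "h \<in> BM" "0 < R"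
 shows "(\<integral>\<^sup>+y. ennreal (bmp R (x - y)) * enorm (h y)) \<le> ennreal (bconst TYPE('a) * l)"
 by (rule nn_integral_bmp) (use assms in \<open>auto simp: avgok_def\<close>)

lemma LINT_bmp_le:
 fixes h :: "'a => complex"
 assumes ok: "avgok h x l" "0 \<le> l" and [measurable]: "h \<in> BM" and R: "0 < R" and c: "0 \<le> c"
  and le: "\<And>y. norm (F y) \<le> c * bmp R (x - y) * norm (h y)"
 shows "norm (LINT y|lborel. F y :: complex) \<le> c * bconst TYPE('a) * l"
proof -
 have "enorm (LINT y|lborel. F y) \<le> (\<integral>\<^sup>+y. enorm (F y))" by (rule norm_LINT_le)
 also have "\<dots> \<le> (\<integral>\<^sup>+y. ennreal c * (ennreal (bmp R (x - y)) * enorm (h y)))"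
  using le c R by (intro nn_integral_mono) (simp add: ennreal_leI bmp_nonneg mult.assoc flip: ennreal_mult)
 also have "\<dots> = ennreal c * (\<integral>\<^sup>+y. ennreal (bmp R (x - y)) * enorm (h y))"
  by (intro nn_integral_cmult) measurable
 also have "\<dots> \<le> ennreal c * ennreal (bconst TYPE('a) * l)"
  using ok R by (intro mult_left_mono nn_integral_bmp_avgok) auto
 also have "\<dots> = ennreal (c * bconst TYPE('a) * l)"
  using c ok(2) bconst_pos[where 'a='a] by (simp add: mult.assoc flip: ennreal_mult)
 finally show ?thesis using c ok(2) bconst_pos[where 'a='a] by (subst (asm) ennreal_le_iff) (auto simp: less_imp_le)
qed

text \<open>Scale \<open>j\<close> has Lipschitz constant of order \<open>2^j\<close>, and the sum
  over \<open>j < J\<close> is dominated by the finest scale.\<close>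

lemma Top_diff_le:
 assumes h: "adm h" and ok: "avgok h x l" "0 \<le> l" and c: "1 \<le> c" "2^J * norm (x - x') \<le> c"
 shows "norm (Top K J h x - Top K J h x') \<le> A * (1 + (1 + c) ^ (DIM('a) + 1)) * bconst TYPE('a) * l * (2^J * norm (x - x'))"
proof -
 define D where "D = A * (1 + (1 + c) ^ (DIM('a) + 1))"
 have D: "0 \<le> D" using A c by (simp add: D_def)
 have [measurable]: "h \<in> BM" using h by (simp add: adm_def)
 have 1: "norm ((LINT y|lborel. K j x y * h y) - (LINT y|lborel. K j x' y * h y)) \<le> D * bconst TYPE('a) * l * norm (x - x') * 2^j"
  if "j < J" for j
 proof -
  have j: "2^j * norm (x - x') \<le> c"
   using that c(2) by (intro order_trans[OF mult_right_mono c(2)]) auto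
  have "(LINT y|lborel. K j x y * h y) - (LINT y|lborel. K j x' y * h y) = (LINT y|lborel. (K j x y - K j x' y) * h y)"
   using K_integrable[OF h] by (subst Bochner_Integration.integral_diff[symmetric]) (auto simp: left_diff_distrib)
  also have "norm \<dots> \<le> (D * (2^j * norm (x - x'))) * bconst TYPE('a) * l"
   using K_diff_x[OF c(1) j] D
   by (intro LINT_bmp_le[OF ok _ , where R="2^j"]) (auto simp: norm_mult D_def intro!: mult_right_mono)
  finally show ?thesis by (simp add: mult_ac)
 qed
 have "norm (Top K J h x - Top K J h x') \<le> (\<Sum>j<J. D * bconst TYPE('a) * l * norm (x - x') * 2^j)"
  unfolding Top_def sum_subtractf[symmetric] by (intro sum_norm_le 1) auto
 also have "\<dots> = D * bconst TYPE('a) * l * norm (x - x') * (2^J - 1)"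
 proof -
  have "(\<Sum>j<J. 2^j) = (2^J - 1 :: real)" by (induction J) auto
  then show ?thesis by (simp add: sum_distrib_left[symmetric])
 qed
 also have "\<dots> \<le> D * bconst TYPE('a) * l * norm (x - x') * 2^J"
  using D ok(2) bconst_pos[where 'a='a] by (intro mult_left_mono) auto
 finally show ?thesis by (simp add: D_def mult_ac)
qed

text \<open>At distance \<open>d\<close> the spare power of the size bound is worth
  \<open>1 / (2^j * d)\<close>, a geometric series in \<open>j\<close>. The averages remain centred
  at \<open>x\<close> while the kernel sits at \<open>x'\<close>; this is possible because
  \<open>x'\<close> moves by at most half the distance to the support.\<close>

lemma far_sum_le:
 assumes h: "adm h" and ok: "avgok h x l" "0 \<le> l" and d: "0 < d" "norm (x' - x) \<le> d / 2"
  and van: "\<And>y. norm (x - y) < d ==> h y = 0"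
 shows "(\<Sum>j\<in>{p..<J}. norm (LINT y|lborel. K j x' y * h y)) \<le> A * 2 ^ (DIM('a) + 3) * bconst TYPE('a) * l / (2^p * d)"
proof -
 have [measurable]: "h \<in> BM" using h by (simp add: adm_def)
 have 1: "norm (LINT y|lborel. K j x' y * h y) \<le> (A * 2 ^ (DIM('a) + 2) / d * bconst TYPE('a) * l) / 2 ^ j" for j
 proof -
  have "norm (LINT y|lborel. K j x' y * h y) \<le> (A * 2 ^ (DIM('a) + 2) / (2^j * d)) * bconst TYPE('a) * l"
  proof (rule LINT_bmp_le[OF ok, where R="2^j"])
   fix y
   show "norm (K j x' y * h y) \<le> (A * 2 ^ (DIM('a) + 2) / (2^j * d)) * bmp (2^j) (x - y) * norm (h y)"
   proof (cases "norm (x - y) < d")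
    case False
    have n: "norm (x - y) \<le> 2 * norm (x' - y)"
     using norm_triangle_ineq[of "x' - y" "x - x'"] d(2) False by (simp add: norm_minus_commute)
    have b: "bmp (2^j) (x' - y) \<le> 2 ^ (DIM('a) + 1) * bmp (2^j) (x - y)"
    proof (rule bmp_compare)
     show "1 + 2 ^ j * norm (x - y) \<le> 2 * (1 + 2 ^ j * norm (x' - y))"
     proof -
      have "2^j * norm (x - y) \<le> 2^j * (2 * norm (x' - y))" by (intro mult_left_mono n) auto
      moreover have "2^j * (2 * norm (x' - y)) = 2 * (2^j * norm (x' - y))" by simp
      ultimately show ?thesis unfolding distrib_left by linarith
     qed
    qed auto
    have q: "2^j * d / 2 \<le> 1 + 2^j * norm (x' - y)"
    proof -
     have "2^j * d \<le> 2^j * (2 * norm (x' - y))" using n False by (intro mult_left_mono) auto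
     moreover have "2^j * (2 * norm (x' - y)) = 2 * (2^j * norm (x' - y))" by simp
     ultimately show ?thesis by linarith
    qed
    have "norm (K j x' y) \<le> A * (bmp (2^j) (x' - y) / (1 + 2^j * norm (x' - y)))" by (rule K_size)
    also have "\<dots> \<le> A * ((2 ^ (DIM('a) + 1) * bmp (2^j) (x - y)) / (2^j * d / 2))"
     using A b q d by (intro mult_left_mono frac_le) (auto simp: bmp_nonneg)
    also have "\<dots> = (A * 2 ^ (DIM('a) + 2) / (2^j * d)) * bmp (2^j) (x - y)" by simp
    finally show ?thesis unfolding norm_mult by (intro mult_right_mono) auto
   qed (simp add: van)
  qed (use A d in auto)
  then show ?thesis by (simp add: mult_ac)
 qed
 have "(\<Sum>j\<in>{p..<J}. norm (LINT y|lborel. K j x' y * h y)) \<le> (\<Sum>j\<in>{p..<J}. (A * 2 ^ (DIM('a) + 2) / d * bconst TYPE('a) * l) / 2 ^ j)"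
  by (intro sum_mono 1)
 also have "\<dots> \<le> 2 * (A * 2 ^ (DIM('a) + 2) / d * bconst TYPE('a) * l) / 2 ^ p"
  using A d ok(2) bconst_pos[where 'a='a] by (intro sum_inv_pow2_le) auto
 also have "\<dots> = A * 2 ^ (DIM('a) + 3) * bconst TYPE('a) * l / (2^p * d)" by (simp add: power_add mult_ac)
 finally show ?thesis .
qed

lemma Top_L2: "adm h ==> (\<integral>\<^sup>+x. ennreal (norm (Top K J h x) ^ 2)) \<le> ennreal A * (\<integral>\<^sup>+x. ennreal (norm (h x) ^ 2))"
 using cz by (simp add: czker_def)

end

lemma ennreal_mult2: "0 \<le> a ==> 0 \<le> b ==> ennreal a * (ennreal b * X) = ennreal (a * b) * X"
 by (simp add: ennreal_mult mult.assoc)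

lemma ennreal_mult3: "0 \<le> a ==> 0 \<le> b ==> 0 \<le> c ==> ennreal a * (ennreal b * (ennreal c * X)) = ennreal (a * b * c) * X"
 by (simp add: ennreal_mult mult.assoc)

section \<open>Cotlar's inequality and the weak type (2,2) of the maximal truncation\<close>

context
 fixes A :: real and K :: "nat => 'a => 'a::euclidean_space => complex"
 assumes A: "0 < A" and cz: "czker A K"
begin

text \<open>Compare with every \<open>x'\<close> in the ball of radius \<open>2^(-J)\<close> and
  average. The truncation at \<open>J\<close> varies slowly on that ball. For the part of
  \<open>g\<close> outside the double ball the scales from \<open>J\<close> on contribute little, so
  \<open>N\<close> may replace \<open>J\<close>; the part inside is left to the L^2 bound. The
  exceptional sets depend on \<open>N\<close> only, so all \<open>J \<le> N\<close> are treated at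
  once.\<close>

lemma cotlar:
 assumes g: "adm g" and l: "0 < l" and JN: "J \<le> N"
  and x1: "x \<notin> big_set (\<lambda>y. ennreal (norm (Top K N g y) ^ 2)) (l^2)"
  and x2: "x \<notin> big_set (\<lambda>y. ennreal (norm (g y) ^ 2)) (l^2)"
 shows "norm (Top K J g x) \<le> (A * (1 + 2 ^ (DIM('a) + 1)) * bconst TYPE('a) + A * 2 ^ (DIM('a) + 3) * bconst TYPE('a)
   + 2 + A * 2 ^ DIM('a)) * l"
proof -
 define r :: real where "r = 1 / 2^J"
 have r: "0 < r" "2^J * r = 1" by (auto simp: r_def)
 define b where "b = bconst TYPE('a)"
 have b: "0 < b" by (simp add: b_def bconst_pos)
 define gi where "gi = (\<lambda>y. indicator (ball x (2*r)) y * g y)"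
 define go where "go = (\<lambda>y. indicator (- ball x (2*r)) y * g y)"
 have [measurable]: "g \<in> BM" using g by (simp add: adm_def)
 have ai: "adm gi" and ao: "adm go"
  unfolding gi_def go_def using g by (auto intro!: adm_indicator)
 have sp: "g = (\<lambda>y. gi y + go y)" by (auto simp: gi_def go_def indicator_def)
 have ok: "avgok g x l" using avgok_sq[OF l _ x2] by simp
 have oko: "avgok go x l" by (rule avgok_mono_fun[OF ok]) (auto simp: go_def indicator_def)
 have [measurable]: "Top K J' h \<in> BM" if "adm h" for J' h
  using Top_meas[OF A cz] that by (simp add: adm_def)
 have meas: "Top K J' gi \<in> BM" "Top K J' g \<in> BM" for J'
  using ai g by measurable
 define c1 where "c1 = A * (1 + 2 ^ (DIM('a) + 1)) * b"
 define c2 where "c2 = A * 2 ^ (DIM('a) + 3) * b"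
 define c3 where "c3 = A * 2 ^ DIM('a)"
 have c: "0 \<le> c1" "0 \<le> c2" "0 \<le> c3" using A b by (auto simp: c1_def c2_def c3_def)
 have pw: "norm (Top K J g x) \<le> (c1 + c2) * l + norm (Top K N g x') + norm (Top K N gi x') + norm (Top K J gi x')"
  if x': "x' \<in> ball x r" for x'
 proof -
  have d: "2^J * norm (x - x') \<le> 1"
   using x' r by (metis dist_norm less_imp_le mem_ball mult_left_mono zero_le_numeral zero_le_power)
  have "norm (Top K J g x - Top K J g x') \<le> A * (1 + (1 + 1) ^ (DIM('a) + 1)) * b * l * (2^J * norm (x - x'))"
   using Top_diff_le[OF A cz g ok _ _ d] l b_def by simp
  also have "\<dots> \<le> A * (1 + (1 + 1) ^ (DIM('a) + 1)) * b * l * 1"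
   using d A b l by (intro mult_left_mono) auto
  finally have 1: "norm (Top K J g x - Top K J g x') \<le> c1 * l" by (simp add: c1_def)
  have "norm (Top K N go x' - Top K J go x') \<le> (\<Sum>j\<in>{J..<N}. norm (LINT y|lborel. K j x' y * go y))"
  proof -
   have "Top K N go x' - Top K J go x' = (\<Sum>j\<in>{J..<N}. LINT y|lborel. K j x' y * go y)"
    unfolding Top_def lessThan_atLeast0 using JN by (subst sum_diff_nat_ivl) auto
   then show ?thesis by (simp add: norm_sum)
  qed
  also have "\<dots> \<le> A * 2 ^ (DIM('a) + 3) * bconst TYPE('a) * l / (2^J * (2*r))"
   using r x' l by (intro far_sum_le[OF A cz ao oko]) (auto simp: go_def dist_norm norm_minus_commute indicator_def)
  also have "2^J * (2*r) = 2" using r by simp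
  also have "A * 2 ^ (DIM('a) + 3) * bconst TYPE('a) * l / 2 \<le> c2 * l"
   unfolding c2_def b_def[symmetric] using A b l by simp
  finally have 2: "norm (Top K N go x' - Top K J go x') \<le> c2 * l" .
  \<comment> \<open>At \<open>x'\<close> the truncation \<open>J\<close> is traded for
    \<open>N\<close>: on the outer part the two differ by the small tail, and the inner part is
    removed at \<open>N\<close> and put back at \<open>J\<close>.\<close>
  have "Top K J g x = (Top K J g x - Top K J g x') + Top K N g x' - Top K N gi x' + Top K J gi x' - (Top K N go x' - Top K J go x')"
   using Top_add[OF A cz ai ao, of J x'] Top_add[OF A cz ai ao, of N x'] unfolding sp[symmetric] by simp
  then have "norm (Top K J g x) = norm ((Top K J g x - Top K J g x') + Top K N g x' - Top K N gi x' + Top K J gi x' - (Top K N go x' - Top K J go x'))"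
   by (rule arg_cong)
  also have "\<dots> \<le> norm (Top K J g x - Top K J g x') + norm (Top K N g x') + norm (Top K N gi x') + norm (Top K J gi x')
    + norm (Top K N go x' - Top K J go x')"
  proof -
   have "norm (a + b - c + d - e) \<le> norm a + norm b + norm c + norm d + norm e" for a b c d e :: complex
    using norm_triangle_ineq4[of "a + b - c + d" e] norm_triangle_ineq[of "a + b - c" d]
     norm_triangle_ineq4[of "a + b" c] norm_triangle_ineq[of a b] by linarith
   then show ?thesis .
  qed
  finally show ?thesis unfolding distrib_right using 1 2 by linarith
 qed
 define B where "B = ball x r"
 define V where "V = vol B"
 have [measurable]: "B \<in> sets borel" by (simp add: B_def)
 have "unit_ball_vol (real DIM('a)) \<noteq> 0" by (metis less_irrefl of_nat_0_le_iff unit_ball_vol_pos)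
 then have V: "V \<noteq> \<infinity>" "V \<noteq> 0" using r by (auto simp: V_def B_def emeasure_ball)
 have i1: "(\<integral>\<^sup>+y\<in>B. enorm (Top K N g y) \<partial>lborel) \<le> ennreal ((1 + 1) * l / 2) * V"
  unfolding V_def using not_big_set[OF x1, of x r] r
  by (intro nn_integral_le_of_sq'[OF l]) (auto simp: B_def meas)
 have i2: "(\<integral>\<^sup>+y\<in>B. enorm (Top K J' gi y) \<partial>lborel) \<le> ennreal ((1 + c3) * l / 2) * V" for J'
  unfolding V_def
 proof (rule nn_integral_le_of_sq'[OF l])
  have "(\<integral>\<^sup>+y\<in>B. ennreal (norm (Top K J' gi y) ^ 2) \<partial>lborel) \<le> (\<integral>\<^sup>+y. ennreal (norm (Top K J' gi y) ^ 2))"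
   by (intro nn_integral_mono) (auto simp: indicator_def)
  also have "\<dots> \<le> ennreal A * (\<integral>\<^sup>+y. ennreal (norm (gi y) ^ 2))" by (rule Top_L2[OF A cz ai])
  also have "(\<integral>\<^sup>+y. ennreal (norm (gi y) ^ 2)) = (\<integral>\<^sup>+y\<in>ball x (2*r). ennreal (norm (g y) ^ 2) \<partial>lborel)"
   by (intro nn_integral_cong) (auto simp: gi_def indicator_def)
  also have "\<dots> \<le> ennreal (l^2) * vol (ball x (2*r))" using r by (intro not_big_set[OF x2]) auto
  also have "vol (ball x (2*r)) = ennreal (2 ^ DIM('a)) * vol B"
   unfolding B_def using r by (intro emeasure_ball_scale) auto
  also have "ennreal A * (ennreal (l^2) * (ennreal (2 ^ DIM('a)) * vol B)) = ennreal (c3 * l^2) * vol B"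
   using A by (subst ennreal_mult3) (auto simp: c3_def mult_ac)
  finally show "(\<integral>\<^sup>+y\<in>B. ennreal (norm (Top K J' gi y) ^ 2) \<partial>lborel) \<le> ennreal (c3 * l^2) * vol B"
   by (simp add: mult_left_mono)
 qed (auto simp: meas c)
 \<comment> \<open>Integration over \<open>B\<close> spares the choice of a good \<open>x'\<close>:
   every term on the right has an average of order \<open>l\<close> over the ball.\<close>
 have "enorm (Top K J g x) * V = (\<integral>\<^sup>+y. enorm (Top K J g x) * indicator B y)"
  by (simp add: V_def nn_integral_cmult_indicator)
 also have "\<dots> \<le> (\<integral>\<^sup>+y. ennreal ((c1 + c2) * l) * indicator B y + (enorm (Top K N g y) * indicator B y +
    (enorm (Top K N gi y) * indicator B y + enorm (Top K J gi y) * indicator B y)))"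
 proof (intro nn_integral_mono)
  fix y
  show "enorm (Top K J g x) * indicator B y \<le> ennreal ((c1 + c2) * l) * indicator B y + (enorm (Top K N g y) * indicator B y +
    (enorm (Top K N gi y) * indicator B y + enorm (Top K J gi y) * indicator B y))"
   using pw[of y] c l by (auto simp: indicator_def B_def ennreal_leI add.assoc simp flip: ennreal_plus)
 qed
 also have "\<dots> = ennreal ((c1 + c2) * l) * V + ((\<integral>\<^sup>+y\<in>B. enorm (Top K N g y) \<partial>lborel) +
   ((\<integral>\<^sup>+y\<in>B. enorm (Top K N gi y) \<partial>lborel) + (\<integral>\<^sup>+y\<in>B. enorm (Top K J gi y) \<partial>lborel)))"
  using meas by (simp add: nn_integral_add V_def nn_integral_cmult_indicator)
 also have "\<dots> \<le> ennreal ((c1 + c2) * l) * V + (ennreal ((1 + 1) * l / 2) * V +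
   (ennreal ((1 + c3) * l / 2) * V + ennreal ((1 + c3) * l / 2) * V))"
  by (intro add_mono i1 i2 order_refl)
 also have "\<dots> = ennreal ((c1 + c2) * l + ((1 + 1) * l / 2 + ((1 + c3) * l / 2 + (1 + c3) * l / 2))) * V"
 proof -
  have "ennreal a * V + (ennreal b * V + (ennreal d * V + ennreal e * V)) = ennreal (a + (b + (d + e))) * V"
   if "0 \<le> a" "0 \<le> b" "0 \<le> d" "0 \<le> e" for a b d e
   using that by (simp add: distrib_right)
  from this[of "(c1 + c2) * l" "(1 + 1) * l / 2" "(1 + c3) * l / 2" "(1 + c3) * l / 2"]
  show ?thesis using c l by (meson add_nonneg_nonneg divide_nonneg_pos less_imp_le mult_nonneg_nonneg zero_le_one zero_less_numeral)
 qed
 also have "(c1 + c2) * l + ((1 + 1) * l / 2 + ((1 + c3) * l / 2 + (1 + c3) * l / 2)) = (c1 + c2 + 2 + c3) * l"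
  by (simp add: field_simps)
 finally have "enorm (Top K J g x) \<le> ennreal ((c1 + c2 + 2 + c3) * l)"
  using V by (simp add: ennreal_mult_le_mult_iff mult.commute[of _ V] top.not_eq_extremum)
 then show ?thesis using c l by (subst (asm) ennreal_le_iff) (auto simp: c1_def c2_def c3_def b_def)
qed

text \<open>Off the superlevel sets of the maximal functions of two squares, Cotlar's inequality
  bounds all truncations up to \<open>N\<close>. The measures of both sets are controlled by the L^2
  norm of \<open>g\<close> independently of \<open>N\<close>, and \<open>N\<close> tends to infinity
  along an increasing union.\<close>

lemma weak_type_2:
 assumes g: "adm g" and l: "0 < l"
  and C: "C = A * (1 + 2 ^ (DIM('a) + 1)) * bconst TYPE('a) + A * 2 ^ (DIM('a) + 3) * bconst TYPE('a) + 2 + A * 2 ^ DIM('a)"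
 shows "vol {x. \<exists>J. C * l < norm (Top K J g x)}
  \<le> ennreal (5 ^ DIM('a) / l^2 * (1 + A)) * (\<integral>\<^sup>+y. ennreal (norm (g y) ^ 2))"
proof -
 have [measurable]: "g \<in> BM" using g by (simp add: adm_def)
 have Tm[measurable]: "Top K J g \<in> BM" for J by (rule Top_meas[OF A cz]) simp
 define E where "E N = {x. \<exists>J\<le>N. C * l < norm (Top K J g x)}" for N
 define G where "G = (\<integral>\<^sup>+y. ennreal (norm (g y) ^ 2))"
 have Em: "E N \<in> sets lborel" for N unfolding E_def by measurable
 have le: "vol (E N) \<le> ennreal (5 ^ DIM('a) / l^2 * (1 + A)) * G" for N
 proof -
  let ?B1 = "big_set (\<lambda>y. ennreal (norm (Top K N g y) ^ 2)) (l^2)" and ?B2 = "big_set (\<lambda>y. ennreal (norm (g y) ^ 2)) (l^2)"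
  have "E N \<subseteq> ?B1 \<union> ?B2"
  proof
   fix x assume "x \<in> E N"
   then obtain J where J: "J \<le> N" "C * l < norm (Top K J g x)" by (auto simp: E_def)
   show "x \<in> ?B1 \<union> ?B2"
    using cotlar[OF g l J(1), of x] J(2) unfolding C[symmetric] by auto
  qed
  then have "vol (E N) \<le> vol (?B1 \<union> ?B2)"
   by (intro emeasure_mono) (auto simp: open_big_set)
  also have "\<dots> \<le> vol ?B1 + vol ?B2"
   by (intro emeasure_subadditive) (auto simp: open_big_set)
  also have "\<dots> \<le> ennreal (5 ^ DIM('a) / l^2) * (\<integral>\<^sup>+y. ennreal (norm (Top K N g y) ^ 2)) + ennreal (5 ^ DIM('a) / l^2) * G"
   unfolding G_def using l by (intro add_mono emeasure_big_set) auto
  also have "\<dots> \<le> ennreal (5 ^ DIM('a) / l^2) * (ennreal A * G) + ennreal (5 ^ DIM('a) / l^2) * G"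
   unfolding G_def by (intro add_right_mono mult_left_mono Top_L2[OF A cz g]) auto
  also have "\<dots> = (ennreal (5 ^ DIM('a) / l^2) * ennreal A + ennreal (5 ^ DIM('a) / l^2)) * G"
   by (simp add: distrib_right mult.assoc)
  also have "ennreal (5 ^ DIM('a) / l^2) * ennreal A + ennreal (5 ^ DIM('a) / l^2) = ennreal (5 ^ DIM('a) / l^2 * (1 + A))"
   using A l by (simp add: distrib_left add.commute flip: ennreal_mult ennreal_plus)
  finally show ?thesis .
 qed
 have "{x. \<exists>J. C * l < norm (Top K J g x)} = (\<Union>N. E N)" by (auto simp: E_def)
 also have "vol \<dots> = (SUP N. vol (E N))"
  by (rule SUP_emeasure_incseq[symmetric]) (use Em in \<open>auto simp: incseq_def E_def intro: order_trans\<close>)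
 also have "\<dots> \<le> ennreal (5 ^ DIM('a) / l^2 * (1 + A)) * G" by (intro SUP_least le)
 finally show ?thesis by (simp add: G_def)
qed

end

section \<open>The Calderon-Zygmund decomposition and the weak type (1,1)\<close>

lemma sum_min_pow2_le:
 fixes d :: real
 assumes d: "0 < d"
 shows "(\<Sum>j<J. min (2^j * d) (1 / (2^j * d))) \<le> 4"
proof -
 have ex: "\<exists>p. 1 < 2^p * d"
  using real_arch_pow[of 2 "1/d"] d by (auto simp: field_simps)
 \<comment> \<open>The two terms of the minimum cross at \<open>p\<close>. Before it a geometric sum
   ends with a term at most 1, from it on one starts with a term below 1; each is at most 2.\<close>
 define p where "p = (LEAST p. 1 < 2^p * d)"
 have p: "1 < 2^p * d" unfolding p_def using ex by (rule LeastI_ex)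
 have p': "2^j * d \<le> 1" if "j < p" for j using not_less_Least[of j "\<lambda>p. 1 < 2^p * d"] that by (auto simp: p_def)
 have 1: "(\<Sum>j<p. 2^j * d) \<le> 2"
 proof -
  have "(\<Sum>j<p. 2^j * d) = (2^p - 1) * d" by (induction p) (auto simp: algebra_simps)
  also have "\<dots> \<le> 2"
  proof (cases p)
   case (Suc m)
   then show ?thesis using p'[of m] d by (auto simp: algebra_simps)
  qed simp
  finally show ?thesis .
 qed
 have 2: "(\<Sum>j\<in>{p..<J}. 1 / (2^j * d)) \<le> 2"
 proof -
  have "(\<Sum>j\<in>{p..<J}. 1 / (2^j * d)) = (\<Sum>j\<in>{p..<J}. (1/d) / 2^j)" by (simp add: mult.commute)
  also have "\<dots> \<le> 2 * (1/d) / 2^p" using d by (intro sum_inv_pow2_le) auto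
  also have "\<dots> \<le> 2" using p d by (simp add: field_simps)
  finally show ?thesis .
 qed
 have "(\<Sum>j<J. min (2^j * d) (1 / (2^j * d))) \<le> (\<Sum>j\<in>{..<p} \<union> {p..<J}. min (2^j * d) (1 / (2^j * d)))"
  using d by (intro sum_mono2) (auto simp: min_def)
 also have "\<dots> = (\<Sum>j<p. min (2^j * d) (1 / (2^j * d))) + (\<Sum>j\<in>{p..<J}. min (2^j * d) (1 / (2^j * d)))"
  by (intro sum.union_disjoint) auto
 also have "\<dots> \<le> (\<Sum>j<p. 2^j * d) + (\<Sum>j\<in>{p..<J}. 1 / (2^j * d))"
  by (intro add_mono sum_mono) auto
 finally show ?thesis using 1 2 by linarith
qed

lemma suminf_min_pow2_le:
 fixes d :: real
 assumes "0 < d"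
 shows "(\<Sum>j. ennreal (min (2^j * d) (1 / (2^j * d)))) \<le> 4"
proof (rule suminf_le_const)
 fix J
 have "(\<Sum>j<J. ennreal (min (2^j * d) (1 / (2^j * d)))) = ennreal (\<Sum>j<J. min (2^j * d) (1 / (2^j * d)))"
  using assms by (intro sum_ennreal) auto
 also have "\<dots> \<le> ennreal 4" by (intro ennreal_leI sum_min_pow2_le assms)
 finally show "(\<Sum>j<J. ennreal (min (2^j * d) (1 / (2^j * d)))) \<le> 4" by simp
qed simp

lemma set_nn_integral_UN:
 assumes S: "countable S" and B: "\<And>q. q \<in> S ==> B q \<in> sets M" and disj: "disjoint_family_on B S"
  and [measurable]: "w \<in> borel_measurable M"
 shows "(\<integral>\<^sup>+y\<in>(\<Union>q\<in>S. B q). w y \<partial>M) = (\<integral>\<^sup>+q. (\<integral>\<^sup>+y\<in>B q. w y \<partial>M) \<partial>count_space S)"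
proof -
 have "(\<integral>\<^sup>+y\<in>(\<Union>q\<in>S. B q). w y \<partial>M) = emeasure (density M w) (\<Union>q\<in>S. B q)"
  using S B by (subst emeasure_density) auto
 also have "\<dots> = (\<integral>\<^sup>+q. emeasure (density M w) (B q) \<partial>count_space S)"
  using S B disj by (intro emeasure_UN_countable) auto
 also have "\<dots> = (\<integral>\<^sup>+q. (\<integral>\<^sup>+y\<in>B q. w y \<partial>M) \<partial>count_space S)"
  using B by (intro nn_integral_cong) (auto simp: emeasure_density)
 finally show ?thesis .
qed

lemma set_nn_integral_UN_mono:
 assumes S: "countable S" and B: "\<And>q. q \<in> S ==> B q \<in> sets M" and disj: "disjoint_family_on B S"
  and [measurable]: "v \<in> borel_measurable M" "w \<in> borel_measurable M"
  and le: "\<And>q. q \<in> S ==> (\<integral>\<^sup>+y\<in>B q. v y \<partial>M) \<le> (\<integral>\<^sup>+y\<in>B q. w y \<partial>M)"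
 shows "(\<integral>\<^sup>+y\<in>(\<Union>q\<in>S. B q). v y \<partial>M) \<le> (\<integral>\<^sup>+y\<in>(\<Union>q\<in>S. B q). w y \<partial>M)"
proof -
 have "(\<integral>\<^sup>+q. (\<integral>\<^sup>+y\<in>B q. v y \<partial>M) \<partial>count_space S) \<le> (\<integral>\<^sup>+q. (\<integral>\<^sup>+y\<in>B q. w y \<partial>M) \<partial>count_space S)"
  by (rule nn_integral_mono) (simp add: le)
 then show ?thesis using set_nn_integral_UN[OF S B disj assms(4)] set_nn_integral_UN[OF S B disj assms(5)] by simp
qed

lemma measurable_pieces:
 fixes F :: "'a::topological_space => 'b::topological_space"
 assumes S: "countable S" and B: "\<And>q. q \<in> S ==> B q \<in> sets borel"
  and eq: "\<And>q x. q \<in> S ==> x \<in> B q ==> F x = G q x" "\<And>x. x \<notin> (\<Union>q\<in>S. B q) ==> F x = H x"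
  and G: "\<And>q. q \<in> S ==> G q \<in> BM" and H: "H \<in> BM"
 shows "F \<in> BM"
proof (rule borel_measurableI)
 fix U :: "'b set" assume U: "open U"
 have "F -` U \<inter> space borel = (\<Union>q\<in>S. B q \<inter> (G q -` U \<inter> space borel)) \<union> ((H -` U \<inter> space borel) - (\<Union>q\<in>S. B q))"
 proof (intro set_eqI)
  fix x
  show "x \<in> F -` U \<inter> space borel \<longleftrightarrow> x \<in> (\<Union>q\<in>S. B q \<inter> (G q -` U \<inter> space borel)) \<union> ((H -` U \<inter> space borel) - (\<Union>q\<in>S. B q))"
  proof (cases "x \<in> (\<Union>q\<in>S. B q)")
   case True
   then obtain q where q: "q \<in> S" "x \<in> B q" by blast
   then have "G q' x = F x" if "q' \<in> S" "x \<in> B q'" for q' using eq(1) that by metis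
   then show ?thesis using q by auto
  next
   case False
   then show ?thesis using eq(2)[OF False] by auto
  qed
 qed
 also have "\<dots> \<in> sets borel"
  using S B measurable_sets[OF G borel_open[OF U]] measurable_sets[OF H borel_open[OF U]]
  by (intro sets.Un sets.countable_UN'' sets.Int sets.Diff) auto
 finally show "F -` U \<inter> space borel \<in> sets borel" .
qed

text \<open>The pieces are enumerated by \<open>to_nat\<close>, since countable additivity of the
  Bochner integral is used for a sequence; numbers that code no element of \<open>S\<close> give
  empty pieces.\<close>

lemma LINT_zero_pieces:
 fixes F :: "_ => complex" and B :: "'q::countable => _ set"
 assumes B: "\<And>q. q \<in> S ==> B q \<in> sets M" and disj: "disjoint_family_on B S"
  and int: "integrable M F" and van: "\<And>x. x \<notin> (\<Union>q\<in>S. B q) ==> F x = 0"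
  and zero: "\<And>q. q \<in> S ==> (LINT x:B q|M. F x) = 0"
 shows "(LINT x|M. F x) = 0"
proof -
 define A where "A i = (\<Union>q\<in>{q\<in>S. to_nat q = i}. B q)" for i
 have Aq: "A (to_nat q) = B q" if "q \<in> S" for q
  using that by (auto simp: A_def)
 have A0: "A i = {}" if "i \<notin> to_nat ` S" for i using that by (auto simp: A_def)
 have Am: "A i \<in> sets M" for i
  by (cases "i \<in> to_nat ` S") (auto simp: Aq A0 B)
 have UA: "(\<Union>i. A i) = (\<Union>q\<in>S. B q)" by (auto simp: A_def)
 have dj: "A i \<inter> A j = {}" if "i \<noteq> j" for i j
 proof (cases "i \<in> to_nat ` S \<and> j \<in> to_nat ` S")
  case True
  then obtain q q' where q: "q \<in> S" "i = to_nat q" "q' \<in> S" "j = to_nat q'" by auto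
  then show ?thesis using disj that unfolding disjoint_family_on_def by (metis Aq)
 qed (auto simp: A0)
 have "(LINT x|M. F x) = (LINT x:(\<Union>i. A i)|M. F x)"
  unfolding set_lebesgue_integral_def UA by (intro Bochner_Integration.integral_cong) (auto simp: indicator_def van)
 also have "\<dots> = (\<Sum>i. LINT x:A i|M. F x)"
 proof (rule lebesgue_integral_countable_add[OF Am dj])
  show "set_integrable M (\<Union>i. A i) F"
   unfolding set_integrable_def by (intro integrable_mult_indicator int) (use Am in auto)
 qed
 also have "\<dots> = (\<Sum>i. 0)"
 proof (intro suminf_cong)
  fix i show "(LINT x:A i|M. F x) = 0"
   by (cases "i \<in> to_nat ` S") (auto simp: Aq A0 zero[unfolded set_lebesgue_integral_def] set_lebesgue_integral_def)
 qed
 finally show ?thesis by simp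
qed

lemma mem_big_set: "x \<in> big_set w l \<longleftrightarrow> (\<exists>c r. 0 < r \<and> x \<in> ball c r \<and>
  ennreal l * vol (ball c r) < (\<integral>\<^sup>+y\<in>ball c r. w y \<partial>lborel))"
 unfolding big_set_def Union_iff mem_Collect_eq by blast

text \<open>A bad ball has bounded radius and meets the support of \<open>h\<close>. Therefore the
  good function of the decomposition, which is spread over this set, still has bounded
  support.\<close>

lemma bounded_big_set:
 fixes h :: "'a::euclidean_space => complex"
 assumes h: "adm h" and l: "0 < l"
 shows "bounded (big_set (\<lambda>y. enorm (h y)) l)"
proof -
 define w where "w = (\<lambda>y. enorm (h y))"
 obtain R where R: "\<And>x. h x \<noteq> 0 ==> norm x \<le> R" using h by (auto simp: adm_def bounded_iff)
 have "(\<integral>\<^sup>+y. w y) < \<infinity>" using adm_integrable[OF h] by (simp add: w_def integrable_iff_bounded)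
 then obtain I where I: "(\<integral>\<^sup>+y. w y) = ennreal I" "0 \<le> I" by (cases "\<integral>\<^sup>+y. w y \<partial>lborel") auto
 define V where "V = unit_ball_vol (real DIM('a))"
 have V: "0 < V" by (simp add: V_def)
 have "norm x \<le> R + 2 * max 1 (I / (l * V))" if "x \<in> big_set w l" for x
 proof -
  from that obtain c r where r: "0 < r" and x: "x \<in> ball c r"
   and big: "ennreal l * vol (ball c r) < (\<integral>\<^sup>+y\<in>ball c r. w y \<partial>lborel)"
   unfolding mem_big_set by blast
  have "\<exists>z\<in>ball c r. h z \<noteq> 0"
  proof (rule ccontr)
   assume "\<not> ?thesis"
   then have "(\<integral>\<^sup>+y\<in>ball c r. w y \<partial>lborel) = (\<integral>\<^sup>+y. 0 \<partial>(lborel :: 'a measure))"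
    by (intro nn_integral_cong) (auto simp: w_def indicator_def)
   then show False using big by simp
  qed
  then obtain z where z: "z \<in> ball c r" "norm z \<le> R" using R by blast
  note big
  also have "(\<integral>\<^sup>+y\<in>ball c r. w y \<partial>lborel) \<le> (\<integral>\<^sup>+y. w y)"
   by (intro nn_integral_mono) (auto simp: indicator_def)
  finally have "ennreal (l * (V * r ^ DIM('a))) < ennreal I"
   using l r V by (simp add: emeasure_ball I V_def ennreal_mult)
  then have *: "l * V * r ^ DIM('a) < I"
   using l r V by (simp add: ennreal_less_iff mult_ac)
  have "r \<le> max 1 (I / (l * V))"
  proof (cases "r \<le> 1")
   case False
   then have "r \<le> r ^ DIM('a)" using self_le_power[of r "DIM('a)"] by simp
   then have "l * V * r \<le> l * V * r ^ DIM('a)" using l V by simp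
   then have "l * V * r \<le> I" using * by linarith
   then have "r \<le> I / (l * V)" using l V by (simp add: field_simps)
   then show ?thesis by simp
  qed simp
  moreover have "dist x z < 2 * r" using x z dist_triangle[of x z c] by (simp add: dist_commute)
  moreover have "norm x \<le> norm z + dist x z" by (metis dist_norm norm_triangle_sub)
  ultimately show ?thesis using z by linarith
 qed
 then show ?thesis unfolding w_def[symmetric] bounded_iff by blast
qed

definition corner :: "('n::finite) key => real^'n" where
 "corner q = (\<chi> i. side q * of_int (snd q i))"

lemma corner_in_cube: "corner q \<in> cube q"
 by (simp add: corner_def cube_def)

text \<open>For \<open>2^j * d \<le> 1\<close> the regularity in \<open>y\<close> gains
  \<open>2^j * d\<close>. Otherwise both kernels are evaluated at distance at least
  \<open>d\<close>, where the spare power of the size bound gains the reciprocal; removing three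
  times \<open>d\<close> about \<open>c\<close> keeps \<open>x\<close> that far from
  \<open>y\<close> as well.\<close>

lemma kernel_cancellation:
 fixes K :: "nat => 'a => 'a::euclidean_space => complex"
 assumes A: "0 < A" and cz: "czker A K" and d: "0 < d" "norm (y - c) \<le> d"
 shows "(\<integral>\<^sup>+x\<in>-ball c (3*d). enorm (K j x y - K j x c) \<partial>lborel)
  \<le> ennreal (2 * A * bconst TYPE('a)) * ennreal (min (2^j * d) (1 / (2^j * d)))"
proof -
 define b where "b = bconst TYPE('a)"
 have b: "0 < b" by (simp add: b_def bconst_pos)
 have bi: "(\<integral>\<^sup>+x. ennreal (bmp (2^j) (x - z))) \<le> ennreal b" for z :: 'a
  unfolding b_def by (rule nn_integral_bmp_1(2)) simp
 have [measurable]: "case_prod (K j) \<in> BM2" using cz by (simp add: czker_def)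
 show ?thesis
 proof (cases "2^j * d \<le> 1")
  case True
  moreover have "0 < 2^j * d" using d by simp
  ultimately have "1 \<le> 1 / (2^j * d)" by (simp only: le_divide_eq_1_pos)
  with True have min: "min (2^j * d) (1 / (2^j * d)) = 2^j * d" by linarith
  have "2^j * norm (y - c) \<le> 2^j * d" using d by (intro mult_left_mono) auto
  then have "2^j * norm (y - c) \<le> 1" using True by linarith
  then have "norm (K j x y - K j x c) \<le> A * (2^j * norm (y - c)) * bmp (2^j) (x - y)" for x
   using cz unfolding czker_def by blast
  moreover have "A * (2^j * norm (y - c)) * bmp (2^j) (x - y) \<le> A * (2^j * d) * bmp (2^j) (x - y)" for x
   using d A by (intro mult_right_mono mult_left_mono bmp_nonneg) auto
  ultimately have 1: "norm (K j x y - K j x c) \<le> A * (2^j * d) * bmp (2^j) (x - y)" for x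
   using order_trans by blast
  have "(\<integral>\<^sup>+x\<in>-ball c (3*d). enorm (K j x y - K j x c) \<partial>lborel) \<le> (\<integral>\<^sup>+x. ennreal (A * (2^j * d)) * ennreal (bmp (2^j) (x - y)))"
  proof (intro nn_integral_mono)
   fix x
   have "enorm (K j x y - K j x c) \<le> ennreal (A * (2^j * d)) * ennreal (bmp (2^j) (x - y))"
    using 1[of x] A d by (subst ennreal_mult[symmetric]) (auto simp: bmp_nonneg intro!: ennreal_leI)
   then show "enorm (K j x y - K j x c) * indicator (- ball c (3 * d)) x \<le> ennreal (A * (2^j * d)) * ennreal (bmp (2^j) (x - y))"
    by (auto simp: indicator_def)
  qed
  also have "\<dots> = ennreal (A * (2^j * d)) * (\<integral>\<^sup>+x. ennreal (bmp (2^j) (x - y)))"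
   by (intro nn_integral_cmult) measurable
  also have "\<dots> \<le> ennreal (A * (2^j * d)) * ennreal b" using bi[of y] by (intro mult_left_mono) auto
  also have "\<dots> = ennreal (A * b) * ennreal (2^j * d)" using A d b by (simp add: mult_ac flip: ennreal_mult)
  also have "\<dots> \<le> ennreal (2 * A * b) * ennreal (2^j * d)" using A b by (intro mult_right_mono ennreal_leI) auto
  finally show ?thesis unfolding min b_def .
 next
  case False
  moreover have "0 < 2^j * d" using d by simp
  ultimately have "1 / (2^j * d) \<le> 1" by (simp only: divide_le_eq_1_pos)
  with False have min: "min (2^j * d) (1 / (2^j * d)) = 1 / (2^j * d)" by linarith
  have far: "norm (K j x z) \<le> A / (2^j * d) * bmp (2^j) (x - z)" if "d \<le> norm (x - z)" for x z
  proof -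
   have "2^j * d \<le> 2^j * norm (x - z)" using that by (intro mult_left_mono) auto
   then have "2^j * d \<le> 1 + 2^j * norm (x - z)" by linarith
   then have "bmp (2^j) (x - z) / (1 + 2^j * norm (x - z)) \<le> bmp (2^j) (x - z) / (2^j * d)"
    using d by (intro divide_left_mono bmp_nonneg) (auto intro!: mult_pos_pos add_pos_nonneg)
   then have "A * (bmp (2^j) (x - z) / (1 + 2^j * norm (x - z))) \<le> A * (bmp (2^j) (x - z) / (2^j * d))"
    using A by (intro mult_left_mono) auto
   with K_size[OF A cz, of j x z] show ?thesis by simp
  qed
  have 1: "norm (K j x y - K j x c) \<le> A / (2^j * d) * bmp (2^j) (x - y) + A / (2^j * d) * bmp (2^j) (x - c)"
   if "x \<notin> ball c (3*d)" for x
  proof -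
   have "3 * d \<le> norm (x - c)" using that by (simp add: dist_norm norm_minus_commute)
   moreover have "norm (x - c) \<le> norm (x - y) + norm (y - c)" using norm_triangle_ineq[of "x - y" "y - c"] by simp
   ultimately have "d \<le> norm (x - y)" "d \<le> norm (x - c)" using d by linarith+
   from far[OF this(1)] far[OF this(2)] show ?thesis
    using norm_triangle_ineq4[of "K j x y" "K j x c"] by linarith
  qed
  have "(\<integral>\<^sup>+x\<in>-ball c (3*d). enorm (K j x y - K j x c) \<partial>lborel)
    \<le> (\<integral>\<^sup>+x. ennreal (A / (2^j * d)) * ennreal (bmp (2^j) (x - y)) + ennreal (A / (2^j * d)) * ennreal (bmp (2^j) (x - c)))"
  proof (intro nn_integral_mono)
   fix x
   have "enorm (K j x y - K j x c) \<le> ennreal (A / (2^j * d)) * ennreal (bmp (2^j) (x - y)) + ennreal (A / (2^j * d)) * ennreal (bmp (2^j) (x - c))"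
    if "x \<notin> ball c (3*d)"
    using 1[OF that] A d
    by (simp add: bmp_nonneg ennreal_leI flip: ennreal_mult ennreal_plus)
   then show "enorm (K j x y - K j x c) * indicator (- ball c (3 * d)) x \<le> ennreal (A / (2^j * d)) * ennreal (bmp (2^j) (x - y)) + ennreal (A / (2^j * d)) * ennreal (bmp (2^j) (x - c))"
    by (cases "x \<in> ball c (3*d)") (auto simp: indicator_def)
  qed
  also have "\<dots> = ennreal (A / (2^j * d)) * (\<integral>\<^sup>+x. ennreal (bmp (2^j) (x - y))) + ennreal (A / (2^j * d)) * (\<integral>\<^sup>+x. ennreal (bmp (2^j) (x - c)))"
   by (subst nn_integral_add) (auto simp: nn_integral_cmult)
  also have "\<dots> \<le> ennreal (A / (2^j * d)) * ennreal b + ennreal (A / (2^j * d)) * ennreal b"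
   using bi[of y] bi[of c] by (intro add_mono mult_left_mono) auto
  also have "\<dots> = ennreal (2 * A * b) * ennreal (1 / (2^j * d))"
  proof -
   have "ennreal (A / (2^j * d)) * ennreal b + ennreal (A / (2^j * d)) * ennreal b = ennreal (A / (2^j * d) * b + A / (2^j * d) * b)"
    using A b d by (subst ennreal_plus) (simp_all only: ennreal_mult mult_nonneg_nonneg divide_nonneg_nonneg less_imp_le zero_le_power zero_le_numeral)
   also have "A / (2^j * d) * b + A / (2^j * d) * b = (2 * A * b) * (1 / (2^j * d))" by (simp add: mult_ac)
   also have "ennreal ((2 * A * b) * (1 / (2^j * d))) = ennreal (2 * A * b) * ennreal (1 / (2^j * d))"
    using A b d by (intro ennreal_mult) auto
   finally show ?thesis .
  qed
  finally show ?thesis unfolding min b_def .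
 qed
qed

lemma norm_set_integral_le:
 fixes f :: "'a => complex"
 assumes S: "S \<in> sets M" and c: "0 \<le> c" and le: "(\<integral>\<^sup>+y\<in>S. enorm (f y) \<partial>M) \<le> ennreal c"
 shows "norm (LINT y:S|M. f y) \<le> c"
proof -
 have "enorm (LINT y:S|M. f y) \<le> (\<integral>\<^sup>+y. enorm (indicator S y *\<^sub>R f y) \<partial>M)"
  unfolding set_lebesgue_integral_def by (rule norm_LINT_le)
 also have "\<dots> = (\<integral>\<^sup>+y\<in>S. enorm (f y) \<partial>M)"
  by (intro nn_integral_cong) (auto simp: indicator_def)
 finally have "enorm (LINT y:S|M. f y) \<le> ennreal c" using le by (rule order_trans)
 then show ?thesis using c by (simp only: ennreal_le_iff)
qed

text \<open>That \<open>norm (f x) \<le> l\<close> off the superlevel set is assumed at every point;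
  in the application it comes from continuity. The constant depends on \<open>A\<close> and the
  dimension only, hence serves all kernels of the class.\<close>

lemma weak_type_1:
 fixes K :: "nat => real^'n => real^'n::finite => complex"
 assumes A: "0 < A"
 shows "\<exists>C>0. \<forall>K f l. czker A (K :: nat => real^'n => real^'n => complex) \<longrightarrow> adm f \<longrightarrow> 0 < l \<longrightarrow>
   (\<forall>x. x \<notin> big_set (\<lambda>y. enorm (f y)) l \<longrightarrow> norm (f x) \<le> l) \<longrightarrow>
   vol {x. \<exists>J. C * l < norm (Top K J f x)} \<le> ennreal (C / l) * (\<integral>\<^sup>+y. enorm (f y))"
proof -
 define n where "n = CARD('n)"
 have n: "0 < n" by (simp add: n_def)
 define V where "V = unit_ball_vol (real n)"
 have V: "0 < V" by (simp add: V_def)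
 \<comment> \<open>A stopping cube lies in the ball of radius \<open>2 n + 1\<close> sides about a
   point of its parent outside \<open>Om\<close>, which bounds its average by
   \<open>V * (2 n + 1) ^ n * l\<close>. The added 1 lets \<open>D * l\<close> bound the good
   function off \<open>Om\<close> too.\<close>
 define D where "D = V * (2 * real n + 1) ^ n + 1"
 have D: "1 \<le> D" using V by (simp add: D_def)
 define b where "b = bconst TYPE(real^'n)"
 have b: "0 < b" by (simp add: b_def bconst_pos)
 define C2 where "C2 = A * (1 + 2 ^ (n + 1)) * b + A * 2 ^ (n + 3) * b + 2 + A * 2 ^ n"
 have C2: "0 < C2" using A b by (auto simp: C2_def intro!: add_pos_pos mult_pos_pos)
 define c1 where "c1 = 5 ^ n * (1 + A) * D"
 define c2 where "c2 = 5 ^ n * (V * (3 * real n) ^ n)"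
 define c3 where "c3 = 16 * A * b"
 have c: "0 \<le> c1" "0 \<le> c2" "0 \<le> c3" using A V D b by (auto simp: c1_def c2_def c3_def)
 define C where "C = C2 + 1 + c1 + c2 + c3"
 have C: "0 < C" using C2 c by (simp add: C_def)
 have main: "vol {x. \<exists>J. C * l < norm (Top K J f x)} \<le> ennreal (C / l) * (\<integral>\<^sup>+y. enorm (f y))"
  if cz: "czker A K" and f: "adm f" and l: "0 < l"
   and out: "\<And>x. x \<notin> big_set (\<lambda>y. enorm (f y)) l ==> norm (f x) \<le> l"
  for K :: "nat => real^'n => real^'n => complex" and f l
 proof -
  define w where "w = (\<lambda>y. enorm (f y))"
  have fm[measurable]: "f \<in> BM" using f by (simp add: adm_def)
  have wm[measurable]: "w \<in> BM" by (simp add: w_def)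
  define I where "I = (\<integral>\<^sup>+y. w y)"
  have If: "I < \<infinity>" using adm_integrable[OF f] by (simp add: w_def I_def integrable_iff_bounded)
  define Om where "Om = big_set w l"
  have Oo: "open Om" by (simp add: Om_def open_big_set)
  have Om_m[measurable]: "Om \<in> sets borel" using Oo by simp
  have Ole: "vol Om \<le> ennreal (5 ^ n / l) * I"
   using emeasure_big_set[OF l wm] by (simp add: Om_def I_def n_def)
  have Ofin: "vol Om < \<infinity>"
  proof -
   have "ennreal (5 ^ n / l) * I < \<infinity>" using If by (simp add: ennreal_mult_less_top)
   with Ole show ?thesis by (rule order.strict_trans1)
  qed
  obtain m where m: "vol Om = ennreal m" "0 \<le> m" using Ofin by (cases "vol Om") auto
  \<comment> \<open>Cubes of level \<open>k0\<close> have more volume than \<open>Om\<close>, so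
    none of them fits inside and the selection below \<open>k0\<close> exhausts
    \<open>Om\<close>.\<close>
  obtain k where k: "m < 2 ^ k" using real_arch_pow[of 2 m] by auto
  define k0 where "k0 = int k"
  have nsub: "\<not> cube (key_of k0 x) \<subseteq> Om" for x :: "real^'n"
  proof
   assume "cube (key_of k0 x) \<subseteq> Om"
   then have "vol (cube (key_of k0 x)) \<le> vol Om" by (intro emeasure_mono) auto
   then have "(2 ^ k) ^ n \<le> m" using m by (simp add: emeasure_cube side_def k0_def n_def)
   moreover have "(2::real) ^ k \<le> (2 ^ k) ^ n" using n self_le_power[of "2^k::real" n] by simp
   ultimately show False using k by linarith
  qed
  define S where "S = sel k0 Om"
  have S: "countable S" by (rule countable_keys)
  have disj: "disjoint_family_on cube S" unfolding S_def by (rule disjoint_sel)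
  have UN: "(\<Union>q\<in>S. cube q) = Om"
  proof
   show "(\<Union>q\<in>S. cube q) \<subseteq> Om" by (auto simp: S_def sel_def)
   show "Om \<subseteq> (\<Union>q\<in>S. cube q)"
   proof
    fix x assume "x \<in> Om"
    from sel_cover[OF Oo this nsub] show "x \<in> (\<Union>q\<in>S. cube q)" unfolding S_def by blast
   qed
  qed
  have cube_int: "(\<integral>\<^sup>+y\<in>cube q. w y \<partial>lborel) \<le> ennreal (D * l * side q ^ n)" if q: "q \<in> S" for q
  proof -
   obtain u where u: "u \<in> cube (parent q)" "u \<notin> Om" using q by (auto simp: S_def sel_def)
   define r where "r = (2 * real n + 1) * side q"
   have r: "0 < r" by (simp add: r_def)
   have "cube q \<subseteq> ball u r"
   proof
    fix x assume "x \<in> cube q"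
    then have "norm (u - x) \<le> real n * side (parent q)" unfolding n_def using u cube_subset_parent[of q]
     by (intro cube_dist) auto
    also have "\<dots> < r" by (simp add: side_parent r_def algebra_simps)
    finally show "x \<in> ball u r" by (simp add: dist_norm)
   qed
   then have "(\<integral>\<^sup>+y\<in>cube q. w y \<partial>lborel) \<le> (\<integral>\<^sup>+y\<in>ball u r. w y \<partial>lborel)"
    by (intro nn_integral_mono) (auto simp: indicator_def)
   also have "\<dots> \<le> ennreal l * vol (ball u r)"
    using u(2) r unfolding Om_def by (intro not_big_set) auto
   also have "\<dots> = ennreal (l * (V * r ^ n))"
    using l r V by (simp add: emeasure_ball V_def n_def ennreal_mult)
   also have "\<dots> \<le> ennreal (D * l * side q ^ n)"
   proof (intro ennreal_leI)
    have "l * (V * r ^ n) = (V * (2 * real n + 1) ^ n) * (l * side q ^ n)"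
     by (simp add: r_def power_mult_distrib)
    also have "\<dots> \<le> D * (l * side q ^ n)" using l by (intro mult_right_mono) (auto simp: D_def)
    finally show "l * (V * r ^ n) \<le> D * l * side q ^ n" by simp
   qed
   finally show ?thesis .
  qed
  define avg where "avg q = (LINT y:cube q|lborel. f y) / of_real (side q ^ n)" for q
  have avg_side: "avg q * of_real (side q ^ n) = (LINT y:cube q|lborel. f y)" for q
   using side_pos[of q] by (simp add: avg_def less_imp_neq[symmetric])
  have avg_le: "norm (avg q) \<le> D * l" if q: "q \<in> S" for q
  proof -
   have "norm (LINT y:cube q|lborel. f y) \<le> D * l * side q ^ n"
    using cube_int[OF q] l D by (intro norm_set_integral_le) (auto simp: w_def)
   then show ?thesis using side_pos[of q] by (simp add: avg_def norm_divide norm_power field_simps)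
  qed
  define \<kappa> where "\<kappa> x = (THE q. q \<in> S \<and> x \<in> cube q)" for x
  have \<kappa>: "\<kappa> x = q" if "q \<in> S" "x \<in> cube q" for x q
   unfolding \<kappa>_def using that disj by (intro the_equality) (auto simp: disjoint_family_on_def)
  define g where "g x = (if x \<in> Om then avg (\<kappa> x) else f x)" for x
  define bb where "bb x = f x - g x" for x
  have gq: "g x = avg q" if "q \<in> S" "x \<in> cube q" for x q
   using that UN by (auto simp: g_def \<kappa>)
  have g_out: "g x = f x" if "x \<notin> Om" for x using that by (simp add: g_def)
  have gm[measurable]: "g \<in> BM"
  proof (rule measurable_pieces[OF S cube_borel, where G="\<lambda>q x. avg q" and H=f])
   show "\<And>x. x \<notin> (\<Union>q\<in>S. cube q) ==> g x = f x" using g_out UN by auto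
  qed (auto simp: gq)
  have g_le: "norm (g x) \<le> D * l" for x
  proof (cases "x \<in> Om")
   case True
   then obtain q where "q \<in> S" "x \<in> cube q" using UN by auto
   then show ?thesis using gq avg_le by simp
  next
   case False
   then have "norm (g x) \<le> l" using out by (simp add: g_out Om_def w_def)
   also have "l \<le> D * l" using D l by simp
   finally show ?thesis .
  qed
  have bOm: "bounded Om" unfolding Om_def w_def by (rule bounded_big_set[OF f l])
  have ag: "adm g"
   unfolding adm_def
  proof (intro conjI exI allI)
   show "bounded {x. g x \<noteq> 0}"
    by (rule bounded_subset[of "Om \<union> {x. f x \<noteq> 0}"]) (use bOm f in \<open>auto simp: adm_def g_def split: if_splits\<close>)
  qed (use g_le gm in auto)
  have ab: "adm bb"
  proof -
   have "adm (\<lambda>x. f x + (-1) * g x)"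
    using adm_mult_bounded[OF ag, of "\<lambda>x. -1" 1] by (intro adm_add f) auto
   then show ?thesis by (simp add: bb_def[abs_def])
  qed
  have bm[measurable]: "bb \<in> BM" using ab by (simp add: adm_def)
  have fgb: "f = (\<lambda>x. g x + bb x)" by (auto simp: bb_def)
  have cube_g: "(\<integral>\<^sup>+y\<in>cube q. enorm (g y) \<partial>lborel) \<le> (\<integral>\<^sup>+y\<in>cube q. w y \<partial>lborel)" if q: "q \<in> S" for q
  proof -
   have "(\<integral>\<^sup>+y\<in>cube q. enorm (g y) \<partial>lborel) = (\<integral>\<^sup>+y. enorm (avg q) * indicator (cube q) y)"
    using q by (intro nn_integral_cong) (auto simp: indicator_def gq)
   also have "\<dots> = ennreal (norm (avg q) * side q ^ n)"
    by (simp add: nn_integral_cmult_indicator emeasure_cube n_def ennreal_mult)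
   also have "norm (avg q) * side q ^ n = norm (LINT y:cube q|lborel. f y)"
    unfolding avg_side[symmetric] by (simp add: norm_mult norm_power)
   also have "ennreal \<dots> \<le> (\<integral>\<^sup>+y. enorm (indicator (cube q) y *\<^sub>R f y))"
    unfolding set_lebesgue_integral_def by (rule norm_LINT_le)
   also have "\<dots> = (\<integral>\<^sup>+y\<in>cube q. w y \<partial>lborel)"
    by (intro nn_integral_cong) (auto simp: indicator_def w_def)
   finally show ?thesis .
  qed
  have split: "(\<integral>\<^sup>+y. v y) = (\<integral>\<^sup>+y\<in>Om. v y \<partial>lborel) + (\<integral>\<^sup>+y\<in>-Om. v y \<partial>lborel)"
   if [measurable]: "v \<in> BM" for v :: "real^'n => ennreal"
   by (subst nn_integral_add[symmetric]) (auto simp: indicator_def intro!: nn_integral_cong)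
  have g_int: "(\<integral>\<^sup>+y. enorm (g y)) \<le> I"
  proof -
   have "(\<integral>\<^sup>+y\<in>Om. enorm (g y) \<partial>lborel) \<le> (\<integral>\<^sup>+y\<in>Om. w y \<partial>lborel)"
    unfolding UN[symmetric] by (rule set_nn_integral_UN_mono[OF S _ disj]) (auto simp: cube_g)
   moreover have "(\<integral>\<^sup>+y\<in>-Om. enorm (g y) \<partial>lborel) = (\<integral>\<^sup>+y\<in>-Om. w y \<partial>lborel)"
    by (intro nn_integral_cong) (auto simp: indicator_def g_out w_def)
   ultimately show ?thesis unfolding I_def split[OF wm] by (subst split) (auto intro: add_mono)
  qed
  have g_sq: "(\<integral>\<^sup>+y. ennreal (norm (g y) ^ 2)) \<le> ennreal (D * l) * I"
  proof -
   have "(\<integral>\<^sup>+y. ennreal (norm (g y) ^ 2)) \<le> (\<integral>\<^sup>+y. ennreal (D * l) * enorm (g y))"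
    using D l g_le by (intro nn_integral_mono) (auto simp: power2_eq_square mult_right_mono intro!: ennreal_leI simp flip: ennreal_mult)
   also have "\<dots> = ennreal (D * l) * (\<integral>\<^sup>+y. enorm (g y))" by (intro nn_integral_cmult) simp
   also have "\<dots> \<le> ennreal (D * l) * I" by (intro mult_left_mono g_int) auto
   finally show ?thesis .
  qed
  have b_int: "(\<integral>\<^sup>+y. enorm (bb y)) \<le> 2 * I"
  proof -
   have "(\<integral>\<^sup>+y. enorm (bb y)) \<le> (\<integral>\<^sup>+y. w y + enorm (g y))"
    by (intro nn_integral_mono) (auto simp: bb_def w_def norm_triangle_ineq4 intro!: ennreal_leI simp flip: ennreal_plus)
   also have "\<dots> = I + (\<integral>\<^sup>+y. enorm (g y))" by (simp add: nn_integral_add I_def)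
   also have "\<dots> \<le> I + I" by (intro add_left_mono g_int)
   finally show ?thesis by (simp add: mult_2)
  qed
  have bzero: "(LINT y:cube q|lborel. bb y) = 0" if q: "q \<in> S" for q
  proof -
   have i1: "set_integrable lborel (cube q) f"
    unfolding set_integrable_def by (intro integrable_mult_indicator adm_integrable f) auto
   have i2: "set_integrable lborel (cube q) g"
    unfolding set_integrable_def by (intro integrable_mult_indicator adm_integrable ag) auto
   have "(LINT y:cube q|lborel. bb y) = (LINT y:cube q|lborel. f y) - (LINT y:cube q|lborel. g y)"
    unfolding bb_def by (rule set_integral_diff(2)[OF i1 i2])
   also have "(LINT y:cube q|lborel. g y) = (LINT y:cube q|lborel. avg q)"
    using q by (intro set_lebesgue_integral_cong) (auto simp: gq)
   also have "\<dots> = avg q * of_real (side q ^ n)"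
    by (subst set_integral_const) (auto simp: emeasure_cube measure_def n_def scaleR_conv_of_real)
   also have "\<dots> = (LINT y:cube q|lborel. f y)" by (rule avg_side)
   finally show ?thesis by simp
  qed
  \<comment> \<open>The corner plays the part of the centre of a cube. Subtracting
    \<open>K j x (cn y)\<close> from the kernel changes nothing, because \<open>bb\<close> has
    integral zero over each cube.\<close>
  define cn where "cn y = (if y \<in> Om then corner (\<kappa> y) else 0)" for y
  have cnq: "cn y = corner q" if "q \<in> S" "y \<in> cube q" for y q
   using that UN by (auto simp: cn_def \<kappa>)
  have cnm[measurable]: "cn \<in> BM"
  proof (rule measurable_pieces[OF S cube_borel, where G="\<lambda>q x. corner q" and H="\<lambda>_. 0"])
   show "\<And>x. x \<notin> (\<Union>q\<in>S. cube q) ==> cn x = 0" using UN by (auto simp: cn_def)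
  qed (auto simp: cnq)
  have b_out: "bb y = 0" if "y \<notin> Om" for y using that by (simp add: bb_def g_out)
  \<comment> \<open>\<open>n * side q\<close> bounds the distance from the corner to the points of
    the cube; three times it is the radius required by \<open>kernel_cancellation\<close>.\<close>
  define Os where "Os = (\<Union>q\<in>S. ball (corner q) (3 * (real n * side q)))"
  have Osm[measurable]: "Os \<in> sets borel" unfolding Os_def by (intro borel_open open_UN) auto
  have Os_le: "vol Os \<le> ennreal (c2 / l) * I"
  proof -
   have "vol Os \<le> ennreal (V * (3 * real n) ^ n) * (\<integral>\<^sup>+y\<in>(\<Union>q\<in>S. cube q). 1 \<partial>lborel)"
    unfolding Os_def
   proof (rule emeasure_UN_le_disjoint[OF S _ _ disj])
    fix q assume "q \<in> S"
    have "vol (ball (corner q) (3 * (real n * side q))) = ennreal (V * (3 * real n) ^ n) * ennreal (side q ^ n)"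
     using V by (simp add: emeasure_ball V_def n_def power_mult_distrib mult_ac flip: ennreal_mult)
    also have "ennreal (side q ^ n) = (\<integral>\<^sup>+y\<in>cube q. 1 \<partial>lborel)" by (simp add: emeasure_cube n_def)
    finally show "vol (ball (corner q) (3 * (real n * side q))) \<le> ennreal (V * (3 * real n) ^ n) * (\<integral>\<^sup>+y\<in>cube q. 1 \<partial>lborel)" by simp
   qed auto
   also have "(\<integral>\<^sup>+y\<in>(\<Union>q\<in>S. cube q). 1 \<partial>lborel) = vol Om" unfolding UN by simp
   also have "ennreal (V * (3 * real n) ^ n) * vol Om \<le> ennreal (V * (3 * real n) ^ n) * (ennreal (5 ^ n / l) * I)"
    by (intro mult_left_mono Ole) auto
   also have "\<dots> = ennreal (c2 / l) * I" using V l by (subst ennreal_mult2) (auto simp: c2_def mult_ac)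
   finally show ?thesis .
  qed
  have Km[measurable]: "case_prod (K j) \<in> BM2" for j by (rule K_meas2[OF A cz])
  note Km1[measurable] = K_meas[OF A cz]
  \<comment> \<open>Absolute values are summed over all scales at once. So \<open>H\<close>
    dominates every truncation of the bad part off \<open>Os\<close>, and a single Chebyshev
    estimate serves the maximal function.\<close>
  define F where "F x y = (\<Sum>j. enorm (K j x y - K j x (cn y))) * (enorm (bb y) * indicator (- Os) x)" for x y
  have Fm[measurable]: "case_prod F \<in> BM2"
  proof -
   have "(\<lambda>p. K j (fst p) (snd p)) \<in> BM2" for j
    by (rule K_meas2'[OF A cz])
   then have "(\<lambda>p. K j (fst (fst p, cn (snd p))) (snd (fst p, cn (snd p)))) \<in> BM2" for j
    by (rule measurable_compose[rotated]) measurable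
   then have [measurable]: "(\<lambda>p. K j (fst p) (cn (snd p))) \<in> BM2" for j
    by simp
   note [measurable] = K_meas2'[OF A cz]
   show ?thesis unfolding F_def case_prod_beta' by measurable
  qed
  define H where "H x = (\<integral>\<^sup>+y. F x y)" for x
  have Hm[measurable]: "H \<in> BM"
   unfolding H_def by measurable
  have H_int: "(\<integral>\<^sup>+x. H x) \<le> ennreal c3 * I"
  proof -
   have inner: "(\<integral>\<^sup>+x. F x y) \<le> ennreal (8 * A * b) * enorm (bb y)" for y
   proof (cases "y \<in> Om")
    case True
    then obtain q where q: "q \<in> S" "y \<in> cube q" using UN by auto
    define d where "d = real n * side q"
    have d: "0 < d" using n by (simp add: d_def)
    have dist: "norm (y - corner q) \<le> d" unfolding d_def n_def by (intro cube_dist q corner_in_cube)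
    have "(\<integral>\<^sup>+x. F x y) \<le> (\<integral>\<^sup>+x. enorm (bb y) * (\<Sum>j. enorm (K j x y - K j x (corner q)) * indicator (- ball (corner q) (3 * d)) x))"
    proof (intro nn_integral_mono)
     fix x
     have "- Os \<subseteq> - ball (corner q) (3*d)" using q by (auto simp: Os_def d_def)
     then have "F x y \<le> (\<Sum>j. enorm (K j x y - K j x (corner q))) * (enorm (bb y) * indicator (- ball (corner q) (3 * d)) x)"
      unfolding F_def cnq[OF q] by (intro mult_left_mono) (auto simp: indicator_def)
     then show "F x y \<le> enorm (bb y) * (\<Sum>j. enorm (K j x y - K j x (corner q)) * indicator (- ball (corner q) (3 * d)) x)"
      by (simp add: mult_ac)
    qed
    also have "\<dots> = enorm (bb y) * (\<Sum>j. \<integral>\<^sup>+x\<in>- ball (corner q) (3 * d). enorm (K j x y - K j x (corner q)) \<partial>lborel)"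
    proof -
     have [measurable]: "ball (corner q) (3 * d) \<in> sets borel" by simp
     show ?thesis by (subst nn_integral_cmult, measurable) (subst nn_integral_suminf, measurable)
    qed
    also have "\<dots> \<le> enorm (bb y) * (\<Sum>j. ennreal (2 * A * b) * ennreal (min (2^j * d) (1 / (2^j * d))))"
     unfolding b_def by (intro mult_left_mono suminf_le kernel_cancellation[OF A cz d dist]) auto
    also have "\<dots> = enorm (bb y) * (ennreal (2 * A * b) * (\<Sum>j. ennreal (min (2^j * d) (1 / (2^j * d)))))"
     by simp
    also have "\<dots> \<le> enorm (bb y) * (ennreal (2 * A * b) * 4)"
     by (intro mult_left_mono suminf_min_pow2_le d) auto
    also have "ennreal (2 * A * b) * 4 = ennreal (8 * A * b)"
     using A b by (simp add: ennreal_mult''[symmetric] flip: ennreal_numeral)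
    finally show ?thesis by (simp add: mult.commute)
   next
    case False
    then show ?thesis by (simp add: F_def b_out)
   qed
   have "(\<integral>\<^sup>+x. H x) = (\<integral>\<^sup>+y. (\<integral>\<^sup>+x. F x y))"
    unfolding H_def by (rule lborel_pair.Fubini') simp
   also have "\<dots> \<le> (\<integral>\<^sup>+y. ennreal (8 * A * b) * enorm (bb y))"
    by (intro nn_integral_mono inner)
   also have "\<dots> = ennreal (8 * A * b) * (\<integral>\<^sup>+y. enorm (bb y))" by (intro nn_integral_cmult) simp
   also have "\<dots> \<le> ennreal (8 * A * b) * (ennreal 2 * I)" using b_int by (intro mult_left_mono) auto
   also have "\<dots> = ennreal c3 * I" using A b by (subst ennreal_mult2) (auto simp: c3_def mult_ac)
   finally show ?thesis .
  qed
  have Tb: "enorm (Top K J bb x) \<le> H x" if x: "x \<notin> Os" for J x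
  proof -
   have one: "enorm (LINT y|lborel. K j x y * bb y) \<le> (\<integral>\<^sup>+y. enorm (K j x y - K j x (cn y)) * enorm (bb y))" for j
   proof -
    have i2: "integrable lborel (\<lambda>y. K j x (cn y) * bb y)"
     by (rule integrable_mult_bounded[OF adm_integrable[OF ab] _ K_bounded[OF A cz]]) measurable
    have "(LINT y|lborel. K j x (cn y) * bb y) = 0"
    proof (rule LINT_zero_pieces[OF _ disj i2])
     fix q assume q: "q \<in> S"
     have "(LINT y:cube q|lborel. K j x (cn y) * bb y) = (LINT y:cube q|lborel. K j x (corner q) * bb y)"
      using q by (intro set_lebesgue_integral_cong) (auto simp: cnq)
     also have "\<dots> = K j x (corner q) * (LINT y:cube q|lborel. bb y)" by simp
     finally show "(LINT y:cube q|lborel. K j x (cn y) * bb y) = 0" by (simp add: bzero q)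
    qed (auto simp: UN b_out)
    then have "(LINT y|lborel. K j x y * bb y) = (LINT y|lborel. (K j x y - K j x (cn y)) * bb y)"
     using K_integrable[OF A cz ab] i2 by (simp add: left_diff_distrib)
    then show ?thesis
     using norm_LINT_le[of lborel "\<lambda>y. (K j x y - K j x (cn y)) * bb y"] by (simp add: norm_mult ennreal_mult)
   qed
   have "enorm (Top K J bb x) \<le> ennreal (\<Sum>j<J. norm (LINT y|lborel. K j x y * bb y))"
    unfolding Top_def by (intro ennreal_leI norm_sum)
   also have "\<dots> = (\<Sum>j<J. enorm (LINT y|lborel. K j x y * bb y))" by simp
   also have "\<dots> \<le> (\<Sum>j<J. \<integral>\<^sup>+y. enorm (K j x y - K j x (cn y)) * enorm (bb y))"
    by (intro sum_mono one)
   also have "\<dots> \<le> (\<Sum>j. \<integral>\<^sup>+y. enorm (K j x y - K j x (cn y)) * enorm (bb y))"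
    by (rule sum_le_suminf) auto
   also have "\<dots> = H x" unfolding H_def F_def
    using x by (subst nn_integral_suminf[symmetric]) (auto intro!: nn_integral_cong)
   finally show ?thesis .
  qed
  define E1 where "E1 = {x. \<exists>J. C2 * l < norm (Top K J g x)}"
  define E3 where "E3 = {x. ennreal l \<le> H x}"
  have Tm[measurable]: "Top K J g \<in> BM" for J by (rule Top_meas[OF A cz]) simp
  have E1m: "E1 \<in> sets lborel" unfolding E1_def by measurable
  have E3m: "E3 \<in> sets lborel" unfolding E3_def by measurable
  have sub: "{x. \<exists>J. C * l < norm (Top K J f x)} \<subseteq> E1 \<union> Os \<union> E3"
  proof
   fix x assume "x \<in> {x. \<exists>J. C * l < norm (Top K J f x)}"
   then obtain J where J: "C * l < norm (Top K J f x)" by auto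
   show "x \<in> E1 \<union> Os \<union> E3"
   proof (rule ccontr)
    assume "x \<notin> E1 \<union> Os \<union> E3"
    then have 1: "norm (Top K J g x) \<le> C2 * l" and 2: "x \<notin> Os" and 3: "H x < ennreal l"
     by (auto simp: E1_def E3_def not_less not_le)
    have "enorm (Top K J bb x) < ennreal l" using Tb[OF 2, of J] 3 by simp
    then have "norm (Top K J bb x) < l" using l by (simp add: ennreal_less_iff)
    moreover have "Top K J f x = Top K J g x + Top K J bb x"
     by (subst fgb) (rule Top_add[OF A cz ag ab])
    ultimately have "norm (Top K J f x) < C2 * l + l" using 1 norm_triangle_ineq[of "Top K J g x" "Top K J bb x"] by simp
    also have "\<dots> = (C2 + 1) * l" by (simp add: algebra_simps)
    also have "\<dots> \<le> C * l" using l c by (intro mult_right_mono) (auto simp: C_def)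
    finally show False using J by simp
   qed
  qed
  have "vol E1 \<le> ennreal (5 ^ n / l^2 * (1 + A)) * (\<integral>\<^sup>+y. ennreal (norm (g y) ^ 2))"
   using weak_type_2[OF A cz ag l, of C2] by (simp add: E1_def C2_def n_def b_def)
  also have "\<dots> \<le> ennreal (5 ^ n / l^2 * (1 + A)) * (ennreal (D * l) * I)" by (intro mult_left_mono g_sq) auto
  also have "\<dots> = ennreal (c1 / l) * I"
   using A D l by (subst ennreal_mult2) (auto simp: c1_def power2_eq_square mult_ac)
  finally have e1: "vol E1 \<le> ennreal (c1 / l) * I" .
  have e3: "vol E3 \<le> ennreal (c3 / l) * I"
  proof -
   have "vol E3 = vol {x\<in>space lborel. 1 \<le> ennreal (1 / l) * H x}"
   proof -
    have "(ennreal l \<le> h) = (1 \<le> ennreal (1 / l) * h)" for h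
    proof
     assume "ennreal l \<le> h"
     then have "ennreal (1 / l) * ennreal l \<le> ennreal (1 / l) * h" by (intro mult_left_mono) auto
     then show "1 \<le> ennreal (1 / l) * h" using l by (simp flip: ennreal_mult)
    next
     assume "1 \<le> ennreal (1 / l) * h"
     then have "ennreal l * 1 \<le> ennreal l * (ennreal (1 / l) * h)" by (intro mult_left_mono) auto
     then show "ennreal l \<le> h" using l by (simp add: ennreal_mult2)
    qed
    then show ?thesis by (simp add: E3_def)
   qed
   also have "\<dots> \<le> ennreal (1 / l) * (\<integral>\<^sup>+x. H x * indicator (space lborel) x)"
    by (rule nn_integral_Markov_inequality) auto
   also have "\<dots> \<le> ennreal (1 / l) * (ennreal c3 * I)" using H_int by (intro mult_left_mono) auto
   also have "\<dots> = ennreal (c3 / l) * I" using l c by (subst ennreal_mult2) auto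
   finally show ?thesis .
  qed
  have "vol {x. \<exists>J. C * l < norm (Top K J f x)} \<le> vol (E1 \<union> Os \<union> E3)"
   using E1m E3m by (intro emeasure_mono sub) auto
  also have "\<dots> \<le> vol (E1 \<union> Os) + vol E3"
   using E1m E3m by (intro emeasure_subadditive) auto
  also have "\<dots> \<le> (vol E1 + vol Os) + vol E3"
   using E1m by (intro add_right_mono emeasure_subadditive) auto
  also have "\<dots> \<le> (ennreal (c1 / l) * I + ennreal (c2 / l) * I) + ennreal (c3 / l) * I"
   by (intro add_mono e1 Os_le e3)
  also have "\<dots> = (ennreal (c1 / l) + ennreal (c2 / l) + ennreal (c3 / l)) * I" by (simp add: distrib_right)
  also have "ennreal (c1 / l) + ennreal (c2 / l) + ennreal (c3 / l) = ennreal (c1 / l + c2 / l + c3 / l)"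
   using c l by simp
  also have "ennreal (c1 / l + c2 / l + c3 / l) * I \<le> ennreal (C / l) * I"
   using c l C2 by (intro mult_right_mono ennreal_leI) (auto simp: C_def field_simps)
  finally show ?thesis by (simp add: I_def w_def)
 qed
 show ?thesis using C main by blast
qed

section \<open>Sparse families from stopping cubes\<close>

context
 fixes Om :: "('n::finite) key => (real^'n) set" and F :: "'n key => real^'n => ennreal" and a :: "'n key => ennreal"
 assumes Om_open: "\<And>q. open (Om q)"
  and half: "\<And>q. vol (cube q \<inter> Om q) \<le> ennreal (1/2) * vol (cube q)"
  and good: "\<And>q x. x \<in> cube q ==> x \<notin> Om q ==> F q x \<le> a q"
  and step: "\<And>q p x. p \<in> sel (fst q) (Om q) ==> cube p \<subseteq> cube q ==> x \<in> cube p ==> F q x \<le> a q + F p x"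
begin

definition children :: "'n key => 'n key set" where
 "children q = {p \<in> sel (fst q) (Om q). cube p \<subseteq> cube q}"

primrec gen :: "nat => 'n key => 'n key set" where
 "gen 0 q = {q}"
| "gen (Suc m) q = (\<Union>p\<in>children q. gen m p)"

definition desc :: "'n key => 'n key set" where "desc q = (\<Union>m. gen m q)"

text \<open>Half of the cube is free of \<open>Om q\<close>; this is what allows the search for
  stopping cubes to start at the level of \<open>q\<close> itself.\<close>

lemma cube_not_subset_Om: "\<not> cube q \<subseteq> Om q"
proof
 assume "cube q \<subseteq> Om q"
 then have "cube q \<inter> Om q = cube q" by auto
 then have "vol (cube q) \<le> ennreal (1/2) * vol (cube q)" using half[of q] by simp
 then have "ennreal (side q ^ CARD('n)) \<le> ennreal (1/2 * side q ^ CARD('n))"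
  unfolding emeasure_cube by (subst ennreal_mult) auto
 moreover have "0 < side q ^ CARD('n)" by simp
 ultimately show False by (subst (asm) ennreal_le_iff) auto
qed

lemma child_cover:
 assumes "x \<in> cube q" "x \<in> Om q"
 obtains p where "p \<in> children q" "x \<in> cube p"
proof -
 have k: "key_of (fst q) x = q" using assms(1) by (simp add: mem_cube_iff)
 obtain p where p: "p \<in> sel (fst q) (Om q)" "x \<in> cube p"
  using sel_cover[OF Om_open assms(2), of "fst q"] cube_not_subset_Om[of q] k by metis
 have "cube p \<subseteq> cube q" using p assms(1) by (intro cube_nested[of p q x]) (auto simp: sel_def)
 then show ?thesis using that p by (auto simp: children_def)
qed

lemma children_disjoint: "disjoint_family_on cube (children q)"
 using disjoint_sel[of "fst q" "Om q"] by (auto simp: children_def disjoint_family_on_def)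

lemma gen_subset: "p \<in> gen m q ==> cube p \<subseteq> cube q"
 by (induction m arbitrary: q) (auto simp: children_def)

lemma gen_level: "p \<in> gen m q ==> fst p \<le> fst q"
proof (induction m arbitrary: q)
 case (Suc m)
 then obtain p' where "p' \<in> children q" "p \<in> gen m p'" by auto
 then show ?case using Suc.IH[of p'] by (auto simp: children_def sel_def)
qed simp

definition gens :: "nat => 'n key => (real^'n) set" where "gens m q = (\<Union>p\<in>gen m q. cube p)"

lemma gens_meas[measurable]: "gens m q \<in> sets borel"
 unfolding gens_def by (intro sets.countable_UN'' countable_keys) auto

text \<open>Peel off the first generation: its cubes are disjoint and lie in
  \<open>cube q \<inter> Om q\<close>, at most half of \<open>cube q\<close>.\<close>

lemma emeasure_gens: "vol (gens m q) \<le> ennreal ((1/2) ^ m) * vol (cube q)"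
proof (induction m arbitrary: q)
 case (Suc m)
 have "gens (Suc m) q = (\<Union>p\<in>children q. gens m p)" by (auto simp: gens_def)
 also have "vol \<dots> \<le> ennreal ((1/2)^m) * (\<integral>\<^sup>+y\<in>(\<Union>p\<in>children q. cube p). 1 \<partial>lborel)"
  by (rule emeasure_UN_le_disjoint[OF countable_keys _ _ children_disjoint]) (use Suc in auto)
 also have "(\<integral>\<^sup>+y\<in>(\<Union>p\<in>children q. cube p). 1 \<partial>lborel) = vol (\<Union>p\<in>children q. cube p)"
 proof -
  have "(\<Union>p\<in>children q. cube p) \<in> sets lborel"
   by (intro sets.countable_UN'' countable_keys) auto
  then show ?thesis by simp
 qed
 also have "\<dots> \<le> vol (cube q \<inter> Om q)"
  using Om_open[of q] by (intro emeasure_mono) (auto simp: children_def sel_def)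
 also have "\<dots> \<le> ennreal (1/2) * vol (cube q)" by (rule half)
 also have "ennreal ((1/2)^m) * (ennreal (1/2) * vol (cube q)) = ennreal ((1/2)^Suc m) * vol (cube q)"
  by (subst ennreal_mult2) (auto simp: mult.commute)
 finally show ?case by (simp add: mult_left_mono)
qed (simp add: gens_def)

text \<open>Off the \<open>m\<close>-th generation the chain of stopping cubes through
  \<open>x\<close> ends in fewer than \<open>m\<close> steps at a cube whose set \<open>Om\<close>
  misses \<open>x\<close>. Every step costs one average, and so does the end. For
  \<open>m = 0\<close> the two assumptions contradict each other.\<close>

lemma stopping_bound:
 assumes "x \<in> cube q" "x \<notin> gens m q"
 shows "\<exists>T. finite T \<and> T \<subseteq> desc q \<and> (\<forall>p\<in>T. x \<in> cube p) \<and> F q x \<le> (\<Sum>p\<in>T. a p)"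
 using assms
proof (induction m arbitrary: q)
 case (Suc m)
 have q: "q \<in> desc q" unfolding desc_def by (rule UN_I[of 0]) auto
 show ?case
 proof (cases "x \<in> Om q")
  case False
  then show ?thesis using good[OF Suc.prems(1) False] q Suc.prems(1) by (intro exI[of _ "{q}"]) auto
 next
  case True
  obtain p where p: "p \<in> children q" "x \<in> cube p" using child_cover[OF Suc.prems(1) True] .
  have "x \<notin> gens m p" using Suc.prems(2) p by (auto simp: gens_def)
  from Suc.IH[OF p(2) this] obtain T where T: "finite T" "T \<subseteq> desc p" "\<forall>p\<in>T. x \<in> cube p" "F p x \<le> (\<Sum>p\<in>T. a p)" by blast
  \<comment> \<open>Levels strictly decrease along the chain, so \<open>q\<close> is not in
    \<open>T\<close> and its average enters the sum as a new term.\<close>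
  have "fst q' < fst q" if "q' \<in> desc p" for q'
  proof -
   from that obtain m' where "q' \<in> gen m' p" by (auto simp: desc_def)
   from gen_level[OF this] p(1) show ?thesis by (auto simp: children_def sel_def)
  qed
  then have nq: "q \<notin> T" using T(2) by blast
  have dd: "desc p \<subseteq> desc q"
  proof
   fix q' assume "q' \<in> desc p"
   then obtain m' where "q' \<in> gen m' p" by (auto simp: desc_def)
   then have "q' \<in> gen (Suc m') q" using p(1) by auto
   then show "q' \<in> desc q" unfolding desc_def by blast
  qed
  have "F q x \<le> a q + F p x" using p by (intro step) (auto simp: children_def)
  also have "\<dots> \<le> a q + (\<Sum>p\<in>T. a p)" by (intro add_left_mono T)
  also have "\<dots> = (\<Sum>p\<in>insert q T. a p)" using T(1) nq by simp
  finally show ?thesis using T dd q Suc.prems(1) by (intro exI[of _ "insert q T"]) auto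
 qed
qed (simp add: gens_def)

text \<open>The exceptional points lie in every generation, and the measures of the generations
  decrease geometrically.\<close>

lemma AE_stopping_bound:
 "AE x in lborel. x \<in> cube q \<longrightarrow>
  (\<exists>T. finite T \<and> T \<subseteq> desc q \<and> (\<forall>p\<in>T. x \<in> cube p) \<and> F q x \<le> (\<Sum>p\<in>T. a p))"
proof (rule AE_I)
 define N where "N = (\<Inter>m. gens m q)"
 have Nm: "N \<in> sets borel" unfolding N_def by (intro sets.countable_INT'') auto
 show "{x \<in> space lborel. \<not> (x \<in> cube q \<longrightarrow> (\<exists>T. finite T \<and> T \<subseteq> desc q \<and> (\<forall>p\<in>T. x \<in> cube p) \<and> F q x \<le> (\<Sum>p\<in>T. a p)))} \<subseteq> N"
 proof
  fix x assume "x \<in> {x \<in> space lborel. \<not> (x \<in> cube q \<longrightarrow> (\<exists>T. finite T \<and> T \<subseteq> desc q \<and> (\<forall>p\<in>T. x \<in> cube p) \<and> F q x \<le> (\<Sum>p\<in>T. a p)))}"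
  then have x: "x \<in> cube q" "\<not> (\<exists>T. finite T \<and> T \<subseteq> desc q \<and> (\<forall>p\<in>T. x \<in> cube p) \<and> F q x \<le> (\<Sum>p\<in>T. a p))" by auto
  then have "x \<in> gens m q" for m using stopping_bound[OF x(1), of m] by blast
  then show "x \<in> N" by (auto simp: N_def)
 qed
 have le: "vol N \<le> ennreal ((1/2)^m * side q ^ CARD('n))" for m
 proof -
  have "vol N \<le> vol (gens m q)" by (intro emeasure_mono) (auto simp: N_def)
  also have "\<dots> \<le> ennreal ((1/2) ^ m) * vol (cube q)" by (rule emeasure_gens)
  finally show ?thesis by (simp add: emeasure_cube ennreal_mult)
 qed
 have "(\<lambda>m. ennreal ((1/2)^m * side q ^ CARD('n))) \<longlonglongrightarrow> ennreal (0 * side q ^ CARD('n))"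
  by (intro tendsto_ennrealI tendsto_mult_right LIMSEQ_power_zero) auto
 then have "vol N \<le> ennreal (0 * side q ^ CARD('n))"
  by (rule LIMSEQ_le_const) (use le in auto)
 then show "vol N = 0" by simp
 show "N \<in> sets lborel" using Nm by simp
qed

text \<open>The proper descendants of a cube lie inside its set \<open>Om\<close>, hence miss what
  remains of it; cubes on different branches are disjoint anyway.\<close>

lemma gen_disjoint:
 assumes "q \<in> gen m r" "q' \<in> gen m' r" "q \<noteq> q'"
 shows "(cube q - Om q) \<inter> (cube q' - Om q') = {}"
proof -
 have root: "(cube r - Om r) \<inter> (cube p - Om p) = {}" if "p \<in> gen (Suc i) r" for p i r
 proof -
  from that obtain c where "c \<in> children r" "p \<in> gen i c" by auto
  then have "cube p \<subseteq> Om r" using gen_subset[of p i c] by (auto simp: children_def sel_def)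
  then show ?thesis by auto
 qed
 show ?thesis using assms
 proof (induction m arbitrary: r m')
  case 0
  then show ?case using root[of q' "m' - 1" r] by (cases m') auto
 next
  case (Suc m)
  show ?case
  proof (cases m')
   case 0
   then show ?thesis using root[OF Suc.prems(1)] Suc.prems by auto
  next
   case (Suc i)
   then obtain p p' where p: "p \<in> children r" "q \<in> gen m p" "p' \<in> children r" "q' \<in> gen i p'"
    using Suc.prems by auto
   show ?thesis
   proof (cases "p = p'")
    case True
    then show ?thesis using Suc.IH p Suc.prems(3) by auto
   next
    case False
    then have "cube p \<inter> cube p' = {}" using children_disjoint[of r] p by (auto simp: disjoint_family_on_def)
    then show ?thesis using gen_subset[OF p(2)] gen_subset[OF p(4)] by auto
   qed
  qed
 qed
qed

lemma emeasure_remainder: "ennreal (1/2) * vol (cube q) \<le> vol (cube q - Om q)"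
proof -
 have [measurable]: "Om q \<in> sets borel" using Om_open by simp
 have "vol (cube q) \<le> vol (cube q \<inter> Om q) + vol (cube q - Om q)"
  by (rule order_trans[OF _ emeasure_subadditive]) (auto simp: Int_Diff_Un)
 also have "\<dots> \<le> ennreal (1/2) * vol (cube q) + vol (cube q - Om q)"
  by (intro add_right_mono half)
 finally have 1: "vol (cube q) \<le> ennreal (1/2) * vol (cube q) + vol (cube q - Om q)" .
 define v where "v = side q ^ CARD('n)"
 have v: "vol (cube q) = ennreal v" "0 \<le> v" by (auto simp: emeasure_cube v_def)
 show ?thesis
 proof (cases "vol (cube q - Om q)")
  case (real u)
  have "ennreal v \<le> ennreal (1/2 * v + u)"
  proof -
   have "ennreal (1/2 * v + u) = ennreal (1/2) * ennreal v + ennreal u"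
    using v(2) real(1) by (subst ennreal_plus) (simp_all only: ennreal_mult mult_nonneg_nonneg divide_nonneg_nonneg zero_le_one zero_le_numeral)
   then show ?thesis using 1 unfolding v(1) real(2) by simp
  qed
  then have "v \<le> 1/2 * v + u" using v(2) real(1) by (subst (asm) ennreal_le_iff) auto
  then show ?thesis unfolding v(1) real(2) using v(2) by (subst ennreal_mult[symmetric]) (auto intro!: ennreal_leI)
 qed simp
qed

theorem sparse_iteration:
 assumes roots: "disjoint_family_on cube Rt" "countable Rt"
 obtains S E where "S \<subseteq> {p. \<exists>q\<in>Rt. cube p \<subseteq> cube q}" "disjoint_family_on E S"
  "\<And>q. q \<in> S ==> E q \<in> sets lborel \<and> E q \<subseteq> cube q \<and> ennreal (1/2) * vol (cube q) \<le> vol (E q)"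
  "AE x in lborel. \<forall>q\<in>Rt. x \<in> cube q \<longrightarrow>
   (\<exists>T. finite T \<and> T \<subseteq> S \<and> (\<forall>p\<in>T. x \<in> cube p) \<and> F q x \<le> (\<Sum>p\<in>T. a p))"
proof
 define S where "S = (\<Union>q\<in>Rt. desc q)"
 define E where "E q = cube q - Om q" for q
 show "S \<subseteq> {p. \<exists>q\<in>Rt. cube p \<subseteq> cube q}"
 proof
  fix p assume "p \<in> S"
  then obtain q m where "q \<in> Rt" "p \<in> gen m q" by (auto simp: S_def desc_def)
  then show "p \<in> {p. \<exists>q\<in>Rt. cube p \<subseteq> cube q}" using gen_subset[of p m q] by auto
 qed
 show "disjoint_family_on E S"
  unfolding disjoint_family_on_def
 proof (intro ballI impI)
  fix q q' assume q: "q \<in> S" "q' \<in> S" "q \<noteq> q'"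
  obtain r m r' m' where r: "r \<in> Rt" "q \<in> gen m r" "r' \<in> Rt" "q' \<in> gen m' r'"
   using q unfolding S_def desc_def by auto
  show "E q \<inter> E q' = {}"
  proof (cases "r = r'")
   case True
   then show ?thesis using gen_disjoint[of q m r q' m'] r q by (simp add: E_def)
  next
   case False
   then have "cube r \<inter> cube r' = {}" using roots(1) r by (auto simp: disjoint_family_on_def)
   then show ?thesis using gen_subset[OF r(2)] gen_subset[OF r(4)] by (auto simp: E_def)
  qed
 qed
 show "E q \<in> sets lborel \<and> E q \<subseteq> cube q \<and> ennreal (1/2) * vol (cube q) \<le> vol (E q)" for q
  using emeasure_remainder[of q] using Om_open[of q] by (auto simp: E_def)
 have "AE x in lborel. x \<in> cube q \<longrightarrow>
   (\<exists>T. finite T \<and> T \<subseteq> S \<and> (\<forall>p\<in>T. x \<in> cube p) \<and> F q x \<le> (\<Sum>p\<in>T. a p))" if "q \<in> Rt" for q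
 proof -
  have "desc q \<subseteq> S" using that by (auto simp: S_def)
  with AE_stopping_bound[of q] show ?thesis
   by (elim eventually_mono) blast
 qed
 then show "AE x in lborel. \<forall>q\<in>Rt. x \<in> cube q \<longrightarrow>
   (\<exists>T. finite T \<and> T \<subseteq> S \<and> (\<forall>p\<in>T. x \<in> cube p) \<and> F q x \<le> (\<Sum>p\<in>T. a p))"
  using roots(2) by (simp add: AE_ball_countable)
qed

end

section \<open>Averages over cubes and their comparison\<close>

definition tf :: "('a::euclidean_space => complex) => bool" where
 "tf f \<longleftrightarrow> continuous_on UNIV f \<and> bounded {x. f x \<noteq> 0}"

lemma tf_adm:
 fixes f :: "'a::euclidean_space => complex"
 assumes "tf f" shows "adm f"
proof -
 have c: "continuous_on UNIV f" and b: "bounded {x. f x \<noteq> 0}" using assms by (auto simp: tf_def)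
 have "compact (closure {x. f x \<noteq> 0})" using b by simp
 then have "compact (f ` closure {x. f x \<noteq> 0})"
  using c by (intro compact_continuous_image) (auto intro: continuous_on_subset)
 then obtain B where B: "\<And>x. x \<in> closure {x. f x \<noteq> 0} ==> norm (f x) \<le> B"
  using compact_imp_bounded by (force simp: bounded_iff)
 have "norm (f x) \<le> max B 0" for x
  using B[of x] closure_subset[of "{x. f x \<noteq> 0}"] by (cases "f x = 0") auto
 moreover have "f \<in> BM" using c by (rule borel_measurable_continuous_onI)
 ultimately show ?thesis using b by (auto simp: adm_def)
qed

lemma adm_powr:
 assumes "adm f" "0 < s" shows "adm (\<lambda>x. of_real (norm (f x) powr s))"
proof -
 obtain M where M: "\<And>x. norm (f x) \<le> M" using assms(1) by (auto simp: adm_def)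
 have [measurable]: "f \<in> BM" using assms by (simp add: adm_def)
 have 1: "norm (complex_of_real (norm (f x) powr s)) \<le> M powr s" for x
  using M[of x] assms(2) by (simp add: powr_mono2)
 have 2: "bounded {x. complex_of_real (norm (f x) powr s) \<noteq> 0}"
  using assms(1) by (auto simp: adm_def)
 show ?thesis unfolding adm_def using 1 2 by (intro conjI exI[of _ "M powr s"] allI) measurable
qed

lemma powr_integrable:
 assumes "adm f" "0 < s" shows "integrable lborel (\<lambda>x. norm (f x) powr s)"
 using integrable_norm[OF adm_integrable[OF adm_powr[OF assms]]] by simp

lemma powr_set_integrable:
 assumes "adm f" "0 < s" "Q \<in> sets borel" shows "set_integrable lborel Q (\<lambda>x. norm (f x) powr s)"
 unfolding set_integrable_def using assms by (intro integrable_mult_indicator powr_integrable) auto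

lemma cube_average_nonneg: "0 \<le> cube_average s Q f"
 by (simp add: cube_average_def)

lemma set_LINT_nonneg: "0 \<le> (LINT x:Q|M. norm (f x) powr s)"
 unfolding set_lebesgue_integral_def by (intro integral_nonneg_AE) auto

lemma cube_average_powr:
 fixes Q :: "(real^'n::finite) set"
 assumes "0 < s" "0 < measure lborel Q"
 shows "measure lborel Q * cube_average s Q f powr s = (LINT x:Q|lborel. norm (f x) powr s)"
proof -
 have "cube_average s Q f powr s = (LINT x:Q|lborel. norm (f x) powr s) / measure lborel Q"
  unfolding cube_average_def powr_powr using assms set_LINT_nonneg[where Q=Q and M=lborel and f=f and s=s] by simp
 then show ?thesis using assms by simp
qed

lemma nn_integral_cube_average:
 fixes Q :: "(real^'n::finite) set"
 assumes f: "adm f" and s: "0 < s" and Q: "Q \<in> sets borel" "0 < measure lborel Q"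
 shows "(\<integral>\<^sup>+x\<in>Q. ennreal (norm (f x) powr s) \<partial>lborel) = ennreal (measure lborel Q * cube_average s Q f powr s)"
proof -
 have "(\<integral>\<^sup>+x\<in>Q. ennreal (norm (f x) powr s) \<partial>lborel) = (\<integral>\<^sup>+x. ennreal (indicator Q x *\<^sub>R (norm (f x) powr s)))"
  by (intro nn_integral_cong) (auto simp: indicator_def)
 also have "\<dots> = ennreal (LINT x|lborel. indicator Q x *\<^sub>R (norm (f x) powr s))"
  using powr_set_integrable[OF f s Q(1)] unfolding set_integrable_def by (intro nn_integral_eq_integral) auto
 finally show ?thesis using cube_average_powr[OF s Q(2), of f] by (simp add: set_lebesgue_integral_def)
qed

lemma cube_average_subset:
 fixes Q R :: "(real^'n::finite) set"
 assumes f: "adm f" and s: "1 \<le> s" and Q: "Q \<in> sets borel" "R \<in> sets borel" "Q \<subseteq> R" "0 < measure lborel Q"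
  and c: "1 \<le> c" "0 < measure lborel R" "measure lborel R \<le> c * measure lborel Q"
 shows "cube_average s Q f \<le> c * cube_average s R f"
proof -
 let ?I = "\<lambda>Q. (LINT x:Q|lborel. norm (f x) powr s)"
 have le: "?I Q \<le> ?I R" unfolding set_lebesgue_integral_def
  using powr_set_integrable[OF f _ Q(1)] powr_set_integrable[OF f _ Q(2)] s Q(3)
  by (intro integral_mono) (auto simp: set_integrable_def indicator_def)
 have "?I Q / measure lborel Q \<le> ?I R / (measure lborel R / c)"
  using le Q c set_LINT_nonneg[where Q=Q and M=lborel and f=f and s=s] by (intro frac_le) (auto simp: field_simps)
 also have "\<dots> = c * (?I R / measure lborel R)" by simp
 finally have "cube_average s Q f \<le> (c * (?I R / measure lborel R)) powr (1 / s)"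
  unfolding cube_average_def using set_LINT_nonneg[where Q=Q and M=lborel and f=f and s=s] s by (intro powr_mono2) auto
 also have "\<dots> = c powr (1/s) * cube_average s R f"
  unfolding cube_average_def by (rule powr_mult)
 also have "\<dots> \<le> c powr 1 * cube_average s R f"
  using s c by (intro mult_right_mono powr_mono cube_average_nonneg) auto
 finally show ?thesis using c by simp
qed

text \<open>The concave power lies below its tangent at 1.\<close>

lemma powr_le_linear:
 fixes x \<theta> :: real
 assumes "0 \<le> x" "0 < \<theta>" "\<theta> \<le> 1" shows "x powr \<theta> \<le> \<theta> * x + (1 - \<theta>)"
 using Youngs_inequality_0[of \<theta> "1 - \<theta>" x 1] assms by (cases "x = 0") auto

text \<open>Jensen's inequality: the tangent bound is applied to
  \<open>(norm (f x) / \<mu>) powr r\<close> and integrated over \<open>Q\<close>. Every positive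
  \<open>\<mu>\<close> that is at least the \<open>r\<close>-average works, and the final passage to
  the limit covers a vanishing average.\<close>

lemma cube_average_mono_exponent:
 fixes Q :: "(real^'n::finite) set"
 assumes f: "adm f" and s: "0 < s" "s \<le> r" and Q: "Q \<in> sets borel" "0 < measure lborel Q" "vol Q \<noteq> \<infinity>"
 shows "cube_average s Q f \<le> cube_average r Q f"
proof -
 have r: "0 < r" using s by simp
 define V where "V = measure lborel Q"
 have V: "0 < V" using Q by (simp add: V_def)
 have key: "cube_average s Q f \<le> \<mu>" if \<mu>: "0 < \<mu>" "cube_average r Q f \<le> \<mu>" for \<mu>
 proof -
  have "measure lborel Q * cube_average s Q f powr s = (LINT x:Q|lborel. norm (f x) powr s)"
   using s Q by (intro cube_average_powr) auto
  also have "\<dots> \<le> (LINT x:Q|lborel. (s/r * \<mu> powr (s - r)) * norm (f x) powr r + (1 - s/r) * \<mu> powr s)"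
   unfolding set_lebesgue_integral_def
  proof (intro integral_mono)
   show "integrable lborel (\<lambda>x. indicat_real Q x *\<^sub>R norm (f x) powr s)"
    using powr_set_integrable[OF f s(1) Q(1)] by (simp add: set_integrable_def)
   have "set_integrable lborel Q (\<lambda>x. (s/r * \<mu> powr (s - r)) * norm (f x) powr r + (1 - s/r) * \<mu> powr s)"
    using powr_set_integrable[OF f r Q(1)] Q
    by (intro set_integral_add(1) set_integrable_mult_right) (auto simp: set_integrable_def top.not_eq_extremum intro!: integrable_real_indicator)
   then show "integrable lborel (\<lambda>x. indicat_real Q x *\<^sub>R ((s/r * \<mu> powr (s - r)) * norm (f x) powr r + (1 - s/r) * \<mu> powr s))"
    by (simp add: set_integrable_def)
   fix x
   have "(norm (f x) / \<mu>) powr s = ((norm (f x) / \<mu>) powr r) powr (s / r)" using r by (simp add: powr_powr)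
   also have "\<dots> \<le> s/r * (norm (f x) / \<mu>) powr r + (1 - s/r)" using s r by (intro powr_le_linear) auto
   finally have "\<mu> powr s * (norm (f x) / \<mu>) powr s \<le> \<mu> powr s * (s/r * (norm (f x) / \<mu>) powr r + (1 - s/r))"
    by (intro mult_left_mono) auto
   moreover have "\<mu> powr s * (norm (f x) / \<mu>) powr s = norm (f x) powr s" using \<mu> by (simp add: powr_divide)
   moreover have "\<mu> powr s * (norm (f x) / \<mu>) powr r = \<mu> powr (s - r) * norm (f x) powr r"
    using \<mu> by (simp add: powr_divide powr_diff)
   ultimately have "norm (f x) powr s \<le> (s/r * \<mu> powr (s - r)) * norm (f x) powr r + (1 - s/r) * \<mu> powr s"
    by (simp add: distrib_left mult_ac)
   then show "indicat_real Q x *\<^sub>R norm (f x) powr s \<le> indicat_real Q x *\<^sub>R ((s/r * \<mu> powr (s - r)) * norm (f x) powr r + (1 - s/r) * \<mu> powr s)"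
    by (intro scaleR_left_mono) auto
  qed
  also have "\<dots> = (s/r * \<mu> powr (s - r)) * (LINT x:Q|lborel. norm (f x) powr r) + (1 - s/r) * \<mu> powr s * V"
  proof -
   have i1: "set_integrable lborel Q (\<lambda>x. (s/r * \<mu> powr (s - r)) * norm (f x) powr r)"
    by (intro set_integrable_mult_right powr_set_integrable f r Q)
   have i2: "set_integrable lborel Q (\<lambda>x. (1 - s/r) * \<mu> powr s)"
    using Q by (auto simp: set_integrable_def top.not_eq_extremum intro!: integrable_real_indicator)
   have "(LINT x:Q|lborel. (1 - s/r) * \<mu> powr s) = (1 - s/r) * \<mu> powr s * V"
    using Q by (simp add: set_lebesgue_integral_def V_def)
   then show ?thesis by (subst set_integral_add(2)[OF i1 i2]) simp
  qed
  also have "(LINT x:Q|lborel. norm (f x) powr r) = V * cube_average r Q f powr r"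
   using r Q unfolding V_def by (intro cube_average_powr[symmetric]) auto
  also have "(s/r * \<mu> powr (s - r)) * (V * cube_average r Q f powr r) \<le> (s/r * \<mu> powr (s - r)) * (V * \<mu> powr r)"
   using \<mu> s r V by (intro mult_left_mono powr_mono2 cube_average_nonneg) auto
  also have "(s/r * \<mu> powr (s - r)) * (V * \<mu> powr r) + (1 - s/r) * \<mu> powr s * V = V * \<mu> powr s"
   using \<mu> by (simp add: powr_diff algebra_simps)
  finally have "cube_average s Q f powr s \<le> \<mu> powr s" using V by (simp add: V_def)
  then have "(cube_average s Q f powr s) powr (1/s) \<le> (\<mu> powr s) powr (1/s)" by (rule powr_mono2[rotated 2]) (use s in auto)
  then have "cube_average s Q f powr 1 \<le> \<mu> powr 1" using s unfolding powr_powr by simp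
  then show ?thesis using \<mu> cube_average_nonneg[of s Q f] by (metis powr_one less_imp_le)
 qed
 show ?thesis
 proof (rule field_le_epsilon)
  fix e :: real assume "0 < e"
  then show "cube_average s Q f \<le> cube_average r Q f + e"
   using cube_average_nonneg[of r Q f] by (intro key) auto
 qed
qed

text \<open>A cube of sixteen times the side around the threefold dilate. Left ends of shifted cubes
  are the thirds \<open>w / 3\<close> of that side, and \<open>w = (3 z - 3) div 16\<close> is the
  last one not beyond the dilate; quotient and remainder of \<open>w\<close> by 3 are the integer
  corner and the shift. In units of \<open>side q\<close> the left ends are \<open>16/3\<close>
  apart and the dilate has length 3, so it fits into length 16.\<close>

definition Rof :: "('n::finite) key => (real^'n) set" where
 "Rof q = dyadic_cube (fst q + 4) (\<lambda>i. ((3 * snd q i - 3) div 16) div 3) (\<lambda>i. nat (((3 * snd q i - 3) div 16) mod 3))"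

lemma Rof_dyadic: "Rof q \<in> dyadic_cubes"
proof -
 have "nat (w mod 3) \<in> {0,1,2}" for w :: int
 proof -
  have "w mod 3 \<in> {0..<3}" by simp
  then show ?thesis by (auto simp: nat_less_iff)
 qed
 then show ?thesis unfolding Rof_def dyadic_cubes_def by blast
qed

lemma emeasure_dyadic_cube:
 fixes m :: "'n::finite => int"
 shows "vol (dyadic_cube k m v) = ennreal ((2 powi k) ^ CARD('n))"
 unfolding dyadic_cube_def by (subst emeasure_box_cart) (simp_all add: algebra_simps)

lemma dyadic_cube_borel[measurable]: "dyadic_cube k m v \<in> sets borel"
 by (simp add: dyadic_cube_def)

lemma dil_subset_Rof: "dil q \<subseteq> Rof q"
proof
 fix x assume x: "x \<in> dil q"
 show "x \<in> Rof q" unfolding Rof_def dyadic_cube_def mem_box_cart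
 proof (intro allI)
  fix i
  define z where "z = snd q i"
  define w where "w = (3 * z - 3) div 16"
  have w: "16 * w \<le> 3 * z - 3" "3 * z + 6 \<le> 16 * w + 48" unfolding w_def by presburger+
  have s: "2 powi (fst q + 4) = 16 * side q" by (simp add: side_def power_int_add)
  have wr: "real_of_int (w div 3) + real (nat (w mod 3)) / 3 = real_of_int w / 3"
  proof -
   have "w = 3 * (w div 3) + w mod 3" by simp
   then have "real_of_int w = 3 * real_of_int (w div 3) + real_of_int (w mod 3)"
    by (metis of_int_add of_int_mult of_int_numeral)
   then show ?thesis by simp
  qed
  have "real_of_int (16 * w) \<le> real_of_int (3 * z - 3)" "real_of_int (3 * z + 6) \<le> real_of_int (16 * w + 48)"
   using w by (simp_all only: of_int_le_iff)
  then have "16 * (real_of_int w / 3) \<le> real_of_int z - 1" "real_of_int z + 2 \<le> 16 * (real_of_int w / 3 + 1)" by simp_all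
  then have "side q * (16 * (real_of_int w / 3)) \<le> side q * (real_of_int z - 1)" "side q * (real_of_int z + 2) \<le> side q * (16 * (real_of_int w / 3 + 1))"
   by (intro mult_left_mono, simp_all)+
  moreover have "side q * (real_of_int z - 1) < x$i" "x$i < side q * (real_of_int z + 2)"
   using x by (auto simp: dil_def z_def)
  ultimately have "side q * (16 * (real_of_int w / 3)) \<le> x$i" "x$i \<le> side q * (16 * (real_of_int w / 3 + 1))" by linarith+
  then have "16 * side q * (real_of_int (w div 3) + real (nat (w mod 3)) / 3) \<le> x$i"
   "x$i \<le> 16 * side q * (real_of_int (w div 3) + real (nat (w mod 3)) / 3 + 1)"
   unfolding wr by (simp_all add: mult.assoc mult.left_commute)
  then have "16 * side q * (real_of_int (w div 3) + real (nat (w mod 3)) / 3) \<le> x$i"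
   "x$i \<le> 16 * side q * (real_of_int (w div 3) + 1 + real (nat (w mod 3)) / 3)"
   by (simp_all only: add_ac)
  then show "(\<chi> i. 2 powi (fst q + 4) * (real_of_int ((3 * snd q i - 3) div 16 div 3) + real (nat ((3 * snd q i - 3) div 16 mod 3)) / 3)) $ i \<le> x $ i \<and>
    x $ i \<le> (\<chi> i. 2 powi (fst q + 4) * (real_of_int ((3 * snd q i - 3) div 16 div 3) + 1 + real (nat ((3 * snd q i - 3) div 16 mod 3)) / 3)) $ i"
   by (simp add: s w_def z_def)
 qed
qed

lemma powi2_inj: "(2::real) powi a = 2 powi b ==> a = b"
 using power_int_strict_increasing[of a b "2::real"] power_int_strict_increasing[of b a "2::real"]
 by (cases a b rule: linorder_cases) auto

text \<open>The volume determines the level. Neighbouring cubes may share their image, but among the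
  cubes through one point this makes \<open>Rof\<close> injective.\<close>

lemma Rof_eq_level: "Rof q = Rof (q' :: ('n::finite) key) ==> fst q = fst q'"
proof -
 assume "Rof q = Rof q'"
 then have "vol (Rof q) = vol (Rof q')" by simp
 then have "(2 powi (fst q + 4)) ^ CARD('n) = (2 powi (fst q' + 4) :: real) ^ CARD('n)"
  unfolding Rof_def emeasure_dyadic_cube by (subst (asm) ennreal_inj) auto
 then have "(2::real) powi (fst q + 4) = 2 powi (fst q' + 4)"
  by (rule power_eq_imp_eq_base) auto
 then show ?thesis using powi2_inj by fastforce
qed

text \<open>In each coordinate the interval \<open>2^k [-2/3, 1/3]\<close>: the shift puts the
  origin into the interior, so that these cubes increase to the whole space.\<close>

definition Gc :: "int => (real^'n::finite) set" where "Gc k = dyadic_cube k (\<lambda>_. -1) (\<lambda>_. 1)"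

lemma mem_Gc: "x \<in> Gc k \<longleftrightarrow> (\<forall>i. - (2/3) * 2 powi k \<le> x$i \<and> x$i \<le> 1/3 * 2 powi k)"
 by (simp add: Gc_def dyadic_cube_def mem_box_cart mult.commute)

lemma Gc_mono: "k \<le> k' ==> Gc k \<subseteq> Gc k'"
proof
 fix x assume "k \<le> k'" "x \<in> Gc k"
 then have le: "(2::real) powi k \<le> 2 powi k'" and x: "- (2/3) * 2 powi k \<le> x$i \<and> x$i \<le> 1/3 * 2 powi k" for i
  by (simp_all add: power_int_increasing mem_Gc)
 have "- (2/3) * 2 powi k' \<le> x$i \<and> x$i \<le> 1/3 * 2 powi k'" for i using le x[of i] by linarith
 then show "x \<in> Gc k'" by (simp add: mem_Gc)
qed

lemma emeasure_Gc: "vol (Gc k :: (real^'n::finite) set) = ennreal ((2 powi k) ^ CARD('n))"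
 unfolding Gc_def by (rule emeasure_dyadic_cube)

lemma Gc_inj: "inj (Gc :: int => (real^'n::finite) set)"
proof (rule injI)
 fix k k' assume "Gc k = (Gc k' :: (real^'n) set)"
 then have "vol (Gc k :: (real^'n) set) = vol (Gc k' :: (real^'n) set)" by simp
 then have "(2 powi k) ^ CARD('n) = (2 powi k' :: real) ^ CARD('n)"
  unfolding emeasure_Gc by (subst (asm) ennreal_inj) auto
 then have "(2::real) powi k = 2 powi k'"
  by (rule power_eq_imp_eq_base) auto
 then show "k = k'" by (rule powi2_inj)
qed

lemma Gc_borel[measurable]: "Gc k \<in> sets borel" by (simp add: Gc_def)

lemma measure_Gc_diff: "1/2 * measure lborel (Gc k :: (real^'n::finite) set) \<le> measure lborel (Gc k - Gc (k - 1) :: (real^'n) set)"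
proof -
 let ?G = "\<lambda>k. Gc k :: (real^'n) set"
 have m: "measure lborel (?G k) = (2 powi k) ^ CARD('n)" for k
  unfolding measure_def emeasure_Gc by simp
 have "measure lborel (?G k - ?G (k - 1)) = measure lborel (?G k) - measure lborel (?G (k - 1))"
  using Gc_mono[of "k - 1" k] by (intro measure_Diff) (auto simp: emeasure_Gc)
 moreover have "measure lborel (?G (k - 1)) \<le> 1/2 * measure lborel (?G k)"
 proof -
  have "2 powi (k - 1) = (1/2) * (2 powi k :: real)" by (simp add: power_int_diff)
  then have "measure lborel (?G (k - 1)) = (1/2) ^ CARD('n) * measure lborel (?G k)"
   unfolding m by (simp only: power_mult_distrib)
  also have "(1/2::real) ^ CARD('n) \<le> (1/2) ^ 1" by (intro power_decreasing) (auto simp: Suc_leI)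
  finally show ?thesis by (simp add: mult_right_mono)
 qed
 ultimately show ?thesis by linarith
qed

lemma Rof_borel[measurable, simp]: "Rof q \<in> sets borel" by (simp add: Rof_def)

section \<open>Sparse domination from stopping sets\<close>

abbreviation cut :: "('n::finite) key => (real^'n => complex) => real^'n => complex" where
 "cut q f \<equiv> (\<lambda>y. indicator (dil q) y * f y)"

text \<open>The hypotheses of the stopping iteration for one cube, with \<open>M (cut q f)\<close>
  as the local operator, so that they can be established cube by cube and \<open>Om\<close> can be
  chosen afterwards.\<close>

definition stopset :: "real => real => ((real^'n::finite => complex) => real^'n => ennreal) => (real^'n => complex) => 'n key => (real^'n) set => bool" where
 "stopset s A M f q Om \<longleftrightarrow> open Om \<and> vol (cube q \<inter> Om) \<le> ennreal (1/2) * vol (cube q) \<and>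
  (\<forall>x\<in>cube q - Om. M (cut q f) x \<le> ennreal (A * cube_average s (dil q) f)) \<and>
  (\<forall>p\<in>sel (fst q) Om. cube p \<subseteq> cube q \<longrightarrow> (\<forall>x\<in>cube p.
    M (cut q f) x \<le> ennreal (A * cube_average s (dil q) f) + M (cut p f) x))"

definition stops :: "real => real => ((real^'n::finite => complex) => real^'n => ennreal) => (real^'n => complex) => 'n key => bool" where
 "stops s A M f q \<longleftrightarrow> (\<exists>Om. stopset s A M f q Om)"

lemma stops_mono:
 assumes "stops s A M f q" "A \<le> B" shows "stops s B M f q"
proof -
 have "ennreal (A * cube_average s (dil q) f) \<le> ennreal (B * cube_average s (dil q) f)"
  using assms(2) by (intro ennreal_leI mult_right_mono cube_average_nonneg)
 then show ?thesis using assms(1) unfolding stops_def stopset_def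
  by (meson order_trans add_right_mono)
qed

lemma stops_zero: "(\<And>x. M (cut q f) x \<le> 0) ==> stops s A M f q"
 unfolding stops_def stopset_def using cube_nonempty by (intro exI[of _ "{}"]) (auto simp: sel_def)

text \<open>\<open>16 ^ n\<close> is the volume ratio of \<open>Rof q\<close> to
  \<open>cube q\<close>; half of \<open>cube q\<close> is free, and one more factor 2 makes the
  sparseness inequality strict. \<open>24 ^ n\<close> comes from the far cubes, whose side is below
  \<open>24 * X\<close>.\<close>

theorem sparse_domination:
 fixes M :: "(real^'n::finite => complex) => real^'n => ennreal"
 assumes f: "tf f" and s: "1 \<le> s" and A: "0 < A"
  and stop: "\<And>q. stops s A M f q"
  and supp: "\<And>y i. f y \<noteq> 0 ==> \<bar>y$i\<bar> < 2 powi k"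
  and tail: "\<And>x X i. 2 powi k \<le> X ==> X \<le> \<bar>x$i\<bar> ==> M f x \<le> ennreal (A / X ^ CARD('n)) * (\<integral>\<^sup>+y. enorm (f y))"
 shows "\<exists>S. sparse_family (1 / (4 * 16 ^ CARD('n))) S \<and>
  (AE x in lborel. M f x \<le> ennreal (24 ^ CARD('n) * A) * sparse_operator s S f x)"
proof -
 define n where "n = CARD('n)"
 have n: "0 < n" by (simp add: n_def)
 have af: "adm f" by (rule tf_adm[OF f])
 have "\<forall>q. \<exists>Om. stopset s A M f q Om" using stop by (simp add: stops_def)
 from choice[OF this] obtain Om where "\<forall>q. stopset s A M f q (Om q)" ..
 then have Om: "\<And>q. open (Om q)" "\<And>q. vol (cube q \<inter> Om q) \<le> ennreal (1/2) * vol (cube q)"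
  "\<And>q x. x \<in> cube q ==> x \<notin> Om q ==> M (cut q f) x \<le> ennreal (A * cube_average s (dil q) f)"
  "\<And>q p x. p \<in> sel (fst q) (Om q) ==> cube p \<subseteq> cube q ==> x \<in> cube p ==>
     M (cut q f) x \<le> ennreal (A * cube_average s (dil q) f) + M (cut p f) x"
  unfolding stopset_def by blast+
 \<comment> \<open>The \<open>2^n\<close> cubes of level \<open>k\<close> that meet at the origin.
   They cover the support of \<open>f\<close>, and the dilate of each of them contains it, so on a
   root the local operator is the full one.\<close>
 define Rt where "Rt = {q :: 'n key. fst q = k \<and> (\<forall>i. snd q i \<in> {-1, 0})}"
 have Rt_disj: "disjoint_family_on cube Rt"
  unfolding disjoint_family_on_def using cube_eqI by (fastforce simp: Rt_def)
 obtain S E where S: "S \<subseteq> {p. \<exists>q\<in>Rt. cube p \<subseteq> cube q}" "disjoint_family_on E S"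
  "\<And>q. q \<in> S ==> E q \<in> sets lborel \<and> E q \<subseteq> cube q \<and> ennreal (1/2) * vol (cube q) \<le> vol (E q)"
  and AE: "AE x in lborel. \<forall>q\<in>Rt. x \<in> cube q \<longrightarrow>
   (\<exists>T. finite T \<and> T \<subseteq> S \<and> (\<forall>p\<in>T. x \<in> cube p) \<and> M (cut q f) x \<le> (\<Sum>p\<in>T. ennreal (A * cube_average s (dil p) f)))"
  by (rule sparse_iteration[of Om "\<lambda>q x. M (cut q f) x" "\<lambda>q. ennreal (A * cube_average s (dil q) f)" Rt,
    OF Om Rt_disj countable_keys]) blast+
 have Rt_f: "(\<lambda>y. indicator (dil q) y * f y) = f" if "q \<in> Rt" for q
 proof
  fix y
  have "y \<in> dil q" if y: "f y \<noteq> 0"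
  proof -
   have "side q * (of_int (snd q i) - 1) < y$i \<and> y$i < side q * (of_int (snd q i) + 2)" for i
   proof -
    have "\<bar>y$i\<bar> < side q" "snd q i = 0 \<or> snd q i = -1"
     using supp[OF y, of i] \<open>q \<in> Rt\<close> by (auto simp: Rt_def side_def)
    then show ?thesis by (auto simp: abs_less_iff)
   qed
   then show ?thesis by (simp add: dil_def)
  qed
  then show "indicator (dil q) y * f y = f y" by (cases "f y = 0") auto
 qed
 have root_ex: "\<exists>q\<in>Rt. x \<in> cube q" if x: "\<And>i. \<bar>x$i\<bar> < 2 powi k" for x :: "real^'n"
 proof
  have "\<lfloor>x$i / 2 powi k\<rfloor> \<in> {-1, 0}" for i
  proof -
   have "-1 < x$i / 2 powi k" "x$i / 2 powi k < 1" using x[of i] by (simp_all add: field_simps abs_less_iff)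
   then show ?thesis by (simp add: floor_eq_iff) linarith
  qed
  then show "key_of k x \<in> Rt" by (auto simp: Rt_def key_of_def)
 qed simp
 have root_sub: "cube q \<subseteq> Gc (k + 3)" if q: "q \<in> Rt" for q
 proof
  fix x assume x: "x \<in> cube q"
  have "- (2/3) * 2 powi (k+3) \<le> x$i \<and> x$i \<le> 1/3 * 2 powi (k+3)" for i
  proof -
   have s: "side q = 2 powi k" "0 < (2 powi k :: real)" using q by (simp_all add: Rt_def side_def)
   have "2 powi k * of_int (snd q i) \<le> x$i" "x$i < 2 powi k * (of_int (snd q i) + 1)" "snd q i \<in> {-1,0}"
    using x q s by (auto simp: cube_def Rt_def)
   then show ?thesis using s(2) by (auto simp: power_int_add)
  qed
  then show "x \<in> Gc (k + 3)" by (simp add: mem_Gc)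
 qed
 \<comment> \<open>All roots, hence all sets \<open>E q\<close>, lie in \<open>Gc (k + 3)\<close>.
   From level \<open>k + 4\<close> on the differences of consecutive \<open>Gc\<close> avoid
   them.\<close>
 define GG where "GG = (Gc :: int => (real^'n) set) ` {k + 4..}"
 define SS where "SS = Rof ` S \<union> GG"
 \<comment> \<open>\<open>Rof\<close> may identify several keys, so one of them lends its set. A
   cube that occurs both as a \<open>Rof\<close> and as a \<open>Gc\<close> takes the first branch;
   the remaining \<open>Gc\<close> cubes use their outer layers.\<close>
 define EE where "EE R = (if R \<in> Rof ` S then E (inv_into S Rof R) else R - Gc (inv Gc R - 1))" for R
 have EG: "EE (Gc m) = Gc m - Gc (m - 1)" if "Gc m \<notin> Rof ` S" for m
  using that inv_f_f[OF Gc_inj[where 'n='n], of m] by (simp add: EE_def)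
 have ER: "\<exists>q\<in>S. Rof q = R \<and> EE R = E q" if "R \<in> Rof ` S" for R
  using that by (intro bexI[of _ "inv_into S Rof R"]) (auto simp: EE_def f_inv_into_f inv_into_into)
 have E_sub: "E q \<subseteq> Gc (k + 3)" if "q \<in> S" for q
 proof -
  from that S(1) obtain r where "r \<in> Rt" "cube q \<subseteq> cube r" by blast
  then show ?thesis using S(3)[OF that] root_sub[of r] by blast
 qed
 have sparse: "sparse_family (1 / (4 * 16 ^ n)) SS"
  unfolding sparse_family_def
 proof (intro conjI exI[of _ EE] ballI)
  show "SS \<subseteq> dyadic_cubes"
   unfolding SS_def GG_def using Rof_dyadic by (auto simp: Gc_def dyadic_cubes_def)
  show "disjoint_family_on EE SS"
   unfolding disjoint_family_on_def
  proof (intro ballI impI)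
   have mix: "EE R \<inter> EE R' = {}" if R: "R \<in> Rof ` S" "R' \<in> GG" "R' \<notin> Rof ` S" for R R'
   proof -
    obtain m where m: "R' = Gc m" "k + 4 \<le> m" using R by (auto simp: GG_def)
    obtain q where q: "q \<in> S" "EE R = E q" using ER[OF R(1)] by blast
    have "Gc (k + 3) \<subseteq> (Gc (m - 1) :: (real^'n) set)" using m by (intro Gc_mono) auto
    then show ?thesis using E_sub[OF q(1)] EG[of m] R(3) unfolding m q by blast
   qed
   fix R R' assume R: "R \<in> SS" "R' \<in> SS" "R \<noteq> R'"
   show "EE R \<inter> EE R' = {}"
   proof (cases "R \<in> Rof ` S"; cases "R' \<in> Rof ` S")
    assume a: "R \<in> Rof ` S" "R' \<in> Rof ` S"
    obtain q q' where "q \<in> S" "Rof q = R" "EE R = E q" "q' \<in> S" "Rof q' = R'" "EE R' = E q'"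
     using ER[OF a(1)] ER[OF a(2)] by blast
    then show ?thesis using S(2) R(3) unfolding disjoint_family_on_def by metis
   next
    assume a: "R \<notin> Rof ` S" "R' \<notin> Rof ` S"
    obtain m m' where m: "R = Gc m" "R' = Gc m'" using R a by (auto simp: SS_def GG_def)
    have "m \<noteq> m'" using R m by auto
    then consider "m \<le> m' - 1" | "m' \<le> m - 1" by linarith
    then show ?thesis
    proof cases
     case 1 then have "R \<subseteq> Gc (m' - 1)" unfolding m by (intro Gc_mono)
     then show ?thesis using EG[of m] EG[of m'] a unfolding m by blast
    next
     case 2 then have "R' \<subseteq> Gc (m - 1)" unfolding m by (intro Gc_mono)
     then show ?thesis using EG[of m] EG[of m'] a unfolding m by blast
    qed
   next
    assume "R \<in> Rof ` S" "R' \<notin> Rof ` S" then show ?thesis using mix[of R R'] R by (auto simp: SS_def)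
   next
    assume "R \<notin> Rof ` S" "R' \<in> Rof ` S" then show ?thesis using mix[of R' R] R by (auto simp: SS_def)
   qed
  qed
  fix R assume R: "R \<in> SS"
  have EEp: "EE R \<in> sets borel \<and> EE R \<subseteq> R \<and> 1 / (4 * 16 ^ n) * measure lborel R < measure lborel (EE R) \<and> R \<in> sets borel"
  proof (cases "R \<in> Rof ` S")
   case True
   then obtain q where q: "q \<in> S" "Rof q = R" "EE R = E q" using ER by blast
   have ER': "E q \<subseteq> R" using S(3)[OF q(1)] cube_subset_dil[of q] dil_subset_Rof[of q] q(2) by blast
   have "vol (E q) \<le> vol (cube q)" using S(3)[OF q(1)] by (intro emeasure_mono) auto
   then have fin: "vol (E q) \<noteq> \<infinity>" by (auto simp: emeasure_cube top_unique)
   have "ennreal (1/2 * side q ^ n) \<le> ennreal (measure lborel (E q))"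
   proof -
    have "ennreal (1/2 * side q ^ n) = ennreal (1/2) * vol (cube q)"
     unfolding emeasure_cube n_def by (intro ennreal_mult) auto
    also have "\<dots> \<le> vol (E q)" using S(3)[OF q(1)] by blast
    finally show ?thesis using fin by (simp add: emeasure_eq_ennreal_measure)
   qed
   then have e: "1/2 * side q ^ n \<le> measure lborel (E q)" by (subst (asm) ennreal_le_iff) auto
   have "vol R = ennreal ((16 * side q) ^ n)"
    unfolding q(2)[symmetric] Rof_def emeasure_dyadic_cube by (simp add: side_def power_int_add n_def)
   then have "measure lborel R = 16 ^ n * side q ^ n" by (simp add: measure_def power_mult_distrib)
   then have "1 / (4 * 16 ^ n) * measure lborel R = 1/4 * side q ^ n" by simp
   also have "\<dots> < 1/2 * side q ^ n" by simp
   finally have "1 / (4 * 16 ^ n) * measure lborel R < measure lborel (E q)" using e by linarith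
   then show ?thesis using S(3)[OF q(1)] q ER' Rof_borel[of q] by simp
  next
   case False
   then obtain m where m: "R = Gc m" using R by (auto simp: SS_def GG_def)
   have pos: "0 < measure lborel (Gc m :: (real^'n) set)" unfolding measure_def emeasure_Gc by simp
   have "1 / (4 * 16 ^ n) * measure lborel (Gc m :: (real^'n) set) < 1/2 * measure lborel (Gc m :: (real^'n) set)"
   proof (rule mult_strict_right_mono[OF _ pos])
    have "(1::real) \<le> 16 ^ n" by simp
    then have "1 / (4 * 16 ^ n) \<le> (1 / 4 :: real)" by (intro divide_left_mono) auto
    then show "1 / (4 * 16 ^ n) < (1/2::real)" by linarith
   qed
   also have "\<dots> \<le> measure lborel (EE R)" using measure_Gc_diff[of m] EG[of m] False by (simp add: m)
   finally show ?thesis using EG[of m] False by (auto simp: m)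
  qed
  then show "EE R \<in> sets lebesgue" "EE R \<subseteq> R" "1 / (4 * 16 ^ n) * measure lebesgue R < measure lebesgue (EE R)"
   by (auto simp: measure_completion)
 qed
 have op_ge: "(\<Sum>R\<in>T. ennreal (cube_average s R f) * indicator R x) \<le> sparse_operator s SS f x"
  if "finite T" "T \<subseteq> SS" for T x
  unfolding sparse_operator_def using that
  by (subst nonneg_infsum_complete) (auto intro!: SUP_upper2[of T])
 have AE': "AE x in lborel. M f x \<le> ennreal (24 ^ n * A) * sparse_operator s SS f x"
  using AE
 proof (rule eventually_mono)
  fix x assume x: "\<forall>q\<in>Rt. x \<in> cube q \<longrightarrow>
   (\<exists>T. finite T \<and> T \<subseteq> S \<and> (\<forall>p\<in>T. x \<in> cube p) \<and> M (cut q f) x \<le> (\<Sum>p\<in>T. ennreal (A * cube_average s (dil p) f)))"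
  show "M f x \<le> ennreal (24 ^ n * A) * sparse_operator s SS f x"
  proof (cases "\<forall>i. \<bar>x$i\<bar> < 2 powi k")
   case True
   then obtain q where q: "q \<in> Rt" "x \<in> cube q" using root_ex[of x] by auto
   obtain T where T: "finite T" "T \<subseteq> S" "\<forall>p\<in>T. x \<in> cube p" "M f x \<le> (\<Sum>p\<in>T. ennreal (A * cube_average s (dil p) f))"
    using bspec[OF x q(1), rule_format, OF q(2)] unfolding Rt_f[OF q(1)] by blast
   have inj: "inj_on Rof T"
    proof (rule inj_onI)
    fix p p' assume "p \<in> T" "p' \<in> T" "Rof p = Rof p'"
    then show "p = p'" using T(3) Rof_eq_level[of p p'] cube_eqI[of p p' x] by auto
   qed
   have "(\<Sum>p\<in>T. ennreal (A * cube_average s (dil p) f)) \<le> (\<Sum>p\<in>T. ennreal (24 ^ n * A) * (ennreal (cube_average s (Rof p) f) * indicator (Rof p) x))"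
   proof (intro sum_mono)
    fix p assume p: "p \<in> T"
    have mR: "measure lborel (Rof p) = 16 ^ n * side p ^ n"
     unfolding measure_def Rof_def emeasure_dyadic_cube by (simp add: side_def power_int_add n_def power_mult_distrib)
    have mD: "measure lborel (dil p) = 3 ^ n * side p ^ n"
     unfolding measure_def emeasure_dil by (simp add: n_def power_mult_distrib)
    have "(1::real) \<le> 3 ^ n" by simp
    then have le: "measure lborel (Rof p) \<le> 16 ^ n * measure lborel (dil p)" unfolding mR mD
     by (intro mult_left_mono) auto
    have "cube_average s (dil p) f \<le> 16 ^ n * cube_average s (Rof p) f"
     by (rule cube_average_subset[OF af s _ _ dil_subset_Rof _ _ _ le]) (auto simp: mR mD)
    also have "\<dots> \<le> 24 ^ n * cube_average s (Rof p) f"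
     by (intro mult_right_mono power_mono cube_average_nonneg) auto
    finally have "A * cube_average s (dil p) f \<le> 24 ^ n * A * cube_average s (Rof p) f"
     using A by (simp add: mult_ac)
    then have "ennreal (A * cube_average s (dil p) f) \<le> ennreal (24 ^ n * A * cube_average s (Rof p) f)"
     by (rule ennreal_leI)
    also have "\<dots> = ennreal (24 ^ n * A) * ennreal (cube_average s (Rof p) f)"
     using A cube_average_nonneg by (intro ennreal_mult) auto
    finally have "ennreal (A * cube_average s (dil p) f) \<le> ennreal (24 ^ n * A) * ennreal (cube_average s (Rof p) f)" .
    moreover have "x \<in> Rof p" using T(3) p cube_subset_dil[of p] dil_subset_Rof[of p] by blast
    ultimately show "ennreal (A * cube_average s (dil p) f) \<le> ennreal (24 ^ n * A) * (ennreal (cube_average s (Rof p) f) * indicator (Rof p) x)"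
     by simp
   qed
   also have "\<dots> = ennreal (24 ^ n * A) * (\<Sum>R\<in>Rof ` T. ennreal (cube_average s R f) * indicator R x)"
    by (simp add: sum_distrib_left sum.reindex[OF inj])
   also have "\<dots> \<le> ennreal (24 ^ n * A) * sparse_operator s SS f x"
    using T by (intro mult_left_mono op_ge) (auto simp: SS_def)
   finally show ?thesis using T(4) by (rule order_trans[rotated])
  next
   case False
   define X where "X = Max (range (\<lambda>i. \<bar>x$i\<bar>))"
   have Xle: "\<bar>x$i\<bar> \<le> X" for i unfolding X_def by (intro Max_ge) auto
   have "X \<in> range (\<lambda>i. \<bar>x$i\<bar>)" unfolding X_def by (intro Max_in) auto
   then obtain i0 where i0: "X = \<bar>x$i0\<bar>" by auto
   have Xk: "2 powi k \<le> X" using False Xle by (meson not_le order_trans)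
   have Xp: "0 < X" using Xk by (rule less_le_trans[rotated]) simp
   \<comment> \<open>Rounding up \<open>log 2 (3 * X)\<close> fits \<open>x\<close> into a third of
     the side. The additional 2 forces \<open>m \<ge> k + 4\<close>, the range of \<open>GG\<close>,
     and raises the upper bound from \<open>6 * X\<close> to \<open>24 * X\<close>.\<close>
   define m where "m = \<lceil>log 2 (3 * X)\<rceil> + 2"
   have l1: "3 * X * 4 \<le> 2 powi m" "2 powi m < 24 * X"
   proof -
    define c where "c = \<lceil>log 2 (3 * X)\<rceil>"
    have "log 2 (3 * X) \<le> of_int c" "of_int c < log 2 (3 * X) + 1" unfolding c_def by linarith+
    then have "2 powr log 2 (3 * X) \<le> 2 powr of_int c" "2 powr of_int c < 2 powr (log 2 (3*X) + 1)"
     by simp_all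
    then have "3 * X \<le> 2 powi c" "2 powi c < 6 * X"
     using Xp by (simp_all add: powr_add powr_real_of_int' )
    then show "3 * X * 4 \<le> 2 powi m" "2 powi m < 24 * X" by (simp_all add: m_def c_def[symmetric] power_int_add)
   qed
   have mk: "k + 4 \<le> m"
   proof (rule ccontr)
    assume "\<not> k + 4 \<le> m"
    then have "(2::real) powi m \<le> 2 powi (k + 3)" by (intro power_int_increasing) auto
    then have "2 powi m \<le> 8 * X" using Xk by (simp add: power_int_add)
    then show False using l1 Xp by linarith
   qed
   have xG: "x \<in> Gc m" unfolding mem_Gc
   proof
    fix i show "- (2/3) * 2 powi m \<le> x$i \<and> x$i \<le> 1/3 * 2 powi m"
     using Xle[of i] l1 Xp by (simp add: abs_le_iff)
   qed
   have fG: "f y = 0" if "y \<notin> Gc m" for y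
   proof (rule ccontr)
    assume "f y \<noteq> 0"
    then have "\<bar>y$i\<bar> < X" for i using supp[of y i] Xk by linarith
    then have "- (2/3) * 2 powi m \<le> y$i \<and> y$i \<le> 1/3 * 2 powi m" for i
    proof -
     have "- X < y$i" "y$i < X" using \<open>\<And>i. \<bar>y$i\<bar> < X\<close>[of i] by (simp_all add: abs_less_iff)
     with l1 Xp show ?thesis by linarith
    qed
    then show False using that by (simp add: mem_Gc)
   qed
   define V where "V = measure lborel (Gc m :: (real^'n) set)"
   have V: "V = (2 powi m) ^ n" unfolding V_def measure_def emeasure_Gc by (simp add: n_def)
   have Vp: "0 < V" by (simp add: V)
   have fin: "vol (Gc m :: (real^'n) set) \<noteq> \<infinity>" by (simp add: emeasure_Gc)
   have "(\<integral>\<^sup>+y. enorm (f y)) = (\<integral>\<^sup>+y\<in>Gc m. ennreal (norm (f y) powr 1) \<partial>lborel)"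
    by (intro nn_integral_cong) (auto simp: indicator_def fG)
   also have "\<dots> = ennreal (V * cube_average 1 (Gc m) f)"
    using Vp cube_average_nonneg[of 1 "Gc m" f] unfolding V_def by (subst nn_integral_cube_average[OF af]) auto
   finally have If: "(\<integral>\<^sup>+y. enorm (f y)) = ennreal (V * cube_average 1 (Gc m) f)" .
   have a1: "cube_average 1 (Gc m) f \<le> cube_average s (Gc m) f"
    using s Vp fin unfolding V_def by (intro cube_average_mono_exponent[OF af]) auto
   have "M f x \<le> ennreal (A / X ^ n) * ennreal (V * cube_average 1 (Gc m) f)"
    using tail[OF Xk, of x i0] i0 unfolding If n_def by simp
   also have "\<dots> = ennreal (A / X ^ n * (V * cube_average 1 (Gc m) f))"
    using A Xp Vp cube_average_nonneg[of 1 "Gc m" f] by (intro ennreal_mult[symmetric]) auto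
   also have "\<dots> \<le> ennreal (24 ^ n * A * cube_average s (Gc m) f)"
   proof (intro ennreal_leI)
    have "V \<le> (24 * X) ^ n" unfolding V using l1 by (intro power_mono) auto
    then have "A / X ^ n * (V * cube_average 1 (Gc m) f) \<le> A / X ^ n * ((24 * X) ^ n * cube_average s (Gc m) f)"
     using A Xp Vp a1 cube_average_nonneg[of 1 "Gc m" f] by (intro mult_left_mono mult_mono) auto
    also have "\<dots> = 24 ^ n * A * cube_average s (Gc m) f" using Xp by (simp add: power_mult_distrib)
    finally show "A / X ^ n * (V * cube_average 1 (Gc m) f) \<le> 24 ^ n * A * cube_average s (Gc m) f" .
   qed
   also have "\<dots> = ennreal (24 ^ n * A) * (\<Sum>R\<in>{Gc m}. ennreal (cube_average s R f) * indicator R x)"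
    using A xG cube_average_nonneg by (subst ennreal_mult) auto
   also have "\<dots> \<le> ennreal (24 ^ n * A) * sparse_operator s SS f x"
    using mk by (intro mult_left_mono op_ge) (auto simp: SS_def GG_def)
   finally show ?thesis .
  qed
 qed
 show ?thesis using sparse AE' unfolding n_def by blast
qed

section \<open>Stopping sets for operators controlled by averages over balls\<close>

lemma adm_cut: "adm f ==> adm (cut q f)"
 by (intro adm_indicator) auto

lemma dil_dist:
 fixes q :: "'n::finite key"
 assumes "x \<in> cube q" "y \<in> dil q" shows "norm (x - y) \<le> 2 * real CARD('n) * side q"
proof -
 have "norm (x - y) \<le> real CARD('n) * (2 * side q)"
 proof (rule norm_le_card)
  fix i
  have "side q * of_int (snd q i) \<le> x$i" "x$i < side q * of_int (snd q i) + side q"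
   "side q * of_int (snd q i) - side q < y$i" "y$i < side q * of_int (snd q i) + 2 * side q"
   using assms by (simp_all add: cube_def dil_def algebra_simps)
  then show "\<bar>(x - y)$i\<bar> \<le> 2 * side q" by simp
 qed
 then show ?thesis by simp
qed

lemma parent_dist:
 fixes q :: "'n::finite key"
 assumes "x \<in> cube q" "u \<in> cube (parent q)" shows "norm (u - x) \<le> 2 * real CARD('n) * side q"
 using cube_dist[of u "parent q" x] assms cube_subset_parent[of q] by (auto simp: side_parent)

text \<open>Only radii above the side are of interest, because a function cut off inside
  \<open>dil q\<close> vanishes on the smaller balls about \<open>x\<close>. For these radii a ball
  about \<open>x\<close> lies in one about \<open>u\<close> whose radius is larger by a fixed
  factor.\<close>

lemma avg_transfer:
 fixes q :: "'n::finite key"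
 assumes u: "u \<notin> big_set w L" "u \<in> cube (parent q)" and x: "x \<in> cube q" and t: "side q < t"
 shows "(\<integral>\<^sup>+y\<in>ball x t. w y \<partial>lborel) \<le> ennreal ((2 * real CARD('n) + 1) ^ CARD('n)) * (ennreal L * vol (ball x t))"
proof -
 define r where "r = (2 * real CARD('n) + 1) * t"
 have tp: "0 < t" using t side_pos[of q] by linarith
 have "norm (u - x) \<le> 2 * real CARD('n) * side q" by (rule parent_dist[OF x u(2)])
 also have "\<dots> \<le> 2 * real CARD('n) * t" using t by (intro mult_left_mono) auto
 finally have ux: "norm (u - x) \<le> 2 * real CARD('n) * t" .
 have "ball x t \<subseteq> ball u r"
 proof
  fix y assume "y \<in> ball x t"
  then have "norm (x - y) < t" by (simp add: dist_norm)
  then have "norm (u - y) < r" using ux norm_triangle_ineq[of "u - x" "x - y"] by (simp add: r_def algebra_simps)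
  then show "y \<in> ball u r" by (simp add: dist_norm)
 qed
 then have "(\<integral>\<^sup>+y\<in>ball x t. w y \<partial>lborel) \<le> (\<integral>\<^sup>+y\<in>ball u r. w y \<partial>lborel)"
  by (intro nn_integral_mono) (auto simp: indicator_def)
 also have "\<dots> \<le> ennreal L * vol (ball u r)"
  using tp by (intro not_big_set[OF u(1)]) (simp add: r_def)
 also have "vol (ball u r) = ennreal ((2 * real CARD('n) + 1) ^ CARD('n)) * vol (ball x t)"
  unfolding r_def using emeasure_ball_scale[of "2 * real CARD('n) + 1" t u x] tp by simp
 finally show ?thesis by (simp add: mult_ac)
qed

text \<open>Lebesgue differentiation at every point: if \<open>norm (f x) > L\<close> at a point of
  the open dilate, continuity yields a small ball about it with an average above
  \<open>L\<close>.\<close>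

lemma cut_le_off_big_set:
 fixes f :: "real^'n::finite => complex"
 assumes f: "tf f" and L: "0 \<le> L" and x: "x \<notin> big_set (\<lambda>y. enorm (cut q f y)) L"
 shows "norm (cut q f x) \<le> L"
proof (rule ccontr)
 assume "\<not> norm (cut q f x) \<le> L"
 then have xd: "x \<in> dil q" "L < norm (f x)" using L by (cases "x \<in> dil q"; simp)+
 define L' where "L' = (L + norm (f x)) / 2"
 have L': "L < L'" "L' < norm (f x)" using xd by (auto simp: L'_def)
 have "open {y. L' < norm (f y)}"
  using f unfolding tf_def by (intro open_Collect_less continuous_intros) auto
 then have op: "open (dil q \<inter> {y. L' < norm (f y)})" by (intro open_Int open_dil)
 have "x \<in> dil q \<inter> {y. L' < norm (f y)}" using xd L' by simp
 then obtain t where t: "0 < t" "ball x t \<subseteq> dil q \<inter> {y. L' < norm (f y)}"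
  by (rule openE[OF op])
 have "ennreal L' * vol (ball x t) = (\<integral>\<^sup>+y\<in>ball x t. ennreal L' \<partial>lborel)"
  by (simp add: nn_integral_cmult_indicator)
 also have "\<dots> \<le> (\<integral>\<^sup>+y\<in>ball x t. enorm (cut q f y) \<partial>lborel)"
 proof (intro nn_integral_mono)
  fix y show "ennreal L' * indicator (ball x t) y \<le> enorm (cut q f y) * indicator (ball x t) y"
   using t(2) by (cases "y \<in> ball x t") (auto intro!: ennreal_leI simp: subset_iff less_imp_le)
 qed
 also have "\<dots> \<le> ennreal L * vol (ball x t)" using not_big_set[OF x] t(1) by simp
 finally have "ennreal (L' * (unit_ball_vol (real CARD('n)) * t ^ CARD('n))) \<le> ennreal (L * (unit_ball_vol (real CARD('n)) * t ^ CARD('n)))"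
  using L L' t by (simp add: emeasure_ball ennreal_mult)
 then have "L' * (unit_ball_vol (real CARD('n)) * t ^ CARD('n)) \<le> L * (unit_ball_vol (real CARD('n)) * t ^ CARD('n))"
  using L t by (subst (asm) ennreal_le_iff) auto
 moreover have "0 < unit_ball_vol (real CARD('n)) * t ^ CARD('n)" using t by simp
 ultimately have "L' \<le> L" by (rule mult_right_le_imp_le)
 then show False using L' by simp
qed

lemma cut_split:
 assumes "dil p \<subseteq> dil q"
 shows "cut q f = (\<lambda>y. cut p f y + indicator (- dil p) y * cut q f y)"
 using assms by (auto simp: indicator_def fun_eq_iff)

lemma measure_dil: "measure lborel (dil (q :: 'n::finite key)) = 3 ^ CARD('n) * side q ^ CARD('n)"
 unfolding measure_def emeasure_dil by (simp add: power_mult_distrib)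

lemma nn_integral_cut:
 fixes f :: "real^'n::finite => complex"
 assumes f: "adm f" and s: "0 < s"
 shows "(\<integral>\<^sup>+y. ennreal (norm (cut q f y) powr s)) = ennreal (3 ^ CARD('n) * side q ^ CARD('n) * cube_average s (dil q) f powr s)"
proof -
 have "(\<integral>\<^sup>+y. ennreal (norm (cut q f y) powr s)) = (\<integral>\<^sup>+y\<in>dil q. ennreal (norm (f y) powr s) \<partial>lborel)"
  by (intro nn_integral_cong) (auto simp: indicator_def)
 also have "\<dots> = ennreal (measure lborel (dil q) * cube_average s (dil q) f powr s)"
  using f s by (intro nn_integral_cube_average) (auto simp: measure_dil)
 finally show ?thesis by (simp add: measure_dil)
qed

definition maxop :: "(nat => ('a => complex) => 'a => complex) => ('a => complex) => 'a => ennreal" where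
 "maxop T h x = (SUP J. enorm (T J h x))"

lemma maxop_le: "(\<And>J. norm (T J h x) \<le> c) ==> maxop T h x \<le> ennreal c"
 unfolding maxop_def by (intro SUP_least ennreal_leI)

lemma maxop_add_le:
 assumes "\<And>J. T J h x = T J g x + T J g' x" "\<And>J. norm (T J g' x) \<le> c" "0 \<le> c"
 shows "maxop T h x \<le> ennreal c + maxop T g x"
 unfolding maxop_def
proof (rule SUP_least)
 fix J
 have "norm (T J h x) \<le> c + norm (T J g x)"
  using norm_triangle_ineq[of "T J g x" "T J g' x"] assms(1,2)[of J] by simp
 then have "enorm (T J h x) \<le> ennreal c + enorm (T J g x)"
  using assms(3) by (simp add: ennreal_leI flip: ennreal_plus)
 also have "\<dots> \<le> ennreal c + (SUP J. enorm (T J g x))"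
  by (intro add_left_mono SUP_upper) auto
 finally show "enorm (T J h x) \<le> ennreal c + (SUP J. enorm (T J g x))" .
qed

text \<open>The hypothesis \<open>bd\<close> bounds the truncations by averages centred at the same
  point. For a stopping cube \<open>p\<close> the function outside \<open>dil p\<close> has no mass
  in balls below the side of \<open>p\<close>, and larger balls are compared with a point of the
  parent outside \<open>Om\<close>; so its truncations are bounded on all of
  \<open>p\<close>.\<close>

lemma stopping_set_ball_averages:
 fixes T :: "nat => (real^'n::finite => complex) => real^'n => complex"
 assumes f: "adm f" and s: "1 \<le> s" and A: "0 < A"
  and add: "\<And>J g h x. adm g ==> adm h ==> T J (\<lambda>y. g y + h y) x = T J g x + T J h x"
  and bd: "\<And>J h x l. adm h ==> 0 < l ==>
   (\<And>t. 0 < t ==> (\<integral>\<^sup>+y\<in>ball x t. ennreal (norm (h y) powr s) \<partial>lborel) \<le> ennreal (l powr s) * vol (ball x t)) ==>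
   norm (T J h x) \<le> A * l"
  and C: "C = A * (2 * real CARD('n) + 1) ^ CARD('n) * (2 * 3 ^ CARD('n) * 5 ^ CARD('n))"
 shows "stops s C (maxop T) f q"
proof -
 define n where "n = CARD('n)"
 define \<alpha> where "\<alpha> = cube_average s (dil q) f"
 have \<alpha>0: "0 \<le> \<alpha>" by (simp add: \<alpha>_def cube_average_nonneg)
 have s0: "0 < s" using s by simp
 have h: "adm (cut q f)" by (rule adm_cut[OF f])
 have [measurable]: "f \<in> BM" using f by (simp add: adm_def)
 \<comment> \<open>\<open>5 ^ n\<close> is the weak type constant, \<open>3 ^ n\<close> the volume
   of the dilate relative to the cube, and 2 leaves half of the cube free.\<close>
 define A0 where "A0 = 2 * 3 ^ n * (5 ^ n :: real)"
 have A0: "1 \<le> A0" "0 < A0"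
 proof -
  have "(1::real) \<le> 3 ^ n" "(1::real) \<le> 5 ^ n" by simp_all
  then have "(1::real) * 1 \<le> 3 ^ n * 5 ^ n" by (intro mult_mono) auto
  then show "1 \<le> A0" "0 < A0" by (simp_all add: A0_def mult.assoc)
 qed
 define w where "w = (\<lambda>y. ennreal (norm (cut q f y) powr s))"
 have [measurable]: "w \<in> BM" unfolding w_def by measurable
 have wI: "(\<integral>\<^sup>+y. w y) = ennreal (3 ^ n * side q ^ n * \<alpha> powr s)"
  unfolding w_def n_def \<alpha>_def by (rule nn_integral_cut[OF f s0])
 define N where "N = (2 * real n + 1) ^ n"
 have N: "1 \<le> N" by (simp add: N_def)
 have CN: "C = A * N * A0" by (simp add: C N_def A0_def n_def)
 show ?thesis
 proof (cases "\<alpha> = 0")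
  case True
  have z: "norm (T J (cut q f) x) \<le> 0" for J x
  proof (rule field_le_epsilon)
   fix e :: real assume e: "0 < e"
   \<comment> \<open>With vanishing average all integrals over balls vanish, so \<open>bd\<close>
     applies with arbitrarily small \<open>l\<close>.\<close>
   have "norm (T J (cut q f) x) \<le> A * (e / A)"
   proof (rule bd[OF h])
    fix t :: real
    have "(\<integral>\<^sup>+y\<in>ball x t. w y \<partial>lborel) \<le> (\<integral>\<^sup>+y. w y)"
     by (intro nn_integral_mono) (auto simp: indicator_def)
    then have "(\<integral>\<^sup>+y\<in>ball x t. w y \<partial>lborel) \<le> 0" unfolding wI using True s0 by simp
    then show "(\<integral>\<^sup>+y\<in>ball x t. ennreal (norm (cut q f y) powr s) \<partial>lborel) \<le> ennreal ((e / A) powr s) * vol (ball x t)"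
     by (simp add: w_def)
   qed (use e A in auto)
   then show "norm (T J (cut q f) x) \<le> 0 + e" using A by simp
  qed
  show ?thesis using z maxop_le[of T "cut q f" _ 0] by (intro stops_zero) simp
 next
  case False
  then have \<alpha>: "0 < \<alpha>" using \<alpha>0 by simp
  define L where "L = A0 powr (1/s) * \<alpha>"
  have L: "0 < L" using A0 \<alpha> by (simp add: L_def)
  have Ls: "L powr s = A0 * \<alpha> powr s"
   using A0 \<alpha> s0 by (simp add: L_def powr_mult powr_powr)
  have LA: "L \<le> A0 * \<alpha>"
  proof -
   have "A0 powr (1/s) \<le> A0 powr 1" using A0 s by (intro powr_mono) auto
   then show ?thesis using A0 \<alpha> by (simp add: L_def)
  qed
  define Om where "Om = big_set w (L powr s)"
  have Oo: "open Om" by (simp add: Om_def open_big_set)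
  have [measurable]: "Om \<in> sets borel" using Oo by simp
  have half: "vol (cube q \<inter> Om) \<le> ennreal (1/2) * vol (cube q)"
  proof -
   have "vol (cube q \<inter> Om) \<le> vol Om" by (intro emeasure_mono) auto
   also have "\<dots> \<le> ennreal (5 ^ n / L powr s) * (\<integral>\<^sup>+y. w y)"
    unfolding Om_def using emeasure_big_set[of "L powr s" w] L by (simp add: n_def)
   also have "\<dots> = ennreal (5 ^ n / L powr s * (3 ^ n * side q ^ n * \<alpha> powr s))"
    unfolding wI using L by (intro ennreal_mult[symmetric]) auto
   also have "5 ^ n / L powr s * (3 ^ n * side q ^ n * \<alpha> powr s) = 1/2 * side q ^ n"
    unfolding Ls A0_def using \<alpha> by (simp add: field_simps)
   also have "ennreal (1/2 * side q ^ n) = ennreal (1/2) * vol (cube q)"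
    unfolding emeasure_cube n_def by (intro ennreal_mult) auto
   finally show ?thesis .
  qed
  have good: "maxop T (cut q f) x \<le> ennreal (C * \<alpha>)" if "x \<notin> Om" for x
  proof (rule maxop_le)
   fix J
   have "norm (T J (cut q f) x) \<le> A * L"
   proof (rule bd[OF h L])
    fix t :: real assume "0 < t"
    then show "(\<integral>\<^sup>+y\<in>ball x t. ennreal (norm (cut q f y) powr s) \<partial>lborel) \<le> ennreal (L powr s) * vol (ball x t)"
     using not_big_set[OF that[unfolded Om_def], of x t] by (simp add: w_def)
   qed
   also have "\<dots> \<le> A * (N * (A0 * \<alpha>))"
   proof -
    have "1 * L \<le> N * (A0 * \<alpha>)" using N LA L by (intro mult_mono) auto
    then show ?thesis using A by (intro mult_left_mono) auto
   qed
   finally show "norm (T J (cut q f) x) \<le> C * \<alpha>" by (simp add: CN mult.assoc)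
  qed
  have step: "maxop T (cut q f) x \<le> ennreal (C * \<alpha>) + maxop T (cut p f) x"
   if p: "p \<in> sel (fst q) Om" and pq: "cube p \<subseteq> cube q" and x: "x \<in> cube p" for p x
  proof (rule maxop_add_le)
   obtain u where u: "u \<in> cube (parent p)" "u \<notin> Om" using p by (auto simp: sel_def)
   have sub: "dil p \<subseteq> dil q" using p pq by (intro dil_mono) (auto simp: sel_def)
   define ho where "ho = (\<lambda>y. indicator (- dil p) y * cut q f y)"
   have ho: "adm ho" unfolding ho_def by (intro adm_indicator h) auto
   show "T J (cut q f) x = T J (cut p f) x + T J (\<lambda>y. indicator (- dil p) y * cut q f y) x" for J
    using add[OF adm_cut[OF f, of p] ho] by (subst cut_split[OF sub]) (simp add: ho_def)
   have N1: "N powr (1/s) \<le> N" using powr_mono[of "1/s" 1 N] N s by simp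
   have "norm (T J ho x) \<le> A * (N powr (1/s) * L)" for J
   proof (rule bd[OF ho])
    fix t :: real assume t: "0 < t"
    show "(\<integral>\<^sup>+y\<in>ball x t. ennreal (norm (ho y) powr s) \<partial>lborel) \<le> ennreal ((N powr (1/s) * L) powr s) * vol (ball x t)"
    proof (cases "side p < t")
     case False
     then have "ball x t \<subseteq> dil p" using ball_subset_dil[OF x] subset_ball[of t "side p" x] by auto
     then have "(\<integral>\<^sup>+y\<in>ball x t. ennreal (norm (ho y) powr s) \<partial>lborel) = (\<integral>\<^sup>+y. 0 \<partial>(lborel :: (real^'n) measure))"
      by (intro nn_integral_cong) (auto simp: ho_def indicator_def subset_iff)
     then show ?thesis by simp
    next
     case True
     have "(\<integral>\<^sup>+y\<in>ball x t. ennreal (norm (ho y) powr s) \<partial>lborel) \<le> (\<integral>\<^sup>+y\<in>ball x t. w y \<partial>lborel)"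
      unfolding w_def ho_def by (intro nn_integral_mono) (auto simp: indicator_def)
     also have "\<dots> \<le> ennreal N * (ennreal (L powr s) * vol (ball x t))"
      unfolding N_def n_def using u(2) unfolding Om_def by (intro avg_transfer[OF _ u(1) x True])
     also have "\<dots> = ennreal (N * L powr s) * vol (ball x t)" using N by (subst ennreal_mult2) auto
     also have "N * L powr s = (N powr (1/s) * L) powr s" using N L s0 by (simp add: powr_mult powr_powr)
     finally show ?thesis .
    qed
   qed (use N L in auto)
   moreover have "A * (N powr (1/s) * L) \<le> C * \<alpha>"
   proof -
    have "N powr (1/s) * L \<le> N * (A0 * \<alpha>)" using N1 LA L N by (intro mult_mono) auto
    then show ?thesis using A by (simp add: CN mult.assoc)
   qed
   ultimately show "norm (T J (\<lambda>y. indicator (- dil p) y * cut q f y) x) \<le> C * \<alpha>" for J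
    unfolding ho_def using order_trans by blast
   show "0 \<le> C * \<alpha>" using A N A0 \<alpha> by (simp add: CN)
  qed
  show ?thesis
   using Oo half good step unfolding stops_def stopset_def \<alpha>_def[symmetric] by (intro exI[of _ Om] conjI ballI impI) auto
 qed
qed

section \<open>Stopping sets for Calderon-Zygmund kernels\<close>

lemma Top_0: "Top K 0 h x = 0"
 by (simp add: Top_def)

text \<open>The set where some truncation is large is then a union of open sets; selecting maximal
  dyadic cubes requires an open set.\<close>

lemma continuous_on_Top:
 fixes K :: "nat => 'a => 'a::euclidean_space => complex"
 assumes A: "0 < A" and cz: "czker A K" and h: "adm h"
 shows "continuous_on UNIV (Top K J h)"
proof -
 obtain M where M: "\<And>x. norm (h x) \<le> M" using h by (auto simp: adm_def)
 then have M0: "0 \<le> M" using norm_ge_zero order_trans by blast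
 have ok: "avgok h x M" for x
  unfolding avgok_def
 proof (intro allI impI)
  fix t :: real
  have "(\<integral>\<^sup>+y\<in>ball x t. enorm (h y) \<partial>lborel) \<le> (\<integral>\<^sup>+y. ennreal M * indicator (ball x t) y)"
   by (intro nn_integral_mono mult_right_mono ennreal_leI M) auto
  then show "(\<integral>\<^sup>+y\<in>ball x t. enorm (h y) \<partial>lborel) \<le> ennreal M * vol (ball x t)"
   by (simp add: nn_integral_cmult_indicator)
 qed
 define D where "D = A * (1 + (1 + 1) ^ (DIM('a) + 1)) * bconst TYPE('a) * M * 2^J"
 have D: "norm (Top K J h x - Top K J h x') \<le> D * norm (x - x')" if "2^J * norm (x - x') \<le> 1" for x x'
  using Top_diff_le[OF A cz h ok M0 _ that] by (simp add: D_def mult_ac)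
 have "0 \<le> D" using A M0 bconst_pos[where 'a='a] by (simp add: D_def)
 have "isCont (Top K J h) x" for x
  unfolding continuous_at_eps_delta
 proof (intro allI impI)
  fix e :: real assume e: "0 < e"
  define d where "d = min (1 / 2^J) (e / (D + 1))"
  have d: "0 < d" using e \<open>0 \<le> D\<close> by (simp add: d_def)
  show "\<exists>d>0. \<forall>x'. dist x' x < d \<longrightarrow> dist (Top K J h x') (Top K J h x) < e"
  proof (intro exI conjI allI impI)
   fix x' assume x': "dist x' x < d"
   then have "norm (x' - x) < 1 / 2^J" "norm (x' - x) < e / (D + 1)" by (auto simp: dist_norm d_def)
   then have 1: "2^J * norm (x' - x) \<le> 1" "(D + 1) * norm (x' - x) < e" using \<open>0 \<le> D\<close> by (simp_all add: field_simps)
   have "norm (Top K J h x' - Top K J h x) \<le> D * norm (x' - x)" by (rule D[OF 1(1)])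
   also have "\<dots> \<le> (D + 1) * norm (x' - x)" by (simp add: distrib_right)
   finally show "dist (Top K J h x') (Top K J h x) < e" using 1(2) by (simp add: dist_norm)
  qed (rule d)
 qed
 then show ?thesis by (simp add: continuous_at_imp_continuous_on)
qed

lemma sum_pow2_power_le: "0 < n ==> (\<Sum>j<J. (2^j) ^ n) \<le> ((2::real)^J) ^ n"
proof (induction J)
 case (Suc J)
 have "(2::real) ^ 1 \<le> 2 ^ n" using Suc.prems by (intro power_increasing) auto
 have "(\<Sum>j<Suc J. ((2::real)^j) ^ n) \<le> (2^J) ^ n + (2^J) ^ n" using Suc by simp
 also have "\<dots> = 2 * (2^J) ^ n" by simp
 also have "\<dots> \<le> 2 ^ n * (2^J) ^ n" using \<open>(2::real) ^ 1 \<le> 2 ^ n\<close> by (intro mult_right_mono) auto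
 finally show ?case by (simp add: power_mult_distrib)
qed simp

lemma Top_norm_le:
 fixes K :: "nat => 'a => 'a::euclidean_space => complex"
 assumes A: "0 < A" and cz: "czker A K" and I: "(\<integral>\<^sup>+y. enorm (h y)) \<le> ennreal I" "0 \<le> I"
  and [measurable]: "h \<in> BM"
 shows "norm (Top K J h x) \<le> A * (2^J) ^ DIM('a) * I"
proof -
 have "norm (LINT y|lborel. K j x y * h y) \<le> A * (2^j) ^ DIM('a) * I" for j
 proof -
  have "enorm (LINT y|lborel. K j x y * h y) \<le> (\<integral>\<^sup>+y. enorm (K j x y * h y))" by (rule norm_LINT_le)
  also have "\<dots> \<le> (\<integral>\<^sup>+y. ennreal (A * (2^j) ^ DIM('a)) * enorm (h y))"
  proof (intro nn_integral_mono)
   fix y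
   have "norm (K j x y * h y) \<le> A * (2^j) ^ DIM('a) * norm (h y)"
    unfolding norm_mult by (intro mult_right_mono K_bounded[OF A cz]) auto
   then have "enorm (K j x y * h y) \<le> ennreal (A * (2^j) ^ DIM('a) * norm (h y))" by (rule ennreal_leI)
   also have "\<dots> = ennreal (A * (2^j) ^ DIM('a)) * enorm (h y)" using A by (intro ennreal_mult) auto
   finally show "enorm (K j x y * h y) \<le> ennreal (A * (2^j) ^ DIM('a)) * enorm (h y)" .
  qed
  also have "\<dots> = ennreal (A * (2^j) ^ DIM('a)) * (\<integral>\<^sup>+y. enorm (h y))" by (intro nn_integral_cmult) simp
  also have "\<dots> \<le> ennreal (A * (2^j) ^ DIM('a)) * ennreal I" by (intro mult_left_mono I) auto
  also have "\<dots> = ennreal (A * (2^j) ^ DIM('a) * I)" using A I by (intro ennreal_mult[symmetric]) auto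
  finally show ?thesis using A I by (subst (asm) ennreal_le_iff) auto
 qed
 then have "norm (Top K J h x) \<le> (\<Sum>j<J. A * (2^j) ^ DIM('a) * I)"
  unfolding Top_def by (intro sum_norm_le)
 also have "\<dots> = A * I * (\<Sum>j<J. (2^j) ^ DIM('a))" by (simp add: sum_distrib_left mult_ac)
 also have "\<dots> \<le> A * I * (2^J) ^ DIM('a)" using A I by (intro mult_left_mono sum_pow2_power_le) auto
 finally show ?thesis by (simp add: mult_ac)
qed

text \<open>Off the dilate, \<open>Top K J ho\<close> is split at the scale of \<open>p\<close>: the
  coarse part equals the coarse part of \<open>h\<close> minus that of \<open>hp\<close>, the fine
  part is a tail at distance at least \<open>side p\<close>. The coarse part of \<open>h\<close> is
  compared with its value at \<open>u\<close>, that of \<open>hp\<close> is bounded by the L^1 norm.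
  The constant \<open>c\<close> bounds the radius, in sides of \<open>p\<close>, of a ball about
  \<open>u\<close> that contains \<open>dil p\<close>.\<close>

lemma stopping_step_cz:
 fixes K :: "nat => real^'n => real^'n::finite => complex"
 assumes A: "0 < A" and cz: "czker A K" and f: "adm f" and L: "0 < L" "0 < C1"
  and p: "cube p \<subseteq> cube q" "fst p < fst q" "x \<in> cube p"
  and u: "u \<in> cube (parent p)" "u \<notin> big_set (\<lambda>y. enorm (cut q f y)) L"
   "\<And>J. norm (Top K J (cut q f) u) \<le> C1 * L"
 defines "c \<equiv> 4 * real CARD('n) + 1"
 shows "norm (Top K J (\<lambda>y. indicator (- dil p) y * cut q f y) x) \<le> (C1 + A * (1 + (1 + c) ^ (CARD('n) + 1)) * bconst TYPE(real^'n) * c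
  + A * 2 ^ CARD('n) * (unit_ball_vol (real CARD('n)) * c ^ CARD('n))
  + A * 2 ^ (CARD('n) + 3) * bconst TYPE(real^'n) * c ^ CARD('n)) * L"
proof -
 define n where "n = CARD('n)"
 define b where "b = bconst TYPE(real^'n)"
 have b: "0 < b" by (simp add: b_def bconst_pos)
 have c: "1 \<le> c" by (simp add: c_def)
 define V where "V = unit_ball_vol (real n)"
 have V: "0 < V" by (simp add: V_def)
 define h where "h = cut q f"
 define hp where "hp = cut p f"
 define ho where "ho = (\<lambda>y. indicator (- dil p) y * cut q f y)"
 have sub: "dil p \<subseteq> dil q" using p by (intro dil_mono) auto
 have ah: "adm h" "adm hp" "adm ho" unfolding h_def hp_def ho_def using f by (auto intro!: adm_indicator)
 have [measurable]: "hp \<in> BM" using ah by (simp add: adm_def)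
 have split: "h = (\<lambda>y. hp y + ho y)" unfolding h_def hp_def ho_def by (rule cut_split[OF sub])
 define l where "l = side p"
 have l: "0 < l" by (simp add: l_def)
 \<comment> \<open>The scale \<open>2^(-J1)\<close> is matched to \<open>side p\<close>, with
   \<open>2^J1 * side p\<close> between 1 and 2 wherever this is needed. For cubes of level 1 and
   above \<open>nat\<close> gives 0 and all pieces count as fine.\<close>
 define J1 where "J1 = min J (nat (1 - fst p))"
 have pw: "2 powi (1 - fst p) * l = 2" by (simp add: l_def side_def power_int_diff)
 have J1_le: "2^J1 * l \<le> 2" if "0 < J1"
 proof -
  have "int J1 \<le> 1 - fst p" using that unfolding J1_def by linarith
  then have "(2::real) powi int J1 \<le> 2 powi (1 - fst p)" by (intro power_int_increasing) auto
  then have "2^J1 * l \<le> 2 powi (1 - fst p) * l" using l by (intro mult_right_mono) auto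
  then show ?thesis using pw by simp
 qed
 have J1_ge: "1 \<le> 2^J1 * l" if "J1 < J"
 proof (cases "1 \<le> fst p")
  case True
  then have "(2::real) powi 0 \<le> 2 powi fst p" by (intro power_int_increasing) auto
  moreover have "(1::real) * 1 \<le> 2^J1 * l" if "1 \<le> l" using that by (intro mult_mono) auto
  ultimately show ?thesis by (simp add: l_def side_def)
 next
  case False
  then have "int J1 = 1 - fst p" using that by (auto simp: J1_def)
  then have "(2::real)^J1 = 2 powi (1 - fst p)" by (metis power_int_of_nat)
  then show ?thesis using pw by simp
 qed
 have ux: "norm (u - x) \<le> 2 * real n * l" unfolding n_def l_def by (rule parent_dist[OF p(3) u(1)])
 have oku: "avgok h u L" using u(2) unfolding h_def by (rule avgok_big_set)
 have okx: "avgok ho x (c ^ n * L)"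
  unfolding avgok_def
 proof (intro allI impI)
  fix t :: real assume t: "0 < t"
  show "(\<integral>\<^sup>+y\<in>ball x t. enorm (ho y) \<partial>lborel) \<le> ennreal (c ^ n * L) * vol (ball x t)"
  proof (cases "side p < t")
   case False
   then have "ball x t \<subseteq> dil p" using ball_subset_dil[OF p(3)] subset_ball[of t "side p" x] by auto
   then have "(\<integral>\<^sup>+y\<in>ball x t. enorm (ho y) \<partial>lborel) = (\<integral>\<^sup>+y. 0 \<partial>(lborel :: (real^'n) measure))"
    by (intro nn_integral_cong) (auto simp: ho_def indicator_def subset_iff)
   then show ?thesis by simp
  next
   case True
   have "(\<integral>\<^sup>+y\<in>ball x t. enorm (ho y) \<partial>lborel) \<le> (\<integral>\<^sup>+y\<in>ball x t. enorm (cut q f y) \<partial>lborel)"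
    unfolding ho_def by (intro nn_integral_mono) (auto simp: indicator_def)
   also have "\<dots> \<le> ennreal ((2 * real CARD('n) + 1) ^ CARD('n)) * (ennreal L * vol (ball x t))"
    by (rule avg_transfer[OF u(2) u(1) p(3) True])
   also have "\<dots> = ennreal ((2 * real CARD('n) + 1) ^ CARD('n) * L) * vol (ball x t)" using L by (subst ennreal_mult2) auto
   also have "\<dots> \<le> ennreal (c ^ n * L) * vol (ball x t)"
    using L unfolding n_def c_def by (intro mult_right_mono ennreal_leI power_mono) auto
   finally show ?thesis .
  qed
 qed
 have fin: "norm (Top K J1 h x) \<le> (C1 + A * (1 + (1 + c) ^ (n + 1)) * b * c) * L"
 proof (cases "0 < J1")
  case True
  have "2^J1 * norm (u - x) \<le> 2^J1 * (2 * real n * l)" using ux by (intro mult_left_mono) auto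
  also have "\<dots> = 2 * real n * (2^J1 * l)" by simp
  also have "\<dots> \<le> 2 * real n * 2" using J1_le[OF True] by (intro mult_left_mono) auto
  also have "\<dots> \<le> c" by (simp add: c_def n_def)
  finally have d: "2^J1 * norm (u - x) \<le> c" .
  have "norm (Top K J1 h u - Top K J1 h x) \<le> A * (1 + (1 + c) ^ (n + 1)) * b * L * (2^J1 * norm (u - x))"
   using Top_diff_le[OF A cz ah(1) oku _ c d] L by (simp add: n_def b_def)
  also have "\<dots> \<le> A * (1 + (1 + c) ^ (n + 1)) * b * L * c"
   using A b L c d by (intro mult_left_mono) auto
  finally have 1: "norm (Top K J1 h u - Top K J1 h x) \<le> A * (1 + (1 + c) ^ (n + 1)) * b * L * c" .
  have 2: "norm (Top K J1 h u) \<le> C1 * L" unfolding h_def by (rule u(3))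
  have "norm (Top K J1 h x) \<le> norm (Top K J1 h u) + norm (Top K J1 h u - Top K J1 h x)"
   using norm_triangle_ineq2[of "Top K J1 h x" "Top K J1 h u"] by (simp add: norm_minus_commute)
  also have "\<dots> \<le> C1 * L + A * (1 + (1 + c) ^ (n + 1)) * b * L * c" using 1 2 by linarith
  also have "\<dots> = (C1 + A * (1 + (1 + c) ^ (n + 1)) * b * c) * L" unfolding distrib_right[of C1] by (simp only: mult_ac)
  finally show ?thesis .
 next
  case False
  then show ?thesis using A b c L by (simp add: Top_0)
 qed
 have hpn: "norm (Top K J1 hp x) \<le> A * 2 ^ n * (V * c ^ n) * L"
 proof (cases "0 < J1")
  case True
  have "dil p \<subseteq> ball u (c * l)"
  proof
   fix y assume "y \<in> dil p"
   then have "norm (x - y) \<le> 2 * real n * l" unfolding n_def l_def using p(3) by (intro dil_dist)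
   then have "norm ((u - x) + (x - y)) \<le> 2 * real n * l + 2 * real n * l" by (intro norm_triangle_mono ux)
   then have "norm (u - y) \<le> 2 * real n * l + 2 * real n * l" by (simp only: diff_add_cancel add_diff_eq)
   also have "\<dots> < c * l" using l by (simp add: c_def n_def algebra_simps)
   finally show "y \<in> ball u (c * l)" by (simp add: dist_norm)
  qed
  then have "(\<integral>\<^sup>+y. enorm (hp y)) \<le> (\<integral>\<^sup>+y\<in>ball u (c * l). enorm (cut q f y) \<partial>lborel)"
   using sub unfolding hp_def by (intro nn_integral_mono) (auto simp: indicator_def)
  also have "\<dots> \<le> ennreal L * vol (ball u (c * l))"
   using c l by (intro not_big_set[OF u(2)]) auto
  also have "\<dots> = ennreal (L * (V * (c * l) ^ n))"
   using L V c l by (simp add: emeasure_ball V_def n_def ennreal_mult)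
  finally have "norm (Top K J1 hp x) \<le> A * (2^J1) ^ n * (L * (V * (c * l) ^ n))"
   using Top_norm_le[OF A cz, of hp "L * (V * (c * l) ^ n)" J1 x] L V c l by (simp add: n_def)
  also have "\<dots> = A * (2^J1 * l) ^ n * (V * c ^ n) * L" by (simp add: power_mult_distrib)
  also have "\<dots> \<le> A * 2 ^ n * (V * c ^ n) * L"
   using A V c L l J1_le[OF True] by (intro mult_right_mono mult_left_mono power_mono) auto
  finally show ?thesis .
 next
  case False
  then show ?thesis using A V c L by (simp add: Top_0)
 qed
 have rest: "norm (Top K J ho x - Top K J1 ho x) \<le> A * 2 ^ (n + 3) * b * c ^ n * L"
 proof (cases "J1 < J")
  case True
  have "Top K J ho x - Top K J1 ho x = (\<Sum>j\<in>{J1..<J}. LINT y|lborel. K j x y * ho y)"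
   unfolding Top_def lessThan_atLeast0 using True by (subst sum_diff_nat_ivl) auto
  then have "norm (Top K J ho x - Top K J1 ho x) \<le> (\<Sum>j\<in>{J1..<J}. norm (LINT y|lborel. K j x y * ho y))"
   by (simp add: norm_sum)
  also have "\<dots> \<le> A * 2 ^ (n + 3) * b * (c ^ n * L) / (2^J1 * l)"
  proof -
   have "ho y = 0" if "norm (x - y) < l" for y
    using that ball_subset_dil[OF p(3)] by (auto simp: ho_def l_def dist_norm subset_iff)
   then show ?thesis
    using far_sum_le[OF A cz ah(3) okx _ l, of x J1 J] c L l by (simp add: n_def b_def)
  qed
  also have "\<dots> \<le> A * 2 ^ (n + 3) * b * (c ^ n * L) / 1"
   using J1_ge[OF True] A b c L by (intro divide_left_mono) auto
  finally show ?thesis by (simp add: mult_ac)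
 next
  case False
  then have "J1 = J" by (simp add: J1_def)
  then show ?thesis using A b c L by simp
 qed
 have "Top K J1 h x = Top K J1 hp x + Top K J1 ho x"
  unfolding split by (rule Top_add[OF A cz ah(2,3)])
 then have "norm (Top K J ho x) \<le> norm (Top K J1 h x) + norm (Top K J1 hp x) + norm (Top K J ho x - Top K J1 ho x)"
  using norm_triangle_ineq[of "Top K J1 h x - Top K J1 hp x" "Top K J ho x - Top K J1 ho x"]
   norm_triangle_ineq4[of "Top K J1 h x" "Top K J1 hp x"] by simp
 then have "norm (Top K J ho x) \<le> (C1 + A * (1 + (1 + c) ^ (n + 1)) * b * c) * L + A * 2 ^ n * (V * c ^ n) * L + A * 2 ^ (n + 3) * b * c ^ n * L"
  using fin hpn rest by linarith
 then show ?thesis unfolding ho_def n_def b_def V_def distrib_right by linarith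
qed

text \<open>The stopping set is the superlevel set of the maximal function enlarged by the set where
  some truncation is large; the weak type (1,1) bounds the latter. A point outside controls both the
  averages and all truncations, which is what the step estimate asks of \<open>u\<close>.\<close>

lemma stopping_set_cz:
 assumes A: "0 < A"
 shows "\<exists>C>0. \<forall>(K :: nat => real^'n => real^'n::finite => complex) f q. czker A K \<longrightarrow> tf f \<longrightarrow> stops 1 C (maxop (Top K)) f q"
proof -
 obtain C1 where C1: "0 < C1" and weak: "\<And>(K :: nat => real^'n => real^'n => complex) f l. czker A K ==> adm f ==> 0 < l ==>
   (\<forall>x. x \<notin> big_set (\<lambda>y. enorm (f y)) l \<longrightarrow> norm (f x) \<le> l) ==>
   vol {x. \<exists>J. C1 * l < norm (Top K J f x)} \<le> ennreal (C1 / l) * (\<integral>\<^sup>+y. enorm (f y))"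
  using weak_type_1[OF A, where 'n='n] by blast
 define n where "n = CARD('n)"
 define c where "c = 4 * real n + 1"
 define C2 where "C2 = C1 + A * (1 + (1 + c) ^ (n + 1)) * bconst TYPE(real^'n) * c
  + A * 2 ^ n * (unit_ball_vol (real n) * c ^ n) + A * 2 ^ (n + 3) * bconst TYPE(real^'n) * c ^ n"
 have C2: "C1 \<le> C2" using A bconst_pos[where 'a="real^'n"] by (auto simp: C2_def c_def intro!: add_nonneg_nonneg)
 \<comment> \<open>The sum \<open>5 ^ n + C1\<close> collects the two weak type constants,
   \<open>3 ^ n\<close> is the volume of the dilate relative to the cube, and 2 leaves half of the
   cube free.\<close>
 define A0 where "A0 = 2 * 3 ^ n * (5 ^ n + C1)"
 have A0: "0 < A0" using C1 by (auto simp: A0_def intro!: mult_pos_pos add_pos_pos)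
 define C where "C = C2 * A0"
 have C: "0 < C" using C1 C2 A0 by (simp add: C_def)
 have main: "stops 1 C (maxop (Top K)) f q"
  if cz: "czker A K" and tf: "tf f" for K :: "nat => real^'n => real^'n => complex" and f q
 proof -
  have f: "adm f" by (rule tf_adm[OF tf])
  have h: "adm (cut q f)" by (rule adm_cut[OF f])
  have [measurable]: "f \<in> BM" using f by (simp add: adm_def)
  define \<alpha> where "\<alpha> = cube_average 1 (dil q) f"
  have \<alpha>0: "0 \<le> \<alpha>" by (simp add: \<alpha>_def cube_average_nonneg)
  define w where "w = (\<lambda>y. enorm (cut q f y))"
  have [measurable]: "w \<in> BM" unfolding w_def by measurable
  have wI: "(\<integral>\<^sup>+y. w y) = ennreal (3 ^ n * side q ^ n * \<alpha>)"
   using nn_integral_cut[OF f, of 1 q] \<alpha>0 unfolding w_def n_def \<alpha>_def by simp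
  show ?thesis
  proof (cases "\<alpha> = 0")
   case True
   have z: "norm (Top K J (cut q f) x) \<le> 0" for J x
    using Top_norm_le[OF A cz, of "cut q f" 0 J x] wI True h unfolding w_def adm_def by simp
   show ?thesis using z maxop_le[of "Top K" "cut q f" _ 0] by (intro stops_zero) simp
  next
   case False
   then have \<alpha>: "0 < \<alpha>" using \<alpha>0 by simp
   define L where "L = A0 * \<alpha>"
   have L: "0 < L" using A0 \<alpha> by (simp add: L_def)
   define O2 where "O2 = {x. \<exists>J. C1 * L < norm (Top K J (cut q f) x)}"
   define Om where "Om = big_set w L \<union> O2"
   have "O2 = (\<Union>J. {x. C1 * L < norm (Top K J (cut q f) x)})" by (auto simp: O2_def)
   then have O2: "open O2" using continuous_on_Top[OF A cz h]
    by (auto intro!: open_UN open_Collect_less continuous_intros)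
   have Oo: "open Om" unfolding Om_def using O2 open_big_set by blast
   have [measurable]: "Om \<in> sets borel" using Oo by simp
   have half: "vol (cube q \<inter> Om) \<le> ennreal (1/2) * vol (cube q)"
   proof -
    have "vol (cube q \<inter> Om) \<le> vol Om" by (intro emeasure_mono) auto
    also have "\<dots> \<le> vol (big_set w L) + vol O2"
     unfolding Om_def using O2 open_big_set[of w L] by (intro emeasure_subadditive) auto
    also have "\<dots> \<le> ennreal (5 ^ n / L) * (\<integral>\<^sup>+y. w y) + ennreal (C1 / L) * (\<integral>\<^sup>+y. w y)"
    proof (intro add_mono)
     show "vol (big_set w L) \<le> ennreal (5 ^ n / L) * (\<integral>\<^sup>+y. w y)"
      using emeasure_big_set[of L w] L by (simp add: n_def)
     show "vol O2 \<le> ennreal (C1 / L) * (\<integral>\<^sup>+y. w y)"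
      unfolding O2_def w_def using cut_le_off_big_set[OF tf, of L] L by (intro weak[OF cz h L]) auto
    qed
    also have "\<dots> = ennreal ((5 ^ n + C1) / L * (3 ^ n * side q ^ n * \<alpha>))"
    proof -
     have "ennreal a * ennreal I + ennreal b * ennreal I = ennreal ((a + b) * I)" if "0 \<le> a" "0 \<le> b" "0 \<le> I" for a b I
      using that by (simp add: distrib_right ennreal_mult ennreal_plus)
     from this[of "5 ^ n / L" "C1 / L" "3 ^ n * side q ^ n * \<alpha>"] show ?thesis
      unfolding wI using L C1 \<alpha> by (simp add: add_divide_distrib)
    qed
    also have "(5 ^ n + C1) / L * (3 ^ n * side q ^ n * \<alpha>) = 1/2 * side q ^ n"
    proof -
     have "0 < 5 ^ n + C1" using C1 by (simp add: add_pos_pos)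
     then show ?thesis unfolding L_def A0_def using \<alpha> by (simp add: divide_simps)
    qed
    also have "ennreal (1/2 * side q ^ n) = ennreal (1/2) * vol (cube q)"
     unfolding emeasure_cube n_def by (intro ennreal_mult) auto
    finally show ?thesis .
   qed
   have le: "C1 * L \<le> C * \<alpha>" unfolding L_def C_def using C2 A0 \<alpha> by (simp add: mult_right_mono)
   have out: "norm (Top K J (cut q f) x) \<le> C1 * L" if "x \<notin> Om" for x J
    using that by (auto simp: Om_def O2_def not_less)
   have good: "maxop (Top K) (cut q f) x \<le> ennreal (C * \<alpha>)" if "x \<notin> Om" for x
    using out[OF that] le by (intro maxop_le) (meson order_trans)
   have step: "maxop (Top K) (cut q f) x \<le> ennreal (C * \<alpha>) + maxop (Top K) (cut p f) x"
    if p: "p \<in> sel (fst q) Om" and pq: "cube p \<subseteq> cube q" and x: "x \<in> cube p" for p x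
   proof (rule maxop_add_le)
    obtain u where u: "u \<in> cube (parent p)" "u \<notin> Om" using p by (auto simp: sel_def)
    have sub: "dil p \<subseteq> dil q" using p pq by (intro dil_mono) (auto simp: sel_def)
    have ho: "adm (\<lambda>y. indicator (- dil p) y * cut q f y)" by (intro adm_indicator h) auto
    show "Top K J (cut q f) x = Top K J (cut p f) x + Top K J (\<lambda>y. indicator (- dil p) y * cut q f y) x" for J
     using Top_add[OF A cz adm_cut[OF f, of p] ho] by (subst cut_split[OF sub]) simp
    have "norm (Top K J (\<lambda>y. indicator (- dil p) y * cut q f y) x) \<le> C2 * L" for J
     unfolding C2_def c_def n_def
     using p u out[OF u(2)] by (intro stopping_step_cz[OF A cz f L C1 pq _ x u(1)]) (auto simp: sel_def Om_def w_def)
    then show "norm (Top K J (\<lambda>y. indicator (- dil p) y * cut q f y) x) \<le> C * \<alpha>" for J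
     by (simp add: C_def L_def mult.assoc)
    show "0 \<le> C * \<alpha>" using C \<alpha> by simp
   qed
   show ?thesis
    using Oo half good step unfolding stops_def stopset_def \<alpha>_def[symmetric] by (intro exI[of _ Om] conjI ballI impI) auto
  qed
 qed
 show ?thesis using C main by (intro exI[of _ C] conjI allI impI)
qed

section \<open>Directional derivative bounds and decay of oscillatory integrals\<close>

text \<open>The derivative along lines in one fixed direction. The decay estimates differentiate
  repeatedly in a single coordinate, so neither total nor mixed derivatives have to be carried
  along.\<close>

definition ddir :: "'a::euclidean_space => ('a => complex) => ('a => complex) => bool" where
 "ddir e b b' \<longleftrightarrow> (\<forall>x. ((\<lambda>t. b (x + t *\<^sub>R e)) has_vector_derivative b' x) (at 0))"

text \<open>In \<open>dC N e A s B b\<close> the \<open>k\<close>-th derivative of \<open>b\<close> along \<open>e\<close> is bounded by \<open>B s^k\<close> on \<open>A\<close>.\<close>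

primrec dC :: "nat => 'a::euclidean_space => 'a set => real => real => ('a => complex) => bool" where
 "dC 0 e A s B b \<longleftrightarrow> b \<in> BM \<and> (\<forall>x\<in>A. norm (b x) \<le> B)"
| "dC (Suc N) e A s B b \<longleftrightarrow> b \<in> BM \<and> (\<forall>x\<in>A. norm (b x) \<le> B) \<and>
  (\<exists>b'. ddir e b b' \<and> dC N e A s (B * s) b')"

lemma dC_meas: "dC N e A s B b ==> b \<in> BM"
 by (cases N) auto

lemma dC_bound: "dC N e A s B b ==> x \<in> A ==> norm (b x) \<le> B"
 by (cases N) auto

lemma ddir_shift:
 assumes "ddir e b b'"
 shows "((\<lambda>t. b (x + t *\<^sub>R e)) has_vector_derivative b' (x + t0 *\<^sub>R e)) (at t0)"
proof -
 have "((\<lambda>t. b ((x + t0 *\<^sub>R e) + t *\<^sub>R e)) has_vector_derivative b' (x + t0 *\<^sub>R e)) (at 0)"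
  using assms by (simp add: ddir_def)
 moreover have "((\<lambda>t. t - t0) has_vector_derivative 1) (at t0)"
  by (auto intro!: derivative_eq_intros)
 ultimately have "((\<lambda>t. b ((x + t0 *\<^sub>R e) + t *\<^sub>R e)) \<circ> (\<lambda>t. t - t0) has_vector_derivative 1 *\<^sub>R b' (x + t0 *\<^sub>R e)) (at t0)"
  by (intro vector_diff_chain_at) auto
 then show ?thesis by (simp add: o_def algebra_simps)
qed

lemma ddir_mean_value:
 assumes d: "ddir e b b'" and B: "\<And>x. norm (b' x) \<le> B"
 shows "norm (b (x + t *\<^sub>R e) - b x) \<le> B * \<bar>t\<bar>"
proof -
 have "norm (b (x + t *\<^sub>R e) - b (x + 0 *\<^sub>R e)) \<le> B * norm (t - 0)"
 proof (rule differentiable_bound[where S=UNIV])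
  show "((\<lambda>t. b (x + t *\<^sub>R e)) has_derivative (\<lambda>h. h *\<^sub>R b' (x + u *\<^sub>R e))) (at u within UNIV)" for u
   using ddir_shift[OF d] by (simp add: has_vector_derivative_def)
  show "onorm (\<lambda>h. h *\<^sub>R b' (x + u *\<^sub>R e)) \<le> B" for u :: real
   using mult_right_mono[OF B[of "x + u *\<^sub>R e"], of "\<bar>_\<bar>"] by (intro onorm_le) (simp add: mult.commute)
 qed auto
 then show ?thesis by simp
qed

lemma dC_mono: "dC N e A s B b ==> B \<le> B' ==> 0 \<le> s ==> A' \<subseteq> A ==> dC N e A' s B' b"
proof (induction N arbitrary: B B' b)
 case 0
 then show ?case by (auto intro: order_trans)
next
 case (Suc N)
 then obtain b' where b': "ddir e b b'" "dC N e A s (B * s) b'" by auto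
 have "dC N e A' s (B' * s) b'" using Suc.prems by (intro Suc.IH[OF b'(2)] mult_right_mono) auto
 then show ?case using Suc.prems b'(1) by (auto intro: order_trans)
qed

lemma dC_SucD: "dC (Suc N) e A s B b ==> dC N e A s B b"
proof (induction N arbitrary: B b)
 case (Suc N)
 from Suc.prems obtain b' where b': "ddir e b b'" "dC (Suc N) e A s (B * s) b'" unfolding dC.simps(2)[of "Suc N"] by blast
 have "dC N e A s (B * s) b'" by (rule Suc.IH[OF b'(2)])
 then show ?case using b'(1) Suc.prems by auto
qed auto

lemma dC_of_family:
 assumes "\<And>k. k \<le> N ==> d k \<in> BM"
  and "\<And>k x. k \<le> N ==> x \<in> A ==> norm (d k x) \<le> B * s ^ k"
  and "\<And>k. k < N ==> ddir e (d k) (d (Suc k))"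
 shows "dC N e A s B (d 0)"
 using assms
proof (induction N arbitrary: d B)
 case 0
 from "0.prems"(1)[of 0] "0.prems"(2)[of 0] show ?case by auto
next
 case (Suc N)
 have "dC N e A s (B * s) (d (Suc 0))"
 proof (rule Suc.IH[of "\<lambda>k. d (Suc k)" "B * s"])
  show "\<And>k. k \<le> N ==> d (Suc k) \<in> BM" using Suc.prems(1) by simp
  show "\<And>k x. k \<le> N ==> x \<in> A ==> norm (d (Suc k) x) \<le> B * s * s ^ k"
   using Suc.prems(2)[of "Suc _"] by (simp add: mult.assoc)
  show "\<And>k. k < N ==> ddir e (d (Suc k)) (d (Suc (Suc k)))" using Suc.prems(3) by simp
 qed
 moreover have "ddir e (d 0) (d (Suc 0))" using Suc.prems(3)[of 0] by simp
 ultimately show ?case using Suc.prems(1)[of 0] Suc.prems(2)[of 0] by auto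
qed

text \<open>Replacing the rate \<open>s\<close> by a rate smaller by at most the factor
  \<open>l\<close> costs one \<open>l\<close> per derivative.\<close>

lemma dC_rescale:
 "dC N e A s B b ==> 0 \<le> B ==> 0 \<le> s ==> 0 \<le> s' ==> s \<le> l * s' ==> 1 \<le> l ==> dC N e A s' (B * l ^ N) b"
proof (induction N arbitrary: B b)
 case (Suc N)
 then obtain b' where b': "ddir e b b'" "dC N e A s (B * s) b'" by auto
 have 1: "dC N e A s' (B * s * l ^ N) b'" using Suc.prems by (intro Suc.IH[OF b'(2)]) auto
 have 2: "B * s * l ^ N \<le> B * l ^ Suc N * s'"
 proof -
  have "B * l ^ N * s \<le> B * l ^ N * (l * s')" using Suc.prems by (intro mult_left_mono) auto
  then show ?thesis by (simp add: mult_ac)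
 qed
 have 3: "dC N e A s' (B * l ^ Suc N * s') b'"
  by (rule dC_mono[OF 1 2 Suc.prems(4) order_refl])
 have 4: "B \<le> B * l ^ Suc N"
 proof -
  have "B * 1 \<le> B * l ^ Suc N" using Suc.prems(2,6) by (intro mult_left_mono one_le_power) auto
  then show ?thesis by simp
 qed
 have 5: "norm (b x) \<le> B * l ^ Suc N" if "x \<in> A" for x
  using dC_bound[OF Suc.prems(1) that] 4 by linarith
 show ?case unfolding dC.simps using dC_meas[OF Suc.prems(1)] b'(1) 3 5 by blast
qed auto

lemma dC_add: "dC N e A s B b ==> dC N e A s D c ==> dC N e A s (B + D) (\<lambda>x. b x + c x)"
proof (induction N arbitrary: B D b c)
 case 0
 then show ?case by (auto intro: norm_triangle_mono)
next
 case (Suc N)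
 obtain b' where b': "ddir e b b'" "dC N e A s (B * s) b'" using Suc.prems(1) by auto
 obtain c' where c': "ddir e c c'" "dC N e A s (D * s) c'" using Suc.prems(2) by auto
 have "ddir e (\<lambda>x. b x + c x) (\<lambda>x. b' x + c' x)"
  using b'(1) c'(1) unfolding ddir_def by (auto intro: has_vector_derivative_add)
 moreover have "dC N e A s ((B + D) * s) (\<lambda>x. b' x + c' x)"
  using Suc.IH[OF b'(2) c'(2)] by (simp add: distrib_right)
 ultimately show ?case using Suc.prems by (auto intro: norm_triangle_mono)
qed

lemma dC_cmult: "dC N e A s B b ==> dC N e A s (norm k * B) (\<lambda>x. k * b x)"
proof (induction N arbitrary: B b)
 case 0
 then show ?case by (auto simp: norm_mult mult_left_mono)
next
 case (Suc N)
 obtain b' where b': "ddir e b b'" "dC N e A s (B * s) b'" using Suc.prems(1) by auto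
 have "ddir e (\<lambda>x. k * b x) (\<lambda>x. k * b' x)"
  using b'(1) unfolding ddir_def by (auto intro: has_vector_derivative_mult_right)
 moreover have "dC N e A s (norm k * B * s) (\<lambda>x. k * b' x)"
  using Suc.IH[OF b'(2)] by (simp add: mult.assoc)
 ultimately show ?case using Suc.prems by (auto simp: norm_mult mult_left_mono)
qed

lemma dC_diff: "dC N e A s B b ==> dC N e A s D c ==> dC N e A s (B + D) (\<lambda>x. b x - c x)"
 using dC_add[of N e A s B b D "\<lambda>x. - c x"] dC_cmult[of N e A s D c "-1"] by simp

lemma borel_measurable_cnj[measurable (raw)]:
 "f \<in> borel_measurable M ==> (\<lambda>x. cnj (f x)) \<in> borel_measurable M"
 by (rule measurable_compose[where g=cnj]) (auto intro!: borel_measurable_continuous_onI continuous_intros)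

lemma dC_cnj: "dC N e A s B b ==> dC N e A s B (\<lambda>x. cnj (b x))"
proof (induction N arbitrary: B b)
 case (Suc N)
 obtain b' where b': "ddir e b b'" "dC N e A s (B * s) b'" using Suc.prems(1) by auto
 have "ddir e (\<lambda>x. cnj (b x)) (\<lambda>x. cnj (b' x))"
  using b'(1) unfolding ddir_def by (auto intro: has_vector_derivative_cnj)
 moreover have "b \<in> BM" using Suc.prems by (rule dC_meas)
 ultimately show ?case using Suc.prems Suc.IH[OF b'(2)] by auto
qed auto

text \<open>Leibniz' rule: the number of terms doubles with each derivative, whence
  \<open>2 ^ N\<close>.\<close>

lemma dC_mult:
 "dC N e A s B b ==> dC N e A s D c ==> 0 \<le> B ==> 0 \<le> D ==> 0 \<le> s ==> dC N e A s (2 ^ N * B * D) (\<lambda>x. b x * c x)"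
proof (induction N arbitrary: B D b c)
 case 0
 then show ?case by (auto simp: norm_mult intro!: mult_mono)
next
 case (Suc N)
 obtain b' where b': "ddir e b b'" "dC N e A s (B * s) b'" using Suc.prems(1) by auto
 obtain c' where c': "ddir e c c'" "dC N e A s (D * s) c'" using Suc.prems(2) by auto
 have dd: "ddir e (\<lambda>x. b x * c x) (\<lambda>x. b x * c' x + b' x * c x)"
  unfolding ddir_def
 proof
  fix x
  have "((\<lambda>t. b (x + t *\<^sub>R e)) has_vector_derivative b' x) (at 0)" "((\<lambda>t. c (x + t *\<^sub>R e)) has_vector_derivative c' x) (at 0)"
   using b'(1) c'(1) by (auto simp: ddir_def)
  from has_vector_derivative_mult[OF this] show "((\<lambda>t. b (x + t *\<^sub>R e) * c (x + t *\<^sub>R e)) has_vector_derivative b x * c' x + b' x * c x) (at 0)"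
   by simp
 qed
 have "dC N e A s (2 ^ N * B * (D * s) + 2 ^ N * (B * s) * D) (\<lambda>x. b x * c' x + b' x * c x)"
 proof (rule dC_add)
  show "dC N e A s (2 ^ N * B * (D * s)) (\<lambda>x. b x * c' x)"
   by (rule Suc.IH[OF dC_SucD[OF Suc.prems(1)] c'(2)]) (use Suc.prems(3-5) in auto)
  show "dC N e A s (2 ^ N * (B * s) * D) (\<lambda>x. b' x * c x)"
   by (rule Suc.IH[OF b'(2) dC_SucD[OF Suc.prems(2)]]) (use Suc.prems(3-5) in auto)
 qed
 also have "2 ^ N * B * (D * s) + 2 ^ N * (B * s) * D = 2 ^ Suc N * B * D * s" by simp
 finally have 1: "dC N e A s (2 ^ Suc N * B * D * s) (\<lambda>x. b x * c' x + b' x * c x)" .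
 have 2: "norm (b x * c x) \<le> 2 ^ Suc N * B * D" if "x \<in> A" for x
 proof -
  have "norm (b x * c x) \<le> B * D"
   unfolding norm_mult using Suc.prems dC_bound[OF Suc.prems(1) that] dC_bound[OF Suc.prems(2) that] by (intro mult_mono) auto
  also have "B * D = 1 * (B * D)" by simp
  also have "\<dots> \<le> 2 ^ Suc N * (B * D)" using Suc.prems by (intro mult_right_mono one_le_power) auto
  finally show ?thesis by (simp add: mult.assoc)
 qed
 have "b \<in> BM" "c \<in> BM" using Suc.prems dC_meas by blast+
 then have "(\<lambda>x. b x * c x) \<in> BM" by measurable
 then show ?case using dd 1 2 unfolding dC.simps by blast
qed

lemma ddir_cis: "ddir e (\<lambda>x. cis (h \<bullet> x)) (\<lambda>x. (\<i> * of_real (h \<bullet> e)) * cis (h \<bullet> x))"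
 unfolding ddir_def
proof
 fix x
 have "((\<lambda>t. cis (h \<bullet> x + t * (h \<bullet> e))) has_derivative (\<lambda>u. (u * (h \<bullet> e)) *\<^sub>R (\<i> * cis (h \<bullet> x + 0 * (h \<bullet> e))))) (at 0)"
  by (auto intro!: derivative_eq_intros)
 then show "((\<lambda>t. cis (h \<bullet> (x + t *\<^sub>R e))) has_vector_derivative (\<i> * of_real (h \<bullet> e)) * cis (h \<bullet> x)) (at 0)"
  unfolding has_vector_derivative_def by (simp add: inner_add_right scaleR_conv_of_real mult_ac)
qed

lemma dC_cis: "\<bar>h \<bullet> e\<bar> \<le> s ==> dC N e A s 1 (\<lambda>x. cis (h \<bullet> x))"
proof (induction N)
 case (Suc N)
 have "dC N e A s (norm (\<i> * of_real (h \<bullet> e)) * 1) (\<lambda>x. (\<i> * of_real (h \<bullet> e)) * cis (h \<bullet> x))"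
  by (rule dC_cmult[OF Suc.IH[OF Suc.prems]])
 then have "dC N e A s (1 * s) (\<lambda>x. (\<i> * of_real (h \<bullet> e)) * cis (h \<bullet> x))"
  using Suc.prems by (intro dC_mono[of N e A s _ _ "1 * s" A]) (auto simp: norm_mult)
 moreover have "(\<lambda>x. cis (h \<bullet> x)) \<in> BM" by (intro borel_measurable_continuous_onI continuous_intros)
 ultimately show ?case using ddir_cis[of e h] by auto
qed (auto intro!: borel_measurable_continuous_onI continuous_intros)

lemma cis_m1_le: "norm (cis t - 1) \<le> \<bar>t\<bar>"
proof -
 have "norm (cis t - cis 0) \<le> 1 * norm (t - 0)"
 proof (rule differentiable_bound[where S=UNIV])
  show "(cis has_derivative (\<lambda>h. h *\<^sub>R (\<i> * cis u))) (at u within UNIV)" for u :: real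
   by (auto intro!: derivative_eq_intros)
  show "onorm (\<lambda>h. h *\<^sub>R (\<i> * cis u)) \<le> 1" for u :: real
   by (intro onorm_le) (simp add: norm_mult)
 qed auto
 then show ?thesis by simp
qed

text \<open>Subtracting 1 keeps the small factor \<open>B\<close> at every order: the value is small
  on \<open>A\<close> and the first derivative has size at most \<open>B * s\<close>. This turns
  decay of a kernel into decay of its increments.\<close>

lemma dC_cis_m1:
 assumes "\<bar>h \<bullet> e\<bar> \<le> s" "\<bar>h \<bullet> e\<bar> \<le> B * s" "\<And>x. x \<in> A ==> \<bar>h \<bullet> x\<bar> \<le> B"
 shows "dC N e A s B (\<lambda>x. cis (h \<bullet> x) - 1)"
proof -
 have m: "(\<lambda>x. cis (h \<bullet> x) - 1) \<in> BM" by (intro borel_measurable_continuous_onI continuous_intros)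
 have b: "norm (cis (h \<bullet> x) - 1) \<le> B" if "x \<in> A" for x using cis_m1_le[of "h \<bullet> x"] assms(3)[OF that] by linarith
 show ?thesis
 proof (cases N)
  case (Suc M)
  have "dC M e A s (norm (\<i> * of_real (h \<bullet> e)) * 1) (\<lambda>x. (\<i> * of_real (h \<bullet> e)) * cis (h \<bullet> x))"
   by (rule dC_cmult[OF dC_cis[OF assms(1)]])
  then have "dC M e A s (B * s) (\<lambda>x. (\<i> * of_real (h \<bullet> e)) * cis (h \<bullet> x))"
   using assms by (intro dC_mono[of M e A s _ _ "B * s" A]) (auto simp: norm_mult)
  moreover have "ddir e (\<lambda>x. cis (h \<bullet> x) - 1) (\<lambda>x. (\<i> * of_real (h \<bullet> e)) * cis (h \<bullet> x))"
   using ddir_cis[of e h] unfolding ddir_def by (simp add: has_vector_derivative_diff_const)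
  ultimately show ?thesis using m b Suc by auto
 qed (use m b in auto)
qed

section \<open>Translation, integration by parts and decay\<close>

lemma lborel_integral_shift:
 fixes f :: "'a::euclidean_space => complex"
 assumes [measurable]: "f \<in> BM"
 shows "(LINT x|lborel. f (x + c)) = (LINT x|lborel. f x)"
proof -
 have "(LINT x|lborel. f x) = (LINT x|distr lborel borel ((+) c). f x)" by (simp add: lborel_distr_plus)
 also have "\<dots> = (LINT x|lborel. f (c + x))" by (intro integral_distr) auto
 finally show ?thesis by (simp add: add.commute)
qed

lemma lborel_nn_integral_shift:
 fixes f :: "'a::euclidean_space => ennreal"
 assumes [measurable]: "f \<in> BM"
 shows "(\<integral>\<^sup>+x. f (x + c)) = (\<integral>\<^sup>+x. f x)"
proof -
 have "(\<integral>\<^sup>+x. f x) = (\<integral>\<^sup>+x. f x \<partial>distr lborel borel ((+) c))" by (simp add: lborel_distr_plus)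
 also have "\<dots> = (\<integral>\<^sup>+x. f (c + x))" by (intro nn_integral_distr) auto
 finally show ?thesis by (simp add: add.commute)
qed

lemma integrable_bounded_support:
 fixes f :: "'a::euclidean_space => complex"
 assumes "f \<in> BM" "\<And>x. x \<in> A ==> norm (f x) \<le> B" "\<And>x. x \<notin> A ==> f x = 0" "bounded A"
 shows "integrable lborel f"
proof (rule adm_integrable)
 have "norm (f x) \<le> max B 0" for x using assms(2,3)[of x] by (cases "x \<in> A") auto
 moreover have "bounded {x. f x \<noteq> 0}" using assms(3,4) by (auto intro: bounded_subset)
 ultimately show "adm f" using assms(1) by (auto simp: adm_def)
qed

text \<open>Translation invariance of the integral replaces Fubini and the fundamental theorem of calculus.\<close>

lemma integral_ddir_zero:
 fixes f f' :: "'a::euclidean_space => complex"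
 assumes d: "ddir e f f'" and m[measurable]: "f \<in> BM" "f' \<in> BM"
  and B: "\<And>x. norm (f x) \<le> B" and B': "\<And>x. norm (f' x) \<le> B'"
  and A: "bounded A" "\<And>x. x \<notin> A ==> f x = 0"
 shows "(LINT x|lborel. f' x) = 0"
proof -
 obtain R where R: "\<And>x. x \<in> A ==> norm x \<le> R" using A(1) by (auto simp: bounded_iff)
 define t where "t n = 1 / real (Suc n)" for n
 have t: "0 < t n" "t n \<le> 1" for n by (auto simp: t_def)
 define D where "D n x = (f (x + t n *\<^sub>R e) - f x) / of_real (t n)" for n x
 have int: "integrable lborel f" using B A by (intro integrable_bounded_support[of f A B]) auto
 have int': "integrable lborel (\<lambda>x. f (x + c))" for c
 proof (rule integrable_bounded_support[of _ "(\<lambda>x. x - c) ` A" B])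
  show "bounded ((\<lambda>x. x - c) ` A)" using bounded_translation_minus[OF A(1)] by simp
  show "f (x + c) = 0" if "x \<notin> (\<lambda>x. x - c) ` A" for x
  proof (rule A(2))
   show "x + c \<notin> A" using that by (metis add_diff_cancel_right' image_eqI)
  qed
 qed (auto intro: B)
 have z: "(LINT x|lborel. D n x) = 0" for n
  unfolding D_def using int int' by (simp add: lborel_integral_shift)
 \<comment> \<open>The difference quotients have integral zero. They are bounded by the mean value
   theorem and, the steps being at most 1, supported in a ball enlarged by
   \<open>norm e\<close>.\<close>
 have lim: "(\<lambda>n. LINT x|lborel. D n x) \<longlonglongrightarrow> (LINT x|lborel. f' x)"
 proof (rule integral_dominated_convergence[where w="\<lambda>x. B' * indicator (cball 0 (R + norm e)) x"])
  show "AE x in lborel. (\<lambda>n. D n x) \<longlonglongrightarrow> f' x"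
  proof (rule AE_I2)
   fix x
   define g where "g t = f (x + t *\<^sub>R e)" for t
   have "((\<lambda>h. norm (g (0 + h) - g 0 - h *\<^sub>R f' x) / norm h) \<longlongrightarrow> 0) (at 0)"
    using d unfolding ddir_def has_vector_derivative_def has_derivative_at g_def by blast
   then have "((\<lambda>h. norm ((g h - g 0) /\<^sub>R h - f' x)) \<longlongrightarrow> 0) (at 0)"
   proof (rule Lim_transform_eventually)
    have "norm (g (0 + h) - g 0 - h *\<^sub>R f' x) / norm h = norm ((g h - g 0) /\<^sub>R h - f' x)" if "h \<noteq> 0" for h
    proof -
     have "(g h - g 0) /\<^sub>R h - f' x = (g (0 + h) - g 0 - h *\<^sub>R f' x) /\<^sub>R h"
      using that by (simp add: scaleR_diff_right)
     then show ?thesis by (simp add: divide_inverse mult.commute)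
    qed
    then show "\<forall>\<^sub>F h in at 0. norm (g (0 + h) - g 0 - h *\<^sub>R f' x) / norm h = norm ((g h - g 0) /\<^sub>R h - f' x)"
     by (auto simp: eventually_at_filter)
   qed
   then have "((\<lambda>h. (g h - g 0) /\<^sub>R h - f' x) \<longlongrightarrow> 0) (at 0)" by (rule tendsto_norm_zero_cancel)
   then have "((\<lambda>h. (g h - g 0) /\<^sub>R h) \<longlongrightarrow> f' x) (at 0)" by (rule LIM_zero_cancel)
   then have l: "((\<lambda>t. (f (x + t *\<^sub>R e) - f x) /\<^sub>R t) \<longlongrightarrow> f' x) (at 0)" by (simp add: g_def)
   have "filterlim t (at 0) sequentially"
    using LIMSEQ_inverse_real_of_nat t by (auto simp: t_def[abs_def] filterlim_at divide_inverse)
   from filterlim_compose[OF l this] show "(\<lambda>n. D n x) \<longlonglongrightarrow> f' x"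
    by (simp add: D_def scaleR_conv_of_real divide_inverse mult.commute)
  qed
  show "AE x in lborel. norm (D n x) \<le> B' * indicator (cball 0 (R + norm e)) x" for n
  proof (rule AE_I2)
   fix x
   show "norm (D n x) \<le> B' * indicator (cball 0 (R + norm e)) x"
   proof (cases "x \<in> cball 0 (R + norm e)")
    case True
    have "norm (f (x + t n *\<^sub>R e) - f x) \<le> B' * \<bar>t n\<bar>" by (rule ddir_mean_value[OF d B'])
    then show ?thesis using True t[of n] by (simp add: D_def norm_divide field_simps)
   next
    case False
    have "x \<notin> A" using False R[of x] norm_ge_zero[of e] by auto
    moreover have "x + t n *\<^sub>R e \<notin> A"
    proof
     assume "x + t n *\<^sub>R e \<in> A"
     then have "norm (x + t n *\<^sub>R e) \<le> R" by (rule R)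
     moreover have "norm x \<le> norm (x + t n *\<^sub>R e) + norm (t n *\<^sub>R e)" by (metis add_diff_cancel_right' norm_triangle_ineq4)
     moreover have "norm (t n *\<^sub>R e) \<le> norm e" using t[of n] by (simp add: mult_left_le_one_le)
     ultimately show False using False by simp
    qed
    ultimately show ?thesis using False A(2) by (simp add: D_def)
   qed
  qed
  show "integrable lborel (\<lambda>x. B' * indicator (cball (0::'a) (R + norm e)) x)"
   using emeasure_bounded_finite[OF bounded_cball, of "0::'a" "R + norm e"]
   by (intro integrable_mult_right integrable_real_indicator) auto
 qed (auto simp: D_def)
 show ?thesis using LIMSEQ_unique[OF lim] z by simp
qed

text \<open>Near a point outside a closed set the function vanishes identically. Supports therefore
  do not grow under repeated differentiation.\<close>

lemma ddir_zero_outside: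
 assumes d: "ddir e f f'" and A: "closed A" "\<And>x. x \<notin> A ==> f x = 0" and x: "x \<notin> A"
 shows "f' x = 0"
proof -
 have "open (-A)" using A by auto
 then obtain r where r: "0 < r" "ball x r \<subseteq> - A" using x by (meson ComplI openE)
 have "\<forall>\<^sub>F t in at 0. f (x + t *\<^sub>R e) = 0"
  unfolding eventually_at
 proof (intro exI conjI ballI impI)
  show "0 < r / (norm e + 1)" using r by (simp add: add_nonneg_pos)
  fix t :: real assume t: "t \<noteq> 0 \<and> dist t 0 < r / (norm e + 1)"
  then have "\<bar>t\<bar> * (norm e + 1) < r" by (simp add: pos_less_divide_eq add_nonneg_pos)
  then have "norm (t *\<^sub>R e) < r" by (simp add: algebra_simps)
  then have "x + t *\<^sub>R e \<in> ball x r" by (simp add: dist_norm)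
  then show "f (x + t *\<^sub>R e) = 0" using r A(2) by blast
 qed
 moreover have "((\<lambda>t. f (x + t *\<^sub>R e)) has_vector_derivative f' x) (at 0)" using d by (simp add: ddir_def)
 ultimately have "((\<lambda>t. 0) has_vector_derivative f' x) (at 0)"
  using A(2)[OF x] unfolding has_vector_derivative_def
  by (intro has_derivative_transform_eventually[of "\<lambda>t. f (x + t *\<^sub>R e)" _ 0 UNIV "\<lambda>t. 0"]) (auto elim: eventually_mono)
 then show ?thesis using vector_derivative_unique_at has_vector_derivative_const by blast
qed

text \<open>Integration by parts \<open>N\<close> times. It is stated with an amplitude
  \<open>c\<close> that represents the moment for all \<open>z\<close>, so that Plancherel's theorem
  can be applied to \<open>c\<close> as well as the trivial bound.\<close>

lemma dC_moment:
 assumes "dC N e A s B b" "bounded A" "closed A" "\<And>x. x \<notin> A ==> b x = 0"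
 shows "\<exists>c. c \<in> BM \<and> (\<forall>x\<in>A. norm (c x) \<le> B * s ^ N) \<and> (\<forall>x. x \<notin> A \<longrightarrow> c x = 0) \<and>
  (\<forall>z. (LINT x|lborel. cis (z \<bullet> x) * c x) = (- \<i> * of_real (z \<bullet> e)) ^ N * (LINT x|lborel. cis (z \<bullet> x) * b x))"
 using assms
proof (induction N arbitrary: B b)
 case 0
 then show ?case by (intro exI[of _ b]) auto
next
 case (Suc N)
 obtain b' where b': "ddir e b b'" "dC N e A s (B * s) b'" using Suc.prems(1) by auto
 have z': "b' x = 0" if "x \<notin> A" for x by (rule ddir_zero_outside[OF b'(1) Suc.prems(3,4) that])
 obtain c where c: "c \<in> BM" "\<forall>x\<in>A. norm (c x) \<le> B * s * s ^ N" "\<forall>x. x \<notin> A \<longrightarrow> c x = 0"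
  "\<And>z. (LINT x|lborel. cis (z \<bullet> x) * c x) = (- \<i> * of_real (z \<bullet> e)) ^ N * (LINT x|lborel. cis (z \<bullet> x) * b' x)"
  using Suc.IH[OF b'(2) Suc.prems(2,3) z'] by blast
 have [measurable]: "b \<in> BM" "b' \<in> BM"
  using dC_meas Suc.prems(1) b'(2) by blast+
 have [measurable]: "(\<lambda>x. cis (z \<bullet> x)) \<in> BM" for z :: 'a
  by (intro borel_measurable_continuous_onI continuous_intros)
 have bb: "norm (b x) \<le> max B 0" for x using dC_bound[OF Suc.prems(1), of x] Suc.prems(4)[of x] by (cases "x \<in> A") auto
 have bb': "norm (b' x) \<le> max (B * s) 0" for x using dC_bound[OF b'(2), of x] z'[of x] by (cases "x \<in> A") auto
 have key: "(LINT x|lborel. cis (z \<bullet> x) * b' x) = (- \<i> * of_real (z \<bullet> e)) * (LINT x|lborel. cis (z \<bullet> x) * b x)" for z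
 proof -
  let ?F' = "\<lambda>x. cis (z \<bullet> x) * b' x + (\<i> * of_real (z \<bullet> e)) * cis (z \<bullet> x) * b x"
  have dd: "ddir e (\<lambda>x. cis (z \<bullet> x) * b x) ?F'"
   unfolding ddir_def
  proof
   fix x
   have "((\<lambda>t. cis (z \<bullet> (x + t *\<^sub>R e))) has_vector_derivative (\<i> * of_real (z \<bullet> e)) * cis (z \<bullet> x)) (at 0)"
    "((\<lambda>t. b (x + t *\<^sub>R e)) has_vector_derivative b' x) (at 0)"
    using ddir_cis[of e z] b'(1) by (auto simp: ddir_def)
   from has_vector_derivative_mult[OF this]
   show "((\<lambda>t. cis (z \<bullet> (x + t *\<^sub>R e)) * b (x + t *\<^sub>R e)) has_vector_derivative ?F' x) (at 0)" by simp
  qed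
  have i1: "integrable lborel (\<lambda>x. cis (z \<bullet> x) * b' x)"
   by (rule integrable_bounded_support[of _ A "max (B * s) 0"]) (use bb' z' Suc.prems(2) in \<open>auto simp: norm_mult\<close>)
  have i2: "integrable lborel (\<lambda>x. cis (z \<bullet> x) * b x)"
   by (rule integrable_bounded_support[of _ A "max B 0"]) (use bb Suc.prems(2,4) in \<open>auto simp: norm_mult\<close>)
  have "(LINT x|lborel. ?F' x) = 0"
  proof (rule integral_ddir_zero[OF dd _ _ _ _ Suc.prems(2)])
   show "norm (cis (z \<bullet> x) * b x) \<le> max B 0" for x using bb[of x] by (simp add: norm_mult)
   show "norm (?F' x) \<le> max (B * s) 0 + \<bar>z \<bullet> e\<bar> * max B 0" for x
    using bb[of x] bb'[of x] by (intro norm_triangle_mono) (auto simp: norm_mult mult_left_mono)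
  qed (use Suc.prems(4) in auto)
  moreover have "(LINT x|lborel. ?F' x) = (LINT x|lborel. cis (z \<bullet> x) * b' x) + (\<i> * of_real (z \<bullet> e)) * (LINT x|lborel. cis (z \<bullet> x) * b x)"
   using i1 i2 by (simp add: mult.assoc)
  ultimately have "(LINT x|lborel. cis (z \<bullet> x) * b' x) + (\<i> * of_real (z \<bullet> e)) * (LINT x|lborel. cis (z \<bullet> x) * b x) = 0" by simp
  then show ?thesis by (simp add: add_eq_0_iff)
 qed
 show ?case
  by (rule exI[of _ c]) (use c key in \<open>auto simp: mult_ac\<close>)
qed

abbreviation ax :: "'n::finite => real^'n" where "ax i \<equiv> axis i 1"

definition kern :: "('a::euclidean_space => complex) => 'a => complex" where
 "kern b z = (LINT x|lborel. cis (z \<bullet> x) * b x)"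

lemma cis_inner_measurable[measurable]: "(\<lambda>x. cis (z \<bullet> x)) \<in> BM"
 by (intro borel_measurable_continuous_onI continuous_intros)

lemma kern_le:
 fixes b :: "'a::euclidean_space => complex"
 assumes A: "A \<in> sets borel" "vol A \<le> ennreal V" "0 \<le> V" and B: "\<And>x. x \<in> A ==> norm (b x) \<le> B" "0 \<le> B"
  and z: "\<And>x. x \<notin> A ==> b x = 0"
 shows "norm (kern b z) \<le> B * V"
proof -
 have "enorm (kern b z) \<le> (\<integral>\<^sup>+x. enorm (cis (z \<bullet> x) * b x))"
  unfolding kern_def by (rule norm_LINT_le)
 also have "\<dots> \<le> (\<integral>\<^sup>+x. ennreal B * indicator A x)"
 proof (intro nn_integral_mono)
  fix x show "enorm (cis (z \<bullet> x) * b x) \<le> ennreal B * indicator A x"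
   using B(1)[of x] z[of x] by (cases "x \<in> A") (auto simp: norm_mult ennreal_leI)
 qed
 also have "\<dots> = ennreal B * vol A" using A by (simp add: nn_integral_cmult_indicator)
 also have "\<dots> \<le> ennreal B * ennreal V" by (intro mult_left_mono A) auto
 also have "\<dots> = ennreal (B * V)" using B A by (intro ennreal_mult[symmetric]) auto
 finally show ?thesis using B A by (subst (asm) ennreal_le_iff) auto
qed

lemma kern_moment_le:
 fixes b :: "'a::euclidean_space => complex"
 assumes dC: "dC N e A s B b" and A: "bounded A" "closed A" "vol A \<le> ennreal V" "0 \<le> V"
  and B: "0 \<le> B" "0 \<le> s" and z: "\<And>x. x \<notin> A ==> b x = 0"
 shows "\<bar>z \<bullet> e\<bar> ^ N * norm (kern b z) \<le> B * s ^ N * V"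
proof -
 obtain c where c: "\<And>x. x \<in> A ==> norm (c x) \<le> B * s ^ N" "\<And>x. x \<notin> A ==> c x = 0"
  "kern c z = (- \<i> * of_real (z \<bullet> e)) ^ N * kern b z"
  using dC_moment[OF dC A(1,2) z] unfolding kern_def by blast
 have "norm (kern c z) \<le> (B * s ^ N) * V" using c A B by (intro kern_le[of A]) auto
 then show ?thesis unfolding c(3) by (simp add: norm_mult norm_power)
qed

text \<open>The largest coordinate carries at least the fraction \<open>1 / n\<close> of
  \<open>norm z\<close>, so one moment gives the full decay; for \<open>R * norm z \<le> 1\<close>
  the trivial bound is enough.\<close>

lemma decay_from_moments:
 fixes z :: "real^'n::finite"
 assumes D: "0 \<le> D" and R: "0 < R" and K: "0 \<le> K" "K \<le> D" "\<And>i. \<bar>z \<bullet> ax i\<bar> ^ N * K \<le> D * (1 / R) ^ N"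
 shows "K \<le> D * (2 * real CARD('n)) ^ N / (1 + R * norm z) ^ N"
proof -
 define n where "n = real CARD('n)"
 have n: "1 \<le> n" by (simp add: n_def Suc_leI)
 have p: "0 < 1 + R * norm z" using R by (simp add: add_pos_nonneg)
 have "K * (1 + R * norm z) ^ N \<le> D * (2 * n) ^ N"
 proof (cases "R * norm z \<le> 1")
  case True
  have "(1 + R * norm z) ^ N \<le> (2 * n) ^ N" using True n R by (intro power_mono) (auto intro: add_nonneg_nonneg)
  then show ?thesis using K D p by (intro mult_mono) auto
 next
  case False
  define m where "m = Max (range (\<lambda>i. \<bar>z$i\<bar>))"
  have "m \<in> range (\<lambda>i. \<bar>z$i\<bar>)" unfolding m_def by (intro Max_in) auto
  then obtain i where i: "m = \<bar>z$i\<bar>" by auto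
  have "\<bar>z$j\<bar> \<le> m" for j unfolding m_def by (intro Max_ge) auto
  then have "norm z \<le> n * m" unfolding n_def by (rule norm_le_card)
  then have "R * norm z \<le> R * (n * m)" using R by (intro mult_left_mono) auto
  then have "1 + R * norm z \<le> 2 * n * R * m" using False by (simp add: mult_ac)
  then have "(1 + R * norm z) ^ N \<le> (2 * n * R * m) ^ N" using p by (intro power_mono) auto
  also have "\<dots> = (2 * n) ^ N * R ^ N * m ^ N" by (simp add: power_mult_distrib)
  finally have "K * (1 + R * norm z) ^ N \<le> K * ((2 * n) ^ N * R ^ N * m ^ N)" using K by (intro mult_left_mono)
  also have "\<dots> = (2 * n) ^ N * R ^ N * (\<bar>z \<bullet> ax i\<bar> ^ N * K)" by (simp add: i inner_axis)
  also have "\<dots> \<le> (2 * n) ^ N * R ^ N * (D * (1 / R) ^ N)" using K(3) R n by (intro mult_left_mono) auto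
  also have "\<dots> = D * (2 * n) ^ N" using R by (simp add: power_one_over)
  finally show ?thesis .
 qed
 then show ?thesis using p by (simp add: n_def pos_le_divide_eq)
qed

lemma kern_decay:
 fixes b :: "real^'n::finite => complex"
 assumes dC: "\<And>i. dC N (ax i) A (1 / R) B b" and A: "bounded A" "closed A" "vol A \<le> ennreal V" "0 \<le> V"
  and B: "0 \<le> B" "0 < R" and z: "\<And>x. x \<notin> A ==> b x = 0"
 shows "norm (kern b z) \<le> B * V * (2 * real CARD('n)) ^ N / (1 + R * norm z) ^ N"
proof (rule decay_from_moments)
 show "norm (kern b z) \<le> B * V" using A dC_bound[OF dC] B z by (intro kern_le[of A]) auto
 show "\<bar>z \<bullet> ax i\<bar> ^ N * norm (kern b z) \<le> B * V * (1 / R) ^ N" for i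
  using kern_moment_le[OF dC[of i] A B(1) _ z, of z] B by (simp add: mult_ac)
qed (use A B in auto)

section \<open>A dyadic partition of unity\<close>

lemma antiderivative_exists:
 fixes f :: "real => real"
 assumes "continuous_on UNIV f"
 obtains F where "\<And>t. (F has_real_derivative f t) (at t)"
proof
 fix t :: real
 let ?F = "\<lambda>u. LBINT y=ereal 0..ereal u. f y"
 have "(?F has_vector_derivative f t) (at t within {-\<bar>t\<bar>-1..\<bar>t\<bar>+1})"
  by (rule interval_integral_FTC2[of "-\<bar>t\<bar>-1" 0 "\<bar>t\<bar>+1"]) (use assms in \<open>auto intro: continuous_on_subset\<close>)
 then have "(?F has_vector_derivative f t) (at t)"
  by (subst (asm) at_within_interior) auto
 then show "(?F has_real_derivative f t) (at t)"
  by (simp add: has_real_derivative_iff_has_vector_derivative)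
qed

text \<open>Each averaging over a short interval raises the order of differentiability by one.\<close>

lemma bump_exists:
 fixes a b :: real
 assumes "0 < a" "a < b"
 shows "\<exists>D M. (\<forall>k\<le>N. continuous_on UNIV (D k) \<and> (\<forall>t. \<bar>D k t\<bar> \<le> M)) \<and>
  (\<forall>k<N. \<forall>t. (D k has_real_derivative D (Suc k) t) (at t)) \<and>
  (\<forall>t. \<bar>t\<bar> \<le> a \<longrightarrow> D 0 t = 1) \<and> (\<forall>t. b \<le> \<bar>t\<bar> \<longrightarrow> D 0 t = (0::real))"
 using assms
proof (induction N arbitrary: a b)
 case 0
 define D where "D = (\<lambda>(k::nat) t. max 0 (min 1 ((b - \<bar>t\<bar>) / (b - a))))"
 show ?case
 proof (intro exI[of _ D] exI[of _ 1] conjI allI impI)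
  show "continuous_on UNIV (D k)" for k unfolding D_def by (intro continuous_intros) (use 0 in auto)
 qed (use 0 in \<open>auto simp: D_def max_def min_def field_simps\<close>)
next
 case (Suc N)
 \<comment> \<open>Averaging over \<open>[t - d, t + d]\<close> moves plateau and support by
   \<open>d\<close> each; thirds keep \<open>a + d < b - d\<close> for the previous order.\<close>
 define d where "d = (b - a) / 3"
 have d: "0 < d" using Suc.prems by (simp add: d_def)
 have "0 < a + d" "a + d < b - d" using Suc.prems by (simp_all add: d_def field_simps)
 from Suc.IH[OF this] obtain D M where DM: "(\<forall>k\<le>N. continuous_on UNIV (D k) \<and> (\<forall>t. \<bar>D k t\<bar> \<le> M)) \<and>
  (\<forall>k<N. \<forall>t. (D k has_real_derivative D (Suc k) t) (at t)) \<and>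
  (\<forall>t. \<bar>t\<bar> \<le> a + d \<longrightarrow> D 0 t = 1) \<and> (\<forall>t. b - d \<le> \<bar>t\<bar> \<longrightarrow> D 0 t = 0)" by (elim exE)
 have D: "\<And>k. k \<le> N ==> continuous_on UNIV (D k)" "\<And>k t. k \<le> N ==> \<bar>D k t\<bar> \<le> M"
  "\<And>k t. k < N ==> (D k has_real_derivative D (Suc k) t) (at t)"
  "\<And>t. \<bar>t\<bar> \<le> a + d ==> D 0 t = 1" "\<And>t. b - d \<le> \<bar>t\<bar> ==> D 0 t = 0"
  using DM by (simp_all)
 obtain H where H: "\<And>t. (H has_real_derivative D 0 t) (at t)" using antiderivative_exists[OF D(1)[of 0]] by auto
 define D' where "D' k t = (case k of 0 => (H (t + d) - H (t - d)) / (2 * d) | Suc k => (D k (t + d) - D k (t - d)) / (2 * d))" for k t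
 have D'_0: "D' 0 = (\<lambda>t. (H (t + d) - H (t - d)) / (2 * d))" by (simp add: D'_def fun_eq_iff)
 have D'_S: "D' (Suc k) = (\<lambda>t. (D k (t + d) - D k (t - d)) / (2 * d))" for k by (simp add: D'_def fun_eq_iff)
 \<comment> \<open>The averaged function takes at \<open>t\<close> a value of \<open>D 0\<close> at
   some point within distance \<open>d\<close>, and thus inherits bound, plateau and zeros.\<close>
 have mvt: "\<exists>s. t - d < s \<and> s < t + d \<and> D' 0 t = D 0 s" for t
 proof -
  obtain s where "t - d < s" "s < t + d" "H (t + d) - H (t - d) = (t + d - (t - d)) * D 0 s"
   using MVT2[of "t - d" "t + d" H "D 0"] H d by auto
  then show ?thesis using d by (intro exI[of _ s]) (simp add: D'_def)
 qed
 have shift: "((\<lambda>t. G (t + c)) has_real_derivative g (t + c)) (at t)" if "\<And>t. (G has_real_derivative g t) (at t)" for G g c and t :: real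
  using DERIV_shift[of G "g (t + c)" t c] that by simp
 have der: "(D' k has_real_derivative D' (Suc k) t) (at t)" if "k < Suc N" for k t
 proof (cases k)
  case 0
  have "((\<lambda>t. (H (t + d) - H (t + - d)) / (2 * d)) has_real_derivative (D 0 (t + d) - D 0 (t + - d)) / (2 * d)) (at t)"
   by (intro DERIV_cdivide DERIV_diff shift[of H "D 0"] H)
  then show ?thesis by (simp add: 0 D'_0 D'_S)
 next
  case (Suc j)
  have "((\<lambda>t. (D j (t + d) - D j (t + - d)) / (2 * d)) has_real_derivative (D (Suc j) (t + d) - D (Suc j) (t + - d)) / (2 * d)) (at t)"
   using that Suc by (intro DERIV_cdivide DERIV_diff shift[of "D j" "D (Suc j)"] D(3)) auto
  then show ?thesis by (simp add: Suc D'_S)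
 qed
 have M: "0 \<le> M" using D(2)[of 0 0] by linarith
 show ?case
 proof (intro exI[of _ D'] exI[of _ "max M (M / d)"] conjI allI impI)
  fix k assume k: "k \<le> Suc N"
  show "continuous_on UNIV (D' k)"
  proof (cases k)
   case 0
   then show ?thesis using der[of 0] by (intro continuous_at_imp_continuous_on ballI DERIV_isCont) auto
  next
   case (Suc j)
   then have c: "continuous_on UNIV (D j)" using k D(1) by simp
   have "continuous_on UNIV (\<lambda>t. (D j (t + d) - D j (t - d)) / (2 * d))"
    by (intro continuous_intros continuous_on_compose2[OF c]) (use d in auto)
   then show ?thesis by (simp add: Suc D'_def)
  qed
  show "\<bar>D' k t\<bar> \<le> max M (M / d)" for t
  proof (cases k)
   case 0
   then show ?thesis using mvt[of t] D(2)[of 0] by (metis le_max_iff_disj zero_le)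
  next
   case (Suc j)
   then have j: "\<bar>D j (t + d)\<bar> \<le> M" "\<bar>D j (t - d)\<bar> \<le> M" using k D(2) by auto
   have "\<bar>D j (t + d) - D j (t - d)\<bar> \<le> 2 * M" using j by linarith
   then have "\<bar>D j (t + d) - D j (t - d)\<bar> / (2 * d) \<le> 2 * M / (2 * d)" using d by (intro divide_right_mono) auto
   then have "\<bar>D' k t\<bar> \<le> 2 * M / (2 * d)" using d by (simp add: Suc D'_S abs_divide)
   then show ?thesis by simp
  qed
 next
  fix t :: real assume "\<bar>t\<bar> \<le> a"
  then show "D' 0 t = 1" proof -
   obtain s where s: "t - d < s" "s < t + d" "D' 0 t = D 0 s" using mvt[of t] by blast
   then have "\<bar>s\<bar> \<le> a + d" using \<open>\<bar>t\<bar> \<le> a\<close> by linarith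
   then show ?thesis using D(4) s by simp
  qed
 next
  fix t :: real assume "b \<le> \<bar>t\<bar>"
  then show "D' 0 t = 0" proof -
   obtain s where s: "t - d < s" "s < t + d" "D' 0 t = D 0 s" using mvt[of t] by blast
   then have "b - d \<le> \<bar>s\<bar>" using \<open>b \<le> \<bar>t\<bar>\<close> by linarith
   then show ?thesis using D(5) s by simp
  qed
 qed (rule der)
qed

text \<open>A cut-off of finite order \<open>N\<close> that carries its derivatives along as the
  family \<open>D\<close>, with one common bound \<open>M\<close>.\<close>

definition profile :: "nat => (nat => real => real) => real => bool" where
 "profile N D M \<longleftrightarrow> (\<forall>k\<le>N. continuous_on UNIV (D k) \<and> (\<forall>t. \<bar>D k t\<bar> \<le> M)) \<and>
  (\<forall>k<N. \<forall>t. (D k has_real_derivative D (Suc k) t) (at t)) \<and>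
  (\<forall>t. \<bar>t\<bar> \<le> 1 \<longrightarrow> D 0 t = 1) \<and> (\<forall>t. 2 \<le> \<bar>t\<bar> \<longrightarrow> D 0 t = 0)"

lemma profile_exists: "\<exists>D M. profile N D M"
 using bump_exists[of 1 2 N] unfolding profile_def by simp

text \<open>Dyadic shells in the maximum norm, \<open>2^(j-1) \<le> |x| \<le> 2^(j+1)\<close> for
  \<open>j > 0\<close> and a full cube for \<open>j = 0\<close>. In this norm cut-offs are products
  of one-variable profiles.\<close>

definition ring :: "nat => (real^'n::finite) set" where
 "ring j = {x. (\<forall>i. \<bar>x$i\<bar> \<le> 2 * 2^j) \<and> (j = 0 \<or> (\<exists>i. 2^j \<le> 2 * \<bar>x$i\<bar>))}"

lemma closed_ring: "closed (ring j :: (real^'n::finite) set)"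
proof -
 have "(ring j :: (real^'n) set) = (\<Inter>i. {x. \<bar>x$i\<bar> \<le> 2 * 2^j}) \<inter> (if j = 0 then UNIV else (\<Union>i. {x. 2^j \<le> 2 * \<bar>x$i\<bar>}))"
  by (auto simp: ring_def)
 moreover have "closed ((\<Inter>i. {x :: real^'n. \<bar>x$i\<bar> \<le> 2 * 2^j}) \<inter> (if j = 0 then UNIV else (\<Union>i. {x. 2^j \<le> 2 * \<bar>x$i\<bar>})))"
  by (intro closed_Int closed_INT) (auto intro!: closed_UN closed_Collect_le continuous_intros)
 ultimately show ?thesis by simp
qed

lemma ring_box: "(ring j :: (real^'n::finite) set) \<subseteq> cbox (\<chi> i. - (2 * 2^j)) (\<chi> i. 2 * 2^j)"
proof
 fix x :: "real^'n" assume "x \<in> ring j"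
 then have "\<bar>x$i\<bar> \<le> 2 * 2^j" for i by (simp add: ring_def)
 then show "x \<in> cbox (\<chi> i. - (2 * 2^j)) (\<chi> i. 2 * 2^j)"
  by (simp add: mem_box_cart abs_le_iff minus_le_iff)
qed

lemma bounded_ring: "bounded (ring j :: (real^'n::finite) set)"
 by (rule bounded_subset[OF bounded_cbox ring_box])

lemma emeasure_ring: "vol (ring j :: (real^'n::finite) set) \<le> ennreal ((4 * 2^j) ^ CARD('n))"
proof -
 have "vol (ring j :: (real^'n) set) \<le> vol (cbox (\<chi> i. - (2 * 2^j)) (\<chi> i. 2 * 2^j) :: (real^'n) set)"
  using ring_box by (intro emeasure_mono) auto
 also have "\<dots> = ennreal ((4 * 2^j) ^ CARD('n))"
  by (subst emeasure_box_cart(2)) auto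
 finally show ?thesis .
qed

context
 fixes N :: nat and D :: "nat => real => real" and M :: real
 assumes prof: "profile N D M"
begin

lemma prof_1: "\<bar>t\<bar> \<le> 1 ==> D 0 t = 1" and prof_0: "2 \<le> \<bar>t\<bar> ==> D 0 t = 0"
 and prof_M: "k \<le> N ==> \<bar>D k t\<bar> \<le> M" and prof_c: "k \<le> N ==> continuous_on UNIV (D k)"
 and prof_d: "k < N ==> (D k has_real_derivative D (Suc k) t) (at t)"
 using prof by (auto simp: profile_def)

lemma M_ge_1: "1 \<le> M"
 using prof_M[of 0 0] prof_1[of 0] by simp

definition phi :: "nat => real^'n::finite => complex" where
 "phi j x = of_real (\<Prod>i\<in>UNIV. D 0 (x$i / 2^j))"

definition psi :: "nat => real^'n::finite => complex" where
 "psi j x = (case j of 0 => phi 0 x | Suc i => phi (Suc i) x - phi i x)"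

lemma sum_psi: "(\<Sum>j\<le>J. psi j x) = phi J x"
 by (induction J) (simp_all add: psi_def)

lemma phi_1: "(\<And>i. \<bar>x$i\<bar> \<le> 2^j) ==> phi j x = 1"
 by (simp add: phi_def prof_1)

lemma phi_0: "2 * 2^j \<le> \<bar>x$i\<bar> ==> phi j x = 0"
 using prof_0[of "x$i / 2^j"] by (auto simp: phi_def field_simps)

lemma psi_0:
 assumes "x \<notin> ring j" shows "psi j x = 0"
proof (cases "\<forall>i. \<bar>x$i\<bar> \<le> 2 * 2^j")
 case True
 then have j: "j \<noteq> 0" "\<And>i. 2 * \<bar>x$i\<bar> < 2^j" using assms by (auto simp: ring_def not_le)
 then obtain k where k: "j = Suc k" by (cases j) auto
 have b: "\<bar>x$i\<bar> \<le> 2^k" for i using j(2)[of i] by (simp add: k)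
 then have "\<bar>x$i\<bar> \<le> 2^Suc k" for i by (rule order_trans) simp
 then show ?thesis using b by (simp add: psi_def k phi_1)
next
 case False
 then obtain i where i: "2 * 2^j < \<bar>x$i\<bar>" by (auto simp: not_le)
 show ?thesis
 proof (cases j)
  case 0
  then show ?thesis using i phi_0[of 0 x i] by (simp add: psi_def)
 next
  case (Suc k)
  have "2 * 2^Suc k \<le> \<bar>x$i\<bar>" "2 * 2^k \<le> \<bar>x$i\<bar>" using i by (simp_all add: Suc)
  then show ?thesis using phi_0[of "Suc k" x i] phi_0[of k x i] by (simp add: Suc psi_def)
 qed
qed

text \<open>Along the \<open>i\<close>-th axis a single factor of the product varies; the remaining
  ones are bounded by \<open>M\<close> each.\<close>

lemma phi_dC: "dC N (ax i) A (1 / 2^j) (M ^ CARD('n)) (phi j :: real^'n::finite => complex)"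
proof -
 define g where "g x = (\<Prod>l\<in>UNIV - {i}. D 0 (x$l / 2^j))" for x :: "real^'n"
 have gc: "continuous_on UNIV g"
  unfolding g_def by (intro continuous_intros continuous_on_compose2[OF prof_c[of 0]]) auto
 have gM: "\<bar>g x\<bar> \<le> M ^ (CARD('n) - 1)" for x
 proof -
  have "\<bar>g x\<bar> \<le> (\<Prod>l\<in>UNIV - {i}. M)"
   unfolding g_def abs_prod by (intro prod_mono conjI prof_M) auto
  then show ?thesis by simp
 qed
 define d where "d k x = complex_of_real ((1/2^j) ^ k * D k (x$i / 2^j) * g x)" for k x
 have "phi j = d 0"
 proof
  fix x show "phi j x = d 0 x"
   unfolding phi_def d_def g_def by (subst prod.remove[of UNIV i]) auto
 qed
 moreover have "dC N (ax i) A (1 / 2^j) (M ^ CARD('n)) (d 0)"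
 proof (rule dC_of_family[where d=d])
  fix k assume k: "k \<le> N"
  have "continuous_on UNIV (d k)"
   unfolding d_def by (intro continuous_intros gc continuous_on_compose2[OF prof_c[OF k]]) auto
  then show "d k \<in> BM" by (rule borel_measurable_continuous_onI)
  fix x :: "real^'n"
  have "\<bar>D k (x$i / 2^j) * g x\<bar> \<le> M * M ^ (CARD('n) - 1)"
   unfolding abs_mult using prof_M[OF k] gM M_ge_1 by (intro mult_mono) auto
  also have "M * M ^ (CARD('n) - 1) = M ^ CARD('n)" by (metis power_eq_if zero_less_card_finite less_irrefl)
  finally have "(1/2^j) ^ k * \<bar>D k (x$i / 2^j) * g x\<bar> \<le> (1/2^j) ^ k * M ^ CARD('n)" by (intro mult_left_mono) auto
  moreover have "norm (d k x) = (1/2^j) ^ k * \<bar>D k (x$i / 2^j) * g x\<bar>"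
   unfolding d_def norm_of_real by (simp add: abs_mult)
  ultimately show "norm (d k x) \<le> M ^ CARD('n) * (1 / 2^j) ^ k" by (simp add: mult.commute)
 next
  fix k assume k: "k < N"
  show "ddir (ax i) (d k) (d (Suc k))"
   unfolding ddir_def
  proof
   fix x :: "real^'n"
   have gx: "g (x + t *\<^sub>R ax i) = g x" for t unfolding g_def by (intro prod.cong) (auto simp: axis_def)
   have "((\<lambda>t. (x$i + t) / 2^j) has_real_derivative 1 / 2^j) (at 0)" by (auto intro!: derivative_eq_intros)
   from DERIV_chain2[OF prof_d[OF k, of "(x$i + 0) / 2^j"] this]
   have "((\<lambda>t. D k ((x$i + t) / 2^j)) has_real_derivative D (Suc k) (x$i / 2^j) * (1 / 2^j)) (at 0)" by simp
   then have "((\<lambda>t. (1/2^j) ^ k * D k ((x$i + t) / 2^j) * g x) has_real_derivative (1/2^j) ^ k * (D (Suc k) (x$i / 2^j) * (1 / 2^j)) * g x) (at 0)"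
    by (intro DERIV_cmult_right DERIV_cmult)
   then have "((\<lambda>t. complex_of_real ((1/2^j) ^ k * D k ((x$i + t) / 2^j) * g x)) has_vector_derivative of_real ((1/2^j) ^ k * (D (Suc k) (x$i / 2^j) * (1 / 2^j)) * g x)) (at 0)"
    unfolding has_real_derivative_iff_has_vector_derivative by (rule bounded_linear.has_vector_derivative[OF bounded_linear_of_real])
   then show "((\<lambda>t. d k (x + t *\<^sub>R ax i)) has_vector_derivative d (Suc k) x) (at 0)"
   proof -
    assume h: "((\<lambda>t. complex_of_real ((1/2^j) ^ k * D k ((x$i + t) / 2^j) * g x)) has_vector_derivative of_real ((1/2^j) ^ k * (D (Suc k) (x$i / 2^j) * (1 / 2^j)) * g x)) (at 0)"
    have xi: "(x + t *\<^sub>R ax i)$i = x$i + t" for t by (simp add: axis_def)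
    have "(1/2^j) ^ k * (D (Suc k) (x$i / 2^j) * (1 / 2^j)) * g x = (1/2^j) ^ Suc k * D (Suc k) (x$i / 2^j) * g x" by simp
    with h show ?thesis unfolding d_def gx xi by metis
   qed
  qed
 qed
 ultimately show ?thesis by simp
qed

text \<open>The subtracted cut-off lives at half the scale; rescaling its rate by 2 costs the
  \<open>2 ^ N\<close>.\<close>

lemma psi_dC: "dC N (ax i) A (1 / 2^j) (M ^ CARD('n) * (1 + 2 ^ N)) (psi j :: real^'n::finite => complex)"
proof (cases j)
 case 0
 have "M ^ CARD('n) * 1 \<le> M ^ CARD('n) * (1 + 2 ^ N)" using M_ge_1 by (intro mult_left_mono) auto
 then have "dC N (ax i) A (1 / 2^0) (M ^ CARD('n) * (1 + 2 ^ N)) (phi 0 :: real^'n => complex)"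
  by (intro dC_mono[OF phi_dC]) auto
 then show ?thesis using 0 by (simp add: psi_def[abs_def])
next
 case (Suc k)
 have "dC N (ax i) A (1 / 2^Suc k) (M ^ CARD('n) * 2 ^ N) (phi k :: real^'n => complex)"
  using M_ge_1 by (intro dC_rescale[OF phi_dC]) (auto simp: field_simps)
 from dC_diff[OF phi_dC this] show ?thesis by (simp add: Suc psi_def[abs_def] distrib_left)
qed

end

section \<open>Square integrable functions\<close>

definition sqi :: "('a::euclidean_space => complex) => ennreal" where
 "sqi u = (\<integral>\<^sup>+x. ennreal (norm (u x) ^ 2))"

definition L2 :: "('a::euclidean_space => complex) => bool" where
 "L2 u \<longleftrightarrow> u \<in> BM \<and> sqi u < \<infinity>"

text \<open>For infinite \<open>sqi\<close> the value is 0, the default of \<open>enn2real\<close>;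
  bounds on \<open>n2\<close> are therefore paired with \<open>L2\<close>.\<close>

definition n2 :: "('a::euclidean_space => complex) => real" where
 "n2 u = sqrt (enn2real (sqi u))"

lemma n2_nonneg: "0 \<le> n2 u" by (simp add: n2_def)

lemma sqi_n2: "L2 u ==> sqi u = ennreal (n2 u ^ 2)"
 by (simp add: L2_def n2_def)

lemma L2_meas[measurable_dest]: "L2 u ==> u \<in> BM" by (simp add: L2_def)

lemma L2I: "u \<in> BM ==> sqi u \<le> ennreal c ==> L2 u"
 unfolding L2_def by (auto intro: order.strict_trans1)

lemma n2_leI: "sqi u \<le> ennreal (c^2) ==> 0 \<le> c ==> n2 u \<le> c"
 unfolding n2_def by (intro real_le_lsqrt) (auto intro: enn2real_leI)

lemma L2_leI:
 assumes "u \<in> BM" "L2 v" "sqi u \<le> ennreal (c^2) * sqi v" "0 \<le> c"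
 shows "L2 u \<and> n2 u \<le> c * n2 v"
proof -
 have "sqi u \<le> ennreal ((c * n2 v)^2)"
  using assms(3) unfolding sqi_n2[OF assms(2)] by (simp add: power_mult_distrib ennreal_mult)
 then show ?thesis using assms n2_nonneg[of v] by (auto intro!: L2I n2_leI)
qed

lemma adm_L2:
 assumes "adm h" shows "L2 h"
proof -
 obtain M where M: "\<And>x. norm (h x) \<le> M" using assms by (auto simp: adm_def)
 have M0: "0 \<le> M" using M norm_ge_zero order_trans by blast
 have [measurable]: "h \<in> BM" using assms by (simp add: adm_def)
 have "sqi h \<le> (\<integral>\<^sup>+x. ennreal M * enorm (h x))"
  unfolding sqi_def using M M0 by (intro nn_integral_mono) (auto simp: power2_eq_square mult_right_mono intro!: ennreal_leI simp flip: ennreal_mult)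
 also have "\<dots> = ennreal M * (\<integral>\<^sup>+x. enorm (h x))" by (intro nn_integral_cmult) simp
 also have "\<dots> < \<infinity>" using adm_integrable[OF assms] by (simp add: integrable_iff_bounded ennreal_mult_less_top)
 finally show ?thesis by (simp add: L2_def)
qed

lemma nn_CS:
 assumes "L2 u" "L2 v"
 shows "(\<integral>\<^sup>+x. enorm (u x) * enorm (v x)) \<le> ennreal (n2 u * n2 v)"
proof -
 have [measurable]: "u \<in> BM" "v \<in> BM" using assms by (auto simp: L2_def)
 let ?I = "(\<integral>\<^sup>+x. enorm (u x) * enorm (v x))"
 have "?I ^ 2 \<le> (\<integral>\<^sup>+x. enorm (u x) ^ 2) * (\<integral>\<^sup>+x. enorm (v x) ^ 2)"
  by (intro Cauchy_Schwarz_nn_integral) auto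
 also have "\<dots> = sqi u * sqi v" by (simp add: sqi_def ennreal_power)
 also have "\<dots> = ennreal ((n2 u * n2 v) ^ 2)" unfolding sqi_n2[OF assms(1)] sqi_n2[OF assms(2)]
  by (simp add: power_mult_distrib ennreal_mult)
 also have "\<dots> = ennreal (n2 u * n2 v) ^ 2" using n2_nonneg[of u] n2_nonneg[of v] by (simp add: ennreal_power)
 finally have le: "?I ^ 2 \<le> ennreal (n2 u * n2 v) ^ 2" .
 show ?thesis
 proof (cases ?I)
  case (real r)
  then have "ennreal (r^2) \<le> ennreal ((n2 u * n2 v)^2)"
   using le n2_nonneg[of u] n2_nonneg[of v] by (simp add: ennreal_power)
  then have "r^2 \<le> (n2 u * n2 v)^2" by (subst (asm) ennreal_le_iff) auto
  then have "r \<le> n2 u * n2 v" by (rule power2_le_imp_le) (simp add: n2_nonneg)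
  then show ?thesis by (simp add: real ennreal_leI)
 next
  case top
  then have "top \<le> ennreal ((n2 u * n2 v) ^ 2)"
   using le n2_nonneg[of u] n2_nonneg[of v] by (simp add: power2_eq_square ennreal_mult_top ennreal_mult)
  then show ?thesis by (simp add: top_unique)
 qed
qed

lemma ip_integrable:
 assumes "L2 u" "L2 v" shows "integrable lborel (\<lambda>x. u x * cnj (v x))"
proof -
 have [measurable]: "u \<in> BM" "v \<in> BM" using assms by (auto simp: L2_def)
 have "(\<integral>\<^sup>+x. enorm (u x * cnj (v x))) \<le> ennreal (n2 u * n2 v)"
  using nn_CS[OF assms] by (simp add: norm_mult ennreal_mult)
 then show ?thesis by (intro integrableI_bounded) (auto intro: order.strict_trans1)
qed

lemma ip_le:
 assumes "L2 u" "L2 v" shows "norm (LINT x|lborel. u x * cnj (v x)) \<le> n2 u * n2 v"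
proof -
 have "enorm (LINT x|lborel. u x * cnj (v x)) \<le> (\<integral>\<^sup>+x. enorm (u x * cnj (v x)))" by (rule norm_LINT_le)
 also have "\<dots> = (\<integral>\<^sup>+x. enorm (u x) * enorm (v x))" by (simp add: norm_mult ennreal_mult)
 also have "\<dots> \<le> ennreal (n2 u * n2 v)" by (rule nn_CS[OF assms])
 finally show ?thesis using n2_nonneg[of u] n2_nonneg[of v] by (subst (asm) ennreal_le_iff) auto
qed

lemma ip_self:
 assumes "L2 u" shows "(LINT x|lborel. u x * cnj (u x)) = of_real (n2 u ^ 2)"
proof -
 have [measurable]: "u \<in> BM" using assms by (auto simp: L2_def)
 have "(LINT x|lborel. u x * cnj (u x)) = (LINT x|lborel. complex_of_real (norm (u x) ^ 2))"
  by (simp only: complex_norm_square)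
 also have "\<dots> = of_real (LINT x|lborel. norm (u x) ^ 2)" by (rule integral_complex_of_real)
 also have "(LINT x|lborel. norm (u x) ^ 2) = enn2real (sqi u)" unfolding sqi_def by (intro integral_eq_nn_integral) auto
 finally show ?thesis by (simp add: n2_def)
qed

lemma L2_add:
 assumes "L2 u" "L2 v" shows "L2 (\<lambda>x. u x + v x)" and "n2 (\<lambda>x. u x + v x) \<le> n2 u + n2 v"
proof -
 have m[measurable]: "u \<in> BM" "v \<in> BM" using assms by (auto simp: L2_def)
 have "sqi (\<lambda>x. u x + v x) \<le> (\<integral>\<^sup>+x. ennreal (norm (u x) ^ 2) + (2 * (enorm (u x) * enorm (v x)) + ennreal (norm (v x) ^ 2)))"
  unfolding sqi_def
 proof (intro nn_integral_mono)
  fix x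
  have "norm (u x + v x) ^ 2 \<le> (norm (u x) + norm (v x)) ^ 2" by (intro power_mono norm_triangle_ineq) auto
  also have "\<dots> = norm (u x) ^ 2 + (2 * (norm (u x) * norm (v x)) + norm (v x) ^ 2)" by (simp add: power2_sum)
  finally have "ennreal (norm (u x + v x) ^ 2) \<le> ennreal (norm (u x) ^ 2 + (2 * (norm (u x) * norm (v x)) + norm (v x) ^ 2))" by (rule ennreal_leI)
  then show "ennreal (norm (u x + v x) ^ 2) \<le> ennreal (norm (u x) ^ 2) + (2 * (enorm (u x) * enorm (v x)) + ennreal (norm (v x) ^ 2))"
   by (simp add: ennreal_mult)
 qed
 also have "\<dots> = sqi u + (2 * (\<integral>\<^sup>+x. enorm (u x) * enorm (v x)) + sqi v)"
  unfolding sqi_def by (simp add: nn_integral_add nn_integral_cmult)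
 also have "\<dots> \<le> sqi u + (2 * ennreal (n2 u * n2 v) + sqi v)"
  by (intro add_left_mono add_right_mono mult_left_mono nn_CS assms) auto
 also have "\<dots> = ennreal ((n2 u + n2 v)^2)"
 proof -
  have "2 * ennreal (n2 u * n2 v) = ennreal (2 * (n2 u * n2 v))"
   using n2_nonneg[of u] n2_nonneg[of v] by (simp add: ennreal_mult)
  then show ?thesis unfolding sqi_n2[OF assms(1)] sqi_n2[OF assms(2)]
   using n2_nonneg[of u] n2_nonneg[of v] by (simp add: power2_sum flip: ennreal_plus)
 qed
 finally have le: "sqi (\<lambda>x. u x + v x) \<le> ennreal ((n2 u + n2 v)^2)" .
 show "L2 (\<lambda>x. u x + v x)" by (rule L2I[OF _ le]) measurable
 show "n2 (\<lambda>x. u x + v x) \<le> n2 u + n2 v" using n2_nonneg[of u] n2_nonneg[of v] by (intro n2_leI[OF le]) auto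
qed

lemma L2_shift: "L2 u ==> L2 (\<lambda>x. u (x + h))" and n2_shift: "L2 u ==> n2 (\<lambda>x. u (x + h)) = n2 u"
proof -
 assume u: "L2 u"
 have [measurable]: "u \<in> BM" using u by (auto simp: L2_def)
 have "sqi (\<lambda>x. u (x + h)) = sqi u" unfolding sqi_def
  using lborel_nn_integral_shift[of "\<lambda>x. ennreal (norm (u x) ^ 2)" h] by simp
 then show "L2 (\<lambda>x. u (x + h))" "n2 (\<lambda>x. u (x + h)) = n2 u" using u by (auto simp: L2_def n2_def)
qed

lemma L2_bounded_mult:
 assumes "L2 u" "k \<in> BM" "\<And>x. norm (k x) * norm (u x) \<le> c * norm (u x)" "0 \<le> c"
 shows "L2 (\<lambda>x. k x * u x)" and "n2 (\<lambda>x. k x * u x) \<le> c * n2 u"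
proof -
 have [measurable]: "u \<in> BM" "k \<in> BM" using assms by (auto simp: L2_def)
 have "sqi (\<lambda>x. k x * u x) \<le> (\<integral>\<^sup>+x. ennreal (c^2) * ennreal (norm (u x) ^ 2))"
  unfolding sqi_def
 proof (intro nn_integral_mono)
  fix x
  have "norm (k x * u x) ^ 2 \<le> (c * norm (u x)) ^ 2" using assms(3)[of x] by (intro power_mono) (auto simp: norm_mult)
  then show "ennreal (norm (k x * u x) ^ 2) \<le> ennreal (c^2) * ennreal (norm (u x) ^ 2)"
   by (simp add: power_mult_distrib ennreal_leI flip: ennreal_mult)
 qed
 also have "\<dots> = ennreal (c^2) * sqi u" unfolding sqi_def by (intro nn_integral_cmult) simp
 finally have "L2 (\<lambda>x. k x * u x) \<and> n2 (\<lambda>x. k x * u x) \<le> c * n2 u" using assms by (intro L2_leI) auto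
 then show "L2 (\<lambda>x. k x * u x)" "n2 (\<lambda>x. k x * u x) \<le> c * n2 u" by auto
qed

lemma L2_indicator_integrable:
 assumes "L2 u" "S \<in> sets borel" "bounded S" shows "integrable lborel (\<lambda>x. indicator S x * u x)"
proof -
 have "adm (\<lambda>x. indicator S x)" using assms by (auto simp: adm_def indicator_def intro: bounded_subset exI[of _ 1])
 from ip_integrable[OF assms(1) adm_L2[OF this]] show ?thesis
  by (rule back_subst[of "integrable lborel"]) (auto simp: indicator_def)
qed

lemma Fubini_kernel_integrable:
 fixes h g :: "'a::euclidean_space => complex"
 assumes h: "integrable lborel h" and g: "integrable lborel g"
  and m[measurable]: "case_prod k \<in> BM2" and B: "\<And>x y. norm (k x y) \<le> B"
 shows "integrable (lborel \<Otimes>\<^sub>M lborel) (\<lambda>(x, y). k x y * h x * g y)"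
proof -
 have [measurable]: "h \<in> BM" "g \<in> BM" using h g by auto
 have m': "(\<lambda>p. k (fst p) (snd p)) \<in> BM2" using m by (simp add: case_prod_beta')
 note [measurable] = m'
 have B0: "0 \<le> B" using B norm_ge_zero order_trans by blast
 have le: "norm (k x y * h x * g y) \<le> B * norm (h x) * norm (g y)" for x y
  unfolding norm_mult using B[of x y] B0 by (intro mult_right_mono) auto
 have km: "k x \<in> BM" for x using m by measurable
 note [measurable] = km
 have inner: "integrable lborel (\<lambda>y. k x y * h x * g y)" for x
  by (rule Bochner_Integration.integrable_bound[of _ "\<lambda>y. B * norm (h x) * norm (g y)"])
   (use g le[of x] B0 in \<open>auto intro!: always_eventually intro: order_trans[OF _ abs_ge_self]\<close>)
 show ?thesis
 proof (rule lborel_pair.Fubini_integrable)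
  show "(\<lambda>(x, y). k x y * h x * g y) \<in> borel_measurable (lborel \<Otimes>\<^sub>M lborel)"
   unfolding case_prod_beta' by measurable
  show "AE x in lborel. integrable lborel (\<lambda>y. case (x, y) of (x, y) => k x y * h x * g y)" using inner by simp
  have [measurable]: "(\<lambda>x. LINT y|lborel. norm (k x y * h x * g y)) \<in> borel_measurable lborel"
   by (intro lborel.borel_measurable_lebesgue_integral) (simp add: case_prod_beta', measurable)
  have "integrable lborel (\<lambda>x. LINT y|lborel. norm (k x y * h x * g y))"
  proof (rule Bochner_Integration.integrable_bound[of _ "\<lambda>x. B * norm (h x) * (LINT y|lborel. norm (g y))"])
   show "integrable lborel (\<lambda>x. B * norm (h x) * (LINT y|lborel. norm (g y)))" using h by simp
   show "AE x in lborel. norm (LINT y|lborel. norm (k x y * h x * g y)) \<le> norm (B * norm (h x) * (LINT y|lborel. norm (g y)))"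
   proof (rule AE_I2)
    fix x
    have "(LINT y|lborel. norm (k x y * h x * g y)) \<le> (LINT y|lborel. B * norm (h x) * norm (g y))"
     using inner[of x] g le by (intro integral_mono) auto
    also have "\<dots> = B * norm (h x) * (LINT y|lborel. norm (g y))" by simp
    finally show "norm (LINT y|lborel. norm (k x y * h x * g y)) \<le> norm (B * norm (h x) * (LINT y|lborel. norm (g y)))"
     by (simp add: integral_nonneg_AE)
   qed
  qed simp
  then show "integrable lborel (\<lambda>x. LINT y|lborel. norm (case (x, y) of (x, y) => k x y * h x * g y))" by simp
 qed
qed

lemma Fubini_kernel:
 fixes h g :: "'a::euclidean_space => complex"
 assumes h: "integrable lborel h" and g: "integrable lborel g"
  and m: "case_prod k \<in> BM2" and B: "\<And>x y. norm (k x y) \<le> B"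
 shows "(LINT x|lborel. h x * (LINT y|lborel. k x y * g y)) = (LINT y|lborel. (LINT x|lborel. k x y * h x) * g y)"
proof -
 have i: "integrable (lborel \<Otimes>\<^sub>M lborel) (\<lambda>(x, y). k x y * h x * g y)" by (rule Fubini_kernel_integrable[OF assms])
 have "(LINT x|lborel. h x * (LINT y|lborel. k x y * g y)) = (LINT x|lborel. LINT y|lborel. k x y * h x * g y)"
  by (intro Bochner_Integration.integral_cong refl) (subst integral_mult_right_zero[symmetric], simp add: mult_ac)
 also have "\<dots> = (LINT y|lborel. LINT x|lborel. k x y * h x * g y)"
  by (rule lborel_pair.Fubini_integral[OF i, symmetric])
 also have "\<dots> = (LINT y|lborel. (LINT x|lborel. k x y * h x) * g y)" by simp
 finally show ?thesis .
qed

section \<open>Oscillatory integral operators\<close>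

text \<open>An amplitude at frequency scale \<open>R\<close> that is smooth in \<open>\<xi>\<close>
  along each axis; \<open>x\<close> is a mere parameter on which it depends measurably.\<close>

definition sy :: "nat => (real^'n::finite) set => real => real => (real^'n => real^'n => complex) => bool" where
 "sy N A R B b \<longleftrightarrow> case_prod b \<in> BM2 \<and>
  (\<forall>x \<xi>. \<xi> \<notin> A \<longrightarrow> b x \<xi> = 0) \<and> (\<forall>x i. dC N (ax i) A (1 / R) B (b x))"

definition Uop :: "('a::euclidean_space => 'a => complex) => ('a => complex) => 'a => complex" where
 "Uop b g x = (LINT \<xi>|lborel. (cis (x \<bullet> \<xi>) * b x \<xi>) * g \<xi>)"

definition Ustar :: "('a::euclidean_space => 'a => complex) => ('a => complex) => 'a => complex" where
 "Ustar b h \<xi> = (LINT x|lborel. cnj (cis (x \<bullet> \<xi>) * b x \<xi>) * h x)"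

lemma cis_inner2_measurable[measurable]:
 "(\<lambda>p. cis (fst p \<bullet> snd p)) \<in> borel_measurable (borel \<Otimes>\<^sub>M (borel :: 'a::euclidean_space measure))"
 unfolding borel_prod by (intro borel_measurable_continuous_onI continuous_intros)

text \<open>The constant of \<open>kern_decay\<close> for a product of two amplitudes:
  \<open>2 ^ N\<close> by Leibniz' rule, \<open>4 ^ n\<close> from the volume
  \<open>(4 R)^n\<close>, \<open>(2 n)^N\<close> from the moments, with
  \<open>N = n + 2\<close>.\<close>

definition Dk :: "nat => real" where "Dk n = 2 ^ (n + 2) * 4 ^ n * (2 * real n) ^ (n + 2)"

lemma Dk_pos: "0 < n ==> 0 < Dk n" by (simp add: Dk_def)

context
 fixes A :: "(real^'n::finite) set" and R B :: real and b :: "real^'n => real^'n => complex" and N :: nat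
 assumes sy: "sy N A R B b" and A: "bounded A" "closed A" "vol A \<le> ennreal ((4 * R) ^ CARD('n))"
  and R: "0 < R" and B: "0 \<le> B" and N: "N = CARD('n) + 2"
begin

lemma b_meas[measurable]: "case_prod b \<in> BM2" using sy by (simp add: sy_def)
lemma b_zero: "\<xi> \<notin> A ==> b x \<xi> = 0" using sy by (simp add: sy_def)
lemma b_dC: "dC N (ax i) A (1 / R) B (b x)" using sy by (simp add: sy_def)

lemma b_bound: "norm (b x \<xi>) \<le> B"
 using dC_bound[OF b_dC, of \<xi>] b_zero[of \<xi> x] B by (cases "\<xi> \<in> A") auto

lemma b_meas2[measurable]: "(\<lambda>p. b (fst p) (snd p)) \<in> BM2"
 using b_meas by (simp add: case_prod_beta')

lemma b_meas1[measurable]: "b x \<in> BM" "(\<lambda>x. b x \<xi>) \<in> BM"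
proof -
 show "b x \<in> BM" using b_meas by measurable
 show "(\<lambda>x. b x \<xi>) \<in> BM" using b_meas by measurable
qed

lemma cisb_meas: "case_prod (\<lambda>x \<xi>. cis (x \<bullet> \<xi>) * b x \<xi>) \<in> BM2"
 unfolding case_prod_beta' by measurable

lemma cisb_bound: "norm (cis (x \<bullet> \<xi>) * b x \<xi>) \<le> B"
 using b_bound by (simp add: norm_mult)

lemma cisb_bound_cnj: "norm (cnj (cis (x \<bullet> \<xi>) * b x \<xi>)) \<le> B"
 unfolding complex_mod_cnj by (rule cisb_bound)

lemma Uop_meas:
 assumes [measurable]: "g \<in> BM" shows "Uop b g \<in> BM"
 unfolding Uop_def by (intro lborel.borel_measurable_lebesgue_integral) (simp add: case_prod_beta', measurable)

lemma Ustar_meas: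
 assumes [measurable]: "h \<in> BM" shows "Ustar b h \<in> BM"
proof -
 have "(\<lambda>p. cis (snd p \<bullet> fst p) * b (snd p) (fst p)) \<in> BM2"
  using measurable_compose[OF measurable_pair_swap' cisb_meas] by (simp add: case_prod_beta')
 note [measurable] = this
 show ?thesis unfolding Ustar_def
  by (intro lborel.borel_measurable_lebesgue_integral) (simp only: case_prod_beta', measurable)
qed

lemma Uop_indicator: "Uop b g = Uop b (\<lambda>\<xi>. indicator A \<xi> * g \<xi>)"
 unfolding Uop_def fun_eq_iff by (intro allI Bochner_Integration.integral_cong) (auto simp: indicator_def b_zero)

lemma adjoint:
 assumes h: "adm h" and g: "integrable lborel g"
 shows "(LINT x|lborel. h x * cnj (Uop b g x)) = (LINT \<xi>|lborel. Ustar b h \<xi> * cnj (g \<xi>))"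
proof -
 have "(LINT x|lborel. h x * cnj (Uop b g x)) = (LINT x|lborel. h x * (LINT \<xi>|lborel. cnj (cis (x \<bullet> \<xi>) * b x \<xi>) * cnj (g \<xi>)))"
 proof -
  have "cnj (Uop b g x) = (LINT \<xi>|lborel. cnj (cis (x \<bullet> \<xi>) * b x \<xi>) * cnj (g \<xi>))" for x
   unfolding Uop_def by (subst Bochner_Integration.integral_cnj[symmetric]) simp
  then show ?thesis by simp
 qed
 also have "\<dots> = (LINT \<xi>|lborel. (LINT x|lborel. cnj (cis (x \<bullet> \<xi>) * b x \<xi>) * h x) * cnj (g \<xi>))"
 proof (rule Fubini_kernel[OF adm_integrable[OF h]])
  show "integrable lborel (\<lambda>\<xi>. cnj (g \<xi>))" using g by simp
  show "case_prod (\<lambda>x \<xi>. cnj (cis (x \<bullet> \<xi>) * b x \<xi>)) \<in> BM2"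
   using cisb_meas unfolding case_prod_beta' by measurable
  show "norm (cnj (cis (x \<bullet> \<xi>) * b x \<xi>)) \<le> B" for x \<xi> by (rule cisb_bound_cnj)
 qed
 finally show ?thesis by (simp add: Ustar_def)
qed

text \<open>This is the kernel of \<open>Uop\<close> composed with its adjoint. Integration by parts
  acts on \<open>\<xi>\<close> only, so the roughness in \<open>x\<close> and \<open>x'\<close> does
  no harm.\<close>

lemma TT_kernel: "norm (kern (\<lambda>\<xi>. b x \<xi> * cnj (b x' \<xi>)) z) \<le> Dk CARD('n) * B^2 * bmp R z"
proof -
 have "norm (kern (\<lambda>\<xi>. b x \<xi> * cnj (b x' \<xi>)) z) \<le> (2 ^ N * B * B) * (4 * R) ^ CARD('n) * (2 * real CARD('n)) ^ N / (1 + R * norm z) ^ N"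
 proof (rule kern_decay[OF _ A])
  show "dC N (ax i) A (1 / R) (2 ^ N * B * B) (\<lambda>\<xi>. b x \<xi> * cnj (b x' \<xi>))" for i
   using B R by (intro dC_mult dC_cnj b_dC) auto
 qed (use B R b_zero in auto)
 also have "\<dots> = Dk CARD('n) * B^2 * (R ^ CARD('n) / (1 + R * norm z) ^ N)"
  by (simp add: Dk_def N power2_eq_square power_mult_distrib)
 also have "\<dots> \<le> Dk CARD('n) * B^2 * (R ^ CARD('n) / (1 + R * norm z) ^ (CARD('n) + 1))"
  using R B unfolding N by (intro mult_left_mono divide_left_mono power_increasing) (auto intro!: mult_pos_pos mult_nonneg_nonneg zero_less_power add_pos_nonneg less_imp_le[OF Dk_pos])
 finally show ?thesis by (simp add: bump_def)
qed

lemma Ustar_bounded_adm: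
 assumes h: "adm h" shows "adm (Ustar b h)"
proof -
 have [measurable]: "h \<in> BM" using h by (simp add: adm_def)
 have "norm (Ustar b h \<xi>) \<le> B * (LINT x|lborel. norm (h x))" for \<xi>
 proof -
  have i: "integrable lborel (\<lambda>x. norm (h x))" using adm_integrable[OF h] by simp
  have "norm (Ustar b h \<xi>) \<le> (LINT x|lborel. B * norm (h x))"
   unfolding Ustar_def
  proof (rule Bochner_Integration.integral_norm_bound_integral)
   show "integrable lborel (\<lambda>x. cnj (cis (x \<bullet> \<xi>) * b x \<xi>) * h x)"
   proof (rule integrable_mult_bounded[OF adm_integrable[OF h], of _ B])
    have "(\<lambda>x. cis (x \<bullet> \<xi>)) \<in> BM" by (intro borel_measurable_continuous_onI continuous_intros)
    then show "(\<lambda>x. cnj (cis (x \<bullet> \<xi>) * b x \<xi>)) \<in> BM" by measurable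
   qed (rule cisb_bound_cnj)
   show "norm (cnj (cis (x \<bullet> \<xi>) * b x \<xi>) * h x) \<le> B * norm (h x)" for x
    unfolding norm_mult[of _ "h x"] by (intro mult_right_mono cisb_bound_cnj norm_ge_zero)
  qed (use i in simp)
  then show ?thesis by simp
 qed
 moreover have "bounded {\<xi>. Ustar b h \<xi> \<noteq> 0}"
 proof (rule bounded_subset[OF A(1)])
  show "{\<xi>. Ustar b h \<xi> \<noteq> 0} \<subseteq> A" by (auto simp: Ustar_def b_zero) (use b_zero in force)
 qed
 ultimately show ?thesis using Ustar_meas unfolding adm_def by auto
qed

lemma UUstar:
 assumes h: "adm h"
 shows "Uop b (Ustar b h) x = (LINT x'|lborel. kern (\<lambda>\<xi>. b x \<xi> * cnj (b x' \<xi>)) (x - x') * h x')"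
proof -
 define g where "g \<xi> = (cis (x \<bullet> \<xi>) * b x \<xi>)" for \<xi>
 have gi: "integrable lborel g"
  unfolding g_def by (rule integrable_bounded_support[of _ A B]) (use cisb_bound b_zero A in auto)
 have "Uop b (Ustar b h) x = (LINT \<xi>|lborel. (LINT x'|lborel. cnj (cis (x' \<bullet> \<xi>) * b x' \<xi>) * h x') * g \<xi>)"
  unfolding Uop_def Ustar_def g_def by (simp only: mult.commute)
 also have "\<dots> = (LINT x'|lborel. h x' * (LINT \<xi>|lborel. cnj (cis (x' \<bullet> \<xi>) * b x' \<xi>) * g \<xi>))"
 proof (rule Fubini_kernel[OF adm_integrable[OF h] gi, symmetric])
  show "case_prod (\<lambda>x \<xi>. cnj (cis (x \<bullet> \<xi>) * b x \<xi>)) \<in> BM2"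
   using cisb_meas unfolding case_prod_beta' by measurable
  show "norm (cnj (cis (x \<bullet> \<xi>) * b x \<xi>)) \<le> B" for x \<xi> by (rule cisb_bound_cnj)
 qed
 also have "\<dots> = (LINT x'|lborel. kern (\<lambda>\<xi>. b x \<xi> * cnj (b x' \<xi>)) (x - x') * h x')"
 proof (intro Bochner_Integration.integral_cong refl)
  fix x'
  have "cnj (cis (x' \<bullet> \<xi>) * b x' \<xi>) * g \<xi> = cis ((x - x') \<bullet> \<xi>) * (b x \<xi> * cnj (b x' \<xi>))" for \<xi>
  proof -
   have "cis ((x - x') \<bullet> \<xi>) = cnj (cis (x' \<bullet> \<xi>)) * cis (x \<bullet> \<xi>)"
    by (simp add: inner_diff_left cis_cnj cis_mult)
   then show ?thesis by (simp add: g_def)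
  qed
  then show "h x' * (LINT \<xi>|lborel. cnj (cis (x' \<bullet> \<xi>) * b x' \<xi>) * g \<xi>) = kern (\<lambda>\<xi>. b x \<xi> * cnj (b x' \<xi>)) (x - x') * h x'"
   unfolding kern_def by (simp only: mult.commute)
 qed
 finally show ?thesis .
qed

text \<open>Schur's test: \<open>norm (h x) * norm (h y)\<close> is at most half the sum of the
  squares, and the profile has bounded integral in either variable.\<close>

lemma schur:
 fixes h :: "real^'n => complex"
 assumes h: "adm h"
 shows "(\<integral>\<^sup>+x. enorm (h x) * (\<integral>\<^sup>+y. ennreal (bmp R (x - y)) * enorm (h y)))
  \<le> ennreal (bconst TYPE(real^'n)) * sqi h"
proof -
 have [measurable]: "h \<in> BM" using h by (simp add: adm_def)
 let ?b = "bconst TYPE(real^'n)"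
 let ?k = "\<lambda>x y. ennreal (bmp R (x - y))"
 let ?s = "\<lambda>x. ennreal (norm (h x) ^ 2)"
 have km[measurable]: "(\<lambda>p. ?k (fst p) (snd p)) \<in> borel_measurable (borel \<Otimes>\<^sub>M (borel :: (real^'n) measure))" by measurable
 have "(\<integral>\<^sup>+x. enorm (h x) * (\<integral>\<^sup>+y. ?k x y * enorm (h y)))
  = (\<integral>\<^sup>+x. (\<integral>\<^sup>+y. enorm (h x) * (?k x y * enorm (h y))))"
  by (subst nn_integral_cmult) auto
 also have "\<dots> \<le> (\<integral>\<^sup>+x. (\<integral>\<^sup>+y. ennreal (1/2) * (?k x y * ?s x) + ennreal (1/2) * (?k x y * ?s y)))"
 proof (intro nn_integral_mono)
  fix x y
  have "0 \<le> (norm (h x) - norm (h y))^2" by simp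
  then have "norm (h x) * norm (h y) \<le> 1/2 * norm (h x)^2 + 1/2 * norm (h y)^2" by (simp add: power2_diff)
  then have "bmp R (x - y) * (norm (h x) * norm (h y)) \<le> bmp R (x - y) * (1/2 * norm (h x)^2 + 1/2 * norm (h y)^2)"
   using bmp_nonneg[OF R] by (intro mult_left_mono)
  then have "ennreal (norm (h x) * (bmp R (x - y) * norm (h y))) \<le> ennreal (1/2 * (bmp R (x - y) * norm (h x)^2) + 1/2 * (bmp R (x - y) * norm (h y)^2))"
   by (intro ennreal_leI) (simp add: algebra_simps)
  moreover have "ennreal (1/2 * (bmp R (x - y) * norm (h x)^2) + 1/2 * (bmp R (x - y) * norm (h y)^2))
    = ennreal (1/2) * (?k x y * ?s x) + ennreal (1/2) * (?k x y * ?s y)"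
   using bmp_nonneg[OF R, of "x - y"] by (subst ennreal_plus) (simp_all only: ennreal_mult mult_nonneg_nonneg zero_le_power norm_ge_zero zero_le_divide_1_iff zero_le_numeral divide_nonneg_nonneg zero_le_one)
  ultimately show "enorm (h x) * (?k x y * enorm (h y)) \<le> ennreal (1/2) * (?k x y * ?s x) + ennreal (1/2) * (?k x y * ?s y)"
   using bmp_nonneg[OF R, of "x - y"] by (simp only: ennreal_mult mult_nonneg_nonneg norm_ge_zero)
 qed
 also have "\<dots> = ennreal (1/2) * (\<integral>\<^sup>+x. (\<integral>\<^sup>+y. ?k x y * ?s x)) + ennreal (1/2) * (\<integral>\<^sup>+x. (\<integral>\<^sup>+y. ?k x y * ?s y))"
  by (simp add: nn_integral_add nn_integral_cmult)
 finally have fin: "(\<integral>\<^sup>+x. enorm (h x) * (\<integral>\<^sup>+y. ?k x y * enorm (h y)))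
  \<le> ennreal (1/2) * (\<integral>\<^sup>+x. (\<integral>\<^sup>+y. ?k x y * ?s x)) + ennreal (1/2) * (\<integral>\<^sup>+x. (\<integral>\<^sup>+y. ?k x y * ?s y))" .
 have i1: "(\<integral>\<^sup>+x. (\<integral>\<^sup>+y. ?k x y * ?s x)) \<le> ennreal ?b * sqi h"
 proof -
  have "(\<integral>\<^sup>+x. (\<integral>\<^sup>+y. ?k x y * ?s x)) = (\<integral>\<^sup>+x. (\<integral>\<^sup>+y. ?k x y) * ?s x)"
   by (simp add: nn_integral_multc)
  also have "\<dots> \<le> (\<integral>\<^sup>+x. ennreal ?b * ?s x)"
   by (intro nn_integral_mono mult_right_mono nn_integral_bmp_1(1)[OF R]) auto
  also have "\<dots> = ennreal ?b * sqi h" unfolding sqi_def by (intro nn_integral_cmult) simp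
  finally show ?thesis .
 qed
 have i2: "(\<integral>\<^sup>+x. (\<integral>\<^sup>+y. ?k x y * ?s y)) \<le> ennreal ?b * sqi h"
 proof -
  have "(\<integral>\<^sup>+x. (\<integral>\<^sup>+y. ?k x y * ?s y)) = (\<integral>\<^sup>+y. (\<integral>\<^sup>+x. ?k x y * ?s y))"
   by (rule lborel_pair.Fubini') (simp add: case_prod_beta')
  also have "\<dots> = (\<integral>\<^sup>+y. (\<integral>\<^sup>+x. ?k x y) * ?s y)"
   by (simp add: nn_integral_multc)
  also have "\<dots> \<le> (\<integral>\<^sup>+x. ennreal ?b * ?s x)"
   by (intro nn_integral_mono mult_right_mono nn_integral_bmp_1(2)[OF R]) auto
  also have "\<dots> = ennreal ?b * sqi h" unfolding sqi_def by (intro nn_integral_cmult) simp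
  finally show ?thesis .
 qed
 have "ennreal (1/2) * (ennreal ?b * sqi h) + ennreal (1/2) * (ennreal ?b * sqi h) = (ennreal (1/2) + ennreal (1/2)) * (ennreal ?b * sqi h)"
  by (rule distrib_right[symmetric])
 also have "ennreal (1/2) + ennreal (1/2) = 1" by (subst ennreal_plus[symmetric]) auto
 finally have half: "ennreal (1/2) * (ennreal ?b * sqi h) + ennreal (1/2) * (ennreal ?b * sqi h) = ennreal ?b * sqi h" by simp
 show ?thesis
  by (rule order_trans[OF fin]) (subst half[symmetric], intro add_mono mult_left_mono i1 i2, simp_all)
qed

end

definition Cb :: "'n::finite itself => real" where
 "Cb _ = sqrt (Dk CARD('n) * bconst TYPE(real^'n))"

lemma Cb_sq: "Cb TYPE('n::finite) ^ 2 = Dk CARD('n) * bconst TYPE(real^'n)" and Cb_pos: "0 < Cb TYPE('n::finite)"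
proof -
 have "0 < Dk CARD('n) * bconst TYPE(real^'n)" by (intro mult_pos_pos Dk_pos bconst_pos) simp
 then show "Cb TYPE('n::finite) ^ 2 = Dk CARD('n) * bconst TYPE(real^'n)" "0 < Cb TYPE('n::finite)" by (simp_all add: Cb_def)
qed

lemma nn_integral_cball_limit:
 fixes f :: "'a::euclidean_space => ennreal"
 assumes [measurable]: "f \<in> BM" and le: "\<And>r::nat. (\<integral>\<^sup>+x\<in>S r. f x \<partial>lborel) \<le> c"
  and S: "\<And>r. S r \<in> sets borel" "incseq S" "(\<Union>r. S r) = UNIV"
 shows "(\<integral>\<^sup>+x. f x) \<le> c"
proof -
 have [measurable]: "S r \<in> sets borel" for r by (rule S)
 have pt: "(SUP r. f x * indicator (S r) x) = f x" for x
 proof (rule antisym)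
  obtain r where "x \<in> S r" using S(3) by blast
  then show "f x \<le> (SUP r. f x * indicator (S r) x)" by (intro SUP_upper2[of r]) auto
 qed (auto intro!: SUP_least simp: indicator_def)
 have "(\<integral>\<^sup>+x. f x) = (\<integral>\<^sup>+x. (SUP r. f x * indicator (S r) x))" by (simp add: pt)
 also have "\<dots> = (SUP r. \<integral>\<^sup>+x\<in>S r. f x \<partial>lborel)"
 proof (rule nn_integral_monotone_convergence_SUP)
  show "incseq (\<lambda>r x. f x * indicator (S r) x)"
   using S(2) by (auto simp: incseq_def le_fun_def indicator_def intro!: mult_left_mono)
 qed measurable
 also have "\<dots> \<le> c" by (intro SUP_least le)
 finally show ?thesis .
qed

section \<open>L^2 bounds through the composition with the adjoint\<close>

context
 fixes A :: "(real^'n::finite) set" and R B :: real and b :: "real^'n => real^'n => complex" and N :: nat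
 assumes sy: "sy N A R B b" and A: "bounded A" "closed A" "vol A \<le> ennreal ((4 * R) ^ CARD('n))"
  and R: "0 < R" and B: "0 \<le> B" and N: "N = CARD('n) + 2"
begin

text \<open>For \<open>w = Ustar b h\<close> the square of the norm is the pairing of
  \<open>h\<close> with \<open>Uop b w\<close>, whose kernel against \<open>h\<close> decays like
  the profile; Schur's test finishes.\<close>

lemma Ustar_L2:
 assumes h: "adm h" shows "L2 (Ustar b h)" and "n2 (Ustar b h) \<le> Cb TYPE('n) * B * n2 h"
proof -
 have [measurable]: "h \<in> BM" using h by (simp add: adm_def)
 define w where "w = Ustar b h"
 have aw: "adm w" unfolding w_def by (rule Ustar_bounded_adm[OF sy A R B N h])
 show "L2 (Ustar b h)" using adm_L2[OF aw] by (simp add: w_def)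
 have Dp: "0 \<le> Dk CARD('n) * B^2" using Dk_pos[of "CARD('n)"] by (simp add: less_imp_le)
 have "of_real (n2 w ^ 2) = (LINT \<xi>|lborel. Ustar b h \<xi> * cnj (w \<xi>))"
  using ip_self[OF adm_L2[OF aw]] by (simp add: w_def)
 also have "\<dots> = (LINT x|lborel. h x * cnj (Uop b w x))"
  by (rule adjoint[OF sy A R B N h adm_integrable[OF aw], symmetric])
 finally have eq: "of_real (n2 w ^ 2) = (LINT x|lborel. h x * cnj (Uop b w x))" .
 have Uw: "enorm (Uop b w x) \<le> ennreal (Dk CARD('n) * B^2) * (\<integral>\<^sup>+y. ennreal (bmp R (x - y)) * enorm (h y))" for x
 proof -
  have "enorm (Uop b w x) \<le> (\<integral>\<^sup>+y. enorm (kern (\<lambda>\<xi>. b x \<xi> * cnj (b y \<xi>)) (x - y) * h y))"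
   unfolding w_def UUstar[OF sy A R B N h] by (rule norm_LINT_le)
  also have "\<dots> \<le> (\<integral>\<^sup>+y. ennreal (Dk CARD('n) * B^2) * (ennreal (bmp R (x - y)) * enorm (h y)))"
  proof (intro nn_integral_mono)
   fix y
   have "norm (kern (\<lambda>\<xi>. b x \<xi> * cnj (b y \<xi>)) (x - y) * h y) \<le> Dk CARD('n) * B^2 * (bmp R (x - y) * norm (h y))"
    unfolding norm_mult mult.assoc[symmetric] by (intro mult_right_mono TT_kernel[OF sy A R B N]) auto
   then have "enorm (kern (\<lambda>\<xi>. b x \<xi> * cnj (b y \<xi>)) (x - y) * h y) \<le> ennreal (Dk CARD('n) * B^2 * (bmp R (x - y) * norm (h y)))"
    by (rule ennreal_leI)
   also have "\<dots> = ennreal (Dk CARD('n) * B^2) * (ennreal (bmp R (x - y)) * enorm (h y))"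
    using Dp bmp_nonneg[OF R, of "x - y"] by (subst ennreal_mult, simp, simp, subst ennreal_mult) auto
   finally show "enorm (kern (\<lambda>\<xi>. b x \<xi> * cnj (b y \<xi>)) (x - y) * h y) \<le> ennreal (Dk CARD('n) * B^2) * (ennreal (bmp R (x - y)) * enorm (h y))" .
  qed
  also have "\<dots> = ennreal (Dk CARD('n) * B^2) * (\<integral>\<^sup>+y. ennreal (bmp R (x - y)) * enorm (h y))"
   by (intro nn_integral_cmult) measurable
  finally show ?thesis .
 qed
 have "ennreal (n2 w ^ 2) = enorm (complex_of_real (n2 w ^ 2))" unfolding norm_of_real by simp
 also have "\<dots> \<le> (\<integral>\<^sup>+x. enorm (h x * cnj (Uop b w x)))" unfolding eq by (rule norm_LINT_le)
 also have "\<dots> \<le> (\<integral>\<^sup>+x. ennreal (Dk CARD('n) * B^2) * (enorm (h x) * (\<integral>\<^sup>+y. ennreal (bmp R (x - y)) * enorm (h y))))"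
 proof (intro nn_integral_mono)
  fix x
  have "enorm (h x * cnj (Uop b w x)) = enorm (h x) * enorm (Uop b w x)" by (simp add: norm_mult ennreal_mult)
  also have "\<dots> \<le> enorm (h x) * (ennreal (Dk CARD('n) * B^2) * (\<integral>\<^sup>+y. ennreal (bmp R (x - y)) * enorm (h y)))"
   by (intro mult_left_mono Uw) auto
  finally show "enorm (h x * cnj (Uop b w x)) \<le> ennreal (Dk CARD('n) * B^2) * (enorm (h x) * (\<integral>\<^sup>+y. ennreal (bmp R (x - y)) * enorm (h y)))"
   by (simp add: mult_ac)
 qed
 also have "\<dots> = ennreal (Dk CARD('n) * B^2) * (\<integral>\<^sup>+x. enorm (h x) * (\<integral>\<^sup>+y. ennreal (bmp R (x - y)) * enorm (h y)))"
  by (intro nn_integral_cmult) measurable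
 also have "\<dots> \<le> ennreal (Dk CARD('n) * B^2) * (ennreal (bconst TYPE(real^'n)) * sqi h)"
  by (intro mult_left_mono schur[OF sy A R B N h]) auto
 also have "\<dots> = ennreal (Dk CARD('n) * B^2 * bconst TYPE(real^'n) * n2 h ^ 2)"
  unfolding sqi_n2[OF adm_L2[OF h]] mult.assoc[of "Dk CARD('n) * B^2"] using Dp bconst_pos[where 'a="real^'n"]
  by (subst ennreal_mult, simp, simp, subst ennreal_mult) auto
 also have "Dk CARD('n) * B^2 * bconst TYPE(real^'n) * n2 h ^ 2 = (Cb TYPE('n) * B * n2 h) ^ 2"
  unfolding power_mult_distrib Cb_sq by simp
 finally have "n2 w ^ 2 \<le> (Cb TYPE('n) * B * n2 h) ^ 2" by (subst (asm) ennreal_le_iff) auto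
 then show "n2 (Ustar b h) \<le> Cb TYPE('n) * B * n2 h" unfolding w_def
  by (rule power2_le_imp_le) (use Cb_pos[where 'n='n] B n2_nonneg[of h] in auto)
qed

lemma cisg_integrable:
 assumes g: "L2 g" shows "integrable lborel (\<lambda>\<xi>. (cis (y \<bullet> \<xi>) * b x \<xi>) * g \<xi>)"
proof -
 have i: "integrable lborel (\<lambda>\<xi>. indicator A \<xi> * g \<xi>)"
  using A by (intro L2_indicator_integrable[OF g]) auto
 have [measurable]: "b x \<in> BM" by (rule b_meas1[OF sy A R B N])
 have "integrable lborel (\<lambda>\<xi>. (cis (y \<bullet> \<xi>) * b x \<xi>) * (indicator A \<xi> * g \<xi>))"
 proof (rule integrable_mult_bounded[OF i])
  show "norm (cis (y \<bullet> \<xi>) * b x \<xi>) \<le> B" for \<xi> using b_bound[OF sy A R B N] by (simp add: norm_mult)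
 qed measurable
 moreover have "(cis (y \<bullet> \<xi>) * b x \<xi>) * (indicator A \<xi> * g \<xi>) = (cis (y \<bullet> \<xi>) * b x \<xi>) * g \<xi>" for \<xi>
  by (cases "\<xi> \<in> A") (simp_all add: b_zero[OF sy A R B N])
 ultimately show ?thesis by simp
qed

text \<open>Duality with the restriction of \<open>Uop b g\<close> to a ball, which is admissible:
  its squared norm is at most \<open>C * n2 h * n2 g\<close>, one factor \<open>n2 h\<close>
  cancels, and the ball grows.\<close>

lemma Uop_L2:
 assumes g: "L2 g" shows "L2 (Uop b g)" and "n2 (Uop b g) \<le> Cb TYPE('n) * B * n2 g"
proof -
 have gm[measurable]: "g \<in> BM" using g by (simp add: L2_def)
 define g' where "g' = (\<lambda>\<xi>. indicator A \<xi> * g \<xi>)"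
 have Am[measurable]: "A \<in> sets borel" using A by simp
 have i: "integrable lborel g'" unfolding g'_def using A by (intro L2_indicator_integrable[OF g]) auto
 have g': "L2 g'" "n2 g' \<le> 1 * n2 g"
  unfolding g'_def using L2_bounded_mult[OF g, of "indicator A" 1] by (auto simp: indicator_def)
 have U: "Uop b g = Uop b g'" unfolding g'_def by (rule Uop_indicator[OF sy A R B N])
 have Um[measurable]: "Uop b g \<in> BM" by (rule Uop_meas[OF sy A R B N]) simp
 have Ub: "norm (Uop b g x) \<le> B * (LINT \<xi>|lborel. norm (g' \<xi>))" for x
 proof -
  have "norm (Uop b g' x) \<le> (LINT \<xi>|lborel. B * norm (g' \<xi>))"
   unfolding Uop_def
  proof (rule Bochner_Integration.integral_norm_bound_integral)
   show "integrable lborel (\<lambda>\<xi>. cis (x \<bullet> \<xi>) * b x \<xi> * g' \<xi>)" by (rule cisg_integrable[OF g'(1)])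
   show "norm (cis (x \<bullet> \<xi>) * b x \<xi> * g' \<xi>) \<le> B * norm (g' \<xi>)" for \<xi>
    unfolding norm_mult[of _ "g' \<xi>"] by (intro mult_right_mono cisb_bound[OF sy A R B N]) auto
  qed (use i in simp)
  then show ?thesis by (simp add: U)
 qed
 define C where "C = Cb TYPE('n) * B"
 have C: "0 \<le> C" using Cb_pos[where 'n='n] B by (simp add: C_def)
 have key: "(\<integral>\<^sup>+x\<in>cball 0 (real r). ennreal (norm (Uop b g x) ^ 2) \<partial>lborel) \<le> ennreal ((C * n2 g)^2)" for r
 proof -
  define h where "h x = indicator (cball 0 (real r)) x * Uop b g x" for x
  have ah: "adm h" unfolding adm_def
  proof (intro conjI exI allI)
   show "h \<in> BM" unfolding h_def by (intro borel_measurable_times Um borel_measurable_indicator) simp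
   show "bounded {x. h x \<noteq> 0}" by (rule bounded_subset[OF bounded_cball[of 0 "real r"]]) (auto simp: h_def indicator_def)
   show "norm (h x) \<le> B * (LINT \<xi>|lborel. norm (g' \<xi>))" for x
    using Ub[of x] order_trans[OF norm_ge_zero Ub[of x]] by (auto simp: h_def indicator_def)
  qed
  have "of_real (n2 h ^ 2) = (LINT x|lborel. h x * cnj (h x))" by (rule ip_self[OF adm_L2[OF ah], symmetric])
  also have "\<dots> = (LINT x|lborel. h x * cnj (Uop b g' x))"
   by (intro Bochner_Integration.integral_cong) (auto simp: h_def indicator_def U)
  also have "\<dots> = (LINT \<xi>|lborel. Ustar b h \<xi> * cnj (g' \<xi>))" by (rule adjoint[OF sy A R B N ah i])
  finally have "complex_of_real (n2 h ^ 2) = (LINT \<xi>|lborel. Ustar b h \<xi> * cnj (g' \<xi>))" .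
  then have "norm (complex_of_real (n2 h ^ 2)) \<le> n2 (Ustar b h) * n2 g'"
   using ip_le[OF Ustar_L2(1)[OF ah] g'(1)] by metis
  then have "n2 h ^ 2 \<le> n2 (Ustar b h) * n2 g'" unfolding norm_of_real by simp
  also have "\<dots> \<le> (C * n2 h) * n2 g"
   using Ustar_L2(2)[OF ah] g'(2) C n2_nonneg[of h] n2_nonneg[of g'] unfolding C_def by (intro mult_mono) auto
  finally have "n2 h * n2 h \<le> n2 h * (C * n2 g)" by (simp add: power2_eq_square mult_ac)
  then have "n2 h \<le> C * n2 g" using n2_nonneg[of h] C n2_nonneg[of g]
   by (cases "n2 h = 0") (auto dest: mult_left_le_imp_le)
  then have "n2 h ^ 2 \<le> (C * n2 g)^2" using n2_nonneg[of h] by (intro power_mono) auto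
  then have "sqi h \<le> ennreal ((C * n2 g)^2)" unfolding sqi_n2[OF adm_L2[OF ah]] by (rule ennreal_leI)
  moreover have "sqi h = (\<integral>\<^sup>+x\<in>cball 0 (real r). ennreal (norm (Uop b g x) ^ 2) \<partial>lborel)"
   unfolding sqi_def by (intro nn_integral_cong) (auto simp: h_def indicator_def)
  ultimately show ?thesis by simp
 qed
 have "sqi (Uop b g) \<le> ennreal ((C * n2 g)^2)"
  unfolding sqi_def
 proof (rule nn_integral_cball_limit[where S="\<lambda>r. cball 0 (real r)"])
  show "(\<Union>r. cball 0 (real r)) = (UNIV :: (real^'n) set)" using real_arch_simple by (auto simp: dist_norm)
 qed (use key in \<open>auto simp: incseq_def\<close>)
 then show "L2 (Uop b g)" "n2 (Uop b g) \<le> Cb TYPE('n) * B * n2 g"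
  using C n2_nonneg[of g] by (auto intro!: L2I n2_leI simp flip: C_def)
qed

lemma Uop_mult_diff:
 assumes g: "L2 g" "L2 g2" shows "Uop b (\<lambda>\<xi>. g \<xi> - g2 \<xi>) x = Uop b g x - Uop b g2 x"
 using cisg_integrable[OF g(1)] cisg_integrable[OF g(2)] unfolding Uop_def by (simp add: right_diff_distrib)

lemma Uop_sum:
 assumes g: "\<And>i. i \<in> I ==> L2 (g i)" shows "Uop b (\<lambda>\<xi>. \<Sum>i\<in>I. g i \<xi>) x = (\<Sum>i\<in>I. Uop b (g i) x)"
 using cisg_integrable[OF g] unfolding Uop_def by (simp add: sum_distrib_left)

text \<open>Modulating \<open>g\<close> translates the output, except that the amplitude also
  depends on \<open>x\<close>; the error is the operator with the difference of two
  amplitudes.\<close>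

lemma Uop_shift:
 assumes g: "L2 g" and sy': "sy N A R B' (\<lambda>x \<xi>. b x \<xi> - b (x - h) \<xi>)"
 shows "Uop b (\<lambda>\<xi>. cis (h \<bullet> \<xi>) * g \<xi>) x = Uop b g (x + h) - Uop (\<lambda>x \<xi>. b x \<xi> - b (x - h) \<xi>) g (x + h)"
proof -
 have "Uop b g (x + h) - Uop (\<lambda>x \<xi>. b x \<xi> - b (x - h) \<xi>) g (x + h) =
  (LINT \<xi>|lborel. (cis ((x + h) \<bullet> \<xi>) * b (x + h) \<xi>) * g \<xi> - (cis ((x + h) \<bullet> \<xi>) * (b (x + h) \<xi> - b (x + h - h) \<xi>)) * g \<xi>)"
  unfolding Uop_def
 proof (rule Bochner_Integration.integral_diff[symmetric])
  have "integrable lborel (\<lambda>\<xi>. cis ((x + h) \<bullet> \<xi>) * b (x + h) \<xi> * g \<xi> - cis ((x + h) \<bullet> \<xi>) * b x \<xi> * g \<xi>)"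
   by (intro Bochner_Integration.integrable_diff cisg_integrable g)
  then show "integrable lborel (\<lambda>\<xi>. cis ((x + h) \<bullet> \<xi>) * (b (x + h) \<xi> - b (x + h - h) \<xi>) * g \<xi>)"
   by (simp add: right_diff_distrib left_diff_distrib)
 qed (rule cisg_integrable[OF g])
 also have "\<dots> = Uop b (\<lambda>\<xi>. cis (h \<bullet> \<xi>) * g \<xi>) x"
  unfolding Uop_def by (intro Bochner_Integration.integral_cong) (auto simp: inner_add_left algebra_simps simp flip: cis_mult)
 finally show ?thesis by simp
qed

end

section \<open>Bessel's inequality\<close>

lemma fourier_measurable:
 assumes [measurable]: "h \<in> BM" shows "fourier h \<in> BM"
proof -
 have "(\<lambda>p. cis (- (snd p \<bullet> fst p))) \<in> borel_measurable (borel \<Otimes>\<^sub>M (borel :: (real^'n) measure))"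
  unfolding borel_prod by (intro borel_measurable_continuous_onI continuous_intros)
 note [measurable] = this
 show ?thesis unfolding fourier_def
  by (intro lborel.borel_measurable_lebesgue_integral) (simp only: case_prod_beta', measurable)
qed

text \<open>The cut-off \<open>phi D J\<close> is an amplitude independent of \<open>x\<close>, and
  its adjoint operator is multiplication of the Fourier transform by the cut-off. The bound of
  \<open>Ustar_L2\<close> does not depend on \<open>J\<close>, and the cubes where the cut-off is 1
  exhaust space.\<close>

lemma bessel:
 fixes h :: "real^'n::finite => complex"
 assumes prof: "profile N D M" and N: "N = CARD('n) + 2" and h: "adm h"
 shows "L2 (fourier h)" and "n2 (fourier h) \<le> Cb TYPE('n) * M ^ CARD('n) * n2 h"
proof -
 have hm[measurable]: "h \<in> BM" using h by (simp add: adm_def)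
 have Fm[measurable]: "fourier h \<in> BM" by (rule fourier_measurable) simp
 define C where "C = Cb TYPE('n) * M ^ CARD('n)"
 have M: "1 \<le> M" by (rule M_ge_1[OF prof])
 have C: "0 \<le> C" using Cb_pos[where 'n='n] M by (simp add: C_def)
 define Q where "Q J = {x :: real^'n. \<forall>i. \<bar>x$i\<bar> \<le> 2^J}" for J :: nat
 have key: "(\<integral>\<^sup>+x\<in>Q J. ennreal (norm (fourier h x) ^ 2) \<partial>lborel) \<le> ennreal ((C * n2 h)^2)" for J
 proof -
  define A :: "(real^'n) set" where "A = cbox (\<chi> i. - (2 * 2^J)) (\<chi> i. 2 * 2^J)"
  have Ae: "vol A \<le> ennreal ((4 * 2^J) ^ CARD('n))"
   unfolding A_def by (subst emeasure_box_cart(2)) auto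
  define b where "b x \<xi> = phi D J \<xi>" for x \<xi> :: "real^'n"
  have "phi D J \<in> borel_measurable (borel :: (real^'n) measure)" using dC_meas[OF phi_dC[OF prof]] by blast
  then have bm: "case_prod b \<in> BM2" unfolding b_def case_prod_beta' by measurable
  have z: "b x \<xi> = 0" if "\<xi> \<notin> A" for x \<xi>
  proof -
   have "\<exists>i. \<not> (- (2 * 2^J) \<le> \<xi>$i \<and> \<xi>$i \<le> 2 * 2^J)" using that by (auto simp: A_def mem_box_cart)
   then obtain i where "\<not> (- (2 * 2 ^ J) \<le> \<xi>$i \<and> \<xi>$i \<le> 2 * 2^J)" by blast
   then have "2 * 2^J \<le> \<bar>\<xi>$i\<bar>" by linarith
   then show ?thesis unfolding b_def by (rule phi_0[OF prof])
  qed
  have sy: "sy N A (2^J) (M ^ CARD('n)) b"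
  proof -
   have "b x = phi D J" for x by (simp add: b_def fun_eq_iff)
   then have "dC N (ax i) A (1 / 2^J) (M ^ CARD('n)) (b x)" for x i using phi_dC[OF prof] by metis
   then show ?thesis unfolding sy_def using bm z by blast
  qed
  have n2le: "n2 (Ustar b h) \<le> C * n2 h" and l2: "L2 (Ustar b h)"
   unfolding C_def using M Ae by (auto intro!: Ustar_L2[OF sy _ _ _ _ _ N h] simp: A_def)
  have U: "Ustar b h \<xi> = cnj (phi D J \<xi>) * fourier h \<xi>" for \<xi>
  proof -
   have "Ustar b h \<xi> = (LINT x|lborel. cnj (phi D J \<xi>) * (h x * cis (- (x \<bullet> \<xi>))))"
    unfolding Ustar_def b_def by (intro Bochner_Integration.integral_cong) (auto simp: cis_cnj mult_ac)
   then show ?thesis by (simp add: fourier_def)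
  qed
  have "(\<integral>\<^sup>+x\<in>Q J. ennreal (norm (fourier h x) ^ 2) \<partial>lborel) \<le> sqi (Ustar b h)"
   unfolding sqi_def
  proof (intro nn_integral_mono)
   fix x show "ennreal (norm (fourier h x) ^ 2) * indicator (Q J) x \<le> ennreal (norm (Ustar b h x) ^ 2)"
    using phi_1[OF prof, of x J] by (auto simp: indicator_def Q_def U)
  qed
  also have "\<dots> = ennreal (n2 (Ustar b h) ^ 2)" by (rule sqi_n2[OF l2])
  also have "\<dots> \<le> ennreal ((C * n2 h)^2)" using n2le n2_nonneg by (intro ennreal_leI power_mono)
  finally show ?thesis .
 qed
 have "sqi (fourier h) \<le> ennreal ((C * n2 h)^2)"
  unfolding sqi_def
 proof (rule nn_integral_cball_limit[where S=Q])
  have "Q r = (\<Inter>i. {x. \<bar>x$i\<bar> \<le> 2^r})" for r by (auto simp: Q_def)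
  then have "closed (Q r)" for r by (auto intro!: closed_INT closed_Collect_le continuous_intros)
  then show "Q r \<in> sets borel" for r by simp
  show "incseq Q"
  proof (rule incseq_SucI)
   show "Q i \<subseteq> Q (Suc i)" for i unfolding Q_def by (auto intro: order_trans[of _ "2^i"])
  qed
  show "(\<Union>r. Q r) = UNIV"
  proof (intro set_eqI iffI UNIV_I)
   fix x :: "real^'n"
   obtain r where "norm x < 2 ^ r" using real_arch_pow[of 2 "norm x"] by auto
   then have "x \<in> Q r" unfolding Q_def using component_le_norm_cart[of x] by (auto intro: order_trans[OF _ less_imp_le])
   then show "x \<in> (\<Union>r. Q r)" by blast
  qed
 qed (use key in auto)
 then show "L2 (fourier h)" "n2 (fourier h) \<le> Cb TYPE('n) * M ^ CARD('n) * n2 h"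
  using C n2_nonneg[of h] by (auto intro!: L2I n2_leI simp flip: C_def)
qed

text \<open>Pieces at frequency \<open>2^j\<close> whose increments in \<open>x\<close> are smaller
  by \<open>q^j\<close> than the scale suggests. For a symbol with \<open>\<rho> = 1\<close> one has
  \<open>q = 2 powr (\<delta> - 1)\<close>, as an \<open>x\<close>-derivative costs
  \<open>2^(j \<delta>)\<close> instead of \<open>2^j\<close>.\<close>

definition goodfam :: "nat => real => real => (nat => real^'n::finite => real^'n => complex) => bool" where
 "goodfam N B q b \<longleftrightarrow> (\<forall>j. sy N (ring j) (2^j) B (b j)) \<and>
  (\<forall>j h. sy N (ring j) (2^j) (B * (2^j * norm h) * q^j) (\<lambda>x \<xi>. b j x \<xi> - b j (x - h) \<xi>))"

lemma ring_coord: "\<xi> \<in> ring j ==> \<bar>\<xi> $ i\<bar> \<le> 2 * 2^j" by (simp add: ring_def)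

lemma ring_inner:
 fixes h \<xi> :: "real^'n::finite"
 assumes "\<xi> \<in> ring j" shows "\<bar>h \<bullet> \<xi>\<bar> \<le> 2 * real CARD('n) * (2^j * norm h)"
proof -
 have "\<bar>h \<bullet> \<xi>\<bar> \<le> (\<Sum>i\<in>UNIV. \<bar>h $ i * \<xi> $ i\<bar>)" unfolding inner_vec_def by (simp add: sum_abs)
 also have "\<dots> \<le> (\<Sum>i\<in>(UNIV::'n set). norm h * (2 * 2^j))"
  using ring_coord[OF assms] component_le_norm_cart[of h] by (intro sum_mono) (auto simp: abs_mult intro!: mult_mono)
 finally show ?thesis by (simp add: mult_ac)
qed

lemma cis_m1_ge:
 assumes "1/4 \<le> \<bar>t\<bar>" "\<bar>t\<bar> \<le> 1" shows "sin (1/4) \<le> norm (cis t - 1)" and "0 < sin (1/4 :: real)"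
proof -
 have p: "1 < pi / 2" using pi_gt3 by simp
 have "sin (1/4) \<le> sin \<bar>t\<bar>" using assms p by (intro sin_monotone_2pi_le) auto
 also have "\<dots> \<le> \<bar>Im (cis t - 1)\<bar>" by (auto simp: abs_if)
 also have "\<dots> \<le> norm (cis t - 1)" by (rule abs_Im_le_cmod)
 finally show "sin (1/4) \<le> norm (cis t - 1)" .
 show "0 < sin (1/4 :: real)" using p by (intro sin_gt_zero) auto
qed

lemma sum_power_inj_le:
 fixes q :: real
 assumes "0 \<le> q" "q < 1" "finite I" "inj_on d I" shows "(\<Sum>k\<in>I. q ^ d k) \<le> 1 / (1 - q)"
proof -
 have "(\<Sum>k\<in>I. q ^ d k) = (\<Sum>i\<in>d ` I. q ^ i)" using assms by (simp add: sum.reindex)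
 also have "\<dots> \<le> (\<Sum>i. q ^ i)" using assms by (intro sum_le_suminf) auto
 also have "\<dots> = 1 / (1 - q)" using assms by (intro suminf_geometric) auto
 finally show ?thesis .
qed

definition gap :: "nat => nat => nat" where "gap j k = (j - k) + (k - j)"

lemma sum_gap_le:
 fixes q :: real
 assumes "0 \<le> q" "q < 1" shows "(\<Sum>k<J. q ^ gap j k) \<le> 2 / (1 - q)"
proof -
 have "{..<J} = ({..<J} \<inter> {..j}) \<union> ({..<J} \<inter> {j<..})" by auto
 then have "(\<Sum>k<J. q ^ gap j k) = (\<Sum>k\<in>{..<J} \<inter> {..j}. q ^ gap j k) + (\<Sum>k\<in>{..<J} \<inter> {j<..}. q ^ gap j k)"
  by (metis (no_types, lifting) sum.union_disjoint finite_Int finite_lessThan disjoint_iff IntE atMost_iff greaterThan_iff not_le)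
 also have "\<dots> \<le> 1 / (1 - q) + 1 / (1 - q)"
  by (intro add_mono sum_power_inj_le assms) (auto simp: gap_def inj_on_def)
 finally show ?thesis by simp
qed

section \<open>Almost orthogonality of the dyadic pieces\<close>

context
 fixes N :: nat and B q :: real and b :: "nat => real^'n::finite => real^'n => complex"
 assumes good: "goodfam N B q b" and N: "N = CARD('n) + 2" and B: "0 \<le> B" and q: "1/2 \<le> q" "q < 1"
begin

lemma CB_nn: "0 \<le> (Cb TYPE('n) * B)" using Cb_pos[where 'n='n] B by simp

lemma good_sy: "sy N (ring j) (2^j) B (b j)"
 and good_sy': "sy N (ring j) (2^j) (B * (2^j * norm h) * q^j) (\<lambda>x \<xi>. b j x \<xi> - b j (x - h) \<xi>)"
 using good by (auto simp: goodfam_def)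

lemmas ring_facts = bounded_ring closed_ring emeasure_ring zero_less_power[OF zero_less_numeral]

lemma piece_L2:
 assumes g: "L2 g" shows "L2 (Uop (b j) g)" and "n2 (Uop (b j) g) \<le> (Cb TYPE('n) * B) * n2 g"
 using Uop_L2[OF good_sy ring_facts B N g] by auto

lemma diff_piece_L2:
 assumes g: "L2 g" shows "L2 (Uop (\<lambda>x \<xi>. b j x \<xi> - b j (x - h) \<xi>) g)"
  and "n2 (Uop (\<lambda>x \<xi>. b j x \<xi> - b j (x - h) \<xi>) g) \<le> (Cb TYPE('n) * B) * (2^j * norm h) * q^j * n2 g"
proof -
 have "0 \<le> B * (2^j * norm h) * q^j" using B q by simp
 from Uop_L2[OF good_sy' ring_facts this N g] show "L2 (Uop (\<lambda>x \<xi>. b j x \<xi> - b j (x - h) \<xi>) g)"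
  "n2 (Uop (\<lambda>x \<xi>. b j x \<xi> - b j (x - h) \<xi>) g) \<le> (Cb TYPE('n) * B) * (2^j * norm h) * q^j * n2 g"
  by (auto simp: mult_ac)
qed

lemma cis_measurable'[measurable]: "(\<lambda>\<xi>. cis (h \<bullet> \<xi>) - 1) \<in> BM" for h :: "real^'n"
 by (intro borel_measurable_continuous_onI continuous_intros)

lemma piece_shift:
 assumes g: "L2 g"
 shows "Uop (b j) (\<lambda>\<xi>. (cis (h \<bullet> \<xi>) - 1) * g \<xi>) x
  = Uop (b j) g (x + h) - Uop (\<lambda>x \<xi>. b j x \<xi> - b j (x - h) \<xi>) g (x + h) - Uop (b j) g x"
proof -
 have c: "L2 (\<lambda>\<xi>. cis (h \<bullet> \<xi>) * g \<xi>)" by (rule L2_bounded_mult[OF g, of _ 1]) (auto simp: norm_mult)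
 have "Uop (b j) (\<lambda>\<xi>. (cis (h \<bullet> \<xi>) - 1) * g \<xi>) x = Uop (b j) (\<lambda>\<xi>. cis (h \<bullet> \<xi>) * g \<xi> - g \<xi>) x"
  by (simp add: left_diff_distrib)
 also have "\<dots> = Uop (b j) (\<lambda>\<xi>. cis (h \<bullet> \<xi>) * g \<xi>) x - Uop (b j) g x"
  by (rule Uop_mult_diff[OF good_sy ring_facts B N c g])
 also have "Uop (b j) (\<lambda>\<xi>. cis (h \<bullet> \<xi>) * g \<xi>) x = Uop (b j) g (x + h) - Uop (\<lambda>x \<xi>. b j x \<xi> - b j (x - h) \<xi>) g (x + h)"
  by (rule Uop_shift[OF good_sy ring_facts B N g good_sy'])
 finally show ?thesis by simp
qed

text \<open>Low frequencies vary slowly: on the ring the modulation differs from 1 by at most a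
  multiple of \<open>2^j * norm h\<close>, and the variation of the amplitude in \<open>x\<close> is
  no larger.\<close>

lemma increment:
 assumes g: "L2 g"
 shows "L2 (\<lambda>x. Uop (b j) g (x + h) - Uop (b j) g x)"
  and "n2 (\<lambda>x. Uop (b j) g (x + h) - Uop (b j) g x) \<le> (Cb TYPE('n) * B) * (2^j * norm h) * (2 * real CARD('n) + 1) * n2 g"
proof -
 define g' where "g' = (\<lambda>\<xi>. (indicator (ring j) \<xi> * (cis (h \<bullet> \<xi>) - 1)) * g \<xi>)"
 have rm[measurable]: "ring j \<in> sets borel" by (rule borel_closed[OF closed_ring])
 have g': "L2 g'" "n2 g' \<le> 2 * real CARD('n) * (2^j * norm h) * n2 g"
  unfolding g'_def
 proof (rule_tac[!] L2_bounded_mult[OF g])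
  show "norm (indicator (ring j) \<xi> * (cis (h \<bullet> \<xi>) - 1)) * norm (g \<xi>) \<le> 2 * real CARD('n) * (2^j * norm h) * norm (g \<xi>)" for \<xi>
   using cis_m1_le[of "h \<bullet> \<xi>"] ring_inner[of \<xi> j h] by (intro mult_right_mono) (auto simp: indicator_def)
  then show "norm (indicator (ring j) \<xi> * (cis (h \<bullet> \<xi>) - 1)) * norm (g \<xi>) \<le> 2 * real CARD('n) * (2^j * norm h) * norm (g \<xi>)" for \<xi> .
 qed (auto intro!: borel_measurable_times borel_measurable_indicator)
 let ?d = "\<lambda>x \<xi>. b j x \<xi> - b j (x - h) \<xi>"
 have eq: "Uop (b j) g (x + h) - Uop (b j) g x = Uop (b j) g' x + Uop ?d g (x + h)" for x
  using piece_shift[OF g, of j h x] Uop_indicator[OF good_sy ring_facts B N, of j "\<lambda>\<xi>. (cis (h \<bullet> \<xi>) - 1) * g \<xi>"]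
  unfolding g'_def mult.assoc by simp
 note s = L2_add[OF piece_L2(1)[OF g'(1), of j] L2_shift[OF diff_piece_L2(1)[OF g, of j h], of h]]
 show "L2 (\<lambda>x. Uop (b j) g (x + h) - Uop (b j) g x)" unfolding eq by (rule s(1))
 have "n2 (\<lambda>x. Uop (b j) g' x + Uop ?d g (x + h)) \<le> n2 (Uop (b j) g') + n2 (Uop ?d g)"
  using s(2) n2_shift[OF diff_piece_L2(1)[OF g, of j h], of h] by simp
 also have "\<dots> \<le> (Cb TYPE('n) * B) * (2 * real CARD('n) * (2^j * norm h) * n2 g) + (Cb TYPE('n) * B) * (2^j * norm h) * 1 * n2 g"
 proof (rule add_mono)
  show "n2 (Uop (b j) g') \<le> (Cb TYPE('n) * B) * (2 * real CARD('n) * (2^j * norm h) * n2 g)"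
   using piece_L2(2)[OF g'(1), of j] mult_left_mono[OF g'(2) CB_nn] by linarith
  have "(Cb TYPE('n) * B) * (2^j * norm h) * q^j * n2 g \<le> (Cb TYPE('n) * B) * (2^j * norm h) * 1 * n2 g"
   using CB_nn q n2_nonneg[of g] by (intro mult_right_mono mult_left_mono power_le_one) auto
  then show "n2 (Uop ?d g) \<le> (Cb TYPE('n) * B) * (2^j * norm h) * 1 * n2 g" using diff_piece_L2(2)[OF g, of j h] by linarith
 qed
 finally show "n2 (\<lambda>x. Uop (b j) g (x + h) - Uop (b j) g x) \<le> (Cb TYPE('n) * B) * (2^j * norm h) * (2 * real CARD('n) + 1) * n2 g"
  unfolding eq by (simp add: algebra_simps)
qed

text \<open>On the part of the \<open>k\<close>-th ring where \<open>\<xi>\<^sub>i\<close> is large, the factor \<open>cis (h \<bullet> \<xi>) - 1\<close> for the step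
 \<open>h\<close> of length \<open>2\<^sup>-\<^sup>k\<^sup>-\<^sup>1\<close> along the \<open>i\<close>-th axis is bounded below. So the high-frequency function is a
 difference, and summation by parts moves that difference to the low-frequency one.\<close>

lemma cross_sector:
 assumes g: "L2 g" and v: "L2 v" "\<And>\<xi>. v \<xi> \<noteq> 0 ==> \<xi> \<in> ring k \<and> 2^k \<le> 2 * \<bar>\<xi> $ i\<bar>" and jk: "j < k"
 shows "norm (LINT x|lborel. Uop (b j) g x * cnj (Uop (b k) v x)) \<le> (Cb TYPE('n) * B)^2 * (real CARD('n) + 1) / sin (1/4) * q ^ (k - j) * n2 g * n2 v"
proof -
 \<comment> \<open>On the sector \<open>h \<bullet> \<xi>\<close> has modulus between
   \<open>1/4\<close> and 1: the lower end from the largeness of the \<open>i\<close>-th coordinate,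
   the upper one from the outer bound of the ring.\<close>
 define h :: "real^'n" where "h = (1 / (2 * 2^k)) *\<^sub>R ax i"
 have hin: "h \<bullet> \<xi> = \<xi> $ i / (2 * 2^k)" for \<xi> by (simp add: h_def inner_axis')
 have nh: "norm h = 1 / (2 * 2^k)" by (simp add: h_def norm_axis_1)
 define c0 :: real where "c0 = sin (1/4)"
 have c0: "0 < c0" using cis_m1_ge(2)[of 1] by (simp add: c0_def)
 have low: "c0 \<le> norm (cis (h \<bullet> \<xi>) - 1)" if "v \<xi> \<noteq> 0" for \<xi>
  unfolding c0_def by (rule cis_m1_ge) (use v(2)[OF that] ring_coord[of \<xi> k i] in \<open>auto simp: hin field_simps\<close>)
 define w where "w = (\<lambda>\<xi>. inverse (cis (h \<bullet> \<xi>) - 1) * v \<xi>)"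
 have w: "L2 w" "n2 w \<le> 1 / c0 * n2 v"
  unfolding w_def
 proof (rule_tac[!] L2_bounded_mult[OF v(1)])
  show *: "norm (inverse (cis (h \<bullet> \<xi>) - 1)) * norm (v \<xi>) \<le> 1 / c0 * norm (v \<xi>)" for \<xi>
  proof (cases "v \<xi> = 0")
   case False
   then show ?thesis using low[OF False] c0 unfolding norm_inverse
    by (intro mult_right_mono) (auto simp: divide_inverse intro!: le_imp_inverse_le)
  qed simp
  show "norm (inverse (cis (h \<bullet> \<xi>) - 1)) * norm (v \<xi>) \<le> 1 / c0 * norm (v \<xi>)" for \<xi> by (rule *)
 qed (use c0 in auto)
 have v_eq: "v = (\<lambda>\<xi>. (cis (h \<bullet> \<xi>) - 1) * w \<xi>)"
 proof
  fix \<xi>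
  have "cis (h \<bullet> \<xi>) - 1 \<noteq> 0" if "v \<xi> \<noteq> 0" using low[OF that] c0 by (metis norm_zero not_le)
  then show "v \<xi> = (cis (h \<bullet> \<xi>) - 1) * w \<xi>" by (cases "v \<xi> = 0") (auto simp: w_def)
 qed
 define u where "u = Uop (b j) g"
 define V where "V = Uop (b k) w"
 define D where "D = Uop (\<lambda>x \<xi>. b k x \<xi> - b k (x - h) \<xi>) w"
 have l2: "L2 u" "L2 V" "L2 D" unfolding u_def V_def D_def by (intro piece_L2 diff_piece_L2 g w)+
 have sh: "Uop (b k) v x = V (x + h) - D (x + h) - V x" for x
  unfolding V_def D_def by (subst v_eq) (rule piece_shift[OF w(1)])
 have i: "integrable lborel (\<lambda>x. u x * cnj (V (x + h)))" "integrable lborel (\<lambda>x. u x * cnj (D (x + h)))"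
   "integrable lborel (\<lambda>x. u x * cnj (V x))" "integrable lborel (\<lambda>x. u (x - h) * cnj (V x))"
  using L2_shift[OF l2(1), of "-h"] by (auto intro!: ip_integrable L2_shift l2)
 have um[measurable]: "u \<in> BM" "V \<in> BM" using l2 by (auto simp: L2_def)
 have "(LINT x|lborel. u x * cnj (Uop (b k) v x)) = (LINT x|lborel. u x * cnj (V (x + h)) - u x * cnj (D (x + h)) - u x * cnj (V x))"
  unfolding sh by (simp add: right_diff_distrib)
 also have "\<dots> = (LINT x|lborel. u x * cnj (V (x + h))) - (LINT x|lborel. u x * cnj (D (x + h))) - (LINT x|lborel. u x * cnj (V x))"
  using i by simp
 also have "(LINT x|lborel. u x * cnj (V (x + h))) = (LINT x|lborel. u (x - h) * cnj (V x))"
  using lborel_integral_shift[of "\<lambda>x. u (x - h) * cnj (V x)" h] by simp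
 finally have "(LINT x|lborel. u x * cnj (Uop (b k) v x))
   = (LINT x|lborel. u (x - h) * cnj (V x)) - (LINT x|lborel. u x * cnj (V x)) - (LINT x|lborel. u x * cnj (D (x + h)))" by simp
 also have "(LINT x|lborel. u (x - h) * cnj (V x)) - (LINT x|lborel. u x * cnj (V x)) = (LINT x|lborel. (u (x - h) - u x) * cnj (V x))"
  using i by (simp add: left_diff_distrib)
 finally have eq: "(LINT x|lborel. u x * cnj (Uop (b k) v x))
   = (LINT x|lborel. (u (x - h) - u x) * cnj (V x)) - (LINT x|lborel. u x * cnj (D (x + h)))" .
 have inc: "L2 (\<lambda>x. u (x - h) - u x)" "n2 (\<lambda>x. u (x - h) - u x) \<le> (Cb TYPE('n) * B) * (2^j * norm h) * (2 * real CARD('n) + 1) * n2 g"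
  using increment[OF g, of j "-h"] unfolding u_def by auto
 \<comment> \<open>The bound \<open>q \<ge> 1/2\<close> absorbs the ratio of scales
   \<open>2^(j-k)\<close> into \<open>q ^ (k - j)\<close>; the gain \<open>q ^ k\<close> from the
   variation of the amplitude is absorbed as well.\<close>
 have qk: "(1/2) ^ (k - j) \<le> q ^ (k - j)" "q ^ k \<le> q ^ (k - j)"
  using q by (auto intro!: power_mono power_decreasing)
 have e1: "2^j * norm h \<le> q ^ (k - j) / 2"
 proof -
  have "(2::real)^k = 2^j * 2^(k-j)" using jk by (simp flip: power_add)
  then have "2^j * norm h = (1/2)^(k-j) / 2" by (simp add: nh power_divide field_simps)
  with qk(1) show ?thesis by simp
 qed
 have nn: "0 \<le> n2 g" "0 \<le> n2 w" by (simp_all add: n2_nonneg)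
 have "norm (LINT x|lborel. (u (x - h) - u x) * cnj (V x)) \<le> n2 (\<lambda>x. u (x - h) - u x) * n2 V" by (rule ip_le[OF inc(1) l2(2)])
 also have "\<dots> \<le> ((Cb TYPE('n) * B) * (q ^ (k - j) / 2) * (2 * real CARD('n) + 1) * n2 g) * ((Cb TYPE('n) * B) * n2 w)"
 proof (rule mult_mono)
  have "(Cb TYPE('n) * B) * (2^j * norm h) * (2 * real CARD('n) + 1) * n2 g \<le> (Cb TYPE('n) * B) * (q ^ (k - j) / 2) * (2 * real CARD('n) + 1) * n2 g"
   using e1 CB_nn nn by (intro mult_right_mono mult_left_mono) auto
  with inc(2) show "n2 (\<lambda>x. u (x - h) - u x) \<le> (Cb TYPE('n) * B) * (q ^ (k - j) / 2) * (2 * real CARD('n) + 1) * n2 g" by linarith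
  show "n2 V \<le> (Cb TYPE('n) * B) * n2 w" unfolding V_def by (rule piece_L2[OF w(1)])
  show "0 \<le> (Cb TYPE('n) * B) * (q ^ (k - j) / 2) * (2 * real CARD('n) + 1) * n2 g" using less_imp_le[OF Cb_pos[where 'n='n]] B q nn by (intro mult_nonneg_nonneg) auto
 qed (rule n2_nonneg)
 finally have p1: "norm (LINT x|lborel. (u (x - h) - u x) * cnj (V x)) \<le> ((Cb TYPE('n) * B) * (q ^ (k - j) / 2) * (2 * real CARD('n) + 1) * n2 g) * ((Cb TYPE('n) * B) * n2 w)" .
 have "norm (LINT x|lborel. u x * cnj (D (x + h))) \<le> n2 u * n2 D"
  using ip_le[OF l2(1) L2_shift[OF l2(3), of h]] n2_shift[OF l2(3), of h] by simp
 also have "\<dots> \<le> ((Cb TYPE('n) * B) * n2 g) * ((Cb TYPE('n) * B) * (1/2) * q ^ (k - j) * n2 w)"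
 proof (rule mult_mono)
  show "n2 u \<le> (Cb TYPE('n) * B) * n2 g" unfolding u_def by (rule piece_L2[OF g])
  have "(Cb TYPE('n) * B) * (2^k * norm h) * q^k * n2 w \<le> (Cb TYPE('n) * B) * (1/2) * q^(k - j) * n2 w"
   using qk less_imp_le[OF Cb_pos[where 'n='n]] B nn q by (intro mult_right_mono mult_mono) (auto simp: nh)
  then show "n2 D \<le> (Cb TYPE('n) * B) * (1/2) * q ^ (k - j) * n2 w" using diff_piece_L2(2)[OF w(1), of k h] unfolding D_def by linarith
  show "0 \<le> (Cb TYPE('n) * B) * n2 g" using less_imp_le[OF Cb_pos[where 'n='n]] B nn by (intro mult_nonneg_nonneg)
 qed (rule n2_nonneg)
 finally have p2: "norm (LINT x|lborel. u x * cnj (D (x + h))) \<le> ((Cb TYPE('n) * B) * n2 g) * ((Cb TYPE('n) * B) * (1/2) * q ^ (k - j) * n2 w)" .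
 have "norm (LINT x|lborel. u x * cnj (Uop (b k) v x)) \<le> (Cb TYPE('n) * B)^2 * (real CARD('n) + 1) * q ^ (k - j) * n2 g * n2 w"
  unfolding eq by (rule order_trans[OF norm_triangle_ineq4], rule order_trans[OF add_mono[OF p1 p2]]) (simp add: power2_eq_square field_simps)
 also have "\<dots> \<le> (Cb TYPE('n) * B)^2 * (real CARD('n) + 1) * q ^ (k - j) * n2 g * (1 / c0 * n2 v)"
  using w(2) nn q by (intro mult_left_mono mult_nonneg_nonneg) auto
 finally show ?thesis by (simp add: u_def c0_def)
qed

text \<open>A point of the ring has some large coordinate, but possibly several. Dividing each
  sector indicator by the number of sectors through the point gives a partition of unity, and the
  sectors are treated one by one. Since \<open>k > 0\<close>, the ring stays away from the
  origin.\<close>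

lemma cross:
 assumes g: "L2 g" and v: "L2 v" "\<And>\<xi>. v \<xi> \<noteq> 0 ==> \<xi> \<in> ring k" and jk: "j < k"
 shows "norm (LINT x|lborel. Uop (b j) g x * cnj (Uop (b k) v x))
  \<le> real CARD('n) * ((Cb TYPE('n) * B)^2 * (real CARD('n) + 1) / sin (1/4)) * q ^ (k - j) * n2 g * n2 v"
proof -
 define S where "S i = {\<xi> :: real^'n. 2^k \<le> 2 * \<bar>\<xi> $ i\<bar>}" for i
 have Sm[measurable]: "S i \<in> sets borel" for i
  unfolding S_def by (intro borel_closed closed_Collect_le continuous_intros)
 define m :: "'n => real^'n => complex" where "m i \<xi> = indicator (S i) \<xi> / of_nat (card {l. \<xi> \<in> S l})" for i \<xi>
 have m_alt: "m i = (\<lambda>\<xi>. indicator (S i) \<xi> / (\<Sum>l\<in>UNIV. indicator (S l) \<xi>))" for i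
  unfolding m_def by (auto simp: fun_eq_iff indicator_def sum.If_cases Collect_neg_eq)
 have mm[measurable]: "m i \<in> BM" for i
  unfolding m_alt by (intro borel_measurable_divide borel_measurable_sum borel_measurable_indicator) auto
 have m1: "norm (m i \<xi>) \<le> 1" for i \<xi>
 proof (cases "\<xi> \<in> S i")
  case True
  then have "card {l. \<xi> \<in> S l} \<noteq> 0" by auto
  then show ?thesis using True by (simp add: m_def norm_divide divide_le_eq)
 qed (simp add: m_def)
 have vs: "v = (\<lambda>\<xi>. \<Sum>i\<in>UNIV. m i \<xi> * v \<xi>)"
 proof
  fix \<xi>
  show "v \<xi> = (\<Sum>i\<in>UNIV. m i \<xi> * v \<xi>)"
  proof (cases "v \<xi> = 0")
   case False
   then obtain i where "\<xi> \<in> S i" using v(2)[OF False] jk by (auto simp: ring_def S_def)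
   then have "card {l. \<xi> \<in> S l} \<noteq> 0" by auto
   moreover have "(\<Sum>i\<in>UNIV. m i \<xi>) = of_nat (card {l. \<xi> \<in> S l}) / of_nat (card {l. \<xi> \<in> S l})"
    unfolding m_def sum_divide_distrib[symmetric] by (simp add: indicator_def sum.If_cases)
   ultimately show ?thesis using \<open>\<xi> \<in> S i\<close> by (auto simp: sum_distrib_right[symmetric])
  qed simp
 qed
 have l: "L2 (\<lambda>\<xi>. m i \<xi> * v \<xi>)" "n2 (\<lambda>\<xi>. m i \<xi> * v \<xi>) \<le> 1 * n2 v" for i
  using mult_right_mono[OF m1 norm_ge_zero, of i _ "v _"] by (auto intro: L2_bounded_mult(1)[OF v(1), of _ 1] L2_bounded_mult(2)[OF v(1), of _ 1, simplified])
 have "Uop (b k) v x = (\<Sum>i\<in>UNIV. Uop (b k) (\<lambda>\<xi>. m i \<xi> * v \<xi>) x)" for x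
  by (subst vs) (rule Uop_sum[OF good_sy ring_facts B N l(1)])
 then have "(LINT x|lborel. Uop (b j) g x * cnj (Uop (b k) v x)) = (LINT x|lborel. (\<Sum>i\<in>UNIV. Uop (b j) g x * cnj (Uop (b k) (\<lambda>\<xi>. m i \<xi> * v \<xi>) x)))"
  by (simp add: sum_distrib_left)
 also have "\<dots> = (\<Sum>i\<in>UNIV. LINT x|lborel. Uop (b j) g x * cnj (Uop (b k) (\<lambda>\<xi>. m i \<xi> * v \<xi>) x))"
  by (intro Bochner_Integration.integral_sum ip_integrable piece_L2 g l)
 also have "norm \<dots> \<le> (\<Sum>i\<in>(UNIV::'n set). (Cb TYPE('n) * B)^2 * (real CARD('n) + 1) / sin (1/4) * q ^ (k - j) * n2 g * n2 v)"
 proof (intro order_trans[OF norm_sum] sum_mono)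
  fix i
  have "norm (LINT x|lborel. Uop (b j) g x * cnj (Uop (b k) (\<lambda>\<xi>. m i \<xi> * v \<xi>) x))
    \<le> (Cb TYPE('n) * B)^2 * (real CARD('n) + 1) / sin (1/4) * q ^ (k - j) * n2 g * n2 (\<lambda>\<xi>. m i \<xi> * v \<xi>)"
  proof (rule cross_sector[OF g l(1) _ jk])
   show "\<xi> \<in> ring k \<and> 2 ^ k \<le> 2 * \<bar>\<xi> $ i\<bar>" if "m i \<xi> * v \<xi> \<noteq> 0" for \<xi>
    using that v(2)[of \<xi>] by (auto simp: m_def S_def indicator_def split: if_splits)
  qed
  also have "\<dots> \<le> (Cb TYPE('n) * B)^2 * (real CARD('n) + 1) / sin (1/4) * q ^ (k - j) * n2 g * n2 v"
   using l(2)[of i] q n2_nonneg[of g] less_imp_le[OF cis_m1_ge(2)[of 1]] by (intro mult_left_mono mult_nonneg_nonneg divide_nonneg_nonneg) auto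
  finally show "norm (LINT x|lborel. Uop (b j) g x * cnj (Uop (b k) (\<lambda>\<xi>. m i \<xi> * v \<xi>) x)) \<le> (Cb TYPE('n) * B)^2 * (real CARD('n) + 1) / sin (1/4) * q ^ (k - j) * n2 g * n2 v" .
 qed
 finally show ?thesis by (simp add: mult_ac)
qed

definition Ec :: real where "Ec = real CARD('n) * ((Cb TYPE('n) * B)^2 * (real CARD('n) + 1) / sin (1/4))"

text \<open>Lets the diagonal terms share the bound of the off-diagonal ones.\<close>

lemma Ec_ge: "(Cb TYPE('n) * B)^2 \<le> Ec"
proof -
 have s: "0 < sin (1/4 :: real)" "sin (1/4 :: real) \<le> 1" using cis_m1_ge(2)[of 1] by auto
 have n: "1 \<le> real CARD('n)" by (simp add: Suc_leI)
 have "1 * ((Cb TYPE('n) * B)^2 * 1 / 1) \<le> Ec" unfolding Ec_def using s n by (intro mult_mono frac_le) auto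
 then show ?thesis by simp
qed

lemma pairing_le:
 assumes g: "\<And>j. L2 (g j)" "\<And>j \<xi>. g j \<xi> \<noteq> 0 ==> \<xi> \<in> ring j"
 shows "norm (LINT x|lborel. Uop (b j) (g j) x * cnj (Uop (b k) (g k) x)) \<le> Ec * q ^ gap j k * n2 (g j) * n2 (g k)"
proof -
 consider "j < k" | "k < j" | "j = k" by linarith
 then show ?thesis
 proof cases
  case 1 then show ?thesis using cross[OF g(1) g(1) g(2) 1] by (simp add: Ec_def gap_def)
 next
  case 2
  have "norm (LINT x|lborel. Uop (b j) (g j) x * cnj (Uop (b k) (g k) x)) = norm (cnj (LINT x|lborel. Uop (b k) (g k) x * cnj (Uop (b j) (g j) x)))"
   by (subst Bochner_Integration.integral_cnj[symmetric]) (simp add: mult.commute)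
  also have "\<dots> \<le> Ec * q ^ (j - k) * n2 (g k) * n2 (g j)"
   using cross[OF g(1) g(1) g(2) 2] by (simp add: Ec_def)
  finally show ?thesis using 2 by (simp add: gap_def mult_ac)
 next
  case 3
  have "norm (LINT x|lborel. Uop (b j) (g j) x * cnj (Uop (b k) (g k) x)) \<le> n2 (Uop (b j) (g j)) * n2 (Uop (b k) (g k))"
   by (intro ip_le piece_L2 g)
  also have "\<dots> \<le> ((Cb TYPE('n) * B) * n2 (g j)) * ((Cb TYPE('n) * B) * n2 (g k))"
   using piece_L2(2)[OF g(1)] CB_nn n2_nonneg by (intro mult_mono) auto
  also have "\<dots> = (Cb TYPE('n) * B)^2 * n2 (g j) * n2 (g k)" by (simp add: power2_eq_square)
  also have "\<dots> \<le> Ec * n2 (g j) * n2 (g k)" by (intro mult_right_mono Ec_ge n2_nonneg)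
  finally show ?thesis using 3 by (simp add: gap_def)
 qed
qed

text \<open>Expand the square. The pairings decay geometrically in the distance of the indices; the
  product of two norms is split into halves of squares, and the row sums of the resulting symmetric
  matrix are at most \<open>2 / (1 - q)\<close>.\<close>

lemma almost_orthogonal:
 assumes g: "\<And>j. L2 (g j)" "\<And>j \<xi>. g j \<xi> \<noteq> 0 ==> \<xi> \<in> ring j"
 shows "L2 (\<lambda>x. \<Sum>j<J. Uop (b j) (g j) x)"
  and "n2 (\<lambda>x. \<Sum>j<J. Uop (b j) (g j) x) ^ 2 \<le> Ec * (2 / (1 - q)) * (\<Sum>j<J. n2 (g j) ^ 2)"
proof -
 define u where "u j = Uop (b j) (g j)" for j
 define a where "a j = n2 (g j)" for j
 have lu: "L2 (u j)" for j unfolding u_def by (intro piece_L2 g)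
 have ls: "L2 (\<lambda>x. \<Sum>j<J. u j x)" for J
 proof (induction J)
  case 0 then show ?case by (simp add: L2_def sqi_def)
 next
  case (Suc J) then show ?case using L2_add[OF Suc lu[of J]] by simp
 qed
 then show "L2 (\<lambda>x. \<Sum>j<J. Uop (b j) (g j) x)" by (simp add: u_def)
 have E: "0 \<le> Ec" by (rule order_trans[OF zero_le_power2 Ec_ge])
 have "complex_of_real (n2 (\<lambda>x. \<Sum>j<J. u j x) ^ 2) = (LINT x|lborel. (\<Sum>j<J. u j x) * cnj (\<Sum>j<J. u j x))"
  by (rule ip_self[OF ls, symmetric])
 also have "\<dots> = (LINT x|lborel. (\<Sum>j<J. \<Sum>k<J. u j x * cnj (u k x)))" by (simp add: sum_product)
 also have "\<dots> = (\<Sum>j<J. \<Sum>k<J. LINT x|lborel. u j x * cnj (u k x))"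
  by (simp add: Bochner_Integration.integral_sum Bochner_Integration.integrable_sum ip_integrable lu)
 finally have "n2 (\<lambda>x. \<Sum>j<J. u j x) ^ 2 = norm (\<Sum>j<J. \<Sum>k<J. LINT x|lborel. u j x * cnj (u k x))"
  by (metis norm_of_real abs_of_nonneg zero_le_power2)
 also have "\<dots> \<le> (\<Sum>j<J. \<Sum>k<J. Ec * q ^ gap j k * ((a j ^ 2 + a k ^ 2) / 2))"
 proof (intro order_trans[OF norm_sum] sum_mono)
  fix j k
  have "norm (LINT x|lborel. u j x * cnj (u k x)) \<le> Ec * q ^ gap j k * (a j * a k)"
   using pairing_le[of g, OF g, of j k] by (simp add: u_def a_def mult_ac)
  also have "\<dots> \<le> Ec * q ^ gap j k * ((a j ^ 2 + a k ^ 2) / 2)"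
  proof (intro mult_left_mono)
   show "a j * a k \<le> (a j ^ 2 + a k ^ 2) / 2" using zero_le_power2[of "a j - a k"] by (simp add: power2_diff)
  qed (use E q in auto)
  finally show "norm (LINT x|lborel. u j x * cnj (u k x)) \<le> Ec * q ^ gap j k * ((a j ^ 2 + a k ^ 2) / 2)" .
 qed
 also have "\<dots> = Ec / 2 * ((\<Sum>j<J. \<Sum>k<J. q ^ gap j k * a j ^ 2) + (\<Sum>j<J. \<Sum>k<J. q ^ gap j k * a k ^ 2))"
  unfolding sum_distrib_left sum.distrib[symmetric] by (intro sum.cong refl) (simp add: field_simps)
 also have "(\<Sum>j<J. \<Sum>k<J. q ^ gap j k * a k ^ 2) = (\<Sum>j<J. \<Sum>k<J. q ^ gap j k * a j ^ 2)"
  by (subst sum.swap) (simp add: gap_def add.commute)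
 also have "(\<Sum>j<J. \<Sum>k<J. q ^ gap j k * a j ^ 2) = (\<Sum>j<J. (\<Sum>k<J. q ^ gap j k) * a j ^ 2)"
  by (simp add: sum_distrib_right)
 also have "Ec / 2 * ((\<Sum>j<J. (\<Sum>k<J. q ^ gap j k) * a j ^ 2) + (\<Sum>j<J. (\<Sum>k<J. q ^ gap j k) * a j ^ 2))
   = Ec * (\<Sum>j<J. (\<Sum>k<J. q ^ gap j k) * a j ^ 2)" by simp
 also have "\<dots> \<le> Ec * (\<Sum>j<J. 2 / (1 - q) * a j ^ 2)"
  using q E by (intro mult_left_mono sum_mono mult_right_mono sum_gap_le) auto
 finally show "n2 (\<lambda>x. \<Sum>j<J. Uop (b j) (g j) x) ^ 2 \<le> Ec * (2 / (1 - q)) * (\<Sum>j<J. n2 (g j) ^ 2)"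
  by (simp add: u_def a_def sum_distrib_left mult.assoc)
qed

end

section \<open>From amplitudes to Calderon-Zygmund kernels\<close>

definition k1 :: "'n::finite itself => real" where "k1 _ = 4 ^ CARD('n) * (2 * real CARD('n)) ^ (CARD('n) + 2)"

lemma k1_pos: "0 < k1 TYPE('n::finite)" by (simp add: k1_def)

lemma ring_kern_decay:
 fixes b :: "real^'n::finite => complex"
 assumes dC: "\<And>i. dC N (ax i) (ring j) (1 / 2^j) B b" and z: "\<And>\<xi>. \<xi> \<notin> ring j ==> b \<xi> = 0" and B: "0 \<le> B" and N: "N = CARD('n) + 2"
 shows "norm (kern b z) \<le> k1 TYPE('n) * B * (bmp (2^j) z / (1 + 2^j * norm z))" and "norm (kern b z) \<le> k1 TYPE('n) * B * bmp (2^j) z"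
proof -
 have "norm (kern b z) \<le> B * (4 * 2^j) ^ CARD('n) * (2 * real CARD('n)) ^ N / (1 + 2^j * norm z) ^ N"
  by (rule kern_decay[OF dC bounded_ring closed_ring emeasure_ring]) (use B z in auto)
 also have "\<dots> = k1 TYPE('n) * B * (bmp (2^j) z / (1 + 2^j * norm z))"
  by (simp add: k1_def bump_def N power_mult_distrib mult_ac)
 finally show 1: "norm (kern b z) \<le> k1 TYPE('n) * B * (bmp (2^j) z / (1 + 2^j * norm z))" .
 have "bmp (2^j) z / (1 + 2^j * norm z) \<le> bmp (2^j) z / 1"
  by (intro divide_left_mono bmp_nonneg) (auto intro: add_pos_nonneg)
 then have "k1 TYPE('n) * B * (bmp (2^j) z / (1 + 2^j * norm z)) \<le> k1 TYPE('n) * B * bmp (2^j) z"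
  using k1_pos[where 'n='n] B by (intro mult_left_mono) auto
 with 1 show "norm (kern b z) \<le> k1 TYPE('n) * B * bmp (2^j) z" by linarith
qed

lemma kern_integrable:
 fixes b :: "'a::euclidean_space => complex"
 assumes "b \<in> BM" "\<And>\<xi>. \<xi> \<in> A ==> norm (b \<xi>) \<le> B" "\<And>\<xi>. \<xi> \<notin> A ==> b \<xi> = 0" "bounded A"
 shows "integrable lborel (\<lambda>\<xi>. cis (z \<bullet> \<xi>) * b \<xi>)"
 using assms by (intro integrable_bounded_support[of _ A B]) (auto simp: norm_mult)

text \<open>The increment is again an oscillatory integral, with amplitude multiplied by
  \<open>cis (h \<bullet> \<xi>) - 1\<close>, which is small on the ring together with its
  derivatives.\<close>

lemma kern_increment:
 fixes b :: "real^'n::finite => complex"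
 assumes dC: "\<And>i. dC N (ax i) (ring j) (1 / 2^j) B b" and z: "\<And>\<xi>. \<xi> \<notin> ring j ==> b \<xi> = 0" and B: "0 \<le> B" and N: "N = CARD('n) + 2"
  and h: "2^j * norm h \<le> 1"
 shows "norm (kern b (z + h) - kern b z) \<le> k1 TYPE('n) * (2 ^ N * (2 * real CARD('n)) * B) * (2^j * norm h) * bmp (2^j) z"
proof -
 have n: "1 \<le> real CARD('n)" by (simp add: Suc_leI)
 note i = kern_integrable[OF dC_meas[OF dC] dC_bound[OF dC] z bounded_ring]
 have "kern b (z + h) - kern b z = (LINT \<xi>|lborel. cis ((z + h) \<bullet> \<xi>) * b \<xi> - cis (z \<bullet> \<xi>) * b \<xi>)"
  unfolding kern_def by (intro Bochner_Integration.integral_diff[symmetric] i)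
 also have "\<dots> = kern (\<lambda>\<xi>. (cis (h \<bullet> \<xi>) - 1) * b \<xi>) z"
  unfolding kern_def by (intro Bochner_Integration.integral_cong) (auto simp: inner_add_left algebra_simps simp flip: cis_mult)
 also have "norm \<dots> \<le> k1 TYPE('n) * (2 ^ N * (2 * real CARD('n) * (2^j * norm h)) * B) * bmp (2^j) z"
 proof (rule ring_kern_decay(2)[OF dC_mult[OF dC_cis_m1 dC]])
  fix i
  have 1: "\<bar>h \<bullet> ax i\<bar> \<le> norm h" by (simp add: inner_axis component_le_norm_cart)
  have "2^j * \<bar>h \<bullet> ax i\<bar> \<le> 2^j * norm h" using 1 by (intro mult_left_mono) auto
  then have "2^j * \<bar>h \<bullet> ax i\<bar> \<le> 1" using h by linarith
  then show "\<bar>h \<bullet> ax i\<bar> \<le> 1 / 2^j" by (simp add: field_simps)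
  have "1 * norm h \<le> 2 * real CARD('n) * norm h" by (rule mult_right_mono) (use n in linarith, simp)
  then show "\<bar>h \<bullet> ax i\<bar> \<le> 2 * real CARD('n) * (2^j * norm h) * (1 / 2^j)" using 1 by simp
 qed (use ring_inner z B N in auto)
 finally show ?thesis by (simp add: mult_ac)
qed

text \<open>Two rings of positive index with a common point have indices differing by at most 2, so
  there are at most three of them; the cube of index 0 makes four.\<close>

lemma ring_count: "(\<Sum>j<J. indicator (ring j) \<xi>) \<le> (4::real)" for \<xi> :: "real^'n::finite"
proof -
 define S where "S = {j. j < J \<and> 0 < j \<and> \<xi> \<in> ring j}"
 have close: "j \<le> k + 2" if "j \<in> S" "k \<in> S" for j k
 proof -
  obtain i where "2^j \<le> 2 * \<bar>\<xi> $ i\<bar>" using \<open>j \<in> S\<close> by (auto simp: S_def ring_def)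
  moreover have "\<bar>\<xi> $ i\<bar> \<le> 2 * 2^k" using \<open>k \<in> S\<close> by (auto simp: S_def ring_def)
  ultimately have "(2::real)^j \<le> 2^(k + 2)" by simp
  then show ?thesis by (subst (asm) power_increasing_iff) auto
 qed
 have "card S \<le> 3"
 proof (cases "S = {}")
  case False
  have fS: "finite S" by (rule finite_subset[of _ "{..<J}"]) (auto simp: S_def)
  have "S \<subseteq> {Min S..Min S + 2}" using close Min_in[OF fS False] Min_le[OF fS] by auto
  then have "card S \<le> card {Min S..Min S + 2}" by (intro card_mono) auto
  then show ?thesis by simp
 qed simp
 moreover have "card {j. j < J \<and> \<xi> \<in> ring j} \<le> card (insert 0 S)"
  by (intro card_mono) (auto simp: S_def)
 moreover have "card (insert 0 S) \<le> Suc (card S)" by (rule card_insert_le_m1) auto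
 moreover have "(\<Sum>j<J. indicator (ring j) \<xi>) = real (card {j. j < J \<and> \<xi> \<in> ring j})"
  by (simp add: indicator_def sum.If_cases Int_def)
 ultimately show ?thesis by linarith
qed

lemma sum_ring_n2:
 assumes g: "L2 g"
 shows "(\<Sum>j<J. n2 (\<lambda>\<xi>. indicator (ring j) \<xi> * g \<xi>) ^ 2) \<le> 4 * n2 g ^ 2" and "L2 (\<lambda>\<xi>. indicator (ring j) \<xi> * g \<xi>)"
proof -
 have gm[measurable]: "g \<in> BM" using g by (simp add: L2_def)
 have rm[measurable]: "(ring j :: (real^'n::finite) set) \<in> sets borel" for j by (rule borel_closed[OF closed_ring])
 show l: "L2 (\<lambda>\<xi>. indicator (ring j) \<xi> * g \<xi>)" for j
  by (rule L2_bounded_mult[OF g, of _ 1]) (auto simp: indicator_def)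
 have "ennreal (\<Sum>j<J. n2 (\<lambda>\<xi>. indicator (ring j) \<xi> * g \<xi>) ^ 2) = (\<Sum>j<J. sqi (\<lambda>\<xi>. indicator (ring j) \<xi> * g \<xi>))"
  unfolding sqi_n2[OF l] by (simp add: sum_ennreal)
 also have "\<dots> = (\<integral>\<^sup>+\<xi>. (\<Sum>j<J. ennreal (norm (indicator (ring j) \<xi> * g \<xi>) ^ 2)))"
  unfolding sqi_def by (rule nn_integral_sum[symmetric]) measurable
 also have "\<dots> \<le> (\<integral>\<^sup>+\<xi>. 4 * ennreal (norm (g \<xi>) ^ 2))"
 proof (intro nn_integral_mono)
  fix \<xi>
  have "(\<Sum>j<J. norm (indicator (ring j) \<xi> * g \<xi>) ^ 2) = (\<Sum>j<J. indicator (ring j) \<xi>) * norm (g \<xi>) ^ 2"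
   unfolding sum_distrib_right by (intro sum.cong) (auto simp: indicator_def)
  also have "\<dots> \<le> 4 * norm (g \<xi>) ^ 2" by (intro mult_right_mono ring_count) simp
  finally have "ennreal (\<Sum>j<J. norm (indicator (ring j) \<xi> * g \<xi>) ^ 2) \<le> ennreal (4 * norm (g \<xi>) ^ 2)" by (rule ennreal_leI)
  then show "(\<Sum>j<J. ennreal (norm (indicator (ring j) \<xi> * g \<xi>) ^ 2)) \<le> 4 * ennreal (norm (g \<xi>) ^ 2)"
   by (simp add: ennreal_mult)
 qed
 also have "\<dots> = 4 * sqi g" unfolding sqi_def by (rule nn_integral_cmult) simp
 also have "\<dots> = ennreal (4 * n2 g ^ 2)" unfolding sqi_n2[OF g] by (simp add: ennreal_mult)
 finally show "(\<Sum>j<J. n2 (\<lambda>\<xi>. indicator (ring j) \<xi> * g \<xi>) ^ 2) \<le> 4 * n2 g ^ 2" by (subst (asm) ennreal_le_iff) auto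
qed

definition kfam :: "(nat => 'a::euclidean_space => 'a => complex) => nat => 'a => 'a => complex" where
 "kfam b j x y = kern (b j x) (x - y)"

lemma kfam_meas:
 fixes b :: "nat => 'a::euclidean_space => 'a => complex"
 assumes "case_prod (b j) \<in> BM2"
 shows "case_prod (kfam b j) \<in> BM2"
proof -
 have "(\<lambda>p. (fst (fst p), snd p)) \<in> (borel \<Otimes>\<^sub>M borel) \<Otimes>\<^sub>M borel \<rightarrow>\<^sub>M borel \<Otimes>\<^sub>M (borel :: 'a measure)" by measurable
 from measurable_compose[OF this assms] have [measurable]: "(\<lambda>p :: ('a \<times> 'a) \<times> 'a. b j (fst (fst p)) (snd p)) \<in> borel_measurable ((borel \<Otimes>\<^sub>M borel) \<Otimes>\<^sub>M borel)"
  by simp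
 have "(\<lambda>p :: ('a \<times> 'a) \<times> 'a. cis ((fst (fst p) - snd (fst p)) \<bullet> snd p)) \<in> borel_measurable ((borel \<Otimes>\<^sub>M borel) \<Otimes>\<^sub>M borel)"
  unfolding borel_prod by (intro borel_measurable_continuous_onI continuous_intros)
 note [measurable] = this
 have "(\<lambda>p :: ('a \<times> 'a) \<times> 'a. cis ((fst (fst p) - snd (fst p)) \<bullet> snd p) * b j (fst (fst p)) (snd p)) \<in> borel_measurable ((borel \<Otimes>\<^sub>M borel) \<Otimes>\<^sub>M borel)"
  by measurable
 then have "(\<lambda>p :: ('a \<times> 'a) \<times> 'a. cis ((fst (fst p) - snd (fst p)) \<bullet> snd p) * b j (fst (fst p)) (snd p)) \<in> borel_measurable ((borel \<Otimes>\<^sub>M borel) \<Otimes>\<^sub>M lborel)"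
  by (simp cong: sets_pair_measure_cong measurable_cong_sets)
 then show ?thesis unfolding kfam_def kern_def case_prod_beta'
  by (intro lborel.borel_measurable_lebesgue_integral) (simp only: case_prod_beta')
qed

text \<open>Fubini's theorem passes from the kernel side, where size and regularity are read off, to
  the frequency side, where orthogonality lives.\<close>

lemma kern_conv_eq_Uop:
 fixes b :: "'a::euclidean_space => 'a => complex" and h :: "'a => complex"
 assumes "b x \<in> BM" "\<And>\<xi>. \<xi> \<in> A ==> norm (b x \<xi>) \<le> B" "\<And>\<xi>. \<xi> \<notin> A ==> b x \<xi> = 0" "bounded A"
  and h: "integrable lborel h"
 shows "(LINT y|lborel. kern (b x) (x - y) * h y) = (LINT \<xi>|lborel. (cis (x \<bullet> \<xi>) * b x \<xi>) * (LINT y|lborel. cis (- (y \<bullet> \<xi>)) * h y))"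
proof -
 note i = kern_integrable[OF assms(1-4), of x]
 have m: "case_prod (\<lambda>y \<xi>. cis (- (y \<bullet> \<xi>))) \<in> borel_measurable (borel \<Otimes>\<^sub>M (borel :: 'a measure))"
  unfolding borel_prod case_prod_beta' by (intro borel_measurable_continuous_onI continuous_intros)
 have "(LINT y|lborel. kern (b x) (x - y) * h y) = (LINT y|lborel. h y * (LINT \<xi>|lborel. cis (- (y \<bullet> \<xi>)) * (cis (x \<bullet> \<xi>) * b x \<xi>)))"
 proof (intro Bochner_Integration.integral_cong refl)
  fix y
  have "kern (b x) (x - y) = (LINT \<xi>|lborel. cis (- (y \<bullet> \<xi>)) * (cis (x \<bullet> \<xi>) * b x \<xi>))"
   unfolding kern_def by (intro Bochner_Integration.integral_cong refl) (simp add: inner_diff_left cis_mult flip: mult.assoc)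
  then show "kern (b x) (x - y) * h y = h y * (LINT \<xi>|lborel. cis (- (y \<bullet> \<xi>)) * (cis (x \<bullet> \<xi>) * b x \<xi>))" by simp
 qed
 also have "\<dots> = (LINT \<xi>|lborel. (LINT y|lborel. cis (- (y \<bullet> \<xi>)) * h y) * (cis (x \<bullet> \<xi>) * b x \<xi>))"
  by (rule Fubini_kernel[OF h i m, where B=1]) auto
 finally show ?thesis by (simp add: mult.commute)
qed

lemma Top_kfam:
 fixes b :: "nat => real^'n::finite => real^'n => complex"
 assumes "\<And>j. b j x \<in> BM" "\<And>j \<xi>. \<xi> \<in> ring j ==> norm (b j x \<xi>) \<le> B j" "\<And>j \<xi>. \<xi> \<notin> ring j ==> b j x \<xi> = 0"
  and h: "integrable lborel h"
 shows "Top (kfam b) J h x = (\<Sum>j<J. Uop (b j) (fourier h) x)"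
proof -
 have "(LINT y|lborel. kern (b j x) (x - y) * h y) = Uop (b j) (fourier h) x" for j
  using kern_conv_eq_Uop[where b="b j" and x=x and A="ring j" and B="B j", OF assms(1,2,3) bounded_ring h] by (simp add: Uop_def fourier_def mult.commute)
 then show ?thesis unfolding Top_def kfam_def by simp
qed

text \<open>Size and regularity come from decay of oscillatory integrals. The L^2 bound cuts the
  Fourier transform to the rings, applies almost orthogonality, and ends with bounded overlap and
  Bessel's inequality. The constant depends on \<open>B\<close>, \<open>q\<close> and the dimension
  but not on the family.\<close>

lemma czker_of_goodfam:
 assumes N: "N = CARD('n::finite) + 2" and B: "0 \<le> B" and q: "1/2 \<le> q" "q < 1"
 shows "\<exists>A>0. \<forall>b :: nat => real^'n => real^'n => complex. goodfam N B q b \<longrightarrow> czker A (kfam b)"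
proof -
 from profile_exists[of N] obtain D M where prof: "profile N D M" by blast
 define k where "k = k1 TYPE('n) * (2 ^ N * (2 * real CARD('n)) + 1) * B"
 define e where "e = Ec TYPE('n) B * (2 / (1 - q)) * (4 * (Cb TYPE('n) * M ^ CARD('n))^2)"
 define A where "A = \<bar>k\<bar> + \<bar>e\<bar> + 1"
 have kA: "k \<le> A" "e \<le> A" "0 < A" by (simp_all add: A_def)
 have kk: "k1 TYPE('n) * B \<le> k" "k1 TYPE('n) * (2 ^ N * (2 * real CARD('n)) * B) + k1 TYPE('n) * B = k"
  using B k1_pos[where 'n='n] by (simp_all add: k_def algebra_simps)
 have czker: "czker A (kfam b)" if good: "goodfam N B q b" for b :: "nat => real^'n => real^'n => complex"
 proof -
  have s: "sy N (ring j) (2^j) B (b j)" "sy N (ring j) (2^j) (B * (2^j * norm h) * q^j) (\<lambda>x \<xi>. b j x \<xi> - b j (x - h) \<xi>)" for j h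
   using good by (auto simp: goodfam_def)
  have dC: "dC N (ax i) (ring j) (1 / 2^j) B (b j x)" "dC N (ax i) (ring j) (1 / 2^j) (B * (2^j * norm h) * q^j) (\<lambda>\<xi>. b j x \<xi> - b j (x - h) \<xi>)" for i j x h
   using s(1)[of j] s(2)[of j h] unfolding sy_def by blast+
  have z: "\<xi> \<notin> ring j ==> b j x \<xi> = 0" for x j \<xi> using s(1)[of j] unfolding sy_def by blast
  have bm: "b j x \<in> BM" for j x using dC_meas[OF dC(1)] .
  have le_A: "u \<le> A * v" if "u \<le> k * v" "0 \<le> v" for u v
   using that mult_right_mono[OF kA(1) that(2)] by linarith
  have bn: "0 \<le> bmp (2^j) z" for j and z :: "real^'n" by (rule bmp_nonneg) simp
  show ?thesis unfolding czker_def
  proof (intro conjI allI impI)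
   show "case_prod (kfam b j) \<in> BM2" for j
    using s(1)[of j] unfolding sy_def by (blast intro: kfam_meas)
   show "norm (kfam b j x y) \<le> A * (bmp (2^j) (x - y) / (1 + 2^j * norm (x - y)))" for j x y
   proof (rule le_A)
    have *: "0 \<le> bmp (2^j) (x - y) / (1 + 2^j * norm (x - y))" by (intro divide_nonneg_nonneg bn add_nonneg_nonneg) auto
    then show "norm (kfam b j x y) \<le> k * (bmp (2^j) (x - y) / (1 + 2^j * norm (x - y)))"
     using ring_kern_decay(1)[OF dC(1) z B N, of j x "x - y"] mult_right_mono[OF kk(1) *] unfolding kfam_def by linarith
   qed (intro divide_nonneg_nonneg bn add_nonneg_nonneg, auto)
   have kkm: "k1 TYPE('n) * (2 ^ N * (2 * real CARD('n)) * B) = k - k1 TYPE('n) * B" using kk(2) by linarith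
   have inc: "norm (kern (b j x) (z + h) - kern (b j x) z) \<le> (k - k1 TYPE('n) * B) * (2^j * norm h) * bmp (2^j) z" if "2^j * norm h \<le> 1" for j x z h
    using kern_increment[OF dC(1) z B N that, of x z] unfolding kkm .
   show "norm (kfam b j x y - kfam b j x y') \<le> A * (2^j * norm (y - y')) * bmp (2^j) (x - y)" if "2^j * norm (y - y') \<le> 1" for j x y y'
   proof -
    have *: "0 \<le> (2^j * norm (y - y')) * bmp (2^j) (x - y)" by (intro mult_nonneg_nonneg bn) auto
    have "norm (kfam b j x y - kfam b j x y') = norm (kern (b j x) (x - y + (y - y')) - kern (b j x) (x - y))"
     by (simp add: kfam_def norm_minus_commute)
    also have "\<dots> \<le> k * ((2^j * norm (y - y')) * bmp (2^j) (x - y))"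
    proof -
     have "0 \<le> k1 TYPE('n) * B" using B k1_pos[where 'n='n] by simp
     then have "(k - k1 TYPE('n) * B) * ((2^j * norm (y - y')) * bmp (2^j) (x - y)) \<le> k * ((2^j * norm (y - y')) * bmp (2^j) (x - y))"
      by (intro mult_right_mono *) simp
     then show ?thesis using inc[OF that, of x "x - y"] unfolding mult.assoc by linarith
    qed
    finally show ?thesis using le_A[OF _ *] by (simp add: mult.assoc)
   qed
   show "norm (kfam b j x y - kfam b j x' y) \<le> A * (2^j * norm (x - x')) * bmp (2^j) (x - y)" if "2^j * norm (x - x') \<le> 1" for j x x' y
   proof -
    define h where "h = x - x'"
    have *: "0 \<le> (2^j * norm h) * bmp (2^j) (x - y)" by (intro mult_nonneg_nonneg bn) auto
    have h1: "2^j * norm (- h) \<le> 1" using that by (simp add: h_def norm_minus_commute)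
    \<comment> \<open>Moving \<open>x\<close> changes both the amplitude and the phase; the first
      difference is measured by the amplitude \<open>b j x - b j (x - h)\<close>, the second is an
      increment of a fixed kernel.\<close>
    have eq: "kfam b j x y - kfam b j x' y = kern (\<lambda>\<xi>. b j x \<xi> - b j (x - h) \<xi>) (x - y) - (kern (b j x') (x - y + (- h)) - kern (b j x') (x - y))"
    proof -
     note i = kern_integrable[where b="b j _" and A="ring j" and B=B, OF bm dC_bound[OF dC(1)] z bounded_ring]
     have "kern (\<lambda>\<xi>. b j x \<xi> - b j (x - h) \<xi>) (x - y) = kern (b j x) (x - y) - kern (b j x') (x - y)"
      using i by (simp add: kern_def h_def right_diff_distrib)
     then show ?thesis by (simp add: kfam_def h_def)
    qed
    have "norm (kern (\<lambda>\<xi>. b j x \<xi> - b j (x - h) \<xi>) (x - y)) \<le> k1 TYPE('n) * (B * (2^j * norm h) * q^j) * bmp (2^j) (x - y)"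
     using B q z by (intro ring_kern_decay(2)[OF dC(2) _ _ N]) auto
    also have "\<dots> \<le> k1 TYPE('n) * (B * (2^j * norm h) * 1) * bmp (2^j) (x - y)"
     using B q k1_pos[where 'n='n] bn by (intro mult_right_mono mult_left_mono power_le_one) auto
    finally have "norm (kfam b j x y - kfam b j x' y) \<le> k1 TYPE('n) * B * ((2^j * norm h) * bmp (2^j) (x - y)) + (k - k1 TYPE('n) * B) * ((2^j * norm h) * bmp (2^j) (x - y))"
     using inc[OF h1, of x' "x - y"] norm_triangle_ineq4[of "kern (\<lambda>\<xi>. b j x \<xi> - b j (x - h) \<xi>) (x - y)" "kern (b j x') (x - y + (- h)) - kern (b j x') (x - y)"]
     unfolding eq norm_minus_cancel mult.assoc mult_1_right mult_1_left by linarith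
    also have "\<dots> = k * ((2^j * norm h) * bmp (2^j) (x - y))" by (simp add: left_diff_distrib)
    finally show ?thesis using le_A[OF _ *] unfolding h_def by (simp add: mult.assoc)
   qed
   fix J and h :: "real^'n => complex" assume h: "adm h"
   note F = bessel[OF prof N h]
   \<comment> \<open>Each amplitude vanishes off its ring, so the Fourier transform may be cut to
     the ring without changing the piece; this yields the supports required for
     orthogonality.\<close>
   define g where "g j = (\<lambda>\<xi>. indicator (ring j) \<xi> * fourier h \<xi>)" for j
   have g: "L2 (g j)" "g j \<xi> \<noteq> 0 ==> \<xi> \<in> ring j" for j \<xi>
    using sum_ring_n2(2)[OF F(1)] by (auto simp: g_def indicator_def split: if_splits)
   have "Top (kfam b) J h x = (\<Sum>j<J. Uop (b j) (g j) x)" for x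
    unfolding g_def using Top_kfam[where b=b and x=x and B="\<lambda>_. B" and h=h, OF bm dC_bound[OF dC(1)] z adm_integrable[OF h]]
    by (simp add: Uop_indicator[OF s(1) bounded_ring closed_ring emeasure_ring _ B N, symmetric])
   then have T: "Top (kfam b) J h = (\<lambda>x. \<Sum>j<J. Uop (b j) (g j) x)" by auto
   note ao = almost_orthogonal[OF good N B q, of g, OF g(1) g(2), where J=J]
   have "n2 (Top (kfam b) J h) ^ 2 \<le> Ec TYPE('n) B * (2 / (1 - q)) * (\<Sum>j<J. n2 (g j) ^ 2)" unfolding T by (rule ao)
   also have "\<dots> \<le> Ec TYPE('n) B * (2 / (1 - q)) * (4 * (Cb TYPE('n) * M ^ CARD('n) * n2 h)^2)"
   proof (intro mult_left_mono)
    have "n2 (fourier h) ^ 2 \<le> (Cb TYPE('n) * M ^ CARD('n) * n2 h)^2" by (intro power_mono F n2_nonneg)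
    then show "(\<Sum>j<J. n2 (g j) ^ 2) \<le> 4 * (Cb TYPE('n) * M ^ CARD('n) * n2 h)^2"
     using sum_ring_n2(1)[OF F(1), of J] unfolding g_def by linarith
    show "0 \<le> Ec TYPE('n) B * (2 / (1 - q))" using order_trans[OF zero_le_power2 Ec_ge[OF good N B q]] q by simp
   qed
   also have "\<dots> = e * n2 h ^ 2" by (simp add: e_def power_mult_distrib)
   also have "\<dots> \<le> A * n2 h ^ 2" by (intro mult_right_mono kA) simp
   finally have "ennreal (n2 (Top (kfam b) J h) ^ 2) \<le> ennreal (A * n2 h ^ 2)" by (rule ennreal_leI)
   then have "sqi (Top (kfam b) J h) \<le> ennreal A * sqi h"
    using ao(1) kA(3) unfolding sqi_n2[OF adm_L2[OF h]] by (subst sqi_n2) (simp_all add: T ennreal_mult)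
   then show "(\<integral>\<^sup>+x. ennreal (norm (Top (kfam b) J h x) ^ 2)) \<le> ennreal A * (\<integral>\<^sup>+x. ennreal (norm (h x) ^ 2))"
    by (simp add: sqi_def)
  qed
 qed
 then show ?thesis using kA(3) by blast
qed

section \<open>Symbols\<close>

lemma smooth_partial: "smooth f ==> b \<in> Basis ==> smooth (partial b f)"
 unfolding smooth_def using Ck.simps(2) by blast

lemma smooth_partials: "smooth f ==> b \<in> Basis ==> smooth ((partial b ^^ k) f)"
 by (induction k) (auto intro: smooth_partial)

lemma smooth_has_derivative: "smooth f ==> (f has_derivative frechet_derivative f (at x)) (at x)"
proof -
 assume "smooth f"
 then have "Ck (Suc 0) f" unfolding smooth_def by blast
 then have "f differentiable (at x)" by (simp add: differentiable_on_def)
 then show ?thesis by (simp add: frechet_derivative_works)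
qed

lemma smooth_continuous: "smooth f ==> continuous_on UNIV f"
 unfolding smooth_def using Ck.simps(1) by blast

definition mono1 :: "'n => nat => 'n => nat" where "mono1 i k = (\<lambda>l. if l = i then k else 0)"

lemma multi_order_mono1: "multi_order (mono1 i k) = k" for i :: "'n::finite"
 by (simp add: multi_order_def mono1_def)

lemma multi_order_0: "multi_order (\<lambda>_. 0) = 0" by (simp add: multi_order_def)

text \<open>Pure derivatives in one coordinate are all that the estimates use. As
  \<open>coords\<close> lists each coordinate once, a single factor of the fold acts and the
  arbitrary order is immaterial.\<close>

lemma multi_partial_mono1: "multi_partial e (mono1 i k) f = (partial (e i) ^^ k) f" for i :: "'n::finite"
proof -
 have "foldr (\<lambda>i' g. (partial (e i') ^^ mono1 i k i') g) is f = (if i \<in> set is then (partial (e i) ^^ k) f else f)" if "distinct is" for "is"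
  using that by (induction "is") (auto simp: mono1_def)
 then show ?thesis unfolding multi_partial_def using distinct_coords[where 'n='n] set_coords[where 'n='n] by simp
qed

lemma multi_partial_0: "multi_partial e (\<lambda>_. 0) f = f"
 using multi_partial_mono1[of e undefined 0 f] by (simp add: mono1_def)

lemma axis_Basis: "(0, ax i) \<in> Basis" "(ax i, 0) \<in> Basis" for i :: "'n::finite"
 by (auto simp: Basis_prod_def Basis_vec_def)

lemma has_vector_derivative_along:
 assumes g: "(g has_derivative g') (at z)"
 shows "((\<lambda>t. g (z + t *\<^sub>R v)) has_vector_derivative g' v) (at 0)"
proof -
 have "((\<lambda>t. z + t *\<^sub>R v) has_vector_derivative v) (at 0)" by (auto intro!: derivative_eq_intros)
 moreover have "(g has_derivative g') (at (z + 0 *\<^sub>R v) within range (\<lambda>t. z + t *\<^sub>R v))"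
  using g by (auto intro: has_derivative_at_withinI)
 ultimately have "(g \<circ> (\<lambda>t. z + t *\<^sub>R v) has_vector_derivative g' v) (at 0 within UNIV)"
  by (intro vector_derivative_diff_chain_within)
 then show ?thesis by (simp add: o_def)
qed

text \<open>On the ring \<open>1 + norm \<xi>\<close> is comparable to \<open>2^j\<close> from above
  and below, so the exponent may have either sign.\<close>

lemma one_plus_norm_ring:
 fixes \<xi> :: "real^'n::finite"
 assumes \<xi>: "\<xi> \<in> ring j" and p: "\<bar>p\<bar> \<le> P"
 shows "(1 + norm \<xi>) powr p \<le> (2 * real CARD('n) + 1) powr P * (2^j) powr p"
proof -
 define u where "u = (1 + norm \<xi>) / 2^j"
 define c where "c = 2 * real CARD('n) + 1"
 have n: "1 \<le> real CARD('n)" by (simp add: Suc_leI)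
 then have c: "2 \<le> c" unfolding c_def by linarith
 have "norm \<xi> \<le> (\<Sum>i\<in>(UNIV::'n set). 2 * 2^j)"
  by (rule order_trans[OF norm_le_l1_cart sum_mono]) (use ring_coord[OF \<xi>] in simp)
 moreover have "(1::real) \<le> 2^j" by (rule one_le_power) simp
 moreover have "c * 2^j = real CARD('n) * (2 * 2^j) + 2^j" by (simp add: c_def algebra_simps)
 ultimately have "1 + norm \<xi> \<le> c * 2^j" unfolding sum_constant by linarith
 then have uc: "u \<le> c" by (simp add: u_def divide_le_eq)
 have "2^j \<le> 2 * (1 + norm \<xi>)"
 proof (cases "j = 0")
  case False
  then obtain i where "2^j \<le> 2 * \<bar>\<xi> $ i\<bar>" using \<xi> by (auto simp: ring_def)
  moreover have "2 * \<bar>\<xi> $ i\<bar> \<le> 2 * (1 + norm \<xi>)" using component_le_norm_cart[of \<xi> i] by simp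
  ultimately show ?thesis by linarith
 qed simp
 then have u2: "1/2 \<le> u" by (simp add: u_def field_simps)
 have up: "u powr p \<le> c powr \<bar>p\<bar>"
 proof (cases "0 \<le> p")
  case True then show ?thesis using uc u2 by (auto intro: powr_mono2)
 next
  case False
  have "u powr p = (1 / u) powr \<bar>p\<bar>" using False u2 by (simp add: powr_minus_divide powr_divide)
  also have "\<dots> \<le> c powr \<bar>p\<bar>"
  proof (rule powr_mono2)
   have "1 / u \<le> 2" using u2 by (simp add: field_simps)
   then show "1 / u \<le> c" using c by linarith
  qed (use u2 in auto)
  finally show ?thesis .
 qed
 have "1 + norm \<xi> = u * 2^j" by (simp add: u_def)
 then have "(1 + norm \<xi>) powr p = u powr p * (2^j) powr p" using u2 by (simp add: powr_mult)
 also have "\<dots> \<le> c powr P * (2^j) powr p"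
  using p c by (intro mult_right_mono order_trans[OF up] powr_mono) auto
 finally show ?thesis by (simp add: c_def)
qed

section \<open>The dyadic pieces of a symbol\<close>

definition bfam :: "(nat => real => real) => ((real^'n::finite) \<times> (real^'n) => complex) => nat => real^'n => real^'n => complex" where
 "bfam D a j x \<xi> = a (x, \<xi>) * psi D j \<xi>"

text \<open>The exponents that occur are \<open>m - \<rho> k + \<delta> v\<close> with
  \<open>k \<le> N\<close> and \<open>v \<le> 1\<close>; their modulus is at most
  \<open>|m| + N + 1\<close>.\<close>

definition Gr :: "'n::finite itself => nat => real => real" where
 "Gr _ N m = (2 * real CARD('n) + 1) powr (\<bar>m\<bar> + real N + 1)"

text \<open>The finitely many symbol constants that are consumed: up to \<open>N\<close> derivatives
  in one frequency coordinate, with at most one derivative in \<open>x\<close>. Later constants thus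
  depend on \<open>C\<close> and not on the symbol.\<close>

definition Mc :: "nat => (('n::finite => nat) => ('n => nat) => real) => real" where
 "Mc N C = (\<Sum>i\<in>UNIV. \<Sum>k\<le>N. \<bar>C (\<lambda>_. 0) (mono1 i k)\<bar> + (\<Sum>l\<in>UNIV. \<bar>C (mono1 l 1) (mono1 i k)\<bar>))"

definition Ac :: "nat => real => real => (('n::finite => nat) => ('n => nat) => real) => real" where
 "Ac N M m C = 2 ^ N * (real CARD('n) * Mc N C * Gr TYPE('n) N m) * (M ^ CARD('n) * (1 + 2 ^ N))"

lemma Mc_nonneg: "0 \<le> Mc N C" unfolding Mc_def by (intro sum_nonneg add_nonneg_nonneg) auto

lemma Gr_pos: "0 < Gr TYPE('n::finite) N m"
 using add_nonneg_pos[of "2 * real CARD('n)" 1] by (simp add: Gr_def)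

lemma Ac_nonneg: "0 \<le> M ==> 0 \<le> Ac N M m C"
 using Mc_nonneg[of N C] less_imp_le[OF Gr_pos[of N m]] unfolding Ac_def by (intro mult_nonneg_nonneg) auto

context
 fixes N :: nat and D :: "nat => real => real" and M m \<rho> \<delta> :: real
  and C :: "('n::finite => nat) => ('n => nat) => real" and a :: "(real^'n) \<times> (real^'n) => complex"
 assumes prof: "profile N D M" and \<rho>: "0 \<le> \<rho>" "\<rho> \<le> 1" and \<delta>: "0 \<le> \<delta>" "\<delta> \<le> 1"
  and sm: "smooth a" and est: "\<And>\<nu> \<sigma>. symbol_estimate m \<rho> \<delta> \<nu> \<sigma> (C \<nu> \<sigma>) a"
begin

lemma C_le_Mc:
 assumes "k \<le> N" shows "C (\<lambda>_. 0) (mono1 i k) \<le> Mc N C" "C (mono1 l 1) (mono1 i k) \<le> Mc N C"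
proof -
 let ?t = "\<lambda>i k. \<bar>C (\<lambda>_. 0) (mono1 i k)\<bar> + (\<Sum>l\<in>UNIV. \<bar>C (mono1 l 1) (mono1 i k)\<bar>)"
 have t0: "0 \<le> ?t i k" for i k by (intro add_nonneg_nonneg sum_nonneg) auto
 have "?t i k \<le> (\<Sum>k\<le>N. ?t i k)" using assms t0 by (intro member_le_sum) auto
 also have "\<dots> \<le> Mc N C" unfolding Mc_def using t0 by (intro member_le_sum[of i UNIV "\<lambda>i. \<Sum>k\<le>N. ?t i k"]) (auto intro!: sum_nonneg)
 finally have t: "?t i k \<le> Mc N C" .
 have "\<bar>C (mono1 l 1) (mono1 i k)\<bar> \<le> (\<Sum>l\<in>UNIV. \<bar>C (mono1 l 1) (mono1 i k)\<bar>)"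
  by (intro member_le_sum) auto
 moreover have "0 \<le> (\<Sum>l\<in>UNIV. \<bar>C (mono1 l 1) (mono1 i k)\<bar>)" by (intro sum_nonneg) auto
 ultimately show "C (\<lambda>_. 0) (mono1 i k) \<le> Mc N C" "C (mono1 l 1) (mono1 i k) \<le> Mc N C" using t by linarith+
qed

definition da :: "'n => nat => real^'n => real^'n => complex" where
 "da i k x \<xi> = ((partial (0, ax i) ^^ k) a) (x, \<xi>)"

lemma ring_growth:
 fixes \<xi> :: "real^'n" and w :: complex
 assumes "k \<le> N" "v \<in> {0, 1}" "\<xi> \<in> ring j" "norm w \<le> c * (1 + norm \<xi>) powr (m - \<rho> * real k + \<delta> * v)" "c \<le> Mc N C"
 shows "norm w \<le> Mc N C * Gr TYPE('n) N m * (2^j) powr (m + \<delta> * v) * ((2^j) powr (- \<rho>)) ^ k"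
proof -
 have "\<rho> * real k \<le> 1 * real N" using assms \<rho> by (intro mult_mono) auto
 moreover have "0 \<le> \<rho> * real k" "0 \<le> \<delta> * v" "\<delta> * v \<le> 1" using assms \<rho> \<delta> by auto
 ultimately have "\<bar>m - \<rho> * real k + \<delta> * v\<bar> \<le> \<bar>m\<bar> + real N + 1" by linarith
 note g = one_plus_norm_ring[OF assms(3) this]
 have "norm w \<le> Mc N C * (1 + norm \<xi>) powr (m - \<rho> * real k + \<delta> * v)"
  using assms(4,5) mult_right_mono[OF assms(5) powr_ge_zero] by (rule_tac order_trans)
 also have "\<dots> \<le> Mc N C * (Gr TYPE('n) N m * (2^j) powr (m - \<rho> * real k + \<delta> * v))"
  using g Mc_nonneg unfolding Gr_def by (intro mult_left_mono)
 also have "(2^j) powr (m - \<rho> * real k + \<delta> * v) = (2^j) powr (m + \<delta> * v) * ((2^j :: real) powr (- \<rho>)) ^ k"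
  by (simp add: powr_powr powr_add[symmetric] algebra_simps flip: powr_realpow)
 finally show ?thesis by (simp add: mult.assoc)
qed

lemma da_bound:
 assumes "k \<le> N" "\<xi> \<in> ring j"
 shows "norm (da i k x \<xi>) \<le> Mc N C * Gr TYPE('n) N m * (2^j) powr m * ((2^j) powr (- \<rho>)) ^ k"
proof -
 have "norm (da i k x \<xi>) \<le> C (\<lambda>_. 0) (mono1 i k) * (1 + norm \<xi>) powr (m - \<rho> * real k + \<delta> * 0)"
  using est[of "\<lambda>_. 0" "mono1 i k"] by (simp add: symbol_estimate_def symbol_partial_def multi_partial_mono1 multi_partial_0 multi_order_mono1 multi_order_0 da_def)
 from ring_growth[OF assms(1) _ assms(2) this C_le_Mc(1)[OF assms(1)]] show ?thesis by simp
qed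

lemma da_smooth: "smooth ((partial (0, ax i) ^^ k) a)" by (intro smooth_partials sm axis_Basis)

lemma da_ddir: "ddir (ax i) (da i k x) (da i (Suc k) x)"
 unfolding ddir_def
proof
 fix \<xi>
 let ?g = "(partial (0, ax i) ^^ k) a"
 have "((\<lambda>t. ?g ((x, \<xi>) + t *\<^sub>R (0, ax i))) has_vector_derivative frechet_derivative ?g (at (x, \<xi>)) (0, ax i)) (at 0)"
  by (rule has_vector_derivative_along[OF smooth_has_derivative[OF da_smooth]])
 then show "((\<lambda>t. da i k x (\<xi> + t *\<^sub>R ax i)) has_vector_derivative da i (Suc k) x \<xi>) (at 0)"
  by (simp add: da_def partial_def)
qed

lemma da_meas: "da i k x \<in> BM"
proof -
 have "continuous_on UNIV (\<lambda>\<xi>. ((partial (0, ax i) ^^ k) a) (x, \<xi>))"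
  by (rule continuous_on_compose2[OF smooth_continuous[OF da_smooth]]) (auto intro!: continuous_intros)
 then show ?thesis unfolding da_def by (rule borel_measurable_continuous_onI)
qed

text \<open>The mean value theorem along \<open>h\<close>, with the derivative expanded in the
  coordinate directions; each of them costs \<open>2^(j \<delta>)\<close>.\<close>

lemma da_diff_bound:
 assumes "k \<le> N" "\<xi> \<in> ring j"
 shows "norm (da i k x \<xi> - da i k (x - h) \<xi>) \<le> real CARD('n) * norm h * (Mc N C * Gr TYPE('n) N m * (2^j) powr (m + \<delta>)) * ((2^j) powr (- \<rho>)) ^ k"
proof -
 let ?g = "(partial (0, ax i) ^^ k) a"
 define b' where "b' x = frechet_derivative ?g (at (x, \<xi>)) (h, 0)" for x
 define c where "c = Mc N C * Gr TYPE('n) N m * (2^j) powr (m + \<delta>) * ((2^j) powr (- \<rho>)) ^ k"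
 have d: "ddir h (\<lambda>x. da i k x \<xi>) b'"
  unfolding ddir_def
 proof
  fix x
  have "((\<lambda>t. ?g ((x, \<xi>) + t *\<^sub>R (h, 0))) has_vector_derivative b' x) (at 0)"
   unfolding b'_def by (rule has_vector_derivative_along[OF smooth_has_derivative[OF da_smooth]])
  then show "((\<lambda>t. da i k (x + t *\<^sub>R h) \<xi>) has_vector_derivative b' x) (at 0)" by (simp add: da_def)
 qed
 have b: "norm (b' x) \<le> real CARD('n) * norm h * c" for x
 proof -
  have lin: "linear (frechet_derivative ?g (at (x, \<xi>)))"
   using smooth_has_derivative[OF da_smooth] by (rule has_derivative_linear)
  have "(h, 0) = (\<Sum>l\<in>UNIV. h $ l *\<^sub>R (ax l, 0 :: real^'n))"
   by (simp add: prod_eq_iff fst_sum snd_sum) (metis basis_expansion scalar_mult_eq_scaleR)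
  then have "b' x = (\<Sum>l\<in>UNIV. h $ l *\<^sub>R partial (ax l, 0) ?g (x, \<xi>))"
   unfolding b'_def partial_def[of "(ax _, 0)"] by (simp only: linear_sum[OF lin] linear_cmul[OF lin])
  also have "norm \<dots> \<le> (\<Sum>l\<in>(UNIV::'n set). norm h * c)"
  proof (intro order_trans[OF norm_sum] sum_mono)
   fix l :: 'n
   have "norm (partial (ax l, 0) ?g (x, \<xi>)) \<le> C (mono1 l 1) (mono1 i k) * (1 + norm \<xi>) powr (m - \<rho> * real k + \<delta> * 1)"
    using est[of "mono1 l 1" "mono1 i k"] by (simp add: symbol_estimate_def symbol_partial_def multi_partial_mono1 multi_order_mono1)
   from ring_growth[OF assms(1) _ assms(2) this C_le_Mc(2)[OF assms(1)]]
   have "norm (partial (ax l, 0) ?g (x, \<xi>)) \<le> c" by (simp add: c_def)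
   then show "norm (h $ l *\<^sub>R partial (ax l, 0) ?g (x, \<xi>)) \<le> norm h * c"
    using component_le_norm_cart[of h l] by (auto intro!: mult_mono)
  qed
  finally show ?thesis by simp
 qed
 have "norm (da i k (x - h + 1 *\<^sub>R h) \<xi> - da i k (x - h) \<xi>) \<le> real CARD('n) * norm h * c * \<bar>1\<bar>"
  by (rule ddir_mean_value[OF d b])
 then show ?thesis by (simp add: c_def mult_ac)
qed

text \<open>A derivative of the cut-off gains \<open>2^(-j)\<close>, at least as much as the
  \<open>2^(-j \<rho>)\<close> gained by the symbol, so the product follows the symbol.\<close>

lemma psi_dC': "dC N (ax i) (ring j) ((2^j) powr (- \<rho>)) (M ^ CARD('n) * (1 + 2 ^ N)) (psi D j :: real^'n => complex)"
proof -
 have "1 / 2^j = (2^j :: real) powr (-1)" by (simp add: powr_minus_divide)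
 also have "\<dots> \<le> (2^j) powr (- \<rho>)" using \<rho> by (intro powr_mono) auto
 finally have "(1::real) / 2^j \<le> 1 * (2^j) powr (- \<rho>)" by simp
 moreover have "0 \<le> M ^ CARD('n) * (1 + 2 ^ N)" using M_ge_1[OF prof] by (intro mult_nonneg_nonneg) auto
 ultimately show ?thesis using dC_rescale[OF psi_dC[OF prof, of i "ring j" j], of "(2^j) powr (- \<rho>)" 1] by simp
qed

lemma bfam_dC: "dC N (ax i) (ring j) ((2^j) powr (- \<rho>)) (Ac N M m C * (2^j) powr m) (bfam D a j x)"
proof -
 define B where "B = Mc N C * Gr TYPE('n) N m * (2^j) powr m"
 have B: "0 \<le> B" using Mc_nonneg[of N C] less_imp_le[OF Gr_pos[where 'n='n, of N m]] unfolding B_def by (intro mult_nonneg_nonneg) auto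
 have d0: "dC N (ax i) (ring j) ((2^j) powr (- \<rho>)) B (da i 0 x)"
  by (rule dC_of_family) (use da_meas da_ddir da_bound in \<open>auto simp: B_def\<close>)
 have "1 * B \<le> real CARD('n) * B" using B by (intro mult_right_mono) (simp_all add: Suc_leI)
 then have le: "B \<le> real CARD('n) * B" by simp
 have "dC N (ax i) (ring j) ((2^j) powr (- \<rho>)) (real CARD('n) * B) (da i 0 x)"
  by (rule dC_mono[OF d0 le powr_ge_zero order_refl])
 then have "dC N (ax i) (ring j) ((2^j) powr (- \<rho>)) (2 ^ N * (real CARD('n) * B) * (M ^ CARD('n) * (1 + 2 ^ N))) (\<lambda>\<xi>. da i 0 x \<xi> * psi D j \<xi>)"
  using B M_ge_1[OF prof] by (intro dC_mult psi_dC') auto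
 then show ?thesis by (simp add: B_def Ac_def da_def mult_ac bfam_def[abs_def])
qed

lemma bfam_diff_dC: "dC N (ax i) (ring j) ((2^j) powr (- \<rho>)) (Ac N M m C * (norm h * (2^j) powr (m + \<delta>))) (\<lambda>\<xi>. bfam D a j x \<xi> - bfam D a j (x - h) \<xi>)"
proof -
 define B where "B = real CARD('n) * norm h * (Mc N C * Gr TYPE('n) N m * (2^j) powr (m + \<delta>))"
 have B: "0 \<le> B" using Mc_nonneg[of N C] less_imp_le[OF Gr_pos[where 'n='n, of N m]] unfolding B_def by (intro mult_nonneg_nonneg) auto
 have "dC N (ax i) (ring j) ((2^j) powr (- \<rho>)) B (\<lambda>\<xi>. da i 0 x \<xi> - da i 0 (x - h) \<xi>)"
 proof (rule dC_of_family[where d="\<lambda>k \<xi>. da i k x \<xi> - da i k (x - h) \<xi>"])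
  show "ddir (ax i) (\<lambda>\<xi>. da i k x \<xi> - da i k (x - h) \<xi>) (\<lambda>\<xi>. da i (Suc k) x \<xi> - da i (Suc k) (x - h) \<xi>)" for k
   using da_ddir unfolding ddir_def by (auto intro: has_vector_derivative_diff)
 qed (use da_meas da_diff_bound in \<open>auto simp: B_def\<close>)
 then have "dC N (ax i) (ring j) ((2^j) powr (- \<rho>)) (2 ^ N * B * (M ^ CARD('n) * (1 + 2 ^ N))) (\<lambda>\<xi>. (da i 0 x \<xi> - da i 0 (x - h) \<xi>) * psi D j \<xi>)"
  using B M_ge_1[OF prof] by (intro dC_mult psi_dC') auto
 then show ?thesis by (simp add: B_def Ac_def da_def mult_ac bfam_def right_diff_distrib)
qed

lemma bfam_meas: "case_prod (bfam D a j) \<in> BM2"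
proof -
 have 1: "a \<in> BM2"
  unfolding borel_prod by (rule borel_measurable_continuous_onI[OF smooth_continuous[OF sm]])
 have "psi D j \<in> borel_measurable (borel :: (real^'n) measure)" using dC_meas[OF psi_dC'] .
 then show ?thesis using 1 unfolding bfam_def case_prod_beta' by measurable
qed

lemma bfam_0: "\<xi> \<notin> ring j ==> bfam D a j x \<xi> = 0"
 by (simp add: bfam_def psi_0[OF prof])

text \<open>The cost \<open>2^(j \<delta>)\<close> of an increment in \<open>x\<close> is written as
  \<open>2^j\<close> times \<open>(2 powr (\<delta> - 1)) ^ j\<close>.\<close>

lemma bfam_goodfam:
 assumes "\<rho> = 1" "m = 0" shows "goodfam N (Ac N M m C) (2 powr (\<delta> - 1)) (bfam D a)"
proof -
 have s: "(2^j) powr (- \<rho>) = 1 / (2^j :: real)" for j using assms by (simp add: powr_minus_divide)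
 have e: "norm h * (2^j) powr (m + \<delta>) = 2^j * norm h * (2 powr (\<delta> - 1)) ^ j" for h :: "real^'n" and j
 proof -
  have "(2^j) powr \<delta> = 2^j * (2 powr (\<delta> - 1) :: real) ^ j"
  proof -
   have "2^j * (2 powr (\<delta> - 1) :: real) ^ j = (2 * 2 powr (\<delta> - 1)) ^ j" by (simp add: power_mult_distrib)
   also have "2 * 2 powr (\<delta> - 1) = 2 powr \<delta>" by (simp add: powr_diff)
   also have "(2 powr \<delta>) ^ j = (2^j) powr \<delta>" by (simp add: powr_powr mult.commute flip: powr_realpow)
   finally show ?thesis by simp
  qed
  then show ?thesis using assms by simp
 qed
 have d: "case_prod (\<lambda>x \<xi>. bfam D a j x \<xi> - bfam D a j (x - h) \<xi>) \<in> BM2" for j h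
 proof -
  have [measurable]: "(\<lambda>p. bfam D a j (fst p) (snd p)) \<in> BM2" using bfam_meas[of j] by (simp add: case_prod_beta')
  have "(\<lambda>p. (fst p - h, snd p)) \<in> borel \<Otimes>\<^sub>M borel \<rightarrow>\<^sub>M borel \<Otimes>\<^sub>M (borel :: (real^'n) measure)" by measurable
  from measurable_compose[OF this bfam_meas[of j]] have [measurable]: "(\<lambda>p. bfam D a j (fst p - h) (snd p)) \<in> BM2" by simp
  show ?thesis unfolding case_prod_beta' by measurable
 qed
 have 1: "dC N (ax i) (ring j) (1 / 2^j) (Ac N M m C) (bfam D a j x)" for i j x using bfam_dC[of i j x] assms unfolding s by simp
 have 2: "dC N (ax i) (ring j) (1 / 2^j) (Ac N M m C * (2^j * norm h) * (2 powr (\<delta> - 1)) ^ j) (\<lambda>\<xi>. bfam D a j x \<xi> - bfam D a j (x - h) \<xi>)" for i j x h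
  using bfam_diff_dC[of i j h x] unfolding s e by (simp add: mult.assoc)
 show ?thesis unfolding goodfam_def sy_def using 1 2 d bfam_meas by (auto simp: bfam_0)
qed

end

section \<open>The case \<open>\<rho> < 1\<close>\<close>

lemma kern_eq_fourier: "kern c z = fourier c (- z)"
 unfolding kern_def fourier_def by (simp add: mult.commute inner_commute)

lemma nn_integral_reflect:
 fixes f :: "'a::euclidean_space => ennreal"
 assumes [measurable]: "f \<in> BM"
 shows "(\<integral>\<^sup>+y. f (x - y)) = (\<integral>\<^sup>+y. f y)"
proof -
 have d: "distr lborel borel (\<lambda>y. x - y) = (lborel :: 'a measure)"
  by (subst lborel_affine[of "-1" x]) (auto simp: density_1)
 have "(\<integral>\<^sup>+y. f (x - y)) = (\<integral>\<^sup>+y. f y \<partial>distr lborel borel (\<lambda>y. x - y))"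
  by (subst nn_integral_distr) auto
 then show ?thesis unfolding d .
qed

text \<open>Up to a reflection the kernel is the Fourier transform of its amplitude, so Bessel's
  inequality bounds it by height and volume of the ring.\<close>

lemma kern_plancherel:
 fixes c :: "real^'n::finite => complex"
 assumes prof: "profile N D M" and N: "N = CARD('n) + 2" and c[measurable]: "c \<in> BM"
  and B: "\<And>x. x \<in> ring j ==> norm (c x) \<le> B" "0 \<le> B" and z: "\<And>x. x \<notin> ring j ==> c x = 0"
 shows "sqi (kern c) \<le> ennreal ((Cb TYPE('n) * M ^ CARD('n))^2 * (B^2 * (4 * 2^j) ^ CARD('n)))"
proof -
 let ?k = "Cb TYPE('n) * M ^ CARD('n)"
 have cb: "norm (c x) \<le> B" for x using B(1)[of x] B(2) z[of x] by (cases "x \<in> ring j") auto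
 have adm: "adm c" unfolding adm_def using cb z bounded_ring[of j] by (auto intro: bounded_subset)
 note F = bessel[OF prof N adm]
 have fm[measurable]: "fourier c \<in> BM" using F(1) by (simp add: L2_def)
 have "sqi (kern c) = (\<integral>\<^sup>+z. ennreal (norm (fourier c (- z)) ^ 2))" by (simp add: sqi_def kern_eq_fourier)
 also have "\<dots> = sqi (fourier c)"
  unfolding sqi_def using nn_integral_reflect[of "\<lambda>z. ennreal (norm (fourier c z) ^ 2)" 0] by simp
 also have "\<dots> = ennreal (n2 (fourier c) ^ 2)" by (rule sqi_n2[OF F(1)])
 also have "\<dots> \<le> ennreal ((?k * n2 c) ^ 2)" by (intro ennreal_leI power_mono F n2_nonneg)
 also have "\<dots> = ennreal (?k^2) * sqi c"
  by (simp add: sqi_n2[OF adm_L2[OF adm]] power_mult_distrib ennreal_mult)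
 also have "\<dots> \<le> ennreal (?k^2) * ennreal (B^2 * (4 * 2^j) ^ CARD('n))"
 proof (rule mult_left_mono)
  have "sqi c \<le> (\<integral>\<^sup>+x. ennreal (B^2) * indicator (ring j :: (real^'n) set) x)" unfolding sqi_def
   using B z by (intro nn_integral_mono) (auto simp: indicator_def intro!: ennreal_leI power_mono)
  also have "\<dots> = ennreal (B^2) * vol (ring j :: (real^'n) set)"
   by (rule nn_integral_cmult_indicator) (use borel_closed[OF closed_ring] in simp)
  also have "\<dots> \<le> ennreal (B^2) * ennreal ((4 * 2^j) ^ CARD('n))" by (intro mult_left_mono emeasure_ring) auto
  finally show "sqi c \<le> ennreal (B^2 * (4 * 2^j) ^ CARD('n))" by (simp add: ennreal_mult)
 qed simp
 finally show ?thesis by (simp add: ennreal_mult)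
qed

text \<open>Replaces the radial weight by coordinate moments, each of which is again the kernel of
  an amplitude.\<close>

lemma weight_le:
 fixes z :: "real^'n::finite"
 assumes R: "0 < R" shows "((1 + R * norm z) ^ N)^2 \<le> ((2 * real CARD('n)) ^ N)^2 * (1 + (\<Sum>i\<in>UNIV. (R ^ N * \<bar>z \<bullet> ax i\<bar> ^ N)^2))"
proof -
 have n: "1 \<le> real CARD('n)" by (simp add: Suc_leI)
 define m where "m = Max (range (\<lambda>i. \<bar>z $ i\<bar>))"
 have "m \<in> range (\<lambda>i. \<bar>z $ i\<bar>)" unfolding m_def by (rule Max_in) auto
 then obtain i where i: "m = \<bar>z $ i\<bar>" by auto
 have le: "\<bar>z $ l\<bar> \<le> m" for l unfolding m_def by (rule Max_ge) auto
 have "norm z \<le> real CARD('n) * m" by (rule order_trans[OF norm_le_l1_cart]) (use sum_mono[of UNIV "\<lambda>l. \<bar>z $ l\<bar>" "\<lambda>_. m"] le in simp)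
 then have "R * norm z \<le> R * (real CARD('n) * m)" using R by (intro mult_left_mono) auto
 moreover have "R * (real CARD('n) * m) = real CARD('n) * (R * m)" by simp
 moreover have "real CARD('n) * (R * m) \<le> real CARD('n) * max 1 (R * m)" "1 * 1 \<le> real CARD('n) * max 1 (R * m)"
  by (rule mult_left_mono, simp, simp, rule mult_mono[OF n]) auto
 ultimately have w: "1 + R * norm z \<le> 2 * real CARD('n) * max 1 (R * m)" by linarith
 have "((1 + R * norm z) ^ N)^2 \<le> ((2 * real CARD('n) * max 1 (R * m)) ^ N)^2"
  using w R by (intro power_mono zero_le_power add_nonneg_nonneg) auto
 also have "\<dots> = ((2 * real CARD('n)) ^ N)^2 * (max 1 (R * m) ^ N)^2" by (simp add: power_mult_distrib)
 also have "\<dots> \<le> ((2 * real CARD('n)) ^ N)^2 * (1 + (\<Sum>i\<in>UNIV. (R ^ N * \<bar>z \<bullet> ax i\<bar> ^ N)^2))"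
 proof (rule mult_left_mono)
  have s: "(R ^ N * \<bar>z \<bullet> ax i\<bar> ^ N)^2 \<le> (\<Sum>i\<in>UNIV. (R ^ N * \<bar>z \<bullet> ax i\<bar> ^ N)^2)" by (rule member_le_sum) auto
  show "(max 1 (R * m) ^ N)^2 \<le> 1 + (\<Sum>i\<in>UNIV. (R ^ N * \<bar>z \<bullet> ax i\<bar> ^ N)^2)"
  proof (cases "R * m \<le> 1")
   case True then show ?thesis by (simp add: max_def sum_nonneg)
  next
   case False then show ?thesis using s by (simp add: max_def i inner_axis power_mult_distrib)
  qed
 qed simp
 finally show ?thesis .
qed

definition k4 :: "'n::finite itself => real => real" where
 "k4 _ M = ((2 * real CARD('n)) ^ (CARD('n) + 2))^2 * ((real CARD('n) + 1) * (Cb TYPE('n) * M ^ CARD('n))^2 * 4 ^ CARD('n))"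

lemma kern_measurable[measurable]: "c \<in> BM ==> kern c \<in> BM" for c :: "real^'n::finite => complex"
proof -
 assume "c \<in> BM"
 then have [measurable]: "fourier c \<in> BM" by (rule fourier_measurable)
 show ?thesis unfolding kern_eq_fourier[abs_def] by measurable
qed

text \<open>Plancherel is applied to the kernel and to its \<open>N\<close>-th moments in the
  coordinate directions. The volume that enters is \<open>2^(jn)\<close>, that of the frequency
  ring, although the kernel is spread over the scale \<open>1 / R\<close>.\<close>

lemma kern_weighted_L2:
 fixes b :: "real^'n::finite => complex"
 assumes prof: "profile N D M" and N: "N = CARD('n) + 2" and dC: "\<And>i. dC N (ax i) (ring j) (1 / R) B b"
  and z: "\<And>x. x \<notin> ring j ==> b x = 0" and B: "0 \<le> B" and R: "0 < R"
 shows "(\<integral>\<^sup>+z. ennreal (((1 + R * norm z) ^ N * norm (kern b z))^2)) \<le> ennreal (k4 TYPE('n) M * B^2 * (2^j) ^ CARD('n))"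
proof -
 have bm[measurable]: "b \<in> BM" using dC_meas[OF dC] .
 let ?d = "(2 * real CARD('n)) ^ N"
 let ?k = "(Cb TYPE('n) * M ^ CARD('n))^2"
 define v where "v = ?k * (B^2 * (4 * 2^j) ^ CARD('n))"
 have v: "0 \<le> v" by (simp add: v_def)
 have "\<forall>i. \<exists>c. c \<in> BM \<and> (\<forall>x\<in>ring j. norm (c x) \<le> B * (1 / R) ^ N) \<and> (\<forall>x. x \<notin> ring j \<longrightarrow> c x = 0) \<and>
  (\<forall>z. kern c z = (- \<i> * of_real (z \<bullet> ax i)) ^ N * kern b z)"
  unfolding kern_def using dC_moment[OF dC bounded_ring closed_ring z] by blast
 from choice[OF this] obtain c where "\<forall>i. c i \<in> BM \<and> (\<forall>x\<in>ring j. norm (c i x) \<le> B * (1 / R) ^ N) \<and> (\<forall>x. x \<notin> ring j \<longrightarrow> c i x = 0) \<and>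
  (\<forall>z. kern (c i) z = (- \<i> * of_real (z \<bullet> ax i)) ^ N * kern b z)" ..
 then have c[measurable]: "c i \<in> BM" and cb: "x \<in> ring j ==> norm (c i x) \<le> B * (1 / R) ^ N" and cz: "x \<notin> ring j ==> c i x = 0"
  and ck: "kern (c i) z = (- \<i> * of_real (z \<bullet> ax i)) ^ N * kern b z" for i x z
  by blast+
 have s0: "sqi (kern b) \<le> ennreal v"
  unfolding v_def using dC_bound[OF dC] B z by (intro kern_plancherel[OF prof N]) auto
 have si: "ennreal ((R^N)^2) * sqi (kern (c i)) \<le> ennreal v" for i
 proof -
  have "sqi (kern (c i)) \<le> ennreal (?k * ((B * (1/R)^N)^2 * (4 * 2^j) ^ CARD('n)))"
   using cb B R cz by (intro kern_plancherel[OF prof N]) auto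
  then have "ennreal ((R^N)^2) * sqi (kern (c i)) \<le> ennreal ((R^N)^2) * ennreal (?k * ((B * (1/R)^N)^2 * (4 * 2^j) ^ CARD('n)))"
   by (intro mult_left_mono) auto
  also have "\<dots> = ennreal v"
   using R by (subst ennreal_mult[symmetric]) (auto simp: v_def power_divide power_mult_distrib)
  finally show ?thesis .
 qed
 have "(\<integral>\<^sup>+z. ennreal (((1 + R * norm z) ^ N * norm (kern b z))^2))
  \<le> (\<integral>\<^sup>+z. ennreal (?d^2) * (ennreal (norm (kern b z)^2) + (\<Sum>i\<in>UNIV. ennreal ((R^N)^2) * ennreal (norm (kern (c i) z)^2))))"
 proof (intro nn_integral_mono)
  fix z
  have "((1 + R * norm z) ^ N * norm (kern b z))^2 \<le> ?d^2 * (1 + (\<Sum>i\<in>UNIV. (R ^ N * \<bar>z \<bullet> ax i\<bar> ^ N)^2)) * norm (kern b z)^2"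
   unfolding power_mult_distrib[of _ "norm (kern b z)"] by (intro mult_right_mono weight_le R) simp
  also have "\<dots> = ?d^2 * (norm (kern b z)^2 + (\<Sum>i\<in>UNIV. (R^N)^2 * norm (kern (c i) z)^2))"
   by (simp add: ck norm_mult norm_power power_mult_distrib distrib_right sum_distrib_right mult.assoc)
  finally have "ennreal (((1 + R * norm z) ^ N * norm (kern b z))^2) \<le> ennreal (?d^2 * (norm (kern b z)^2 + (\<Sum>i\<in>UNIV. (R^N)^2 * norm (kern (c i) z)^2)))"
   by (rule ennreal_leI)
  also have "\<dots> = ennreal (?d^2) * (ennreal (norm (kern b z)^2) + (\<Sum>i\<in>UNIV. ennreal ((R^N)^2) * ennreal (norm (kern (c i) z)^2)))"
   by (subst ennreal_mult, simp, simp add: sum_nonneg, subst ennreal_plus, simp, simp add: sum_nonneg)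
    (simp add: ennreal_mult flip: sum_ennreal)
  finally show "ennreal (((1 + R * norm z) ^ N * norm (kern b z))^2) \<le> ennreal (?d^2) * (ennreal (norm (kern b z)^2) + (\<Sum>i\<in>UNIV. ennreal ((R^N)^2) * ennreal (norm (kern (c i) z)^2)))" .
 qed
 also have "\<dots> = ennreal (?d^2) * (sqi (kern b) + (\<Sum>i\<in>UNIV. ennreal ((R^N)^2) * sqi (kern (c i))))"
  unfolding sqi_def by (simp add: nn_integral_cmult nn_integral_add nn_integral_sum)
 also have "\<dots> \<le> ennreal (?d^2) * (ennreal v + (\<Sum>i\<in>(UNIV::'n set). ennreal v))"
  by (intro mult_left_mono add_mono sum_mono s0 si) auto
 also have "\<dots> = ennreal (?d^2 * (v + real CARD('n) * v))"
  using v by (simp add: ennreal_mult ennreal_of_nat_eq_real_of_nat)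
 also have "?d^2 * (v + real CARD('n) * v) = k4 TYPE('n) M * B^2 * (2^j) ^ CARD('n)"
  by (simp add: v_def k4_def N power_mult_distrib algebra_simps)
 finally show ?thesis .
qed

text \<open>Young's inequality with conjugate exponents; since \<open>g \<le> 1\<close> and
  \<open>p \<ge> 2\<close>, the power \<open>g powr p\<close> is at most the square, for which
  Plancherel is available.\<close>

lemma young_le:
 fixes g u \<tau> :: real
 assumes p: "2 \<le> p" "1 < s" "1 / p + 1 / s = 1" and g: "0 \<le> g" "g \<le> 1" and u: "0 \<le> u" and \<tau>: "0 < \<tau>"
 shows "g * u \<le> \<tau> powr p * g^2 + \<tau> powr (- s) * u powr s"
proof -
 have "g * u = (\<tau> * g) * (u / \<tau>)" using \<tau> by simp
 also have "\<dots> \<le> (\<tau> * g) powr p / p + (u / \<tau>) powr s / s" using p g u \<tau> by (intro Youngs_inequality) auto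
 also have "\<dots> \<le> (\<tau> * g) powr p / 1 + (u / \<tau>) powr s / 1" using p by (intro add_mono divide_left_mono) auto
 also have "\<dots> = \<tau> powr p * g powr p + \<tau> powr (- s) * u powr s"
  using g u \<tau> by (simp add: powr_mult powr_divide powr_minus field_simps)
 also have "g powr p \<le> g^2"
 proof (cases "g = 0")
  case False
  then have "g powr p \<le> g powr 2" using g p by (intro powr_mono') auto
  then show ?thesis using False g by simp
 qed simp
 finally show ?thesis by (simp add: mult_left_mono)
qed

text \<open>Hoelder's inequality in the form of Young's inequality with the free weight \<open>\<tau>\<close>.\<close>

lemma piece_bound:
 fixes b :: "real^'n::finite => complex" and h :: "real^'n => complex"
 assumes m: "b \<in> BM" and h: "adm h" and R: "0 < R" and Q: "0 < Q" and N: "N = CARD('n) + 2"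
  and sup: "\<And>z. (1 + R * norm z) ^ N * norm (kern b z) \<le> Q"
  and sq: "(\<integral>\<^sup>+z. ennreal (((1 + R * norm z) ^ N * norm (kern b z))^2)) \<le> ennreal (Q^2 * w)" and w: "0 \<le> w"
  and p: "2 \<le> p" "1 < s" "1 / p + 1 / s = 1" and \<tau>: "0 < \<tau>" and l: "0 < l"
  and avg: "\<And>t. 0 < t ==> (\<integral>\<^sup>+y\<in>ball x t. ennreal (norm (h y) powr s) \<partial>lborel) \<le> ennreal (l powr s) * vol (ball x t)"
 shows "norm (LINT y|lborel. kern b (x - y) * h y) \<le> Q * (\<tau> powr p * w + \<tau> powr (- s) * (bconst TYPE(real^'n) * l powr s / R ^ CARD('n)))"
proof -
 have hm[measurable]: "h \<in> BM" using h by (simp add: adm_def)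
 note [measurable] = m
 define G where "G z = (1 + R * norm z) ^ N * norm (kern b z)" for z
 have Gm[measurable]: "G \<in> BM" unfolding G_def by measurable
 have G0: "0 \<le> G z" for z using R by (simp add: G_def)
 let ?n = "CARD('n)"
 let ?t = "\<tau> powr (- s) / R ^ ?n"
 have pt: "norm (kern b (x - y) * h y) \<le> Q * (\<tau> powr p / Q^2 * G (x - y)^2 + ?t * (bmp R (x - y) * norm (h y) powr s))" for y
 proof -
  define W where "W = 1 + R * norm (x - y)"
  have W: "1 \<le> W" using R by (simp add: W_def)
  \<comment> \<open>The weight is moved from the kernel to \<open>h\<close>: \<open>g\<close> is at
    most 1 by the supremum bound, and \<open>u\<close> carries the decay that turns into the
    profile.\<close>
  define g where "g = G (x - y) / Q"
  define u where "u = norm (h y) / W ^ N"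
  have "norm (kern b (x - y) * h y) = Q * (g * u)" using W Q by (simp add: g_def u_def G_def norm_mult W_def[symmetric])
  also have "\<dots> \<le> Q * (\<tau> powr p * g^2 + \<tau> powr (- s) * u powr s)"
   using sup[of "x - y"] Q W \<tau> G0[of "x - y"] by (intro mult_left_mono young_le[OF p]) (auto simp: g_def u_def G_def)
  also have "\<dots> \<le> Q * (\<tau> powr p / Q^2 * G (x - y)^2 + ?t * (bmp R (x - y) * norm (h y) powr s))"
  proof (intro mult_left_mono add_mono)
   show "\<tau> powr p * g^2 \<le> \<tau> powr p / Q^2 * G (x - y)^2" by (simp add: g_def power_divide)
   \<comment> \<open>\<open>N * s > n + 1\<close>, so the weight raised to the power
     \<open>s\<close> still dominates the exponent of \<open>bump\<close>.\<close>
   have "W ^ (?n + 1) \<le> W powr (real N * s)"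
   proof -
    have "real (?n + 1) * 1 \<le> real N * s" using p N by (intro mult_mono) auto
    then have "W powr real (?n + 1) \<le> W powr (real N * s)" using W by (intro powr_mono) auto
    then show ?thesis using W by (simp only: powr_realpow)
   qed
   then have "norm (h y) powr s / W powr (real N * s) \<le> norm (h y) powr s / W ^ (?n + 1)"
    using W by (intro divide_left_mono mult_pos_pos) auto
   then have "u powr s \<le> norm (h y) powr s / W ^ (?n + 1)"
    using W by (simp add: u_def powr_divide powr_powr flip: powr_realpow)
   also have "\<dots> = bmp R (x - y) * norm (h y) powr s / R ^ ?n" using R by (simp add: bump_def W_def)
   finally have "\<tau> powr (- s) * u powr s \<le> \<tau> powr (- s) * (bmp R (x - y) * norm (h y) powr s / R ^ ?n)" by (intro mult_left_mono) auto
   then show "\<tau> powr (- s) * u powr s \<le> ?t * (bmp R (x - y) * norm (h y) powr s)" by simp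
  qed (use Q in auto)
  finally show ?thesis .
 qed
 have "enorm (LINT y|lborel. kern b (x - y) * h y) \<le> (\<integral>\<^sup>+y. enorm (kern b (x - y) * h y))" by (rule norm_LINT_le)
 also have "\<dots> \<le> (\<integral>\<^sup>+y. ennreal Q * (ennreal (\<tau> powr p / Q^2) * ennreal (G (x - y)^2) + ennreal ?t * (ennreal (bmp R (x - y)) * ennreal (norm (h y) powr s))))"
 proof (intro nn_integral_mono)
  fix y
  have b0: "0 \<le> bmp R (x - y)" by (rule bmp_nonneg[OF R])
  have "ennreal (Q * (\<tau> powr p / Q^2 * G (x - y)^2 + ?t * (bmp R (x - y) * norm (h y) powr s)))
   = ennreal Q * (ennreal (\<tau> powr p / Q^2) * ennreal (G (x - y)^2) + ennreal ?t * (ennreal (bmp R (x - y)) * ennreal (norm (h y) powr s)))"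
  proof -
   have t: "0 \<le> ?t" "0 \<le> \<tau> powr p / Q^2" using R by simp_all
   have 1: "ennreal (\<tau> powr p / Q^2 * G (x - y)^2) = ennreal (\<tau> powr p / Q^2) * ennreal (G (x - y)^2)" by (intro ennreal_mult) auto
   have 2: "ennreal (?t * (bmp R (x - y) * norm (h y) powr s)) = ennreal ?t * (ennreal (bmp R (x - y)) * ennreal (norm (h y) powr s))"
    using t(1) b0 by (subst ennreal_mult, simp, simp, subst ennreal_mult) auto
   have 3: "0 \<le> \<tau> powr p / Q^2 * G (x - y)^2" "0 \<le> ?t * (bmp R (x - y) * norm (h y) powr s)"
    by (intro mult_nonneg_nonneg t b0 zero_le_power2 powr_ge_zero)+
   show ?thesis unfolding 1[symmetric] 2[symmetric] ennreal_plus[OF 3, symmetric] using 3 Q by (intro ennreal_mult) auto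
  qed
  then show "enorm (kern b (x - y) * h y) \<le> ennreal Q * (ennreal (\<tau> powr p / Q^2) * ennreal (G (x - y)^2) + ennreal ?t * (ennreal (bmp R (x - y)) * ennreal (norm (h y) powr s)))"
   using ennreal_leI[OF pt[of y]] by simp
 qed
 also have "\<dots> = ennreal Q * (ennreal (\<tau> powr p / Q^2) * (\<integral>\<^sup>+y. ennreal (G (x - y)^2)) + ennreal ?t * (\<integral>\<^sup>+y. ennreal (bmp R (x - y)) * ennreal (norm (h y) powr s)))"
  by (simp add: nn_integral_cmult nn_integral_add)
 also have "\<dots> \<le> ennreal Q * (ennreal (\<tau> powr p / Q^2) * ennreal (Q^2 * w) + ennreal ?t * ennreal (bconst TYPE(real^'n) * l powr s))"
 proof (intro mult_left_mono add_mono)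
  have "(\<integral>\<^sup>+y. ennreal (G (x - y)^2)) = (\<integral>\<^sup>+y. ennreal (G y^2))"
   by (rule nn_integral_reflect) measurable
  then show "(\<integral>\<^sup>+y. ennreal (G (x - y)^2)) \<le> ennreal (Q^2 * w)" using sq by (simp add: G_def)
  show "(\<integral>\<^sup>+y. ennreal (bmp R (x - y)) * ennreal (norm (h y) powr s)) \<le> ennreal (bconst TYPE(real^'n) * l powr s)"
   by (rule nn_integral_bmp[OF R _ _ avg]) auto
 qed auto
 also have "\<dots> = ennreal (Q * (\<tau> powr p * w + \<tau> powr (- s) * (bconst TYPE(real^'n) * l powr s / R ^ CARD('n))))"
 proof -
  have b: "0 < bconst TYPE(real^'n)" by (rule bconst_pos)
  have "ennreal (\<tau> powr p / Q^2) * ennreal (Q^2 * w) = ennreal (\<tau> powr p * w)"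
   using Q w by (subst ennreal_mult[symmetric]) auto
  moreover have "ennreal ?t * ennreal (bconst TYPE(real^'n) * l powr s) = ennreal (\<tau> powr (- s) * (bconst TYPE(real^'n) * l powr s / R ^ CARD('n)))"
   using R b by (subst ennreal_mult[symmetric]) auto
  ultimately have *: "ennreal (\<tau> powr p / Q^2) * ennreal (Q^2 * w) + ennreal ?t * ennreal (bconst TYPE(real^'n) * l powr s)
    = ennreal (\<tau> powr p * w + \<tau> powr (- s) * (bconst TYPE(real^'n) * l powr s / R ^ CARD('n)))"
   using w R b by (simp only: ennreal_plus mult_nonneg_nonneg divide_nonneg_nonneg powr_ge_zero zero_le_power less_imp_le)
  show ?thesis unfolding * using Q w R b by (intro ennreal_mult[symmetric]) auto
 qed
 finally show ?thesis
  using Q w R less_imp_le[OF bconst_pos[where 'a="real^'n"]] by (subst (asm) ennreal_le_iff) auto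
qed

section \<open>Truncations and the sparse bound\<close>

lemma test_function_tf: "test_function f ==> tf f"
 unfolding test_function_def tf_def by (auto intro: smooth_continuous bounded_subset[OF compact_imp_bounded closure_subset])

text \<open>Smoothness of \<open>f\<close> enters here: as an amplitude at frequency scale 1 it has
  a kernel, its reflected Fourier transform, that decays like the integrable profile.\<close>

lemma fourier_integrable:
 fixes f :: "real^'n::finite => complex"
 assumes f: "test_function f" shows "integrable lborel (fourier f)"
proof -
 define A where "A = closure {x. f x \<noteq> 0}"
 define N where "N = CARD('n) + 2"
 define d where "d i k = (partial (ax i) ^^ k) f" for i k
 have sm: "smooth f" and cA: "compact A" using f by (auto simp: test_function_def A_def)
 have z: "f x = 0" if "x \<notin> A" for x using that closure_subset[of "{x. f x \<noteq> 0}"] by (auto simp: A_def)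
 have sd: "smooth (d i k)" for i k unfolding d_def by (intro smooth_partials sm) (auto simp: Basis_vec_def)
 have "\<exists>B. \<forall>x\<in>A. norm (d i k x) \<le> B" for i k
 proof -
  have "compact (d i k ` A)" by (intro compact_continuous_image continuous_on_subset[OF smooth_continuous[OF sd]] cA) auto
  then show ?thesis using compact_imp_bounded[of "d i k ` A"] by (auto simp: bounded_iff)
 qed
 then obtain B0 where B0: "\<And>i k x. x \<in> A ==> norm (d i k x) \<le> B0 i k" by metis
 define B where "B = (\<Sum>i\<in>UNIV. \<Sum>k\<le>N. \<bar>B0 i k\<bar>)"
 have B: "norm (d i k x) \<le> B" if "x \<in> A" "k \<le> N" for i k x
 proof -
  have "\<bar>B0 i k\<bar> \<le> (\<Sum>k\<le>N. \<bar>B0 i k\<bar>)" using that by (intro member_le_sum) auto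
  also have "\<dots> \<le> B" unfolding B_def by (intro member_le_sum[of i UNIV "\<lambda>i. \<Sum>k\<le>N. \<bar>B0 i k\<bar>"]) (auto intro!: sum_nonneg)
  finally show ?thesis using B0[OF that(1), of i k] by linarith
 qed
 have B00: "0 \<le> B" unfolding B_def by (intro sum_nonneg) auto
 have dC: "dC N (ax i) A (1 / 1) B f" for i
 proof -
  have "dC N (ax i) A (1 / 1) B (d i 0)"
  proof (rule dC_of_family)
   show "ddir (ax i) (d i k) (d i (Suc k))" for k
    unfolding ddir_def using has_vector_derivative_along[OF smooth_has_derivative[OF sd[of i k]], of _ "ax i"]
    by (simp add: d_def partial_def)
  qed (use B sd in \<open>auto intro!: borel_measurable_continuous_onI smooth_continuous\<close>)
  then show ?thesis by (simp add: d_def)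
 qed
 define V where "V = measure lborel A"
 have V: "vol A \<le> ennreal V" unfolding V_def
  using emeasure_bounded_finite[OF compact_imp_bounded[OF cA]] by (subst emeasure_eq_ennreal_measure) auto
 define c where "c = B * V * (2 * real CARD('n)) ^ N"
 have c0: "0 \<le> c" using B00 by (simp add: c_def V_def)
 have dec: "norm (fourier f \<xi>) \<le> c * bmp 1 \<xi>" for \<xi>
 proof -
  have "norm (fourier f \<xi>) = norm (kern f (- \<xi>))" by (simp add: kern_eq_fourier)
  also have "\<dots> \<le> c / (1 + 1 * norm (- \<xi>)) ^ N"
   unfolding c_def by (rule kern_decay[OF dC]) (use cA B00 z V in \<open>auto intro: compact_imp_bounded compact_imp_closed simp: V_def\<close>)
  also have "\<dots> \<le> c / (1 + 1 * norm (- \<xi>)) ^ (CARD('n) + 1)"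
   unfolding N_def using c0 by (intro divide_left_mono power_increasing mult_pos_pos zero_less_power add_pos_nonneg) auto
  finally show ?thesis by (simp add: bump_def)
 qed
 have af: "adm f" by (rule tf_adm[OF test_function_tf[OF f]])
 have fm: "fourier f \<in> BM" using af by (intro fourier_measurable) (simp add: adm_def)
 have "(\<integral>\<^sup>+\<xi>. enorm (fourier f \<xi>)) \<le> (\<integral>\<^sup>+\<xi>. ennreal c * ennreal (bmp 1 (\<xi> - 0 :: real^'n)))"
  using dec c0 by (intro nn_integral_mono) (auto simp: bmp_nonneg intro!: ennreal_leI simp flip: ennreal_mult)
 also have "\<dots> = ennreal c * (\<integral>\<^sup>+\<xi>. ennreal (bmp 1 (\<xi> - 0 :: real^'n)))" by (intro nn_integral_cmult) simp
 also have "\<dots> \<le> ennreal c * ennreal (bconst TYPE(real^'n))" by (intro mult_left_mono nn_integral_bmp_1(2)) auto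
 also have "\<dots> < \<infinity>" by (simp add: ennreal_mult_less_top)
 finally show ?thesis using fm by (intro integrableI_bounded) auto
qed

lemma Top_kfam_add:
 fixes b :: "nat => real^'n::finite => real^'n => complex"
 assumes k: "\<And>j. b j x \<in> BM" "\<And>j z. norm (kern (b j x) z) \<le> B j" and "adm g" "adm h"
 shows "Top (kfam b) J (\<lambda>y. g y + h y) x = Top (kfam b) J g x + Top (kfam b) J h x"
proof -
 have i: "integrable lborel (\<lambda>y. kern (b j x) (x - y) * u y)" if "adm u" for u j
 proof (rule integrable_mult_bounded[OF adm_integrable[OF that]])
  have [measurable]: "kern (b j x) \<in> BM" by (rule kern_measurable[OF k(1)])
  show "(\<lambda>y. kern (b j x) (x - y)) \<in> BM" by measurable
 qed (rule k(2))
 show ?thesis unfolding Top_def kfam_def by (simp add: distrib_left i assms sum.distrib)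
qed

text \<open>One constant for the supremum bound and the weighted L^2 bound of the kernels; the added
  ones keep it positive and make its square dominate the second.\<close>

definition Kc :: "nat => real => real => (('n::finite => nat) => ('n => nat) => real) => real" where
 "Kc N M \<rho> C = (k1 TYPE('n) + k4 TYPE('n) M + 1) * (Ac N M (- real CARD('n) * (1 - \<rho>)) C + 1)"

lemma k4_nonneg: "0 \<le> k4 TYPE('n::finite) M" unfolding k4_def by (intro mult_nonneg_nonneg) auto

lemma Kc_ge:
 fixes N :: nat and \<rho> :: real and C :: "('n::finite => nat) => ('n => nat) => real"
 assumes "0 \<le> M" defines "A \<equiv> Ac N M (- real CARD('n) * (1 - \<rho>)) C"
 shows "0 < Kc N M \<rho> C" "k1 TYPE('n) * A \<le> Kc N M \<rho> C" "k4 TYPE('n) M * A^2 \<le> Kc N M \<rho> C ^ 2"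
proof -
 have A: "0 \<le> A" unfolding A_def by (rule Ac_nonneg[OF assms(1)])
 have k: "0 < k1 TYPE('n)" "0 \<le> k4 TYPE('n) M" by (rule k1_pos, rule k4_nonneg)
 have K: "Kc N M \<rho> C = (k1 TYPE('n) + k4 TYPE('n) M + 1) * (A + 1)" by (simp add: Kc_def A_def)
 show "0 < Kc N M \<rho> C" "k1 TYPE('n) * A \<le> Kc N M \<rho> C" unfolding K using A k by (auto intro!: mult_mono mult_pos_pos)
 have "k4 TYPE('n) M * A^2 \<le> (k1 TYPE('n) + k4 TYPE('n) M + 1)^2 * (A + 1)^2"
 proof (rule mult_mono)
  have "k4 TYPE('n) M \<le> k1 TYPE('n) + k4 TYPE('n) M + 1" using k by simp
  also have "\<dots> \<le> (k1 TYPE('n) + k4 TYPE('n) M + 1)^2" unfolding power2_eq_square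
   using k mult_left_mono[of 1 "k1 TYPE('n) + k4 TYPE('n) M + 1" "k1 TYPE('n) + k4 TYPE('n) M + 1"] by simp
  finally show "k4 TYPE('n) M \<le> (k1 TYPE('n) + k4 TYPE('n) M + 1)^2" .
 qed (use A in \<open>auto intro: power_mono\<close>)
 then show "k4 TYPE('n) M * A^2 \<le> Kc N M \<rho> C ^ 2" by (simp add: K power_mult_distrib)
qed

context
 fixes N :: nat and D :: "nat => real => real" and M \<rho> \<delta> :: real
  and C :: "('n::finite => nat) => ('n => nat) => real" and a :: "(real^'n) \<times> (real^'n) => complex"
 assumes prof: "profile N D M" and \<rho>: "0 < \<rho>" "\<rho> \<le> 1" and \<delta>: "0 \<le> \<delta>" "\<delta> \<le> 1" and N: "N = CARD('n) + 2"
  and sm: "smooth a" and est: "\<And>\<nu> \<sigma>. symbol_estimate (- real CARD('n) * (1 - \<rho>)) \<rho> \<delta> \<nu> \<sigma> (C \<nu> \<sigma>) a"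
begin

lemma M_nonneg: "0 \<le> M" using M_ge_1[OF prof] by simp

lemma bfam_facts:
 "dC N (ax i) (ring j) (1 / (2^j) powr \<rho>) (Ac N M (- real CARD('n) * (1 - \<rho>)) C * (2^j) powr (- real CARD('n) * (1 - \<rho>))) (bfam D a j x)"
 "\<xi> \<notin> ring j ==> bfam D a j x \<xi> = 0" "bfam D a j x \<in> BM"
 "case_prod (bfam D a j) \<in> BM2"
proof -
 note p = prof less_imp_le[OF \<rho>(1)] \<rho>(2) \<delta> sm est
 show 1: "dC N (ax i) (ring j) (1 / (2^j) powr \<rho>) (Ac N M (- real CARD('n) * (1 - \<rho>)) C * (2^j) powr (- real CARD('n) * (1 - \<rho>))) (bfam D a j x)" for i
  using bfam_dC[OF p, of i j x] by (simp add: powr_minus_divide)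
 show "bfam D a j x \<in> BM" by (rule dC_meas[OF 1])
 show "case_prod (bfam D a j) \<in> BM2" by (rule bfam_meas[OF p])
 show "\<xi> \<notin> ring j ==> bfam D a j x \<xi> = 0" by (rule bfam_0[OF p])
qed

text \<open>The order \<open>-n(1-\<rho>)\<close> and the volume \<open>2^(jn)\<close> of the ring
  combine to \<open>2^(j n \<rho>)\<close>, the height of an L^1-normalised kernel at scale
  \<open>2^(-j \<rho>)\<close>.\<close>

lemma kern_sup: "(1 + (2^j) powr \<rho> * norm z) ^ N * norm (kern (bfam D a j x) z) \<le> Kc N M \<rho> C * ((2^j) powr \<rho>) ^ CARD('n)"
proof -
 define A where "A = Ac N M (- real CARD('n) * (1 - \<rho>)) C"
 have A: "0 \<le> A" unfolding A_def by (rule Ac_nonneg[OF M_nonneg])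
 have W: "0 < (1 + (2^j) powr \<rho> * norm z) ^ N" by (intro zero_less_power add_pos_nonneg) auto
 have "norm (kern (bfam D a j x) z) \<le> A * (2^j) powr (- real CARD('n) * (1 - \<rho>)) * (4 * 2^j) ^ CARD('n) * (2 * real CARD('n)) ^ N / (1 + (2^j) powr \<rho> * norm z) ^ N"
  unfolding A_def by (rule kern_decay[OF bfam_facts(1) bounded_ring closed_ring emeasure_ring]) (use A bfam_facts(2) in \<open>auto simp: A_def\<close>)
 then have "(1 + (2^j) powr \<rho> * norm z) ^ N * norm (kern (bfam D a j x) z) \<le> A * (2^j) powr (- real CARD('n) * (1 - \<rho>)) * (4 * 2^j) ^ CARD('n) * (2 * real CARD('n)) ^ N"
  using W by (simp add: pos_le_divide_eq mult.commute)
 also have "\<dots> = k1 TYPE('n) * A * ((2^j) powr (- real CARD('n) * (1 - \<rho>)) * (2^j) ^ CARD('n))"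
  by (simp add: k1_def N power_mult_distrib mult_ac)
 also have "(2^j :: real) powr (- real CARD('n) * (1 - \<rho>)) * (2^j) ^ CARD('n) = ((2^j) powr \<rho>) ^ CARD('n)"
  by (simp add: powr_powr powr_add[symmetric] algebra_simps flip: powr_realpow[of "2^j"] powr_realpow[of "(2^j) powr \<rho>"])
 also have "k1 TYPE('n) * A * ((2^j) powr \<rho>) ^ CARD('n) \<le> Kc N M \<rho> C * ((2^j) powr \<rho>) ^ CARD('n)"
  unfolding A_def by (intro mult_right_mono Kc_ge M_nonneg) auto
 finally show ?thesis .
qed

lemma kern_le': "norm (kern (bfam D a j x) z) \<le> Kc N M \<rho> C * ((2^j) powr \<rho>) ^ CARD('n)"
proof -
 have "1 * norm (kern (bfam D a j x) z) \<le> (1 + (2^j) powr \<rho> * norm z) ^ N * norm (kern (bfam D a j x) z)"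
  by (intro mult_right_mono one_le_power) auto
 then show ?thesis using kern_sup[of j z x] by linarith
qed

text \<open>The two powers by which \<open>N\<close> exceeds the dimension are spent on
  \<open>2^(-2 j \<rho>)\<close>, which makes the pieces summable away from the origin.\<close>

lemma tail_sum:
 assumes z: "1 \<le> norm z"
 shows "(\<Sum>j<J. norm (kern (bfam D a j x) z)) \<le> Kc N M \<rho> C / (1 - 2 powr (- 2 * \<rho>)) / norm z ^ CARD('n)"
proof -
 define K where "K = Kc N M \<rho> C"
 have K: "0 < K" unfolding K_def by (rule Kc_ge[OF M_nonneg])
 define q where "q = 2 powr (- 2 * \<rho>)"
 have q: "0 \<le> q" "q < 1" using \<rho> by (auto simp: q_def intro!: powr_less_one)
 have "norm (kern (bfam D a j x) z) \<le> K / norm z ^ CARD('n) * q ^ j" for j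
 proof -
  define W where "W = (2^j) powr \<rho>"
  have W: "0 < W" by (simp add: W_def)
  have qW: "q ^ j = 1 / W^2"
   by (simp add: q_def W_def powr_powr powr_minus_divide power_divide mult_ac flip: powr_realpow[of "2::real"] powr_realpow[of "2 powr _"] powr_realpow[of "(2 powr _) powr _"])
  have "W ^ CARD('n) * norm z ^ CARD('n) * W^2 = (W * norm z) ^ CARD('n) * W^2 * 1" by (simp add: power_mult_distrib)
  also have "\<dots> \<le> (W * norm z) ^ CARD('n) * W^2 * norm z ^ 2" using W z by (intro mult_left_mono one_le_power) auto
  also have "\<dots> = (W * norm z) ^ N" by (simp add: N power_add power_mult_distrib power2_eq_square mult_ac)
  also have "\<dots> \<le> (1 + W * norm z) ^ N" using W by (intro power_mono) auto
  finally have "W ^ CARD('n) * norm z ^ CARD('n) * W^2 * norm (kern (bfam D a j x) z) \<le> (1 + W * norm z) ^ N * norm (kern (bfam D a j x) z)"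
   by (intro mult_right_mono) auto
  also have "\<dots> \<le> K * W ^ CARD('n)" using kern_sup[of j z x] by (simp add: W_def K_def)
  finally have "W ^ CARD('n) * (norm z ^ CARD('n) * W^2 * norm (kern (bfam D a j x) z)) \<le> W ^ CARD('n) * K" by (simp add: mult_ac)
  then have "norm z ^ CARD('n) * W^2 * norm (kern (bfam D a j x) z) \<le> K" using W by (subst (asm) mult_le_cancel_left_pos) auto
  moreover have "0 < norm z" using z by linarith
  ultimately show ?thesis using W by (simp add: qW field_simps)
 qed
 then have "(\<Sum>j<J. norm (kern (bfam D a j x) z)) \<le> (\<Sum>j<J. K / norm z ^ CARD('n) * q ^ j)" by (intro sum_mono)
 also have "\<dots> = K / norm z ^ CARD('n) * (\<Sum>j<J. q ^ id j)" by (simp add: sum_distrib_left)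
 also have "\<dots> \<le> K / norm z ^ CARD('n) * (1 / (1 - q))" using K q by (intro mult_left_mono sum_power_inj_le) auto
 finally show ?thesis by (simp add: K_def q_def mult.commute)
qed

text \<open>The geometric ratio is below 1 exactly because \<open>\<rho> < 1\<close> and
  \<open>s > 1\<close> in the case where it is used; the rest of the estimate is uniform in
  \<open>j\<close>.\<close>

lemma piece_le:
 assumes h: "adm h" and s: "1 < s" "s \<le> 2" and l: "0 < l"
  and avg: "\<And>t. 0 < t ==> (\<integral>\<^sup>+y\<in>ball x t. ennreal (norm (h y) powr s) \<partial>lborel) \<le> ennreal (l powr s) * vol (ball x t)"
 shows "norm (LINT y|lborel. kern (bfam D a j x) (x - y) * h y)
  \<le> Kc N M \<rho> C * (1 + bconst TYPE(real^'n)) * l * (2 powr (- real CARD('n) * (1 - \<rho>) * (1 - 1 / s))) ^ j"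
proof -
 define n where "n = real CARD('n)"
 define A where "A = Ac N M (- n * (1 - \<rho>)) C"
 define X :: real where "X = 2^j"
 have X: "0 < X" by (simp add: X_def)
 define R where "R = X powr \<rho>"
 have R: "0 < R" using X by (simp add: R_def)
 have Rn: "R ^ CARD('n) = X powr (n * \<rho>)" and Xn: "X ^ CARD('n) = X powr n"
  using X by (simp_all add: R_def n_def powr_powr mult.commute flip: powr_realpow)
 define K where "K = Kc N M \<rho> C"
 have K: "0 < K" "k4 TYPE('n) M * A^2 \<le> K^2" unfolding K_def A_def n_def by (rule Kc_ge[OF M_nonneg])+
 \<comment> \<open>The conjugate exponent; \<open>s \<le> 2\<close> gives \<open>p \<ge> 2\<close>,
   as the comparison with squares demands.\<close>
 define p where "p = s / (s - 1)"
 have p: "2 \<le> p" "1 < s" "1 / p + 1 / s = 1" using s by (auto simp: p_def field_simps)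
 have ip: "1 / p = 1 - 1 / s" using p(3) by linarith
 define e where "e = n * (1 - \<rho>) * (1 - 1 / s)"
 define \<theta> where "\<theta> = n * (1 - \<rho>) * (1 - 1 / s) / s"
 \<comment> \<open>Chosen so that both terms of \<open>piece_bound\<close>, multiplied by
   \<open>R ^ n\<close>, become \<open>l * X powr (- e)\<close> up to constants; the power of
   \<open>l\<close> restores homogeneity.\<close>
 define \<tau> where "\<tau> = l powr (1 - 1 / s) * X powr \<theta>"
 have pz: "p \<noteq> 0" "s \<noteq> 0" "s \<noteq> 1" using s p by auto
 have pp: "(1 - 1 / s) * p = 1" using pz by (simp add: ip[symmetric])
 have t1: "\<tau> powr p = l * X powr (n * (1 - \<rho>) / s)"
 proof -
  have "\<tau> powr p = l powr ((1 - 1 / s) * p) * X powr (n * (1 - \<rho>) / s * ((1 - 1 / s) * p))"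
   using l X by (simp add: \<tau>_def \<theta>_def powr_mult powr_powr mult_ac)
  then show ?thesis unfolding pp using l by simp
 qed
 have t2: "\<tau> powr (- s) * l powr s = l * X powr (- e)"
 proof -
  have "\<tau> powr (- s) * l powr s = (l powr ((1 - 1 / s) * (- s)) * l powr s) * X powr (\<theta> * (- s))"
   using l X by (simp add: \<tau>_def powr_mult powr_powr mult_ac)
  also have "l powr ((1 - 1 / s) * (- s)) * l powr s = l powr 1"
   unfolding powr_add[symmetric] using s by (intro arg_cong2[where f="(powr)"]) (auto simp: field_simps)
  also have "\<theta> * (- s) = - e" using s by (simp add: \<theta>_def e_def)
  finally show ?thesis using l by simp
 qed
 have "norm (LINT y|lborel. kern (bfam D a j x) (x - y) * h y)
  \<le> (K * R ^ CARD('n)) * (\<tau> powr p * X powr (- n) + \<tau> powr (- s) * (bconst TYPE(real^'n) * l powr s / R ^ CARD('n)))"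
 proof (rule piece_bound[OF bfam_facts(3) h R _ N _ _ _ p _ l avg])
  show "(1 + R * norm z) ^ N * norm (kern (bfam D a j x) z) \<le> K * R ^ CARD('n)" for z
   using kern_sup[of j z x] by (simp add: R_def X_def K_def)
  have "(\<integral>\<^sup>+z. ennreal (((1 + R * norm z) ^ N * norm (kern (bfam D a j x) z))^2)) \<le> ennreal (k4 TYPE('n) M * (A * X powr (- n * (1 - \<rho>)))^2 * (2^j) ^ CARD('n))"
   using bfam_facts(1)[of _ j x] Ac_nonneg[OF M_nonneg, of N "- n * (1 - \<rho>)" C] R
   by (intro kern_weighted_L2[OF prof N _ bfam_facts(2)]) (auto simp: R_def X_def A_def n_def)
  also have "\<dots> \<le> ennreal ((K * R ^ CARD('n))^2 * X powr (- n))"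
  proof (rule ennreal_leI)
   have "(X powr (- n * (1 - \<rho>)))^2 * X powr n = (X powr (n * \<rho>))^2 * X powr (- n)"
    by (simp add: power2_eq_square powr_add[symmetric] algebra_simps)
   then have "k4 TYPE('n) M * (A * X powr (- n * (1 - \<rho>)))^2 * (2^j) ^ CARD('n) = (k4 TYPE('n) M * A^2) * ((X powr (n * \<rho>))^2 * X powr (- n))"
    unfolding X_def[symmetric] Xn by (simp add: power_mult_distrib mult_ac)
   also have "\<dots> \<le> K^2 * ((X powr (n * \<rho>))^2 * X powr (- n))" by (intro mult_right_mono K) auto
   finally show "k4 TYPE('n) M * (A * X powr (- n * (1 - \<rho>)))^2 * (2^j) ^ CARD('n) \<le> (K * R ^ CARD('n))^2 * X powr (- n)"
    by (simp add: Rn power_mult_distrib mult_ac)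
  qed
  finally show "(\<integral>\<^sup>+z. ennreal (((1 + R * norm z) ^ N * norm (kern (bfam D a j x) z))^2)) \<le> ennreal ((K * R ^ CARD('n))^2 * X powr (- n))" .
  show "0 < \<tau>" using l X by (simp add: \<tau>_def)
 qed (use K R in auto)
 also have "\<dots> = K * (l * (X powr (n * (1 - \<rho>) / s) * (X powr (- n) * R ^ CARD('n))) + bconst TYPE(real^'n) * (\<tau> powr (- s) * l powr s))"
  unfolding t1 using R by (simp add: algebra_simps)
 also have "X powr (n * (1 - \<rho>) / s) * (X powr (- n) * R ^ CARD('n)) = X powr (- e)"
  unfolding Rn powr_add[symmetric] by (intro arg_cong2[where f="(powr)"]) (auto simp: e_def algebra_simps diff_divide_distrib)
 also have "X powr (- e) = (2 powr (- e)) ^ j" by (simp add: X_def powr_powr mult.commute flip: powr_realpow)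
 finally show ?thesis unfolding t2 K_def e_def n_def
  by (simp add: algebra_simps X_def powr_powr flip: powr_realpow)
qed

text \<open>The partial sums telescope to the cut-off \<open>phi D J\<close>, which is eventually 1
  at each frequency. The symbol is bounded, since its order is at most 0, so dominated convergence
  needs only the integrability of the Fourier transform.\<close>

lemma pseudo_diff_limit:
 assumes f: "test_function f"
 shows "(\<lambda>J. Top (kfam (bfam D a)) (Suc J) f x) \<longlonglongrightarrow> pseudo_diff a f x"
proof -
 define c where "c = \<bar>C (\<lambda>_. 0) (\<lambda>_. 0)\<bar>"
 have ab: "norm (a (x, \<xi>)) \<le> c" for \<xi>
 proof -
  have "norm (a (x, \<xi>)) \<le> C (\<lambda>_. 0) (\<lambda>_. 0) * (1 + norm \<xi>) powr (- real CARD('n) * (1 - \<rho>))"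
   using est[of "\<lambda>_. 0" "\<lambda>_. 0"] by (simp add: symbol_estimate_def symbol_partial_def multi_partial_0 multi_order_0)
  also have "\<dots> \<le> c * 1"
  proof (rule mult_mono)
   have "(1 + norm \<xi>) powr (- real CARD('n) * (1 - \<rho>)) \<le> (1 + norm \<xi>) powr 0"
    using \<rho> by (intro powr_mono) (auto simp: mult_le_0_iff)
   moreover have "1 + norm \<xi> \<noteq> 0" using norm_ge_zero[of \<xi>] by linarith
   ultimately show "(1 + norm \<xi>) powr (- real CARD('n) * (1 - \<rho>)) \<le> 1" by simp
  qed (auto simp: c_def)
  finally show ?thesis by simp
 qed
 note Fi = fourier_integrable[OF f]
 have [measurable]: "fourier f \<in> BM" using Fi by auto
 have am: "(\<lambda>\<xi>. a (x, \<xi>)) \<in> BM"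
  by (intro borel_measurable_continuous_onI continuous_on_compose2[OF smooth_continuous[OF sm]] continuous_intros) auto
 note [measurable] = am
 have pm[measurable]: "phi D J \<in> borel_measurable (borel :: (real^'n) measure)" for J using dC_meas[OF phi_dC[OF prof]] by blast
 have pb: "norm (phi D J \<xi>) \<le> M ^ CARD('n)" for J and \<xi> :: "real^'n" using dC_bound[OF phi_dC[OF prof], of \<xi> UNIV] by blast
 define g where "g J \<xi> = (cis (x \<bullet> \<xi>) * a (x, \<xi>)) * fourier f \<xi> * phi D J \<xi>" for J \<xi>
 have adf: "adm f" by (rule tf_adm[OF test_function_tf[OF f]])
 \<comment> \<open>\<open>Top\<close> counts the pieces below its index, whereas
   \<open>phi D J\<close> is the sum up to and including \<open>J\<close>.\<close>
 have T: "Top (kfam (bfam D a)) (Suc J) f x = (LINT \<xi>|lborel. g J \<xi>)" for J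
 proof -
  have b: "norm (bfam D a j x \<xi>) \<le> Ac N M (- real CARD('n) * (1 - \<rho>)) C * (2^j) powr (- real CARD('n) * (1 - \<rho>))" if "\<xi> \<in> ring j" for j \<xi>
   using dC_bound[OF bfam_facts(1) that] .
  have "Top (kfam (bfam D a)) (Suc J) f x = (\<Sum>j\<le>J. Uop (bfam D a j) (fourier f) x)"
   unfolding lessThan_Suc_atMost[symmetric] by (rule Top_kfam[where b="bfam D a" and x=x and h=f, OF bfam_facts(3) b bfam_facts(2) adm_integrable[OF adf]])
  also have "\<dots> = (LINT \<xi>|lborel. (\<Sum>j\<le>J. (cis (x \<bullet> \<xi>) * bfam D a j x \<xi>) * fourier f \<xi>))"
   unfolding Uop_def
  proof (rule Bochner_Integration.integral_sum[symmetric])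
   fix j
   show "integrable lborel (\<lambda>\<xi>. (cis (x \<bullet> \<xi>) * bfam D a j x \<xi>) * fourier f \<xi>)"
   proof (rule integrable_mult_bounded[OF Fi])
    show "(\<lambda>\<xi>. cis (x \<bullet> \<xi>) * bfam D a j x \<xi>) \<in> BM" using bfam_facts(3) by measurable
    show "norm (cis (x \<bullet> \<xi>) * bfam D a j x \<xi>) \<le> max 0 (Ac N M (- real CARD('n) * (1 - \<rho>)) C * (2^j) powr (- real CARD('n) * (1 - \<rho>)))" for \<xi>
     using b[of \<xi> j] bfam_facts(2)[of \<xi> j x] by (cases "\<xi> \<in> ring j") (auto simp: norm_mult)
   qed
  qed
  also have "\<dots> = (LINT \<xi>|lborel. g J \<xi>)"
   unfolding g_def bfam_def sum_psi[OF prof, symmetric] by (simp add: sum_distrib_left mult_ac)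
  finally show ?thesis .
 qed
 have "(\<lambda>J. LINT \<xi>|lborel. g J \<xi>) \<longlonglongrightarrow> (LINT \<xi>|lborel. cis (x \<bullet> \<xi>) * a (x, \<xi>) * fourier f \<xi>)"
 proof (rule integral_dominated_convergence[where w="\<lambda>\<xi>. c * M ^ CARD('n) * norm (fourier f \<xi>)"])
  show "integrable lborel (\<lambda>\<xi>. c * M ^ CARD('n) * norm (fourier f \<xi>))" using Fi by simp
  show "AE \<xi> in lborel. norm (g J \<xi>) \<le> c * M ^ CARD('n) * norm (fourier f \<xi>)" for J
  proof (rule AE_I2)
   fix \<xi>
   have le: "norm (a (x, \<xi>)) * norm (phi D J \<xi>) \<le> c * M ^ CARD('n)" using ab pb by (intro mult_mono) (auto simp: c_def)
   then show "norm (g J \<xi>) \<le> c * M ^ CARD('n) * norm (fourier f \<xi>)"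
    using mult_right_mono[OF le, of "norm (fourier f \<xi>)"] by (simp add: g_def norm_mult mult_ac)
  qed
  show "AE \<xi> in lborel. (\<lambda>J. g J \<xi>) \<longlonglongrightarrow> cis (x \<bullet> \<xi>) * a (x, \<xi>) * fourier f \<xi>"
  proof (rule AE_I2)
   fix \<xi> :: "real^'n"
   obtain J0 where J0: "norm \<xi> < 2 ^ J0" using real_arch_pow[of 2 "norm \<xi>"] by auto
   have "g J \<xi> = cis (x \<bullet> \<xi>) * a (x, \<xi>) * fourier f \<xi>" if "J0 \<le> J" for J
   proof -
    have "(2::real)^J0 \<le> 2^J" using that by (rule power_increasing) simp
    then have "phi D J \<xi> = 1" using J0 component_le_norm_cart[of \<xi>] by (intro phi_1[OF prof]) (meson less_le_trans less_imp_le order_trans)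
    then show ?thesis by (simp add: g_def)
   qed
   then have "\<forall>\<^sub>F J in sequentially. g J \<xi> = cis (x \<bullet> \<xi>) * a (x, \<xi>) * fourier f \<xi>" by (auto simp: eventually_sequentially)
   then show "(\<lambda>J. g J \<xi>) \<longlonglongrightarrow> cis (x \<bullet> \<xi>) * a (x, \<xi>) * fourier f \<xi>" by (rule tendsto_eventually)
  qed
 qed (simp_all add: g_def[abs_def])
 then show ?thesis by (simp add: T pseudo_diff_def)
qed

lemma pseudo_diff_le_maxop:
 assumes f: "test_function f"
 shows "enorm (pseudo_diff a f x) \<le> maxop (Top (kfam (bfam D a))) f x"
proof (rule LIMSEQ_le_const2)
 show "(\<lambda>J. enorm (Top (kfam (bfam D a)) (Suc J) f x)) \<longlonglongrightarrow> enorm (pseudo_diff a f x)"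
  by (intro tendsto_ennrealI tendsto_norm pseudo_diff_limit f)
 show "\<exists>N. \<forall>J\<ge>N. enorm (Top (kfam (bfam D a)) (Suc J) f x) \<le> maxop (Top (kfam (bfam D a))) f x"
  unfolding maxop_def by (intro exI allI impI SUP_upper) auto
qed

end

section \<open>Change of exponent, the far tail and the two cases of the stopping property\<close>

lemma dyadic_cube_measure:
 assumes "Q \<in> dyadic_cubes" shows "Q \<in> sets borel" "0 < measure lborel Q" "vol Q \<noteq> \<infinity>"
proof -
 from assms obtain k m v where Q: "Q = dyadic_cube k m v" by (auto simp: dyadic_cubes_def)
 show "Q \<in> sets borel" by (simp add: Q dyadic_cube_def)
 have p: "0 < (2::real) powi k" by simp
 have "vol Q = ennreal ((2 powi k) ^ CARD('a))"
  unfolding Q dyadic_cube_def using p by (subst emeasure_box_cart(2)) (auto simp: algebra_simps)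
 then show "0 < measure lborel Q" "vol Q \<noteq> \<infinity>" using p by (simp_all add: measure_def)
qed

lemma sparse_operator_mono_exponent:
 assumes S: "S \<subseteq> dyadic_cubes" and f: "adm f" and s: "0 < s" "s \<le> r"
 shows "sparse_operator s S f x \<le> sparse_operator r S f x"
 unfolding sparse_operator_def
proof (rule infsum_mono)
 fix Q assume "Q \<in> S"
 then have Q: "Q \<in> dyadic_cubes" using S by auto
 show "ennreal (cube_average s Q f) * indicator Q x \<le> ennreal (cube_average r Q f) * indicator Q x"
  by (intro mult_right_mono ennreal_leI cube_average_mono_exponent[OF f s dyadic_cube_measure[OF Q]]) auto
qed (simp_all add: nonneg_summable_on_complete)

text \<open>A coordinate of \<open>x\<close> beyond twice the support puts \<open>x - y\<close> at
  distance at least \<open>X / 2\<close>, where the kernels are summable in absolute value; no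
  cancellation is involved.\<close>

lemma maxop_tail:
 fixes b :: "nat => real^'n::finite => real^'n => complex"
 assumes bm: "\<And>j. b j x \<in> BM" and f: "adm f" and X: "2 \<le> X" and c: "0 \<le> c"
  and k: "\<And>J z. 1 \<le> norm z ==> (\<Sum>j<J. norm (kern (b j x) z)) \<le> c / norm z ^ CARD('n)"
  and supp: "\<And>y. f y \<noteq> 0 ==> \<bar>y $ i\<bar> \<le> X / 2" and x: "X \<le> \<bar>x $ i\<bar>"
 shows "maxop (Top (kfam b)) f x \<le> ennreal (c * 2 ^ CARD('n) / X ^ CARD('n)) * (\<integral>\<^sup>+y. enorm (f y))"
 unfolding maxop_def
proof (rule SUP_least)
 fix J
 have [measurable]: "f \<in> BM" using f by (simp add: adm_def)
 have [measurable]: "kern (b j x) \<in> BM" for j by (rule kern_measurable[OF bm])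
 have "enorm (Top (kfam b) J f x) \<le> ennreal (\<Sum>j<J. norm (LINT y|lborel. kern (b j x) (x - y) * f y))"
  unfolding Top_def kfam_def by (intro ennreal_leI norm_sum)
 also have "\<dots> = (\<Sum>j<J. enorm (LINT y|lborel. kern (b j x) (x - y) * f y))" by (simp add: sum_ennreal)
 also have "\<dots> \<le> (\<Sum>j<J. \<integral>\<^sup>+y. enorm (kern (b j x) (x - y) * f y))" by (intro sum_mono norm_LINT_le)
 also have "\<dots> = (\<integral>\<^sup>+y. (\<Sum>j<J. enorm (kern (b j x) (x - y) * f y)))" by (intro nn_integral_sum[symmetric]) measurable
 also have "\<dots> \<le> (\<integral>\<^sup>+y. ennreal (c * 2 ^ CARD('n) / X ^ CARD('n)) * enorm (f y))"
 proof (intro nn_integral_mono)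
  fix y
  show "(\<Sum>j<J. enorm (kern (b j x) (x - y) * f y)) \<le> ennreal (c * 2 ^ CARD('n) / X ^ CARD('n)) * enorm (f y)"
  proof (cases "f y = 0")
   case False
   have "X / 2 \<le> \<bar>(x - y) $ i\<bar>" using supp[OF False] x unfolding vector_minus_component by linarith
   also have "\<dots> \<le> norm (x - y)" by (rule component_le_norm_cart)
   finally have z: "X / 2 \<le> norm (x - y)" .
   have "(\<Sum>j<J. norm (kern (b j x) (x - y))) \<le> c / norm (x - y) ^ CARD('n)" using z X by (intro k) linarith
   also have "\<dots> \<le> c / (X / 2) ^ CARD('n)"
    using z X c by (intro divide_left_mono power_mono mult_pos_pos zero_less_power) auto
   finally have "(\<Sum>j<J. norm (kern (b j x) (x - y))) * norm (f y) \<le> c * 2 ^ CARD('n) / X ^ CARD('n) * norm (f y)"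
    by (intro mult_right_mono) (auto simp: power_divide)
   then have "ennreal (\<Sum>j<J. norm (kern (b j x) (x - y) * f y)) \<le> ennreal (c * 2 ^ CARD('n) / X ^ CARD('n) * norm (f y))"
    by (intro ennreal_leI) (simp add: norm_mult sum_distrib_right)
   moreover have "ennreal (c * 2 ^ CARD('n) / X ^ CARD('n) * norm (f y)) = ennreal (c * 2 ^ CARD('n) / X ^ CARD('n)) * enorm (f y)"
    using c X by (intro ennreal_mult) auto
   ultimately show ?thesis by (simp only: sum_ennreal norm_ge_zero)
  qed simp
 qed
 also have "\<dots> = ennreal (c * 2 ^ CARD('n) / X ^ CARD('n)) * (\<integral>\<^sup>+y. enorm (f y))"
  by (intro nn_integral_cmult) measurable
 finally show "enorm (Top (kfam b) J f x) \<le> ennreal (c * 2 ^ CARD('n) / X ^ CARD('n)) * (\<integral>\<^sup>+y. enorm (f y))" .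
qed

text \<open>The constant and the exponent \<open>s\<close> are chosen before the symbol. For
  \<open>\<rho> = 1\<close> the exponent 1 is reached through the Calderon-Zygmund theory; for
  \<open>\<rho> < 1\<close> the pieces are summed one by one.\<close>

lemma stops_symbol:
 fixes C :: "('n::finite => nat) => ('n => nat) => real"
 assumes prof: "profile N D M" and N: "N = CARD('n) + 2" and \<rho>: "0 < \<rho>" "\<rho> \<le> 1" and \<delta>: "0 \<le> \<delta>" "\<delta> < 1" and r: "1 < r"
 shows "\<exists>A>0. \<exists>s\<ge>1. s \<le> r \<and> (\<forall>a f q. smooth a \<longrightarrow> (\<forall>\<nu> \<sigma>. symbol_estimate (- real CARD('n) * (1 - \<rho>)) \<rho> \<delta> \<nu> \<sigma> (C \<nu> \<sigma>) a) \<longrightarrow>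
  tf f \<longrightarrow> stops s A (maxop (Top (kfam (bfam D a)))) f q)"
proof (cases "\<rho> = 1")
 case True
 have M: "0 \<le> M" using M_ge_1[OF prof] by simp
 define q where "q = 2 powr (\<delta> - 1)"
 have q: "1/2 \<le> q" "q < 1"
 proof -
  have "(2::real) powr (-1) \<le> q" unfolding q_def using \<delta> by (intro powr_mono) auto
  then show "1/2 \<le> q" by (simp add: powr_minus_divide)
  show "q < 1" unfolding q_def using \<delta> by (intro powr_less_one) auto
 qed
 obtain A where A: "0 < A" and cz: "\<And>b :: nat => real^'n => real^'n => complex. goodfam N (Ac N M 0 C) q b ==> czker A (kfam b)"
  using czker_of_goodfam[OF N Ac_nonneg[OF M] q] by blast
 obtain B where B: "0 < B" and st: "\<And>(K :: nat => real^'n => real^'n => complex) f q. czker A K ==> tf f ==> stops 1 B (maxop (Top K)) f q"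
  using stopping_set_cz[OF A, where 'n='n] by blast
 have "stops 1 B (maxop (Top (kfam (bfam D a)))) f q'"
  if "smooth a" "\<forall>\<nu> \<sigma>. symbol_estimate (- real CARD('n) * (1 - \<rho>)) \<rho> \<delta> \<nu> \<sigma> (C \<nu> \<sigma>) a" "tf f" for a f and q' :: "'n key"
 proof (intro st cz that(3))
  have e: "symbol_estimate 0 1 \<delta> \<nu> \<sigma> (C \<nu> \<sigma>) a" for \<nu> \<sigma> using that(2) True by simp
  show "goodfam N (Ac N M 0 C) q (bfam D a)"
   unfolding q_def by (rule bfam_goodfam[OF prof _ _ \<delta>(1) less_imp_le[OF \<delta>(2)] that(1) e]) auto
 qed
 then show ?thesis using B r by (intro exI[of _ B] conjI exI[of _ 1]) auto
next
 case False
 then have \<rho>1: "\<rho> < 1" using \<rho> by simp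
 have M: "0 \<le> M" using M_ge_1[OF prof] by simp
 \<comment> \<open>The estimate of a piece requires \<open>s \<le> 2\<close>; larger
   \<open>r\<close> is recovered at the end because averages increase with the exponent.\<close>
 define s where "s = min r 2"
 have s: "1 < s" "s \<le> 2" "s \<le> r" using r by (auto simp: s_def)
 define \<omega> where "\<omega> = 2 powr (- real CARD('n) * (1 - \<rho>) * (1 - 1 / s))"
 have \<omega>: "0 \<le> \<omega>" "\<omega> < 1"
  using \<rho>1 s unfolding \<omega>_def by (auto intro!: powr_less_one mult_neg_pos)
 define k where "k = Kc N M \<rho> C * (1 + bconst TYPE(real^'n))"
 have k: "0 < k" unfolding k_def using bconst_pos[where 'a="real^'n"] by (intro mult_pos_pos Kc_ge(1) M) auto
 define A where "A = k / (1 - \<omega>)"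
 have A: "0 < A" using k \<omega> by (simp add: A_def)
 define B where "B = A * (2 * real CARD('n) + 1) ^ CARD('n) * (2 * 3 ^ CARD('n) * 5 ^ CARD('n))"
 have B: "0 < B" unfolding B_def using A by (intro mult_pos_pos zero_less_power add_nonneg_pos) auto
 have "stops s B (maxop (Top (kfam (bfam D a)))) f q"
  if sm: "smooth a" and est: "\<forall>\<nu> \<sigma>. symbol_estimate (- real CARD('n) * (1 - \<rho>)) \<rho> \<delta> \<nu> \<sigma> (C \<nu> \<sigma>) a" and f: "tf f" for a f and q :: "'n key"
 proof (rule stopping_set_ball_averages[OF tf_adm[OF f] _ A _ _ B_def])
  have est': "symbol_estimate (- real CARD('n) * (1 - \<rho>)) \<rho> \<delta> \<nu> \<sigma> (C \<nu> \<sigma>) a" for \<nu> \<sigma> using est by blast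
  note p = prof \<rho> \<delta>(1) less_imp_le[OF \<delta>(2)] N sm est'
  show "Top (kfam (bfam D a)) J (\<lambda>y. g y + h y) x = Top (kfam (bfam D a)) J g x + Top (kfam (bfam D a)) J h x" if "adm g" "adm h" for J g h x
   by (rule Top_kfam_add[OF bfam_facts(3)[OF p] kern_le'[OF p] that])
  show "norm (Top (kfam (bfam D a)) J h x) \<le> A * l"
   if h: "adm h" "0 < l" "\<And>t. 0 < t ==> (\<integral>\<^sup>+y\<in>ball x t. ennreal (norm (h y) powr s) \<partial>lborel) \<le> ennreal (l powr s) * vol (ball x t)" for J h x l
  proof -
   have "norm (Top (kfam (bfam D a)) J h x) \<le> (\<Sum>j<J. k * l * \<omega> ^ id j)"
    unfolding Top_def kfam_def
   proof (intro order_trans[OF norm_sum] sum_mono)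
    fix j
    show "norm (LINT y|lborel. kern (bfam D a j x) (x - y) * h y) \<le> k * l * \<omega> ^ id j"
     unfolding k_def \<omega>_def id_def by (rule piece_le[OF p h(1) s(1,2) h(2,3)])
   qed
   also have "\<dots> = k * l * (\<Sum>j<J. \<omega> ^ id j)" by (simp add: sum_distrib_left)
   also have "\<dots> \<le> k * l * (1 / (1 - \<omega>))" using k h(2) \<omega> by (intro mult_left_mono sum_power_inj_le) auto
   finally show ?thesis by (simp add: A_def)
  qed
 qed (use s in auto)
 then show ?thesis using B s by (intro exI[of _ B] conjI exI[of _ s]) auto
qed

text \<open>Fixing the family \<open>C\<close> of symbol constants first expresses what the implicit
  constant depends on: \<open>K\<close> is chosen before the symbol. The sparseness found is
  \<open>1 / (4 * 16 ^ n)\<close>, a function of the dimension alone.\<close>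

theorem theorem1p3:
  fixes \<rho> \<delta> r :: real
    and C :: "('n::finite \<Rightarrow> nat) \<Rightarrow> ('n \<Rightarrow> nat) \<Rightarrow> real"
  assumes "0 < \<rho>" "\<rho> \<le> 1" "0 \<le> \<delta>" "\<delta> < 1" "1 < r"
  shows "\<exists>K>0. \<forall>a \<in> symbol_class (- real CARD('n) * (1 - \<rho>)) \<rho> \<delta>.
           (\<forall>\<nu> \<sigma>. symbol_estimate (- real CARD('n) * (1 - \<rho>)) \<rho> \<delta> \<nu> \<sigma> (C \<nu> \<sigma>) a) \<longrightarrow>
           (\<exists>\<eta>. 0 < \<eta> \<and> \<eta> < 1 \<and>
             (\<forall>f :: real^'n \<Rightarrow> complex. test_function f \<longrightarrow>
               (\<exists>S. sparse_family \<eta> S \<and>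
                 (AE x in lborel. ennreal (norm (pseudo_diff a f x))
                    \<le> ennreal K * sparse_operator r S f x))))"
proof -
 define N where "N = CARD('n) + 2"
 obtain D M where prof: "profile N D M" using profile_exists by blast
 obtain A s where A: "0 < A" and s: "1 \<le> s" "s \<le> r"
  and st: "\<forall>a f q. smooth a \<longrightarrow> (\<forall>\<nu> \<sigma>. symbol_estimate (- real CARD('n) * (1 - \<rho>)) \<rho> \<delta> \<nu> \<sigma> (C \<nu> \<sigma>) a) \<longrightarrow>
   tf f \<longrightarrow> stops s A (maxop (Top (kfam (bfam D a)))) f q"
  using stops_symbol[OF prof N_def assms, of C] by blast
 have M: "0 \<le> M" using M_ge_1[OF prof] by simp
 \<comment> \<open>The geometric series over all pieces of the tail bound, with ratio
   \<open>2 powr (- 2 * \<rho>)\<close>.\<close>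
 define c where "c = Kc N M \<rho> C / (1 - 2 powr (- 2 * \<rho>))"
 have "2 powr (- 2 * \<rho>) < 1" using assms by (intro powr_less_one) auto
 then have c: "0 < c" using Kc_ge(1)[OF M, of N \<rho> C] by (simp add: c_def)
 define B where "B = A + c * 2 ^ CARD('n)"
 have B: "0 < B" "A \<le> B" "c * 2 ^ CARD('n) \<le> B" using A c by (auto simp: B_def add_pos_pos)
 define \<eta> :: real where "\<eta> = 1 / (4 * 16 ^ CARD('n))"
 have \<eta>: "0 < \<eta>" "\<eta> < 1"
 proof -
  have "(1::real) \<le> 16 ^ CARD('n)" by (rule one_le_power) simp
  then have "(1::real) < 4 * 16 ^ CARD('n)" by linarith
  then show "0 < \<eta>" "\<eta> < 1" unfolding \<eta>_def by (simp, subst divide_less_eq_1_pos) linarith+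
 qed
 have main: "\<exists>S. sparse_family \<eta> S \<and> (AE x in lborel. enorm (pseudo_diff a f x) \<le> ennreal (24 ^ CARD('n) * B) * sparse_operator r S f x)"
  if a: "a \<in> symbol_class (- real CARD('n) * (1 - \<rho>)) \<rho> \<delta>" and est: "\<forall>\<nu> \<sigma>. symbol_estimate (- real CARD('n) * (1 - \<rho>)) \<rho> \<delta> \<nu> \<sigma> (C \<nu> \<sigma>) a"
   and f: "test_function f" for a f
 proof -
  have sm: "smooth a" using a by (simp add: symbol_class_def)
  have est': "symbol_estimate (- real CARD('n) * (1 - \<rho>)) \<rho> \<delta> \<nu> \<sigma> (C \<nu> \<sigma>) a" for \<nu> \<sigma> using est by blast
  note p = prof assms(1-3) less_imp_le[OF assms(4)] N_def sm est'
  have tf: "tf f" by (rule test_function_tf[OF f])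
  have adm: "adm f" by (rule tf_adm[OF tf])
  define T where "T = maxop (Top (kfam (bfam D a)))"
  obtain L where L: "\<And>y. f y \<noteq> 0 ==> norm y \<le> L" using tf by (auto simp: tf_def bounded_iff)
  obtain k0 where k0: "L < 2 ^ k0" using real_arch_pow[of 2 L] by auto
  \<comment> \<open>One level above the size of the support: the coordinates are then strictly below
    \<open>2 powi k\<close>, and a point beyond \<open>X \<ge> 2 powi k\<close> has distance at
    least \<open>X / 2 \<ge> 1\<close> from the support, as the tail bound asks.\<close>
  define k where "k = int (Suc k0)"
  have pk: "(2::real) powi k = 2 * 2 ^ k0" by (simp only: k_def power_int_of_nat power_Suc)
  have supp: "\<bar>y $ i\<bar> \<le> 2 ^ k0" if "f y \<noteq> 0" for y i
   using L[OF that] k0 component_le_norm_cart[of y i] by linarith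
  have "\<exists>S. sparse_family (1 / (4 * 16 ^ CARD('n))) S \<and> (AE x in lborel. T f x \<le> ennreal (24 ^ CARD('n) * B) * sparse_operator s S f x)"
  proof (rule sparse_domination[OF tf s(1) B(1), where k=k])
   fix q :: "'n key"
   have "stops s A T f q" using st sm est tf unfolding T_def by blast
   then show "stops s B T f q" using B(2) by (rule stops_mono)
  next
   show "\<bar>y $ i\<bar> < 2 powi k" if "f y \<noteq> 0" for y i
   proof -
    have "(0::real) < 2 ^ k0" by simp
    then show ?thesis using supp[OF that, of i] unfolding pk by linarith
   qed
  next
   fix x :: "real^'n" and X i assume X: "2 powi k \<le> X" "X \<le> \<bar>x $ i\<bar>"
   have X2: "2 ^ k0 \<le> X / 2" using X(1) by (simp add: pk)
   have "(1::real) \<le> 2 ^ k0" by (rule one_le_power) simp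
   then have X1: "2 \<le> X" using X2 by linarith
   have "T f x \<le> ennreal (c * 2 ^ CARD('n) / X ^ CARD('n)) * (\<integral>\<^sup>+y. enorm (f y))"
    unfolding T_def
   proof (rule maxop_tail[OF bfam_facts(3)[OF p] adm X1 less_imp_le[OF c] _ _ X(2)])
    show "(\<Sum>j<J. norm (kern (bfam D a j x) z)) \<le> c / norm z ^ CARD('n)" if "1 \<le> norm z" for J z
     unfolding c_def by (rule tail_sum[OF p that])
    show "\<bar>y $ i\<bar> \<le> X / 2" if "f y \<noteq> 0" for y using supp[OF that, of i] X2 by linarith
   qed
   also have "\<dots> \<le> ennreal (B / X ^ CARD('n)) * (\<integral>\<^sup>+y. enorm (f y))"
    using B(3) X1 by (intro mult_right_mono ennreal_leI divide_right_mono) auto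
   finally show "T f x \<le> ennreal (B / X ^ CARD('n)) * (\<integral>\<^sup>+y. enorm (f y))" .
  qed
  then obtain S where S: "sparse_family \<eta> S" "AE x in lborel. T f x \<le> ennreal (24 ^ CARD('n) * B) * sparse_operator s S f x"
   unfolding \<eta>_def by blast
  have "AE x in lborel. enorm (pseudo_diff a f x) \<le> ennreal (24 ^ CARD('n) * B) * sparse_operator r S f x"
   using S(2)
  proof eventually_elim
   case (elim x)
   have "enorm (pseudo_diff a f x) \<le> T f x" unfolding T_def by (rule pseudo_diff_le_maxop[OF p f])
   also note elim
   also have "ennreal (24 ^ CARD('n) * B) * sparse_operator s S f x \<le> ennreal (24 ^ CARD('n) * B) * sparse_operator r S f x"
    using S(1) s by (intro mult_left_mono sparse_operator_mono_exponent adm) (auto simp: sparse_family_def)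
   finally show ?case .
  qed
  with S(1) show ?thesis by blast
 qed
 have "0 < 24 ^ CARD('n) * B" using B(1) by simp
 with main \<eta> show ?thesis by blast
qed

end
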